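(* Let $1\le m\le k\le 7$, $\beta\ge3$, $v\in L^2(\Omega)$ and $f=0$. Let $V(t)$ be the solution of $$V'(t)-AV(t)=Av,\quad 0<t\le T,\qquad V(0)=0,$$ and let $V^n$ be the solution of the corrected ID$m$-WSBDF$k$ scheme with $f=0$ (defined in the context). Then there is a constant $c>0$, independent of $\tau$, $n$ and $v$, such that for every $t_n>0$ $$\|V(t_n)-V^n\|_{L^2(\Omega)}\le\left(c\tau^{m+1}t_n^{-m-1}+c\tau^kt_n^{-k}\right)\|v\|_{L^2(\Omega)}.$$
   Context: $\Omega\subset\mathbb{R}^d$ is a (bounded) convex polyhedral domain and $A=\Delta$ is the Laplacian with homogeneous Dirichlet boundary conditions, $\mathcal{D}(A)=H_0^1(\Omega)\cap H^2(\Omega)$, acting in $L^2(\Omega)$. If $u$ solves $\partial_tu-Au=0$, $u(0)=v$, then $V(t)=u(t)-v$. When $v$ is only in $L^2(\Omega)$, $Av$ and the equations are understood with $A$ extended by duality to $L^2(\Omega)$ (equivalently, $(\lambda-A)^{-1}Av:=\lambda(\lambda-A)^{-1}v-v$). Let $N\in\mathbb{N}$, $\tau=T/N$, $t_n=n\tau$. Define $$\rho_b(\xi)=\frac1\tau\sum_{j=1}^k\frac1j(1-\xi)^j,\qquad \rho_s(\xi)=\frac1\tau\Big(\sum_{j=1}^k\frac1j(1-\xi)^j-\sum_{j=2}^k\frac1{j-1}(1-\xi)^j\Big),\qquad \rho_w=\beta\rho_b+(1-\beta)\rho_s$$ (the second sum is empty if $k=1$). Define coefficients $w_j,b_j,s_j$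 by $$\rho_w(\xi)=\frac1\tau\sum_{j\ge0}w_j\xi^j,\qquad \rho_b(\xi)^m=\frac1{\tau^m}\sum_{j\ge0}b_j\xi^j,\qquad \rho_s(\xi)^m=\frac1{\tau^m}\sum_{j\ge0}s_j\xi^j .$$ The corrected ID$m$-WSBDF$k$ scheme with $f=0$ is: $V^0=0$ and, for $n\ge1$, $$\frac1\tau\sum_{j=0}^nw_jV^{n-j}-\beta AV^n-(1-\beta)AV^{n-1}=\frac{\beta Av}{\Gamma(m+1)}\frac1{\tau^m}\sum_{j=0}^nb_jt_{n-j}^m+\frac{(1-\beta)Av}{\Gamma(m+1)}\frac1{\tau^m}\sum_{j=0}^{n-1}s_jt_{n+m-1-j}^m.$$ *)

theory Defs
  imports "HOL-Analysis.Analysis" "HOL-Computational_Algebra.Polynomial"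
begin

definition convex_polyhedral_domain :: "'a::euclidean_space set \<Rightarrow> bool" where
  "convex_polyhedral_domain \<Omega> \<longleftrightarrow>
     \<Omega> \<noteq> {} \<and> open \<Omega> \<and> bounded \<Omega> \<and> convex \<Omega> \<and> polyhedron (closure \<Omega>)"


section \<open>\<open>L\<^sup>2\<close> and Sobolev spaces\<close>

text \<open>Elements of the function spaces are represented by real functions on the whole space;
  only their values on \<open>\<Omega>\<close> matter, and two functions that agree almost everywhere on \<open>\<Omega>\<close>
  represent the same element.\<close>

definition L2 :: "'a::euclidean_space set \<Rightarrow> ('a \<Rightarrow> real) set" where
  "L2 \<Omega> = {u \<in> borel_measurable (lebesgue_on \<Omega>). integrable (lebesgue_on \<Omega>) (\<lambda>x. (u x)\<^sup>2)}"

definition L2_inner :: "'a::euclidean_space set \<Rightarrow> ('a \<Rightarrow> real) \<Rightarrow> ('a \<Rightarrow> real) \<Rightarrow> real" where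
  "L2_inner \<Omega> u w = (LINT x|lebesgue_on \<Omega>. u x * w x)"

definition L2_norm :: "'a::euclidean_space set \<Rightarrow> ('a \<Rightarrow> real) \<Rightarrow> real" where
  "L2_norm \<Omega> u = sqrt (L2_inner \<Omega> u u)"

definition partial :: "'a::euclidean_space \<Rightarrow> ('a \<Rightarrow> real) \<Rightarrow> 'a \<Rightarrow> real" where
  "partial i f x = frechet_derivative f (at x) i"

primrec C_diff :: "nat \<Rightarrow> ('a::euclidean_space \<Rightarrow> real) \<Rightarrow> bool" where
  "C_diff 0 f \<longleftrightarrow> continuous_on UNIV f"
| "C_diff (Suc n) f \<longleftrightarrow> f differentiable_on UNIV \<and> (\<forall>i\<in>Basis. C_diff n (partial i f))"

text \<open>\<open>C\<^sub>c\<^sup>\<infinity>(\<Omega>)\<close>, its members being extended by zero outside \<open>\<Omega>\<close>.\<close>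

definition test_functions :: "'a::euclidean_space set \<Rightarrow> ('a \<Rightarrow> real) set" where
  "test_functions \<Omega> =
     {\<phi>. (\<forall>n. C_diff n \<phi>) \<and> compact (closure {x. \<phi> x \<noteq> 0}) \<and> closure {x. \<phi> x \<noteq> 0} \<subseteq> \<Omega>}"

definition has_weak_partial ::
    "'a::euclidean_space set \<Rightarrow> 'a \<Rightarrow> ('a \<Rightarrow> real) \<Rightarrow> ('a \<Rightarrow> real) \<Rightarrow> bool" where
  "has_weak_partial \<Omega> i u w \<longleftrightarrow>
     (\<forall>\<phi>\<in>test_functions \<Omega>. L2_inner \<Omega> u (partial i \<phi>) = - L2_inner \<Omega> w \<phi>)"

text \<open>A weak derivative is unique only up to equality almost everywhere on \<open>\<Omega>\<close>, hence the choice
  of a representative. It is meaningful for \<open>u\<close> in the space \<open>H1\<close> below.\<close>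

definition weak_partial :: "'a::euclidean_space set \<Rightarrow> 'a \<Rightarrow> ('a \<Rightarrow> real) \<Rightarrow> 'a \<Rightarrow> real" where
  "weak_partial \<Omega> i u = (SOME w. w \<in> L2 \<Omega> \<and> has_weak_partial \<Omega> i u w)"

definition H1 :: "'a::euclidean_space set \<Rightarrow> ('a \<Rightarrow> real) set" where
  "H1 \<Omega> = {u \<in> L2 \<Omega>. \<forall>i\<in>Basis. \<exists>w\<in>L2 \<Omega>. has_weak_partial \<Omega> i u w}"

definition H1_norm :: "'a::euclidean_space set \<Rightarrow> ('a \<Rightarrow> real) \<Rightarrow> real" where
  "H1_norm \<Omega> u = sqrt ((L2_norm \<Omega> u)\<^sup>2 + (\<Sum>i\<in>Basis. (L2_norm \<Omega> (weak_partial \<Omega> i u))\<^sup>2))"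

definition H10 :: "'a::euclidean_space set \<Rightarrow> ('a \<Rightarrow> real) set" where
  "H10 \<Omega> = {u \<in> H1 \<Omega>. \<forall>\<epsilon>>0. \<exists>\<phi>\<in>test_functions \<Omega>. H1_norm \<Omega> (\<lambda>x. u x - \<phi> x) < \<epsilon>}"

definition H2 :: "'a::euclidean_space set \<Rightarrow> ('a \<Rightarrow> real) set" where
  "H2 \<Omega> = {u \<in> H1 \<Omega>. \<forall>i\<in>Basis. weak_partial \<Omega> i u \<in> H1 \<Omega>}"


section \<open>The Dirichlet Laplacian\<close>

definition dirichlet_domain :: "'a::euclidean_space set \<Rightarrow> ('a \<Rightarrow> real) set" where
  "dirichlet_domain \<Omega> = H10 \<Omega> \<inter> H2 \<Omega>"

definition dirichlet_laplacian ::
    "'a::euclidean_space set \<Rightarrow> ('a \<Rightarrow> real) \<Rightarrow> 'a \<Rightarrow> real" where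
  "dirichlet_laplacian \<Omega> u x = (\<Sum>i\<in>Basis. weak_partial \<Omega> i (weak_partial \<Omega> i u) x)"

text \<open>The extension of the (symmetric) Dirichlet Laplacian \<open>A\<close> by duality to \<open>L\<^sup>2(\<Omega>)\<close>: for
  \<open>w \<in> L\<^sup>2(\<Omega>)\<close>, \<open>A w\<close> is the functional \<open>\<phi> \<mapsto> \<langle>w, A \<phi>\<rangle>\<close> on the domain of \<open>A\<close>. An element \<open>g\<close> of
  \<open>L\<^sup>2(\<Omega>)\<close> is identified with the functional \<open>\<phi> \<mapsto> \<langle>g, \<phi>\<rangle>\<close>, and an equation involving the extended
  operator is an equality of functionals on the domain of \<open>A\<close>.\<close>

definition dirichlet_laplacian_ext ::
    "'a::euclidean_space set \<Rightarrow> ('a \<Rightarrow> real) \<Rightarrow> ('a \<Rightarrow> real) \<Rightarrow> real" where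
  "dirichlet_laplacian_ext \<Omega> w \<phi> = L2_inner \<Omega> w (dirichlet_laplacian \<Omega> \<phi>)"


section \<open>The evolution equation\<close>

text \<open>\<open>V' - A V = A v\<close> on \<open>(0, T]\<close>, \<open>V(0) = 0\<close>: the curve is continuous on \<open>[0, T]\<close> and
  differentiable on \<open>(0, T]\<close> as a map into \<open>L\<^sup>2(\<Omega>)\<close>; \<open>D\<close> is its derivative at \<open>t\<close>, which is
  one-sided at \<open>t = T\<close>.\<close>

definition evolution_solution ::
    "'a::euclidean_space set \<Rightarrow> real \<Rightarrow> ('a \<Rightarrow> real) \<Rightarrow> (real \<Rightarrow> 'a \<Rightarrow> real) \<Rightarrow> bool" where
  "evolution_solution \<Omega> T v V \<longleftrightarrow>
     (\<forall>t\<in>{0..T}. V t \<in> L2 \<Omega>) \<and>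
     (\<forall>t\<in>{0..T}. ((\<lambda>s. L2_norm \<Omega> (\<lambda>x. V s x - V t x)) \<longlongrightarrow> 0) (at t within {0..T})) \<and>
     (AE x in lebesgue_on \<Omega>. V 0 x = 0) \<and>
     (\<forall>t\<in>{0<..T}. \<exists>D\<in>L2 \<Omega>.
        ((\<lambda>s. L2_norm \<Omega> (\<lambda>x. (V s x - V t x) / (s - t) - D x)) \<longlongrightarrow> 0) (at t within {0..T}) \<and>
        (\<forall>\<phi>\<in>dirichlet_domain \<Omega>.
           L2_inner \<Omega> D \<phi> - dirichlet_laplacian_ext \<Omega> (V t) \<phi> = dirichlet_laplacian_ext \<Omega> v \<phi>))"


section \<open>The corrected ID\<open>m\<close>-WSBDF\<open>k\<close> scheme\<close>

text \<open>The generating polynomials in \<open>\<xi>\<close>; \<open>[:1, -1:]\<close> is \<open>1 - \<xi>\<close>.\<close>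

definition rho_b :: "real \<Rightarrow> nat \<Rightarrow> real poly" where
  "rho_b \<tau> k = smult (1 / \<tau>) (\<Sum>j=1..k. smult (1 / real j) ([:1, -1:] ^ j))"

definition rho_s :: "real \<Rightarrow> nat \<Rightarrow> real poly" where
  "rho_s \<tau> k = smult (1 / \<tau>)
     ((\<Sum>j=1..k. smult (1 / real j) ([:1, -1:] ^ j)) -
      (\<Sum>j=2..k. smult (1 / (real j - 1)) ([:1, -1:] ^ j)))"

definition rho_w :: "real \<Rightarrow> nat \<Rightarrow> real \<Rightarrow> real poly" where
  "rho_w \<tau> k \<beta> = smult \<beta> (rho_b \<tau> k) + smult (1 - \<beta>) (rho_s \<tau> k)"

definition w_coeff :: "real \<Rightarrow> nat \<Rightarrow> real \<Rightarrow> nat \<Rightarrow> real" where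
  "w_coeff \<tau> k \<beta> j = \<tau> * coeff (rho_w \<tau> k \<beta>) j"

definition b_coeff :: "real \<Rightarrow> nat \<Rightarrow> nat \<Rightarrow> nat \<Rightarrow> real" where
  "b_coeff \<tau> k m j = \<tau> ^ m * coeff (rho_b \<tau> k ^ m) j"

definition s_coeff :: "real \<Rightarrow> nat \<Rightarrow> nat \<Rightarrow> nat \<Rightarrow> real" where
  "s_coeff \<tau> k m j = \<tau> ^ m * coeff (rho_s \<tau> k ^ m) j"

text \<open>The scheme with \<open>f = 0\<close>, on the grid \<open>t\<^sub>n = n \<tau>\<close>, \<open>n \<le> N\<close>.\<close>

definition scheme_solution ::
    "'a::euclidean_space set \<Rightarrow> nat \<Rightarrow> nat \<Rightarrow> real \<Rightarrow> real \<Rightarrow> nat \<Rightarrow> ('a \<Rightarrow> real) \<Rightarrow>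
     (nat \<Rightarrow> 'a \<Rightarrow> real) \<Rightarrow> bool" where
  "scheme_solution \<Omega> m k \<beta> \<tau> N v V \<longleftrightarrow>
     (\<forall>n\<le>N. V n \<in> L2 \<Omega>) \<and>
     (AE x in lebesgue_on \<Omega>. V 0 x = 0) \<and>
     (\<forall>n\<in>{1..N}. \<forall>\<phi>\<in>dirichlet_domain \<Omega>.
        L2_inner \<Omega> (\<lambda>x. 1 / \<tau> * (\<Sum>j=0..n. w_coeff \<tau> k \<beta> j * V (n - j) x)) \<phi>
          - \<beta> * dirichlet_laplacian_ext \<Omega> (V n) \<phi>
          - (1 - \<beta>) * dirichlet_laplacian_ext \<Omega> (V (n - 1)) \<phi>
        = \<beta> * dirichlet_laplacian_ext \<Omega> v \<phi> / Gamma (real (m + 1)) * (1 / \<tau> ^ m)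
            * (\<Sum>j=0..n. b_coeff \<tau> k m j * (real (n - j) * \<tau>) ^ m)
          + (1 - \<beta>) * dirichlet_laplacian_ext \<Omega> v \<phi> / Gamma (real (m + 1)) * (1 / \<tau> ^ m)
            * (\<Sum>j=0..n - 1. s_coeff \<tau> k m j * (real (n + m - 1 - j) * \<tau>) ^ m))"

end

theory Submission
  imports Defs "HOL-Complex_Analysis.Complex_Analysis"
    "HOL-Computational_Algebra.Fundamental_Theorem_Algebra"
begin

text \<open>The error is a function of the self-adjoint operator \<open>A\<close> applied to \<open>v\<close>. By the functional calculus it
  suffices to bound \<open>|exp (- z n) - 1 - W\<^sub>n|\<close> by a multiple of \<open>n\<^sup>-\<^sup>m\<^sup>-\<^sup>1 + n\<^sup>-\<^sup>k\<close> uniformly in \<open>z > 0\<close>, where \<open>W\<close> is the scheme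
  for the number \<open>- z / \<tau>\<close> in place of \<open>A\<close> and \<open>v = 1\<close>. The generating function of \<open>1 + W\<close> has the denominator
  \<open>\<tau> \<rho>\<^sub>w(\<xi>) + z (\<beta> + (1 - \<beta>) \<xi>)\<close>, which has no zero in the closed unit disc, because \<open>\<beta> \<ge> 3\<close> and \<open>k \<le> 7\<close>. For
  large \<open>z\<close> the bound follows by compactness and Cauchy's inequalities; for small \<open>z\<close> one divides by the approximate
  root \<open>exp z\<close> of the denominator and concludes with a discrete Gronwall inequality.

  The functional calculus needs that \<open>1 - A\<close> has dense range on \<open>H\<^sub>0\<^sup>1 \<inter> H\<^sup>2\<close>. Let \<open>x\<close> be orthogonal to the
  range and \<open>u \<in> H\<^sub>0\<^sup>1\<close> the weak solution of \<open>u - \<Delta>u = x\<close>. If \<open>\<eta>\<close> cuts off a neighbourhood of the edges of the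
  polyhedron, then \<open>\<eta> u\<close> is in the domain by difference quotients along the faces. A Hardy inequality near
  the edges, which holds with a constant better than the critical one because the wedges are convex, keeps
  \<open>A (\<eta> u)\<close> bounded as \<open>\<eta>\<close> tends to 1. In the limit \<open>\<langle>x, u\<rangle> = \<langle>x, u - x\<rangle>\<close>, that is, \<open>x = 0\<close>.\<close>

section \<open>Stability of the scheme\<close>

text \<open>The equations hold only when tested against the Dirichlet domain, so \<open>V\<close>
  and the discrete solution are arbitrary functions obeying duality relations. Density of the range
  of \<open>1 - A\<close> pins both down: it yields a bounded operator \<open>B\<close>, the inverse
  of \<open>1 - A\<close>, and the rule \<open>B A = B - 1\<close> turns each weak equation into an
  identity between bounded operators. Regularity up to the edges is thereby bypassed: it is enough
  that functions with square-integrable second derivatives produce a dense range.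

  The two rates have different origins. The approximate root \<open>exp z\<close> leaves a remainder
  of order \<open>z^(k+1)\<close>, which accumulates over \<open>n\<close> steps; half of the decay
  \<open>exp (- z n)\<close> pays for it, and \<open>n^-k\<close> remains. The starting error has
  order \<open>z^min(k, m+1)\<close>: the difference symbol imitates \<open>m\<close>-fold
  differentiation up to the relative error \<open>z^k\<close>, while the sum over the grid differs
  from its pole at \<open>z = 0\<close> by a bounded amount, which is multiplied by
  \<open>z^(m+1)\<close>. The conditions \<beta> \<ge> 3 and k \<le> 7 enter through the sign of one
  polynomial on the unit circle.\<close>

fun cheb_coeff :: "real => nat => real" where
  "cheb_coeff y 0 = 0"
| "cheb_coeff y (Suc 0) = 1"
| "cheb_coeff y (Suc (Suc n)) = y * cheb_coeff y (Suc n) - y * cheb_coeff y n"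

text \<open>For \<open>|xi| = 1\<close> the number \<open>x = 1 - xi\<close> satisfies
  \<open>x^2 = y x - y\<close> with \<open>y = |x|^2\<close>, because \<open>x + cnj x = y\<close>.
  Iteration makes every power of \<open>x\<close> affine in \<open>x\<close>;
  \<open>cheb_coeff\<close> is that iteration, a rescaled Chebyshev recursion of the second kind,
  and \<open>bdf_lin\<close>, \<open>bdf_const\<close> collect the coefficients of the truncated
  logarithm.\<close>

definition bdf_lin :: "nat => real => real" where
  "bdf_lin k y = (\<Sum>j=1..k. cheb_coeff y j / j)"

definition bdf_const :: "nat => real => real" where
  "bdf_const k y = (\<Sum>j=1..k. - y * cheb_coeff y (j - 1) / j)"

text \<open>On the unit circle, with \<open>x = 1 - \<xi>\<close> and \<open>y = |x|\<^sup>2\<close>, this is the coefficient of \<open>x\<close> when \<open>P(\<xi>)\<close> times the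
  conjugate of \<open>Q(\<xi>)\<close> is reduced to a polynomial of degree one in \<open>x\<close>. Its coefficients as a polynomial
  in \<open>g - 2\<close> are written as sums of squares with positive weights.\<close>

lemma wsbdf_symbol_pos:
  fixes y g :: real
  assumes "1 <= k" "k <= 7" and y: "0 <= y" "y <= 4" and "2 <= g"
  shows "0 < (bdf_lin k y + g * (y * bdf_lin (k - 1) y + bdf_const (k - 1) y))
             - g * (bdf_const k y - g * y * bdf_lin (k - 1) y)" (is "0 < ?a k")
proof -
  define h where "h = g - 2"
  have h: "0 <= h" "g = h + 2" using assms by (auto simp: h_def)
  have k: "k \<in> {1,2,3,4,5,6,7}" using assms(1,2) by auto
  note expand = h(2) bdf_lin_def bdf_const_def eval_nat_numeral field_simps
    and nonneg = add_pos_nonneg add_nonneg_nonneg mult_nonneg_nonneg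
  have e1: "?a 1 = 1" by (simp add: expand)
  have e2: "?a 2 = (1 + 15/2*y)
      + h * (y * (11/2))
      + h^2 * (y * (1))" by (simp add: expand)
  have e3: "?a 3 = (1 + 37/6*y + 4*y^2)
      + h * (y * (5 + 17/6*y))
      + h^2 * (y * (1 + 1/2*y))" by (simp add: expand)
  have e4: "?a 4 = (1 + 37/6*y + 1/3*y^2 + 11/4*y^3)
      + h * (y * (5 + 7/12*y + 23/12*y^2))
      + h^2 * (y * (1 + 1/6*y + 1/3*y^2))" by (simp add: expand)
  have e5: "?a 5 = (1 + 37/6*y + 109/480*y^2 + 2/3*y^4 + 43/30*y^2*(y - 3/4)^2)
      + h * (y * (5 + 13/60*y + 5/6*y^3 + 37/60*y*(y - 1)^2))
      + h^2 * (y * (1 + 5/36*y + 1/4*y*(y - 1/3)^2))" by (simp add: expand)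
  have e6: "?a 6 = (1 + 39/20*y + 461/960*y^5 + 253/240*y*(y - 2)^2 + 21/16*y^2*(y - 2)^2 + 1171/960*y^3*(y - 2)^2)
      + h * (y * (9/2 + 25/24*y^2*(y - 1)^2 + 1/8*(y - 2)^2 + 1/3*y*(y - 2)^2 + 1/8*y^2*(y - 2)^2))
      + h^2 * (y * (1 + 1/36*y*(y - 1)^2 + 1/5*y^2*(y - 1)^2 + 1/45*y*(y - 5/2)^2))" by (simp add: expand)
  have e7: "?a 7 = (1/2 + 259/10152*(y - 4/3)^2 + 2077/12690*(y - 5/3)^2 + 451/1128*y^2*(y - 2)^2 + 257/210*y^3*(y - 2)^2 + 10/7*y^4*(y - 2)^2 + 7375/5922*y*(y - 7/3)^2 + 36667/39480*y^2*(y - 7/3)^2)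
      + h * (y * (53/42 + 11/168*y^2*(y - 1)^2 + 157/168*(y - 2)^2 + 8/7*y*(y - 2)^2 + 157/168*y^2*(y - 2)^2 + 41/42*y^3*(y - 2)^2))
      + h^2 * (y * (1/3 + 1/160*y^5 + 1/6*(y - 2)^2 + 5/24*y*(y - 2)^2 + 7/40*y^2*(y - 2)^2 + 77/480*y^3*(y - 2)^2))"
    by (simp add: expand)
  have "0 < ?a 2" "0 < ?a 3" "0 < ?a 4" "0 < ?a 5" "0 < ?a 6" "0 < ?a 7"
    unfolding e2 e3 e4 e5 e6 e7 by (-, (intro nonneg; use y h(1) in simp)+)
  with k e1 show ?thesis by auto
qed

section \<open>The symbol of the scheme on the unit circle and in the disc\<close>

definition bdf_sum :: "nat => 'a::field_char_0 => 'a" where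
  "bdf_sum k x = (\<Sum>j=1..k. x ^ j / of_nat j)"

text \<open>\<open>bdf_sum\<close> truncates \<open>- ln (1 - x)\<close>, and at
  \<open>x = 1 - xi\<close> it is \<tau> times \<open>rho_b\<close>. The present expression is
  \<tau> times \<open>rho_w\<close> for \<open>g = \<beta> - 1\<close>, since \<open>\<beta> rho_b +
  (1 - \<beta>) rho_s = rho_b + (\<beta> - 1) (rho_b - rho_s)\<close>.\<close>

definition wsbdf_symbol :: "nat => real => complex => complex" where
  "wsbdf_symbol k g x = bdf_sum k x + of_real g * x * bdf_sum (k - 1) x"

lemma power_Suc_cheb_coeff:
  fixes x :: complex
  assumes "x\<^sup>2 = of_real y * x - of_real y"
  shows "x ^ Suc n = of_real (cheb_coeff y (Suc n)) * x - of_real (y * cheb_coeff y n)"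
proof (induction n)
  case (Suc n)
  have "x ^ Suc (Suc n) = of_real (cheb_coeff y (Suc n)) * x\<^sup>2 - of_real (y * cheb_coeff y n) * x"
    unfolding power_Suc[of x "Suc n"] Suc by (simp add: algebra_simps power2_eq_square)
  thus ?case unfolding assms by (simp add: algebra_simps)
qed auto

lemma bdf_sum_eq_linear:
  fixes x :: complex
  assumes "x\<^sup>2 = of_real y * x - of_real y"
  shows "bdf_sum k x = of_real (bdf_lin k y) * x + of_real (bdf_const k y)"
proof -
  have "x ^ j / of_nat j = of_real (cheb_coeff y j / j) * x + of_real (- y * cheb_coeff y (j - 1) / j)"
    if "j \<in> {1..k}" for j using power_Suc_cheb_coeff[OF assms, of "j - 1"] that
    by (simp add: field_simps del: power_Suc)
  hence "bdf_sum k x = (\<Sum>j=1..k. of_real (cheb_coeff y j / j) * x + of_real (- y * cheb_coeff y (j - 1) / j))"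
    unfolding bdf_sum_def by (intro sum.cong) auto
  thus ?thesis unfolding bdf_lin_def bdf_const_def by (simp only: sum.distrib sum_distrib_right of_real_sum)
qed

text \<open>Multiplication by the conjugate of the weight has the same argument as division by the
  weight. The product is affine in \<open>x\<close> with real coefficients and positive slope, so
  the quotient is real only where \<open>x\<close> is, that is, at \<open>xi = 1\<close> and
  \<open>xi = - 1\<close>.\<close>

lemma Im_symbol_on_circle:
  fixes xi :: complex
  assumes "cmod xi = 1" "1 <= k" "k <= 7" "2 <= g"
  defines "x \<equiv> 1 - xi"
  shows "\<exists>a>0. Im (wsbdf_symbol k g x * cnj (1 + of_real g * x)) = a * Im x"
proof -
  define y where "y = (cmod x)\<^sup>2"
  have "(cmod xi)\<^sup>2 = 1" using assms(1) by simp
  hence circ: "(Re xi)\<^sup>2 + (Im xi)\<^sup>2 = 1" by (simp add: cmod_power2)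
  have y2: "y = 2 - 2 * Re xi"
    using circ unfolding y_def x_def cmod_power2 by (simp add: power2_eq_square algebra_simps)
  have cx: "cnj x = of_real y - x" unfolding y2 x_def by (simp add: complex_eq_iff)
  have "x * cnj x = of_real y" unfolding y_def by (rule complex_norm_square[symmetric])
  hence x2: "x\<^sup>2 = of_real y * x - of_real y" unfolding cx by (simp add: algebra_simps power2_eq_square)
  have "\<bar>Re xi\<bar> <= 1" using abs_Re_le_cmod[of xi] assms(1) by simp
  hence y: "0 <= y" "y <= 4" unfolding y2 by auto
  define A B A' B' where "A = bdf_lin k y" and "B = bdf_const k y"
    and "A' = bdf_lin (k - 1) y" and "B' = bdf_const (k - 1) y"
  let ?a = "(A + g * (y * A' + B')) - g * (B - g * y * A')"
  have "wsbdf_symbol k g x * cnj (1 + of_real g * x)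
      = (of_real A * x + of_real B + of_real g * (of_real A' * x\<^sup>2 + of_real B' * x)) * (1 + of_real g * (of_real y - x))"
    unfolding wsbdf_symbol_def bdf_sum_eq_linear[OF x2] A_def B_def A'_def B'_def
    by (simp add: cx algebra_simps power2_eq_square)
  also have "... = of_real ?a * x + of_real ((B - g * y * A') * (1 + g * y) + g * y * (A + g * (A' * y + B')))"
  proof -
    have xx: "x * x = of_real y * x - of_real y" using x2 by (simp add: power2_eq_square)
    show ?thesis unfolding of_real_add of_real_diff of_real_mult of_real_1 using x2 by algebra
  qed finally have "Im (wsbdf_symbol k g x * cnj (1 + of_real g * x)) = ?a * Im x" by simp
  moreover have "0 < ?a" unfolding A_def B_def A'_def B'_def by (rule wsbdf_symbol_pos) (use assms y in auto)
  ultimately show ?thesis by blast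
qed

lemma bdf_sum_of_real: "bdf_sum k (of_real r :: complex) = of_real (bdf_sum k r)" unfolding bdf_sum_def by simp

lemma bdf_sum_nonneg: "0 <= r ==> 0 <= bdf_sum k (r::real)"
  unfolding bdf_sum_def by (intro sum_nonneg) auto

lemma bdf_sum_pos: "0 < r ==> 1 <= k ==> 0 < bdf_sum k (r::real)"
  unfolding bdf_sum_def by (intro sum_pos) auto

lemma wsbdf_symbol_real_pos:
  assumes "0 < r" "1 <= k" "0 <= g"
  shows "\<exists>p>0. wsbdf_symbol k g (of_real r) = of_real p"
proof (intro exI conjI)
  show "0 < bdf_sum k r + g * r * bdf_sum (k - 1) r"
    using assms bdf_sum_pos[of r k] bdf_sum_nonneg[of r "k-1"] by (intro add_pos_nonneg mult_nonneg_nonneg) auto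
qed (simp add: wsbdf_symbol_def bdf_sum_of_real)

lemma shift_weight_nonzero:
  assumes "cmod xi <= 1" "0 <= g"
  shows "1 + of_real g * (1 - xi) ~= 0"
proof -
  have "Re xi <= 1" using complex_Re_le_cmod[of xi] assms(1) by simp
  hence "0 < Re (1 + of_real g * (1 - xi))" using assms(2) by (auto intro!: add_pos_nonneg)
  thus ?thesis by (metis order_less_irrefl zero_complex.sel(1))
qed

text \<open>A zero makes the symbol times the conjugate weight real, which leaves only
  \<open>xi = - 1\<close>; there \<open>x = 2\<close>, the symbol is positive and the other term
  nonnegative.\<close>

lemma symbol_nonzero_on_circle:
  fixes xi :: complex
  assumes "cmod xi = 1" "xi ~= 1" "1 <= k" "k <= 7" "2 <= g" "0 <= t"
  shows "wsbdf_symbol k g (1 - xi) + of_real t * (1 + of_real g * (1 - xi)) ~= 0"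
proof
  define x Q where "x = 1 - xi" and "Q = 1 + of_real g * x"
  assume "wsbdf_symbol k g (1 - xi) + of_real t * (1 + of_real g * (1 - xi)) = 0"
  hence *: "wsbdf_symbol k g x = - of_real t * Q" by (simp add: x_def Q_def add_eq_0_iff)
  have "wsbdf_symbol k g x * cnj Q = - of_real (t * (cmod Q)\<^sup>2)"
    unfolding * by (simp add: complex_norm_square del: of_real_power)
  hence "Im (wsbdf_symbol k g x * cnj Q) = 0" by simp
  hence "Im x = 0" using Im_symbol_on_circle[OF assms(1,3-5)] unfolding Q_def x_def by force
  hence "Im xi = 0" by (simp add: x_def)
  hence "xi = of_real (Re xi)" by (simp add: complex_eq_iff)
  moreover from this have "\<bar>Re xi\<bar> = 1" using assms(1) by (metis norm_of_real)
  ultimately have "xi = -1" using assms(2) by (auto simp: abs_if split: if_splits)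
  hence x: "x = of_real 2" by (simp add: x_def)
  obtain p where p: "0 < p" "wsbdf_symbol k g (of_real 2) = of_real p"
    using wsbdf_symbol_real_pos[of 2 k g] assms by auto
  have "of_real (p + t * (1 + g * 2)) = (0::complex)" using * p(2) unfolding Q_def x by (simp add: eq_neg_iff_add_eq_0)
  hence "p + t * (1 + g * 2) = 0" by (simp only: of_real_eq_0_iff)
  moreover have "0 <= t * (1 + g * 2)" using assms by auto
  ultimately show False using p(1) by linarith
qed

lemma wsbdf_symbol_zero: "wsbdf_symbol k g 0 = 0" by (auto simp: wsbdf_symbol_def bdf_sum_def intro!: sum.neutral)

text \<open>The most negative real value taken by the quotient on the closed disc cannot be attained in
  the interior, because the quotient is an open map there.\<close>

lemma symbol_nonzero_in_disc:
  fixes xi :: complex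
  assumes "cmod xi <= 1" "xi ~= 1" "1 <= k" "k <= 7" "2 <= g" "0 <= t"
  shows "wsbdf_symbol k g (1 - xi) + of_real t * (1 + of_real g * (1 - xi)) ~= 0"
proof
  assume zero: "wsbdf_symbol k g (1 - xi) + of_real t * (1 + of_real g * (1 - xi)) = 0"
  define Q where "Q xi = 1 + of_real g * (1 - xi)" for xi :: complex
  define f where "f xi = wsbdf_symbol k g (1 - xi) / Q xi" for xi
  have Q: "Q xi ~= 0" if "cmod xi <= 1" for xi
    unfolding Q_def by (rule shift_weight_nonzero) (use that assms in auto)
  have holP: "(%xi. wsbdf_symbol k g (1 - xi)) holomorphic_on A" for A
    unfolding wsbdf_symbol_def bdf_sum_def by (intro holomorphic_intros) auto
  have holf: "f holomorphic_on cball 0 1"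
    unfolding f_def by (intro holomorphic_intros holP) (use Q in \<open>auto simp: Q_def intro!: holomorphic_intros\<close>)
  hence contf: "continuous_on (cball 0 1) f" by (rule holomorphic_on_imp_continuous_on)
  have f_neg: "f xi = - of_real t \<longleftrightarrow> wsbdf_symbol k g (1 - xi) + of_real t * Q xi = 0"
    if "cmod xi <= 1" for xi t using Q[OF that] unfolding f_def by (simp add: divide_eq_eq add_eq_0_iff2)
  \<comment> \<open>The points where the quotient is real and nonpositive; a zero for the parameter
    \<open>t\<close> is a point with value \<open>- t\<close>.\<close>
  define S where "S = cball 0 1 \<inter> f -` {w. Im w = 0 \<and> Re w <= 0}"
  have "compact S"
  proof -
    have "closed {w. Im w = 0 \<and> Re w <= 0}"
      by (intro closed_Collect_conj closed_Collect_eq closed_Collect_le continuous_intros)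
    hence "closed S" unfolding S_def by (intro continuous_closed_preimage contf) auto
    moreover have "bounded S" unfolding S_def by (rule bounded_subset[OF bounded_cball]) auto
    ultimately show ?thesis using compact_eq_bounded_closed by blast
  qed
  have xiS: "xi \<in> S"
  proof -
    have "f xi = - of_real t" using f_neg[OF assms(1)] zero by (simp add: Q_def)
    thus ?thesis using assms by (simp add: S_def)
  qed
  have "continuous_on S (%xi. Re (f xi))"
    by (intro continuous_intros continuous_on_subset[OF contf]) (auto simp: S_def)
  then obtain xi0 where xi0: "xi0 \<in> S" "!!zeta. zeta \<in> S ==> Re (f xi0) <= Re (f zeta)"
    using continuous_attains_inf[OF \<open>compact S\<close>] xiS by blast
  have f1: "f 1 = 0" by (simp add: f_def wsbdf_symbol_zero)
  \<comment> \<open>The minimum has to be attained away from 1, where the argument on the circle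
    applies. If 1 is a minimizer, the minimal value is 0, and the assumed zero \<open>xi\<close> is
    then a minimizer as well.\<close>
  obtain xi1 where xi1: "xi1 \<in> S" "xi1 ~= 1" "!!zeta. zeta \<in> S ==> Re (f xi1) <= Re (f zeta)"
  proof (cases "xi0 = 1")
    case True
    hence "Re (f xi) <= Re (f zeta)" if "zeta \<in> S" for zeta
      using xi0(2)[OF that] f1 xiS by (auto simp: S_def)
    thus ?thesis using that xiS assms(2) by blast
  qed (use that xi0 in blast)
  have fr: "f xi1 = - of_real (- Re (f xi1))" "0 <= - Re (f xi1)" "cmod xi1 <= 1"
    using xi1(1) by (auto simp: S_def complex_eq_iff)
  have "cmod xi1 ~= 1"
    using symbol_nonzero_on_circle[OF _ xi1(2) assms(3-5) fr(2)] f_neg[OF fr(3), of "- Re (f xi1)"] fr(1)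
    by (auto simp: Q_def)
  hence in_ball: "xi1 \<in> ball 0 1" using fr(3) by simp
  \<comment> \<open>The value of the quotient at 0 is positive, whereas the minimal value is
    not.\<close>
  have "\<not> f constant_on ball 0 1"
  proof
    assume "f constant_on ball 0 1"
    hence "f 0 = f xi1" using in_ball unfolding constant_on_def by (metis centre_in_ball zero_less_one)
    obtain p where p: "0 < p" "wsbdf_symbol k g (of_real 1) = of_real p"
      using wsbdf_symbol_real_pos[of 1 k g] assms by auto
    have "f 0 = of_real (p / (1 + g))" unfolding f_def Q_def using p(2) by simp
    hence "0 < Re (f 0)" using p(1) assms(5) by simp
    thus False using \<open>f 0 = f xi1\<close> fr(2) by simp
  qed
  hence "open (f ` ball 0 1)" by (intro open_mapping_thm[of f "ball 0 1"] holomorphic_on_subset[OF holf]) auto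
  then obtain e where e: "0 < e" "ball (f xi1) e \<subseteq> f ` ball 0 1"
    using in_ball by (meson image_eqI open_contains_ball)
  have "f xi1 - of_real (e / 2) \<in> ball (f xi1) e" using e(1) by (simp add: dist_norm)
  hence "f xi1 - of_real (e / 2) \<in> f ` ball 0 1" using e(2) by blast
  then obtain zeta where zeta: "zeta \<in> ball 0 1" "f zeta = f xi1 - of_real (e / 2)" by (metis imageE)
  hence "zeta \<in> S" using fr e(1) by (auto simp: S_def complex_eq_iff)
  hence "Re (f xi1) <= Re (f zeta)" by (rule xi1(3))
  thus False using zeta(2) e(1) by simp
qed

section \<open>Error bounds from the generating function\<close>

unbundle fps_syntax

section \<open>Cauchy estimates, uniform on a slightly larger disc\<close>

lemma fps_nth_ratio_bound:
  fixes A B :: "complex poly"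
  assumes "0 < R" and B: "!!xi. cmod xi <= R ==> poly B xi ~= 0"
    and C: "!!xi. cmod xi <= R ==> cmod (poly A xi / poly B xi) <= C"
  shows "cmod ((fps_of_poly A / fps_of_poly B) $ n) <= C / R ^ n"
proof -
  let ?f = "%xi. poly A xi / poly B xi"
  have poly_exp: "poly p has_fps_expansion fps_of_poly p" for p :: "complex poly"
    unfolding has_fps_expansion_def by simp
  have "coeff B 0 ~= 0" using B[of 0] \<open>0 < R\<close> by (simp add: poly_0_coeff_0)
  hence exp: "?f has_fps_expansion fps_of_poly A / fps_of_poly B" by (intro has_fps_expansion_divide' poly_exp) simp
  have hol: "?f holomorphic_on cball 0 R" using B by (intro holomorphic_intros) auto
  have "cmod ((deriv ^^ n) ?f 0) <= fact n * C / R ^ n"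
  proof (rule Cauchy_inequality)
    show "?f holomorphic_on ball 0 R" by (rule holomorphic_on_subset[OF hol]) auto
    show "continuous_on (cball 0 R) ?f" by (rule holomorphic_on_imp_continuous_on[OF hol])
  qed (use C \<open>0 < R\<close> in auto)
  thus ?thesis unfolding fps_nth_fps_expansion[OF exp] by (simp add: norm_divide divide_le_eq mult.commute)
qed

text \<open>By compactness, absence of zeros on the closed unit disc extends, with a uniform lower
  bound, to a disc of radius \<open>R > 1\<close> and to nearby parameters. The gain
  \<open>R > 1\<close> is what makes the coefficients of the power series decay
  geometrically.\<close>

lemma uniform_disc_bound:
  fixes f :: "real \<times> complex => complex"
  assumes "compact K" and cont: "continuous_on UNIV f"
    and nz: "!!b xi. b \<in> K ==> cmod xi <= 1 ==> f (b, xi) ~= 0"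
  obtains R c e where "1 < R" "0 < c" "0 < e"
    "!!b b' xi. b \<in> K ==> \<bar>b - b'\<bar> <= e ==> cmod xi <= R ==> c <= cmod (f (b', xi))"
proof -
  let ?S = "K \<times> cball (0::complex) 1"
  have S: "compact ?S" by (intro compact_Times assms compact_cball)
  obtain c where c: "0 < c" "!!p. p \<in> ?S ==> c < cmod (f p)"
  proof (cases "K = {}")
    case False
    have "continuous_on ?S (%p. cmod (f p))" by (intro continuous_intros continuous_on_subset[OF cont]) auto
    moreover have "?S ~= {}" using False by auto
    ultimately obtain p where p: "p \<in> ?S" "!!q. q \<in> ?S ==> cmod (f p) <= cmod (f q)"
      using continuous_attains_inf[OF S] by metis
    hence "0 < cmod (f p)" using nz[of "fst p" "snd p"] by auto
    moreover from this have "cmod (f p) / 2 < cmod (f q)" if "q \<in> ?S" for q using p(2)[OF that] by linarith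
    ultimately show ?thesis by (intro that[of "cmod (f p) / 2"]) auto
  qed (auto intro: that[of 1])
  have "open {p. c < cmod (f p)}" by (intro open_Collect_less continuous_intros cont)
  then obtain e where e: "0 < e" "(\<Union>p\<in>?S. ball p e) \<subseteq> {p. c < cmod (f p)}"
    using compact_subset_open_imp_ball_epsilon_subset[OF S, of "{p. c < cmod (f p)}"] c(2) by blast
  show ?thesis
  proof (rule that[of "1 + e / 3" c "e / 3"])
    fix b b' xi assume b: "b \<in> K" "\<bar>b - b'\<bar> <= e / 3" "cmod xi <= 1 + e / 3"
    \<comment> \<open>The radial projection of \<open>xi\<close> to the unit disc, at distance at
      most \<open>e / 3\<close>.\<close>
    let ?xi = "xi /\<^sub>R max 1 (cmod xi)"
    have "xi - ?xi = (1 - 1 / max 1 (cmod xi)) *\<^sub>R xi" by (simp add: scaleR_left_diff_distrib divide_inverse)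
    hence "dist ?xi xi <= e / 3" using b(3) e(1)
      by (cases "cmod xi <= 1") (auto simp: dist_norm norm_minus_commute max_def left_diff_distrib abs_if)
    hence "dist (b, ?xi) (b', xi) < e"
      using b(2) e(1) sqrt_sum_squares_le_sum_abs[of "dist b b'" "dist ?xi xi"]
      by (simp add: dist_Pair_Pair dist_real_def)
    moreover have "(b, ?xi) \<in> ?S" using b(1) by (auto simp: divide_simps max_def)
    ultimately show "c <= cmod (f (b', xi))" using e(2) by (force simp: less_imp_le)
  qed (use e c in auto)
qed

lemma uniform_disc_upper_bound:
  fixes f :: "real \<times> complex => complex"
  assumes "compact K" and cont: "continuous_on (K \<times> UNIV) f"
  obtains C where "0 < C" "!!b xi. b \<in> K ==> cmod xi <= R ==> cmod (f (b, xi)) <= C"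
proof -
  have "compact (f ` (K \<times> cball 0 R))"
    by (intro compact_continuous_image compact_Times assms compact_cball continuous_on_subset[OF cont]) auto
  then obtain C where "0 < C" "\<forall>w\<in>f ` (K \<times> cball 0 R). norm w <= C"
    using compact_imp_bounded bounded_pos by metis
  thus ?thesis by (intro that[of C]) auto
qed

section \<open>Division by a linear factor, continuous in its root\<close>

lemma synthetic_div_add: "synthetic_div (p + q) c = synthetic_div p c + synthetic_div q (c :: 'a :: comm_ring_1)"
proof -
  have "(p + q) + smult c (synthetic_div p c + synthetic_div q c)
      = (p + smult c (synthetic_div p c)) + (q + smult c (synthetic_div q c))" by (simp add: smult_add_right)
  also have "... = pCons (poly p c + poly q c) (synthetic_div p c + synthetic_div q c)"
    unfolding synthetic_div_correct by simp
  finally show ?thesis by (rule synthetic_div_unique[THEN conjunct2, symmetric])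
qed

lemma synthetic_div_smult: "synthetic_div (smult a p) c = smult a (synthetic_div p (c :: 'a :: comm_ring_1))"
proof -
  have "smult a p + smult c (smult a (synthetic_div p c)) = smult a (p + smult c (synthetic_div p c))"
    by (simp add: smult_add_right mult.commute)
  also have "... = pCons (a * poly p c) (smult a (synthetic_div p c))" unfolding synthetic_div_correct by simp
  finally show ?thesis by (rule synthetic_div_unique[THEN conjunct2, symmetric])
qed

lemma continuous_poly_synthetic_div:
  fixes p :: "'a :: real_normed_field poly"
  assumes "continuous_on A c" "continuous_on A x"
  shows "continuous_on A (%t. poly (synthetic_div p (c t)) (x t))"
  using assms by (induction p) (auto intro!: continuous_intros)

lemma continuous_poly_synthetic_div_twice:
  fixes p :: "'a :: real_normed_field poly"
  assumes "continuous_on A c" "continuous_on A d" "continuous_on A x"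
  shows "continuous_on A (%t. poly (synthetic_div (synthetic_div p (c t)) (d t)) (x t))"
  using assms by (induction p) (auto intro!: continuous_intros continuous_poly_synthetic_div)

section \<open>Trading exponential decay for powers of \<open>1 / n\<close>\<close>

lemma power_le_fact_exp: "y ^ mu / fact mu <= exp y" if "0 <= y" for y :: real
proof -
  have "(\<Sum>n\<in>{mu}. y ^ n /\<^sub>R fact n) <= (\<Sum>n. y ^ n /\<^sub>R fact n)"
    using that by (intro sum_le_suminf summable_exp_generic) auto
  thus ?thesis by (simp add: exp_def divide_inverse mult.commute)
qed

text \<open>Half of the decay \<open>exp (- x n)\<close> absorbs any power of \<open>x\<close> at
  the price of the same power of \<open>1 / n\<close>, uniformly in \<open>x\<close>. This converts
  orders of consistency into rates of convergence.\<close>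

lemma power_exp_bound: "x ^ mu * exp (- (x * real n) / 2) <= 2 ^ mu * fact mu / real n ^ mu"
  if "0 <= x" "1 <= n" for x :: real
proof -
  let ?y = "x * real n / 2"
  have "?y ^ mu / fact mu <= exp ?y" using that by (intro power_le_fact_exp) auto
  hence "?y ^ mu / fact mu * exp (- ?y) <= exp ?y * exp (- ?y)" by (rule mult_right_mono) simp
  also have "... = 1" by (simp flip: exp_add)
  finally have le: "?y ^ mu * exp (- ?y) <= fact mu" by (simp add: pos_divide_le_eq)
  have "x ^ mu = ?y ^ mu * (2 ^ mu / real n ^ mu)" using that by (simp add: power_mult_distrib power_divide)
  hence "x ^ mu * exp (- (x * real n) / 2) = ?y ^ mu * exp (- ?y) * (2 ^ mu / real n ^ mu)" by simp
  also have "... <= fact mu * (2 ^ mu / real n ^ mu)" by (rule mult_right_mono[OF le]) simp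
  finally show ?thesis by (simp add: mult.commute)
qed

lemma geometric_le_power:
  assumes "1 < R"
  obtains C where "0 < C" "!!n. 1 <= n ==> 1 / R ^ n <= C / real n ^ mu"
proof -
  \<comment> \<open>Chosen so that \<open>exp (- (x n) / 2)\<close> equals
    \<open>1 / R ^ n\<close>.\<close>
  define x where "x = 2 * ln R"
  have x: "0 < x" using assms by (simp add: x_def)
  have le: "1 / R ^ n <= (2 ^ mu * fact mu / x ^ mu) / real n ^ mu" if "1 <= n" for n
  proof -
    have "- (x * real n) / 2 = - (real n * ln R)" by (simp add: x_def)
    hence "exp (- (x * real n) / 2) = inverse (exp (real n * ln R))" by (simp only: exp_minus)
    also have "... = 1 / R ^ n" using assms by (simp only: exp_of_nat_mult exp_ln inverse_eq_divide)
    finally have "x ^ mu * (1 / R ^ n) <= 2 ^ mu * fact mu / real n ^ mu"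
      using power_exp_bound[of x n mu] x that by simp
    hence "1 / R ^ n <= (2 ^ mu * fact mu / real n ^ mu) / x ^ mu"
      using x by (subst pos_le_divide_eq) (simp_all only: zero_less_power mult.commute)
    thus ?thesis by (simp only: divide_divide_eq_left mult.commute)
  qed
  have "0 < 2 ^ mu * fact mu / x ^ mu" using x by simp
  thus ?thesis using that le by blast
qed

lemma discrete_gronwall:
  fixes f :: "nat => real"
  assumes f: "!!n. n <= N ==> f n <= B + c * (\<Sum>j<n. f j)" and "0 <= B" "0 <= c" "n <= N"
  shows "f n <= B * (1 + c) ^ n"
proof -
  have "B + c * (\<Sum>j<n. f j) <= B * (1 + c) ^ n" if "n <= N" for n using that
  proof (induction n)
    case (Suc n)
    hence IH: "B + c * (\<Sum>j<n. f j) <= B * (1 + c) ^ n" by simp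
    moreover have "f n <= B * (1 + c) ^ n" using f[of n] Suc.prems IH by linarith
    hence "c * f n <= c * (B * (1 + c) ^ n)" using \<open>0 <= c\<close> by (rule mult_left_mono)
    ultimately show ?case by (simp add: algebra_simps)
  qed simp
  from this[OF assms(4)] f[OF assms(4)] show ?thesis by linarith
qed

text \<open>The parameter \<open>b = 1 / (1 + z)\<close> makes the range of eigenvalues compact: the
  expression in \<open>nz\<close> is \<open>b\<close> times the denominator for
  \<open>z = (1 - b) / b\<close>, and \<open>b = 0\<close> is the limit of infinite
  \<open>z\<close>. At \<open>b = 1\<close>, that is \<open>z = 0\<close>, the denominator has the
  zero \<open>xi = 1\<close>; there the remaining factor \<open>P0\<close> takes over.\<close>

locale one_step_symbol =
  fixes P0 Q h :: "complex poly" and k mu :: nat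
  assumes nz: "!!b xi. 0 <= b ==> b < 1 ==> cmod xi <= 1 ==>
      of_real b * ((1 - xi) * poly P0 xi) + of_real (1 - b) * poly Q xi ~= 0"
    and P0_nz: "!!xi. cmod xi <= 1 ==> poly P0 xi ~= 0" and k: "1 <= k"
begin

text \<open>The coefficients of \<open>Y z\<close> are the numerical solution for the eigenvalue \<open>z\<close>. Division of \<open>D z\<close> by its
  approximate root \<open>exp z\<close> gives \<open>D z = (1 - exp (- z) \<xi>) E z + d z\<close> with a small remainder \<open>d z\<close>, and
  \<open>M z\<close> measures the effect of the starting values in the same way.\<close>

definition D :: "real => complex poly" where "D z = [:1, -1:] * P0 + smult (of_real z) Q"
definition N :: "real => complex poly" where "N z = P0 - smult (of_real z) h"
definition Y :: "real => complex fps" where "Y z = fps_of_poly (N z) / fps_of_poly (D z)"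

definition E :: "real => complex poly" where
  "E z = smult (- of_real (exp z)) (synthetic_div (D z) (of_real (exp z)))"
definition M :: "real => complex poly" where "M z = E z - N z"
definition M1 :: "real => complex poly" where
  "M1 z = smult (- of_real (exp z)) (synthetic_div (M z) (of_real (exp z)))"

abbreviation d :: "real => complex" where "d z \<equiv> poly (D z) (of_real (exp z))"
abbreviation Mw :: "real => complex" where "Mw z \<equiv> poly (M z) (of_real (exp z))"

text \<open>The linear factor is normalised to \<open>1 - exp (- z) X\<close>, because the
  reciprocal of this polynomial generates the exact values \<open>exp (- z n)\<close>.\<close>

lemma synthetic_div_exp:
  fixes p :: "complex poly"
  shows "[:1, - of_real (exp (- z)):] * smult (- of_real (exp z)) (synthetic_div p (of_real (exp z)))
     + [:poly p (of_real (exp z)):] = p"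
proof -
  have "[:1, - of_real (exp (- z)):] * smult (- of_real (exp z)) q = [:- of_real (exp z), 1:] * q"
    for q :: "complex poly" unfolding mult_smult_right mult_smult_left[symmetric]
    by (simp add: exp_minus flip: of_real_mult)
  thus ?thesis using synthetic_div_correct'[of "of_real (exp z)" p] by metis
qed

lemma D_split: "[:1, - of_real (exp (- z)):] * E z + [:d z:] = D z" unfolding E_def by (rule synthetic_div_exp)

lemma M_split: "[:1, - of_real (exp (- z)):] * M1 z + [:Mw z:] = M z" unfolding M1_def by (rule synthetic_div_exp)

lemma E_0: "E 0 = P0"
proof -
  have "[:1, -1:] * E 0 = [:1, -1:] * P0" using D_split[of 0] by (simp add: D_def)
  moreover have "[:1, -1:] ~= (0 :: complex poly)" by simp
  ultimately show ?thesis by (metis mult_cancel_left)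
qed

text \<open>Synthetic division is linear, so the dependence of the quotient on \<open>z\<close>
  becomes explicit, and joint continuity in \<open>z\<close> and \<open>xi\<close> can be read off,
  also at \<open>z = 0\<close>.\<close>

lemma E_eq: "poly (E z) xi = - of_real (exp z) *
   (poly (synthetic_div ([:1, -1:] * P0) (of_real (exp z))) xi + of_real z * poly (synthetic_div Q (of_real (exp z))) xi)"
  unfolding E_def D_def synthetic_div_add synthetic_div_smult by simp

lemma continuous_E: "continuous_on A (%p. poly (E (fst p)) (snd p))"
  unfolding E_eq by (intro continuous_intros continuous_poly_synthetic_div)

lemma M1_eq: "poly (M1 z) xi = - of_real (exp z) * (
    - of_real (exp z) * (
       poly (synthetic_div (synthetic_div ([:1, -1:] * P0) (of_real (exp z))) (of_real (exp z))) xi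
     + of_real z * poly (synthetic_div (synthetic_div Q (of_real (exp z))) (of_real (exp z))) xi)
    - (poly (synthetic_div P0 (of_real (exp z))) xi - of_real z * poly (synthetic_div h (of_real (exp z))) xi))"
proof -
  have diff: "synthetic_div (p - q) c = synthetic_div p c - synthetic_div q c" for p q :: "complex poly" and c
    using synthetic_div_add[of "p - q" q c] by (simp add: algebra_simps)
  define L where "L = [:1, -1:] * P0"
  show ?thesis unfolding M1_def M_def E_def D_def N_def L_def[symmetric]
    by (simp only: synthetic_div_add synthetic_div_smult diff poly_add poly_smult poly_diff)
qed

lemma continuous_M1: "continuous_on A (%p. poly (M1 (fst p)) (snd p))"
  unfolding M1_eq by (intro continuous_intros continuous_poly_synthetic_div continuous_poly_synthetic_div_twice)

lemma D_nonzero: "0 < z ==> cmod xi <= 1 ==> poly (D z) xi ~= 0"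
proof -
  assume z: "0 < z" and "cmod xi <= 1"
  define b where "b = 1 / (1 + z)"
  have b: "0 <= b" "b < 1" "1 - b = z / (1 + z)" using z by (auto simp: b_def field_simps)
  have "of_real b * poly (D z) xi = of_real b * ((1 - xi) * poly P0 xi) + of_real (1 - b) * poly Q xi"
    unfolding b(3) by (simp add: D_def b_def algebra_simps)
  thus ?thesis using nz[OF b(1,2) \<open>cmod xi <= 1\<close>] by auto
qed

text \<open>The error satisfies \<open>D e = M + d y\<close>. Splitting the root off
  \<open>D\<close> and off \<open>M\<close> and multiplying by \<open>y / E\<close>, where
  \<open>y\<close> is the inverse of the linear factor, gives the claim. The unknown error recurs on
  the right, but only with the small factor \<open>d z\<close>.\<close>

lemma error_identity:
  assumes z: "0 < z" and E0: "coeff (E z) 0 ~= 0"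
  defines "y \<equiv> Abs_fps (%n. of_real (exp (- z * real n)))"
  defines "e \<equiv> y - Y z"
  shows "e = fps_of_poly (M1 z) / fps_of_poly (E z)
     + (fps_of_poly 1 / fps_of_poly (E z)) * y * (fps_const (Mw z) + fps_const (d z) * (y - e))"
proof -
  let ?G = "fps_of_poly [:1, - of_real (exp (- z)):] :: complex fps"
  let ?E = "fps_of_poly (E z)" and ?D = "fps_of_poly (D z)" and ?M = "fps_of_poly (M z)"
    and ?M1 = "fps_of_poly (M1 z)" and ?N = "fps_of_poly (N z)"
  have Gy: "?G * y = 1"
  proof (rule fps_ext)
    fix n
    show "(?G * y) $ n = 1 $ n"
    proof (cases n)
      case (Suc m)
      have "?G = 1 - fps_const (of_real (exp (- z))) * fps_X" by (simp add: fps_of_poly_pCons)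
      hence "?G * y = y - fps_const (of_real (exp (- z))) * (fps_X * y)"
        by (simp only: left_diff_distrib mult.assoc mult_1_left)
      hence "(?G * y) $ n = y $ n - of_real (exp (- z)) * y $ m" using Suc by simp
      thus ?thesis using Suc by (simp add: y_def algebra_simps flip: of_real_mult exp_add)
    qed (simp add: y_def)
  qed
  have "poly (D z) 0 ~= 0" using D_nonzero[OF z, of 0] by simp
  hence D0: "?D $ 0 ~= 0" by (simp add: poly_0_coeff_0)
  have DY: "?D * Y z = ?N"
    unfolding Y_def using D0 inverse_mult_eq_1'[of ?D] by (simp add: fps_divide_unit mult.left_commute)
  have Dsp: "?D = ?G * ?E + fps_const (d z)"
    using arg_cong[OF D_split[of z], of fps_of_poly] by (simp add: fps_of_poly_add fps_of_poly_mult fps_of_poly_const)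
  have Msp: "?M = ?G * ?M1 + fps_const (Mw z)"
    using arg_cong[OF M_split[of z], of fps_of_poly] by (simp add: fps_of_poly_add fps_of_poly_mult fps_of_poly_const)
  have MEN: "?M = ?E - ?N" unfolding M_def by (simp add: fps_of_poly_diff)
  define i where "i = inverse ?E"
  have i: "i * ?E = 1" unfolding i_def using E0 by (intro inverse_mult_eq_1) simp
  have *: "?G * ?E * e = ?M + fps_const (d z) * y - fps_const (d z) * e"
  proof -
    have "?D * e = ?D * y - ?N" unfolding e_def by (simp add: right_diff_distrib DY)
    also have "?D * y = ?E * (?G * y) + fps_const (d z) * y" unfolding Dsp by (simp add: algebra_simps)
    finally have "?D * e = ?M + fps_const (d z) * y" unfolding MEN Gy by simp
    thus ?thesis unfolding Dsp by (simp add: algebra_simps)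
  qed
  have "e = (i * ?E) * ((?G * y) * e)" by (simp add: i Gy)
  also have "... = i * y * (?G * ?E * e)" by (simp add: mult_ac)
  also have "... = i * ((?G * y) * ?M1) + i * y * (fps_const (Mw z) + fps_const (d z) * (y - e))"
    unfolding * Msp by (simp add: algebra_simps)
  finally have "e = i * ?M1 + i * y * (fps_const (Mw z) + fps_const (d z) * (y - e))" unfolding Gy by simp
  thus ?thesis unfolding i_def using E0 by (simp add: fps_divide_unit mult.commute)
qed

section \<open>Error bounds for small and for large \<open>z\<close>\<close>

lemma sum_geometric_le:
  fixes q :: real
  assumes "0 <= q" "q < 1"
  shows "(\<Sum>i\<le>n. q ^ i) <= 1 / (1 - q)"
  using sum_gp_basic[of q n] assms by (simp add: pos_le_divide_eq mult.commute)

text \<open>The part \<open>M1 / E\<close> decays geometrically, since \<open>E\<close> has no zero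
  in a disc of radius \<open>R > 1\<close>. The rest, divided by \<open>exp (- z n)\<close>, obeys a
  Gronwall inequality with rate at most \<open>z / 2\<close> per step, so half of the decay survives
  and turns powers of \<open>z\<close> into powers of \<open>1 / n\<close>. Summation over
  \<open>n\<close> steps costs one of the \<open>k + 1\<close> powers.\<close>

lemma error_bound_small:
  assumes cons: "0 < C0" "0 < z00"
      "!!z. 0 < z ==> z <= z00 ==> cmod (d z) <= C0 * z ^ (k + 1)"
      "!!z. 0 < z ==> z <= z00 ==> cmod (Mw z) <= C0 * z ^ mu"
  obtains z1 C where "0 < z1" "0 < C"
    "!!z n. 0 < z ==> z <= z1 ==> 1 <= n ==>
       cmod (of_real (exp (- z * real n)) - Y z $ n) <= C * (1 / real n ^ k + 1 / real n ^ mu)"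
proof -
  obtain R c z0 where R: "1 < R" "0 < c" "0 < z0"
    and El: "!!b z xi. b \<in> {0} ==> \<bar>b - z\<bar> <= z0 ==> cmod xi <= R ==> c <= cmod (poly (E z) xi)"
    by (rule uniform_disc_bound[of "{0}" "%p. poly (E (fst p)) (snd p)"]) (use P0_nz continuous_E in \<open>auto simp: E_0\<close>)
  obtain C2' where C2': "0 < C2'" "!!z xi. z \<in> {0..z0} ==> cmod xi <= R ==> cmod (poly (M1 z) xi) <= C2'"
    using uniform_disc_upper_bound[of "{0..z0}" "%p. poly (M1 (fst p)) (snd p)" R] continuous_M1 by auto
  \<comment> \<open>The square root leaves room on both sides: \<open>exp z \<le> r\<close> implies
    \<open>r \<le> R exp (- z)\<close>, so \<open>R^-j\<close> is at most \<open>exp (- z j)\<close>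
    times the summable factor \<open>r^-j\<close>.\<close>
  define r C1 C2 where "r = sqrt R" and "C1 = (1 / c) * (1 / (1 - 1 / r))" and "C2 = C2' / c"
  have r: "1 < r" "r * r = R" using R by (auto simp: r_def)
  have C: "0 < C1" "0 < C2" using R C2' r unfolding C1_def C2_def by (auto intro!: mult_pos_pos divide_pos_pos)
  \<comment> \<open>The bound \<open>ln r\<close> serves the comparison of \<open>R\<close> with
    \<open>exp z\<close>; the bound \<open>1 / (4 C1 C0)\<close> makes \<open>C1 |d z|\<close> at
    most \<open>z / 4\<close>.\<close>
  define z1 where "z1 = min (min z0 z00) (min (ln r) (min 1 (1 / (4 * C1 * C0))))"
  have z1: "0 < z1" "z1 <= z0" "z1 <= z00" "z1 <= ln r" "z1 <= 1" "z1 <= 1 / (4 * C1 * C0)"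
    using R cons r C by (auto simp: z1_def)
  obtain Cg where Cg: "0 < Cg" "!!n. 1 <= n ==> 1 / R ^ n <= Cg / real n ^ mu"
    using geometric_le_power[OF R(1)] by blast
  define K where "K j = (2 ^ j * fact j :: real)" for j
  have K: "0 < K j" for j by (simp add: K_def)
  define C where "C = C2 * Cg + 2 * C1 * C0 * K mu + 4 * C1 * C0 * (1 + C2) * K (k + 1)"
  have "0 < C" unfolding C_def using \<open>0 < C1\<close> \<open>0 < C2\<close> Cg cons(1) K[of mu] K[of "k + 1"]
    by (intro add_pos_pos mult_pos_pos) auto
  moreover have "cmod (of_real (exp (- z * real n)) - Y z $ n) <= C * (1 / real n ^ k + 1 / real n ^ mu)"
    if z: "0 < z" "z <= z1" and n: "1 <= n" for z n
  proof -
    define a where "a = exp (- z)"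
    have a: "0 < a" "a ^ j = exp (- z * real j)" for j by (auto simp: a_def mult.commute simp flip: exp_of_nat_mult)
    have Ra: "r <= R * a"
    proof -
      have "exp z <= r" using z z1(4) r(1) by (metis exp_ln exp_le_cancel_iff less_trans order_trans zero_less_one)
      hence "r * exp z * a <= r * r * a" using a(1) r(1) by (intro mult_right_mono mult_left_mono) auto
      moreover have "exp z * a = 1" by (simp add: a_def flip: exp_add)
      ultimately show ?thesis using r(2) by (simp add: mult.assoc)
    qed
    have Rj: "1 / R ^ j <= a ^ j * (1 / r) ^ j" for j
    proof -
      have "r ^ j <= (R * a) ^ j" using Ra r(1) by (intro power_mono) auto
      thus ?thesis using R(1) r(1) by (simp add: power_mult_distrib power_divide field_simps)
    qed
    have Rj1: "1 / R ^ j <= a ^ j" for j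
    proof -
      have "(1 / r) ^ j <= 1" using r(1) by (intro power_le_one) auto
      hence "a ^ j * (1 / r) ^ j <= a ^ j * 1" using a(1) by (intro mult_left_mono) auto
      thus ?thesis using Rj[of j] by simp
    qed
    have E_low: "c <= cmod (poly (E z) xi)" if "cmod xi <= R" for xi using El[of 0 z] z z1 that by auto
    hence E_nz: "poly (E z) xi ~= 0" if "cmod xi <= R" for xi using that R(2) by force
    define iE e1 y H e e2 where "iE = fps_of_poly 1 / fps_of_poly (E z)"
      and "e1 = fps_of_poly (M1 z) / fps_of_poly (E z)"
      and "y = Abs_fps (%n. complex_of_real (exp (- z * real n)))" and "H = iE * y"
      and "e = y - Y z" and "e2 = e - e1"
    have y: "cmod (y $ j) = a ^ j" for j unfolding y_def a(2) by simp
    have iE: "cmod (iE $ j) <= (1 / c) / R ^ j" for j unfolding iE_def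
    proof (rule fps_nth_ratio_bound)
      show "cmod (poly 1 xi / poly (E z) xi) <= 1 / c" if "cmod xi <= R" for xi
        using E_low[OF that] R(2) by (simp add: norm_divide frac_le)
    qed (use R E_nz in auto)
    have e1: "cmod (e1 $ j) <= C2 / R ^ j" for j unfolding e1_def
    proof (rule fps_nth_ratio_bound)
      show "cmod (poly (M1 z) xi / poly (E z) xi) <= C2" if "cmod xi <= R" for xi
        unfolding norm_divide C2_def using E_low[OF that] R(2) C2'(1) C2'(2)[of z xi] that z z1
        by (intro frac_le) auto
    qed (use R E_nz in auto)
    have e1a: "cmod (e1 $ j) <= C2 * a ^ j" for j
    proof -
      have "C2 / R ^ j = C2 * (1 / R ^ j)" by simp
      also have "... <= C2 * a ^ j" using \<open>0 < C2\<close> Rj1[of j] by (intro mult_left_mono) auto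
      finally show ?thesis using e1[of j] by linarith
    qed
    have H: "cmod (H $ j) <= C1 * a ^ j" for j
    proof -
      have "cmod (H $ j) <= (\<Sum>i\<le>j. cmod (iE $ i * y $ (j - i)))"
        unfolding H_def fps_mult_nth atLeast0AtMost by (rule norm_sum)
      also have "... <= (\<Sum>i\<le>j. (a ^ j / c) * (1 / r) ^ i)"
      proof (rule sum_mono)
        fix i assume "i \<in> {..j}"
        have "cmod (iE $ i * y $ (j - i)) <= ((1 / c) / R ^ i) * a ^ (j - i)"
          unfolding norm_mult y using iE[of i] a(1) by (intro mult_right_mono) auto
        also have "... = (1 / c) * (1 / R ^ i) * a ^ (j - i)" by simp
        also have "... <= (1 / c) * (a ^ i * (1 / r) ^ i) * a ^ (j - i)"
          using Rj[of i] a(1) R(2) by (intro mult_right_mono mult_left_mono) auto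
        also have "... = (a ^ i * a ^ (j - i)) / c * (1 / r) ^ i" by simp
        also have "a ^ i * a ^ (j - i) = a ^ j" using \<open>i \<in> {..j}\<close> by (simp flip: power_add)
        finally show "cmod (iE $ i * y $ (j - i)) <= (a ^ j / c) * (1 / r) ^ i" .
      qed
      also have "... <= (a ^ j / c) * (1 / (1 - 1 / r))"
        unfolding sum_distrib_left[symmetric] using r(1) a(1) R(2) by (intro mult_left_mono sum_geometric_le) auto
      finally show ?thesis by (simp add: C1_def)
    qed
    have "coeff (E z) 0 ~= 0" using E_nz[of 0] R(1) by (simp add: poly_0_coeff_0)
    from error_identity[OF z(1) this]
    have e2: "e2 = H * (fps_const (Mw z) + fps_const (d z) * (y - e))"
      unfolding e2_def e_def e1_def H_def iE_def y_def by (simp add: algebra_simps)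
    have d_bd: "cmod (d z) <= C0 * z ^ (k + 1)" and M_bd: "cmod (Mw z) <= C0 * z ^ mu"
      using cons(3,4) z z1(3) by auto
    have dz: "C1 * cmod (d z) <= z / 4"
    proof -
      have "z ^ k <= z ^ 1" using z z1(5) k by (intro power_decreasing) auto
      hence zz: "z * z ^ k <= z * (1 / (4 * C1 * C0))" using z z1(6) by (intro mult_left_mono) auto
      have "C1 * C0 * (z * z ^ k) <= C1 * C0 * (z * (1 / (4 * C1 * C0)))"
        by (rule mult_left_mono[OF zz]) (use \<open>0 < C1\<close> cons(1) in auto)
      moreover have "C1 * C0 * (z * (1 / (4 * C1 * C0))) = z / 4"
        using \<open>0 < C1\<close> cons(1) by (simp add: field_simps)
      moreover have "C1 * cmod (d z) <= C1 * (C0 * z ^ (k + 1))"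
        using d_bd \<open>0 < C1\<close> by (intro mult_left_mono) auto
      ultimately show ?thesis by simp
    qed
    \<comment> \<open>Relative to the exact decay the convolution kernel is bounded by a constant,
      which gives a Volterra inequality for \<open>f\<close>.\<close>
    define f where "f j = cmod (e2 $ j) / a ^ j" for j
    have f: "cmod (e2 $ j) = f j * a ^ j" for j using a(1) by (simp add: f_def)
    define B where "B j = C1 * cmod (Mw z) + real (Suc j) * (C1 * cmod (d z) * (1 + C2))" for j
    have f_le: "f j <= B j + C1 * cmod (d z) * (\<Sum>i\<le>j. f i)" for j
    proof -
      let ?X = "fps_const (Mw z) + fps_const (d z) * (y - e)"
      have X: "cmod (?X $ i) <= (if i = 0 then cmod (Mw z) else 0) + cmod (d z) * ((1 + C2) * a ^ i + f i * a ^ i)" for i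
      proof -
        have "cmod ((y - e) $ i) <= cmod (y $ i) + cmod (e1 $ i) + cmod (e2 $ i)"
        proof -
          have "(y - e) $ i = y $ i - e1 $ i - e2 $ i" by (simp add: e2_def)
          hence "cmod ((y - e) $ i) = cmod (y $ i - e1 $ i - e2 $ i)" by (simp only:)
          thus ?thesis using norm_triangle_ineq4[of "y $ i - e1 $ i" "e2 $ i"] norm_triangle_ineq4[of "y $ i" "e1 $ i"]
            by linarith
        qed
        also have "... <= (1 + C2) * a ^ i + f i * a ^ i" using e1a[of i] by (simp add: y f algebra_simps)
        finally have "cmod (d z) * cmod ((y - e) $ i) <= cmod (d z) * ((1 + C2) * a ^ i + f i * a ^ i)"
          by (intro mult_left_mono) auto
        moreover have "cmod (?X $ i) <= (if i = 0 then cmod (Mw z) else 0) + cmod (d z) * cmod ((y - e) $ i)"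
          using norm_triangle_ineq[of "if i = 0 then Mw z else 0" "d z * (y - e) $ i"]
          by (simp add: norm_mult split: if_splits)
        ultimately show ?thesis by linarith
      qed
      have "cmod (e2 $ j) <= (\<Sum>i\<le>j. cmod (H $ (j - i) * ?X $ i))"
        unfolding e2 mult.commute[of H] fps_mult_nth atLeast0AtMost by (subst mult.commute) (rule norm_sum)
      also have "... <= (\<Sum>i\<le>j. a ^ j * ((if i = 0 then C1 * cmod (Mw z) else 0) + C1 * cmod (d z) * (1 + C2) + C1 * cmod (d z) * f i))"
      proof (rule sum_mono)
        fix i assume i: "i \<in> {..j}"
        have ai: "a ^ (j - i) * a ^ i = a ^ j" using i by (simp flip: power_add)
        have "cmod (H $ (j - i) * ?X $ i) <= (C1 * a ^ (j - i)) * ((if i = 0 then cmod (Mw z) else 0) + cmod (d z) * ((1 + C2) * a ^ i + f i * a ^ i))"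
          unfolding norm_mult using H[of "j - i"] X[of i] \<open>0 < C1\<close> a(1) by (intro mult_mono) auto
        also have "... = (if i = 0 then C1 * cmod (Mw z) else 0) * a ^ (j - i) + (a ^ (j - i) * a ^ i) * (C1 * cmod (d z) * (1 + C2) + C1 * cmod (d z) * f i)"
          by (simp add: algebra_simps)
        also have "... = a ^ j * ((if i = 0 then C1 * cmod (Mw z) else 0) + C1 * cmod (d z) * (1 + C2) + C1 * cmod (d z) * f i)"
          unfolding ai by (simp add: algebra_simps) finally show "cmod (H $ (j - i) * ?X $ i) <= ..." .
      qed
      also have "... = a ^ j * (B j + C1 * cmod (d z) * (\<Sum>i\<le>j. f i))"
        unfolding sum_distrib_left[symmetric] sum.distrib B_def by (simp add: sum.delta algebra_simps)
      finally show ?thesis unfolding f_def[of j] using a(1) by (simp add: pos_divide_le_eq mult.commute)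
    qed
    have f_nonneg: "0 <= f j" for j unfolding f_def using a(1) by simp
    have Bmono: "B j <= B n" if "j <= n" for j
      unfolding B_def using that \<open>0 < C1\<close> \<open>0 < C2\<close> by (intro add_left_mono mult_right_mono) auto
    have B_nonneg: "0 <= B n" unfolding B_def using \<open>0 < C1\<close> \<open>0 < C2\<close> by auto
    have "f n <= (2 * B n) * (1 + 2 * (C1 * cmod (d z))) ^ n"
    proof (rule discrete_gronwall)
      fix j assume "j <= n"
      have "(\<Sum>i\<le>j. f i) = (\<Sum>i<j. f i) + f j" by (simp add: lessThan_Suc_atMost[symmetric])
      hence "f j <= B n + C1 * cmod (d z) * (\<Sum>i<j. f i) + C1 * cmod (d z) * f j"
        using f_le[of j] Bmono[OF \<open>j <= n\<close>] by (simp add: algebra_simps)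
      \<comment> \<open>The last term of the sum is absorbed on the left; the factors 2 in front of
        \<open>B\<close> and of the rate come from this.\<close>
      moreover have "C1 * cmod (d z) * f j <= (1 / 2) * f j"
        using dz z z1(5) f_nonneg[of j] by (intro mult_right_mono) auto
      ultimately show "f j <= 2 * B n + 2 * (C1 * cmod (d z)) * (\<Sum>i<j. f i)" by linarith
    qed (use B_nonneg \<open>0 < C1\<close> in auto)
    also have "... <= (2 * B n) * exp (z * real n / 2)"
    proof -
      have "1 + 2 * (C1 * cmod (d z)) <= 1 + z / 2" using dz by simp
      also have "... <= exp (z / 2)" by simp finally have "(1 + 2 * (C1 * cmod (d z))) ^ n <= exp (z / 2) ^ n"
        using \<open>0 < C1\<close> by (intro power_mono) auto
      also have "... = exp (z * real n / 2)" by (simp add: mult.commute flip: exp_of_nat_mult)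
      finally show ?thesis using B_nonneg by (intro mult_left_mono) auto
    qed
    finally have "f n * a ^ n <= (2 * B n) * exp (z * real n / 2) * a ^ n" using a(1) by (intro mult_right_mono) auto
    also have "... = 2 * B n * exp (- (z * real n) / 2)" unfolding a(2) by (simp flip: exp_add)
    finally have e2n: "cmod (e2 $ n) <= 2 * B n * exp (- (z * real n) / 2)" unfolding f .
    define x where "x = exp (- (z * real n) / 2)"
    have x: "0 < x" by (simp add: x_def)
    have pe: "z ^ j * x <= K j / real n ^ j" for j unfolding x_def K_def using power_exp_bound[of z n j] z n by auto
    have "B n <= C1 * (C0 * z ^ mu) + (2 * real n) * (C1 * (C0 * z ^ (k + 1)) * (1 + C2))"
      unfolding B_def using M_bd d_bd \<open>0 < C1\<close> \<open>0 < C2\<close> n by (intro add_mono mult_mono mult_left_mono mult_right_mono) auto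
    hence "2 * B n * x <= 2 * (C1 * (C0 * z ^ mu) + (2 * real n) * (C1 * (C0 * z ^ (k + 1)) * (1 + C2))) * x"
      using x by (intro mult_right_mono mult_left_mono) auto
    also have "... = 2 * C1 * C0 * (z ^ mu * x) + 4 * C1 * C0 * (1 + C2) * real n * (z ^ (k + 1) * x)"
      by (simp add: algebra_simps)
    also have "... <= 2 * C1 * C0 * (K mu / real n ^ mu) + 4 * C1 * C0 * (1 + C2) * real n * (K (k + 1) / real n ^ (k + 1))"
      using pe[of mu] pe[of "k + 1"] \<open>0 < C1\<close> \<open>0 < C2\<close> cons(1) by (intro add_mono mult_left_mono) auto
    also have "... = 2 * C1 * C0 * K mu * (1 / real n ^ mu) + 4 * C1 * C0 * (1 + C2) * K (k + 1) * (1 / real n ^ k)"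
      using n by simp finally have e2f: "cmod (e2 $ n) <= ..." using e2n unfolding x_def by linarith
    have "C2 / R ^ n <= C2 * Cg * (1 / real n ^ mu)"
      using mult_left_mono[OF Cg(2)[OF n], of C2] \<open>0 < C2\<close> by simp
    hence e1f: "cmod (e1 $ n) <= C2 * Cg * (1 / real n ^ mu)" using e1[of n] by linarith
    have "e $ n = e1 $ n + e2 $ n" by (simp add: e2_def)
    hence "cmod (e $ n) <= cmod (e1 $ n) + cmod (e2 $ n)" by (simp add: norm_triangle_ineq)
    also have "... <= (C2 * Cg + 2 * C1 * C0 * K mu) * (1 / real n ^ mu) + 4 * C1 * C0 * (1 + C2) * K (k + 1) * (1 / real n ^ k)"
      using e1f e2f by (simp add: algebra_simps)
    also have "... <= C * (1 / real n ^ mu) + C * (1 / real n ^ k)"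
    proof -
      have "0 <= C2 * Cg" "0 <= 2 * C1 * C0 * K mu" "0 <= 4 * C1 * C0 * (1 + C2) * K (k + 1)"
        using \<open>0 < C1\<close> \<open>0 < C2\<close> Cg(1) cons(1) K[of mu] K[of "k + 1"] by (auto intro!: mult_nonneg_nonneg)
      hence "C2 * Cg + 2 * C1 * C0 * K mu <= C" "4 * C1 * C0 * (1 + C2) * K (k + 1) <= C"
        unfolding C_def by auto
      thus ?thesis by (intro add_mono[OF mult_right_mono mult_right_mono]) auto
    qed finally show ?thesis by (simp add: e_def y_def algebra_simps)
  qed
  ultimately show ?thesis using that[of z1 C] z1(1) by blast
qed

text \<open>Away from \<open>z = 0\<close> no cancellation is involved: exact and numerical value
  are both geometrically small. Dividing numerator and denominator by \<open>1 + z\<close> leaves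
  the compact range \<open>0 \<le> b \<le> b0 < 1\<close> and makes the estimate uniform for large
  \<open>z\<close>.\<close>

lemma error_bound_large:
  assumes "0 < z1"
  obtains C where "0 < C"
    "!!z n. z1 <= z ==> 1 <= n ==> cmod (of_real (exp (- z * real n)) - Y z $ n) <= C / real n ^ mu"
proof -
  define b0 where "b0 = 1 / (1 + z1)"
  have b0: "0 < b0" "b0 < 1" using assms by (auto simp: b0_def)
  let ?D = "%(b, xi). of_real b * ((1 - xi) * poly P0 xi) + of_real (1 - b) * poly Q xi"
  let ?N = "%(b, xi). of_real b * poly P0 xi - of_real (1 - b) * poly h xi"
  have contD: "continuous_on A ?D" for A unfolding case_prod_beta by (intro continuous_intros)
  have contN: "continuous_on A ?N" for A unfolding case_prod_beta by (intro continuous_intros)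
  obtain R c e where R: "1 < R" "0 < c"
    and Dl: "!!b b' xi. b \<in> {0..b0} ==> \<bar>b - b'\<bar> <= e ==> cmod xi <= R ==> c <= cmod (?D (b', xi))" and e: "0 < e"
    by (rule uniform_disc_bound[of "{0..b0}" ?D]) (use nz b0 contD in auto)
  have R3: "c <= cmod (?D (b, xi))" if "b \<in> {0..b0}" "cmod xi <= R" for b xi
    using Dl[of b b xi] that e by simp
  obtain C1 where C1: "0 < C1" "!!b xi. b \<in> {0..b0} ==> cmod xi <= R ==> cmod (?N (b, xi)) <= C1"
    using uniform_disc_upper_bound[of "{0..b0}" ?N R] contN by auto
  obtain Cg where Cg: "0 < Cg" "!!n. 1 <= n ==> 1 / R ^ n <= Cg / real n ^ mu"
    using geometric_le_power[OF R(1)] by blast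
  obtain Ce where Ce: "0 < Ce" "!!n. 1 <= n ==> 1 / exp z1 ^ n <= Ce / real n ^ mu"
    using geometric_le_power[of "exp z1"] assms by auto
  have "cmod (of_real (exp (- z * real n)) - Y z $ n) <= (Ce + C1 / c * Cg) / real n ^ mu"
    if z: "z1 <= z" and n: "1 <= n" for z n
  proof -
    define b where "b = 1 / (1 + z)"
    have b: "b \<in> {0..b0}" "0 < b" "1 - b = b * z" using z assms by (auto simp: b_def b0_def field_simps)
    have D: "of_real b * poly (D z) xi = ?D (b, xi)" for xi unfolding b(3) case_prod_conv by (simp add: D_def algebra_simps)
    have N: "of_real b * poly (N z) xi = ?N (b, xi)" for xi unfolding b(3) case_prod_conv by (simp add: N_def algebra_simps)
    have "cmod (Y z $ n) <= (C1 / c) / R ^ n" unfolding Y_def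
    proof (rule fps_nth_ratio_bound)
      fix xi assume xi: "cmod xi <= R"
      show nz: "poly (D z) xi ~= 0" using R3[OF b(1) xi] R(2) unfolding D[symmetric] by force
      have "poly (N z) xi / poly (D z) xi = ?N (b, xi) / ?D (b, xi)"
        unfolding D[symmetric] N[symmetric] using b(2) by simp
      thus "cmod (poly (N z) xi / poly (D z) xi) <= C1 / c"
        using R3[OF b(1) xi] C1(2)[OF b(1) xi] C1(1) R(2) by (simp only: norm_divide) (intro frac_le, auto)
    qed (use R in auto)
    also have "... <= C1 / c * Cg / real n ^ mu"
      using mult_left_mono[OF Cg(2)[OF n], of "C1 / c"] C1(1) R(2) by simp
    finally have Yn: "cmod (Y z $ n) <= C1 / c * Cg / real n ^ mu" .
    have "exp (- z * real n) <= exp (- (real n * z1))" using z by (simp add: mult.commute mult_right_mono)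
    also have "... = 1 / exp z1 ^ n" by (simp add: exp_minus exp_of_nat_mult inverse_eq_divide)
    also have "... <= Ce / real n ^ mu" by (rule Ce(2)[OF n])
    finally have "cmod (of_real (exp (- z * real n)) - Y z $ n) <= Ce / real n ^ mu + C1 / c * Cg / real n ^ mu"
      using norm_triangle_ineq4[of "complex_of_real (exp (- z * real n))" "Y z $ n"] Yn by simp
    thus ?thesis by (simp only: add_divide_distrib)
  qed
  moreover have "0 < Ce + C1 / c * Cg" using Ce Cg C1 R by (intro add_pos_pos mult_pos_pos divide_pos_pos) auto
  ultimately show ?thesis using that by blast
qed

theorem error_bound:
  assumes "0 < C0" "0 < z00"
      "!!z. 0 < z ==> z <= z00 ==> cmod (d z) <= C0 * z ^ (k + 1)"
      "!!z. 0 < z ==> z <= z00 ==> cmod (Mw z) <= C0 * z ^ mu"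
  obtains C where "0 < C"
    "!!z n. 0 < z ==> 1 <= n ==>
       cmod (of_real (exp (- z * real n)) - Y z $ n) <= C * (1 / real n ^ k + 1 / real n ^ mu)"
proof -
  obtain z1 C1 where 1: "0 < z1" "0 < C1" "!!z n. 0 < z ==> z <= z1 ==> 1 <= n ==>
       cmod (of_real (exp (- z * real n)) - Y z $ n) <= C1 * (1 / real n ^ k + 1 / real n ^ mu)"
    using error_bound_small[OF assms] by blast
  obtain C2 where 2: "0 < C2" "!!z n. z1 <= z ==> 1 <= n ==>
       cmod (of_real (exp (- z * real n)) - Y z $ n) <= C2 / real n ^ mu"
    using error_bound_large[OF 1(1)] by blast
  have "cmod (of_real (exp (- z * real n)) - Y z $ n) <= (C1 + C2) * (1 / real n ^ k + 1 / real n ^ mu)"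
    if "0 < z" "1 <= n" for z n
  proof (cases "z <= z1")
    case True
    have "0 <= C2 * (1 / real n ^ k + 1 / real n ^ mu)" using 2(1) by simp
    thus ?thesis using 1(3)[OF that(1) True that(2)] by (simp only: distrib_right)
  next
    case False
    have "0 <= C1 * (1 / real n ^ k + 1 / real n ^ mu)" "0 <= C2 * (1 / real n ^ k)" using 1(2) 2(1) by auto
    thus ?thesis using 2(2)[of z n] False that by (simp only: distrib_right distrib_left) simp
  qed
  thus ?thesis using that[of "C1 + C2"] 1(2) 2(1) by auto
qed

end

section \<open>Consistency of the corrected scheme\<close>

lemma abs_one_minus_exp_le: "\<bar>1 - exp z\<bar> <= 2 * z" if "0 <= z" "z <= 1" for z :: real
proof -
  have "exp z <= 1 + z + z\<^sup>2" using that by (intro exp_bound)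
  moreover have "z\<^sup>2 <= z * 1" unfolding power2_eq_square using that by (intro mult_left_mono) auto
  moreover have "1 <= exp z" using that by simp
  ultimately show ?thesis by simp
qed

text \<open>By the geometric sum, the derivative of the error in \<open>z\<close> is exactly
  \<open>(1 - exp z) ^ k\<close>, and the mean value theorem contributes one more power. The case
  \<open>k = 0\<close> is included because the second part of the symbol involves
  \<open>k - 1\<close>.\<close>

lemma bdf_sum_exp_bound:
  fixes z :: real
  assumes "0 <= z" "z <= 1"
  shows "\<bar>bdf_sum k (1 - exp z) + z\<bar> <= 2 ^ k * z ^ (k + 1)"
proof (cases "z = 0")
  case True
  thus ?thesis by (auto simp: bdf_sum_def intro!: sum.neutral)
next
  case False
  let ?f = "%z::real. bdf_sum k (1 - exp z) + z"
  have deriv: "(?f has_real_derivative (1 - exp t) ^ k) (at t)" for t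
  proof -
    have "(?f has_real_derivative (\<Sum>j=1..k. - exp t * (1 - exp t) ^ (j - 1)) + 1) (at t)" unfolding bdf_sum_def
      by (rule derivative_eq_intros refl | simp)+
    moreover have "(\<Sum>j=1..k. - exp t * (1 - exp t) ^ (j - 1)) = - exp t * (\<Sum>i<k. (1 - exp t) ^ i)"
      by (simp add: sum.atLeast1_atMost_eq sum_distrib_left)
    moreover have "exp t * (\<Sum>i<k. (1 - exp t) ^ i) = 1 - (1 - exp t) ^ k"
      using one_diff_power_eq[of "1 - exp t" k] by simp
    ultimately show ?thesis by simp
  qed
  obtain c where c: "0 < c" "c < z" "?f z - ?f 0 = (z - 0) * (1 - exp c) ^ k"
    using MVT2[of 0 z ?f "%t. (1 - exp t) ^ k"] deriv assms False by auto
  have "?f 0 = 0" by (auto simp: bdf_sum_def intro!: sum.neutral)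
  hence "\<bar>?f z\<bar> = z * \<bar>1 - exp c\<bar> ^ k" using c assms by (simp add: abs_mult power_abs)
  also have "... <= z * (2 * z) ^ k"
    using abs_one_minus_exp_le[of c] c assms by (intro mult_left_mono power_mono) auto
  finally show ?thesis by (simp add: power_mult_distrib mult_ac)
qed

text \<open>Eulerian polynomials: the generating function of \<open>n^m\<close> is
  \<open>euler_poly m / (1 - xi)^(m + 1)\<close>, and the recursion applies \<open>xi\<close> times
  the derivative in \<open>xi\<close> to this quotient.\<close>

fun euler_poly :: "nat => complex poly" where
  "euler_poly 0 = 1"
| "euler_poly (Suc m) = [:0, 1:] * ([:1, -1:] * pderiv (euler_poly m) + smult (of_nat (Suc m)) (euler_poly m))"

lemma fps_of_poly_one_minus_X: "fps_of_poly [:1, -1:] = (1 - fps_X :: complex fps)" by (simp add: fps_of_poly_pCons)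

lemma fps_euler_poly:
  "fps_of_poly (euler_poly m) = (1 - fps_X) ^ (m + 1) * Abs_fps (%n. of_nat n ^ m)"
proof (induction m)
  case 0
  show ?case
  proof (rule fps_ext)
    fix n show "fps_of_poly (euler_poly 0) $ n = ((1 - fps_X) ^ (0 + 1) * Abs_fps (%n. of_nat n ^ 0)) $ n"
      by (cases n) (simp_all add: left_diff_distrib)
  qed
next
  case (Suc m)
  let ?g = "%m. Abs_fps (%n. of_nat n ^ m) :: complex fps"
  have g: "?g (Suc m) = fps_X * fps_deriv (?g m)"
  proof (rule fps_ext)
    fix n show "?g (Suc m) $ n = (fps_X * fps_deriv (?g m)) $ n" by (cases n) (auto simp: algebra_simps)
  qed
  have dp: "fps_deriv ((1 - fps_X :: complex fps) ^ (m + 1)) = - (of_nat (m + 1) * (1 - fps_X) ^ m)"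
    unfolding fps_deriv_power' by (simp add: algebra_simps)
  have "fps_of_poly (euler_poly (Suc m)) = fps_X * ((1 - fps_X) * fps_deriv ((1 - fps_X) ^ (m + 1) * ?g m)
      + of_nat (m + 1) * ((1 - fps_X) ^ (m + 1) * ?g m))"
    unfolding Suc[symmetric] euler_poly.simps fps_of_poly_mult fps_of_poly_add fps_of_poly_smult
      fps_of_poly_pderiv fps_of_poly_one_minus_X fps_of_poly_fps_X by (simp add: fps_of_nat del: of_nat_Suc)
  also have "... = (1 - fps_X) ^ (m + 2) * (fps_X * fps_deriv (?g m))"
    unfolding fps_deriv_mult dp by (simp add: algebra_simps) finally show ?case unfolding g by simp
qed

text \<open>\<open>1 / (1 - exp w) + 1 / w\<close> is holomorphic at the origin, and \<open>m\<close>-fold differentiation turns it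
  into the difference bounded here.\<close>

lemma euler_poly_exp_bound:
  obtains C where "0 < C" "!!z::real. 0 < z ==> z <= 1 / 2 ==>
    cmod (poly (euler_poly m) (of_real (exp z)) / (1 - of_real (exp z)) ^ (m + 1) - fact m / (- of_real z) ^ (m + 1)) <= C"
proof -
  let ?f = "%w::complex. 1 / (1 - exp w) + 1 / w"
  have exp1: "exp w ~= 1" if "w \<in> ball 0 1 - {0}" for w :: complex
  proof
    assume "exp w = 1"
    then obtain n :: int where n: "w = of_int (2 * n) * of_real pi * \<i>" 
      unfolding exp_eq_1 by (auto simp: complex_eq_iff mult_ac)
    hence "n ~= 0" using that by auto
    hence "1 <= \<bar>real_of_int n\<bar>" by linarith
    hence "2 * pi * 1 <= 2 * pi * \<bar>real_of_int n\<bar>" by (intro mult_left_mono) auto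
    moreover have "cmod w = 2 * pi * \<bar>real_of_int n\<bar>" using n by (simp add: norm_mult)
    ultimately show False using that pi_gt3 unfolding mem_ball Diff_iff dist_0_norm by linarith
  qed
  have holf: "?f holomorphic_on ball 0 1 - {0}" by (intro holomorphic_intros) (use exp1 in auto)
  have lim: "((%w. (w - 0) * ?f w) \<longlongrightarrow> 0) (at 0)"
  proof -
    have "((%w::complex. (exp w - 1) / w) \<longlongrightarrow> 1) (at 0)"
      using DERIV_exp[of "0::complex"] unfolding has_field_derivative_iff by simp
    from tendsto_inverse[OF this] have "((%w::complex. w / (exp w - 1)) \<longlongrightarrow> 1) (at 0)" by simp
    from tendsto_diff[OF tendsto_const[of 1] this] have "((%w::complex. 1 - w / (exp w - 1)) \<longlongrightarrow> 0) (at 0)" by simp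
    moreover have "eventually (%w::complex. 1 - w / (exp w - 1) = (w - 0) * ?f w) (at 0)"
    proof -
      have "eventually (%w::complex. w \<in> ball 0 1 - {0}) (at 0)" by (intro eventually_at_in_open) auto
      thus ?thesis
      proof eventually_elim
        case (elim w)
        hence "w ~= 0" "1 - exp w ~= 0" "exp w - 1 ~= 0" using exp1[OF elim] by auto
        thus ?case by (simp add: field_simps)
      qed
    qed
    ultimately show ?thesis by (rule Lim_transform_eventually)
  qed
  \<comment> \<open>The singularity at the origin is removable, so all derivatives of
    \<open>F\<close> are bounded near 0.\<close>
  obtain F where F: "F holomorphic_on ball 0 1" "!!w. w \<in> ball 0 1 - {0} ==> F w = ?f w"
    using holomorphic_on_extend_lim[OF holf, of] lim by auto
  have holF: "(deriv ^^ m) F holomorphic_on ball 0 1" for m using F(1) by (intro holomorphic_higher_deriv) auto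
  \<comment> \<open>Differentiation in \<open>w\<close> is \<open>xi\<close> times differentiation
    in \<open>xi\<close> at \<open>xi = exp w\<close>, hence it follows the Eulerian
    recursion.\<close>
  have eq: "(deriv ^^ m) F w = poly (euler_poly m) (exp w) / (1 - exp w) ^ (m + 1) - fact m / (- w) ^ (m + 1)"
    if "w \<in> ball 0 1 - {0}" for w using that
  proof (induction m arbitrary: w)
    case 0
    thus ?case using F(2) by simp
  next
    case (Suc m)
    let ?h = "%w. poly (euler_poly m) (exp w) / (1 - exp w) ^ (m + 1) - fact m / (- w) ^ (m + 1)"
    have w: "w ~= 0" "1 - exp w ~= 0" using Suc.prems exp1[OF Suc.prems] by auto
    have "eventually (%v. (deriv ^^ m) F v = ?h v) (nhds w)"
    proof (rule eventually_mono)
      show "eventually (%v. v \<in> ball 0 1 - {0}) (nhds w)"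
        by (rule eventually_nhds_in_open) (use Suc.prems in auto)
    qed (rule Suc.IH)
    hence "(deriv ^^ Suc m) F w = deriv ?h w" by (simp add: deriv_cong_ev)
    also have "... = poly (euler_poly (Suc m)) (exp w) / (1 - exp w) ^ (Suc m + 1) - fact (Suc m) / (- w) ^ (Suc m + 1)"
    proof (rule DERIV_imp_deriv)
      let ?A = "poly (euler_poly m) (exp w)" and ?A' = "poly (pderiv (euler_poly m)) (exp w)"
      have d1: "((%w. poly (euler_poly m) (exp w)) has_field_derivative ?A' * exp w) (at w)"
        by (rule DERIV_chain2[OF poly_DERIV DERIV_exp])
      have d2: "((%w. (1 - exp w) ^ (m + 1)) has_field_derivative of_nat (m + 1) * (1 - exp w) ^ m * (- exp w)) (at w)"
        by (rule derivative_eq_intros refl | simp)+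
      have d3: "((%w. fact m / (- w) ^ (m + 1)) has_field_derivative fact (Suc m) / (- w) ^ (Suc m + 1)) (at w)"
      proof -
        have "((%w. (- w) ^ (m + 1)) has_field_derivative of_nat (m + 1) * (- w) ^ m * (- 1)) (at w)"
          by (rule derivative_eq_intros refl | simp)+
        from DERIV_divide[OF DERIV_const[of "fact m"] this] w(1)
        have "((%w. fact m / (- w) ^ (m + 1)) has_field_derivative
            (0 * (- w) ^ (m + 1) - fact m * (of_nat (m + 1) * (- w) ^ m * (- 1))) / ((- w) ^ (m + 1) * (- w) ^ (m + 1))) (at w)"
          by simp
        moreover have "(0 * (- w) ^ (m + 1) - fact m * (of_nat (m + 1) * (- w) ^ m * (- 1))) / ((- w) ^ (m + 1) * (- w) ^ (m + 1))
            = fact (Suc m) * (- w) ^ m / ((- w) ^ m * (- w) ^ (Suc m + 1))" by (simp add: algebra_simps)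
        ultimately show ?thesis using w(1) by (simp only: mult_divide_mult_cancel_left power_not_zero neg_equal_0_iff_equal mult.commute[of "fact (Suc m)"]) simp
      qed
      have "(?A' * exp w * (1 - exp w) ^ (m + 1) - ?A * (of_nat (m + 1) * (1 - exp w) ^ m * (- exp w)))
          / ((1 - exp w) ^ (m + 1) * (1 - exp w) ^ (m + 1))
          = (1 - exp w) ^ m * (exp w * ((1 - exp w) * ?A' + of_nat (Suc m) * ?A)) / ((1 - exp w) ^ m * (1 - exp w) ^ (Suc m + 1))"
        (is "?n / ?d = ?n' / ?d'")
      proof -
        have "?n = ?n'" "?d = ?d'" by (simp_all add: algebra_simps)
        thus ?thesis by simp
      qed
      also have "exp w * ((1 - exp w) * ?A' + of_nat (Suc m) * ?A) = poly (euler_poly (Suc m)) (exp w)"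
        by (simp add: algebra_simps)
      also have "(1 - exp w) ^ m * poly (euler_poly (Suc m)) (exp w) / ((1 - exp w) ^ m * (1 - exp w) ^ (Suc m + 1))
          = poly (euler_poly (Suc m)) (exp w) / (1 - exp w) ^ (Suc m + 1)"
        using w(2) by (simp only: mult_divide_mult_cancel_left power_not_zero not_False_eq_True)
      finally show "(?h has_field_derivative poly (euler_poly (Suc m)) (exp w) / (1 - exp w) ^ (Suc m + 1) - fact (Suc m) / (- w) ^ (Suc m + 1)) (at w)"
        using DERIV_diff[OF DERIV_divide[OF d1 d2] d3] w(2) by simp
    qed finally show ?case .
  qed
  have "compact ((deriv ^^ m) F ` cball 0 (1 / 2))"
    by (intro compact_continuous_image holomorphic_on_imp_continuous_on holomorphic_on_subset[OF holF]) auto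
  then obtain C where C: "0 < C" "\<forall>v\<in>(deriv ^^ m) F ` cball 0 (1 / 2). norm v <= C"
    using compact_imp_bounded bounded_pos by metis
  show ?thesis
  proof (rule that[OF C(1)])
    fix z :: real assume z: "0 < z" "z <= 1 / 2"
    hence "cmod ((deriv ^^ m) F (of_real z)) <= C" using C(2) by auto
    thus "cmod (poly (euler_poly m) (of_real (exp z)) / (1 - of_real (exp z)) ^ (m + 1) - fact m / (- of_real z) ^ (m + 1)) <= C"
      using eq[of "of_real z"] z by (simp add: exp_of_real)
  qed
qed

lemma one_plus_power_minus_one_bound:
  fixes x :: "'a::{real_normed_algebra_1, comm_ring_1}"
  shows "norm ((1 + x) ^ m - 1) <= norm x * (real m * (1 + norm x) ^ m)"
proof (induction m)
  case (Suc m)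
  have "(1 + x) ^ Suc m - 1 = (1 + x) * ((1 + x) ^ m - 1) + x" by (simp add: algebra_simps)
  hence "norm ((1 + x) ^ Suc m - 1) <= norm (1 + x) * norm ((1 + x) ^ m - 1) + norm x"
    by (metis norm_triangle_mono norm_mult_ineq order_refl)
  also have "... <= (1 + norm x) * (norm x * (real m * (1 + norm x) ^ m)) + norm x * (1 + norm x) ^ Suc m"
  proof (intro add_mono mult_mono)
    show "norm (1 + x) <= 1 + norm x" using norm_triangle_ineq[of 1 x] by simp
    have "norm x * 1 <= norm x * (1 + norm x) ^ Suc m" by (intro mult_left_mono one_le_power) auto
    thus "norm x <= norm x * (1 + norm x) ^ Suc m" by simp
  qed (use Suc in auto)
  also have "... = norm x * (real (Suc m) * (1 + norm x) ^ Suc m)" by (simp add: algebra_simps) finally show ?case .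
qed simp

text \<open>If \<open>u\<close> were \<open>- z\<close> and \<open>a\<close> were the pole
  \<open>m! / (- z)^(m + 1)\<close>, the first summand would be exactly \<open>- 1\<close>. The
  relative error of \<open>u\<close> has order \<open>z^k\<close>; the error of \<open>a\<close> is
  bounded and gets multiplied by \<open>z^(m + 1)\<close>. This is the source of the order
  \<open>min k (m + 1)\<close>.\<close>

lemma corrected_weight_bound:
  fixes u a :: complex and z :: real
  assumes z: "0 < z" "z <= 1" and u: "cmod (u + of_real z) <= C1 * z ^ (k + 1)"
    and a: "cmod (a - fact m / (- of_real z) ^ (m + 1)) <= C2" and C: "0 <= C1" "0 <= C2"
    and mu: "mu <= k" "mu <= m + 1"
  shows "cmod (of_real z * u ^ m * a / fact m + 1) <= (C1 * (real m * (1 + C1) ^ m) + (1 + C1) ^ m * C2) * z ^ mu"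
proof -
  define Z where "Z = complex_of_real z"
  define eps where "eps = - (u + Z) / Z"
  define r where "r = a - fact m / (- Z) ^ (m + 1)"
  have Z: "Z ~= 0" "cmod Z = z" using z by (auto simp: Z_def)
  have u_eq: "u = - Z * (1 + eps)" using Z by (simp add: eps_def field_simps)
  have "cmod eps <= C1 * z ^ (k + 1) / z" 
    using u z unfolding eps_def norm_divide Z(2) norm_minus_cancel Z_def[symmetric]
    by (intro divide_right_mono) auto
  hence eps: "cmod eps <= C1 * z ^ k" using z by simp
  have "C1 * z ^ k <= C1 * 1" using z C by (intro mult_left_mono power_le_one) auto
  hence eps1: "cmod eps <= C1" using eps by simp
  have pow: "(1 + cmod eps) ^ m <= (1 + C1) ^ m" using eps1 by (intro power_mono) auto
  have "(- Z) ^ (m + 1) ~= 0" using Z by simp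
  have a_eq: "a = fact m / (- Z) ^ (m + 1) + r" by (simp add: r_def)
  have "Z * (- Z * (1 + eps)) ^ m * (fact m / (- Z) ^ (m + 1)) = - ((1 + eps) ^ m * fact m)"
    unfolding power_mult_distrib using Z by simp
  hence "Z * u ^ m * a / fact m + 1 = - ((1 + eps) ^ m - 1) + Z * u ^ m * r / fact m"
    unfolding a_eq u_eq distrib_left add_divide_distrib by simp
  hence "cmod (Z * u ^ m * a / fact m + 1) <= cmod ((1 + eps) ^ m - 1) + cmod (Z * u ^ m * r / fact m)"
    by (metis norm_minus_cancel norm_triangle_ineq)
  also have "... <= C1 * (real m * (1 + C1) ^ m) * z ^ mu + (1 + C1) ^ m * C2 * z ^ mu"
  proof (rule add_mono)
    have "cmod ((1 + eps) ^ m - 1) <= cmod eps * (real m * (1 + cmod eps) ^ m)" by (rule one_plus_power_minus_one_bound)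
    also have "... <= (C1 * z ^ k) * (real m * (1 + C1) ^ m)"
      using eps pow z C by (intro mult_mono mult_left_mono) auto
    also have "... = C1 * (real m * (1 + C1) ^ m) * z ^ k" by simp
    also have "... <= C1 * (real m * (1 + C1) ^ m) * z ^ mu"
      using z C mu by (intro mult_left_mono power_decreasing) auto
    finally show "cmod ((1 + eps) ^ m - 1) <= ..." .
  next
    have "cmod (Z * u ^ m * r / fact m) = z ^ (m + 1) * cmod (1 + eps) ^ m * cmod r / fact m"
      unfolding u_eq by (simp add: norm_mult norm_power norm_divide Z power_mult_distrib)
    also have "... <= z ^ (m + 1) * cmod (1 + eps) ^ m * cmod r / 1"
      using z by (intro divide_left_mono) (auto simp: fact_ge_1)
    also have "... <= z ^ mu * (1 + C1) ^ m * C2"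
    proof -
      have "cmod (1 + eps) <= 1 + C1" using norm_triangle_ineq[of 1 eps] eps1 by simp
      hence "cmod (1 + eps) ^ m <= (1 + C1) ^ m" by (intro power_mono) auto
      moreover have "z ^ (m + 1) <= z ^ mu" using z mu by (intro power_decreasing) auto
      moreover have "cmod r <= C2" using a by (simp add: r_def Z_def)
      ultimately have "z ^ (m + 1) * cmod (1 + eps) ^ m * cmod r <= z ^ mu * (1 + C1) ^ m * C2"
        using z C by (intro mult_mono) auto
      thus ?thesis by simp
    qed finally show "cmod (Z * u ^ m * r / fact m) <= (1 + C1) ^ m * C2 * z ^ mu" by (simp add: mult_ac)
  qed finally show ?thesis unfolding Z_def by (simp add: algebra_simps)
qed

section \<open>The generating polynomials with the root at 1 split off\<close>

abbreviation one_minus_X :: "'a::comm_ring_1 poly" where "one_minus_X \<equiv> [:1, -1:]"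

text \<open>The factors \<open>1 / \<tau>\<close> and \<open>1 - X\<close> of \<open>rho_b\<close>
  are removed; the value 1 at \<open>X = 1\<close> then expresses consistency.\<close>

definition bdf_quot :: "nat => 'a::field_char_0 poly" where
  "bdf_quot k = (\<Sum>j=1..k. smult (1 / of_nat j) (one_minus_X ^ (j - 1)))"

definition sbdf_quot :: "nat => 'a::field_char_0 poly" where
  "sbdf_quot k = bdf_quot k - one_minus_X * bdf_quot (k - 1)"

text \<open>Here \<open>g\<close> stands for \<beta> - 1.\<close>

definition wsbdf_quot :: "nat => 'a => 'a::field_char_0 poly" where
  "wsbdf_quot k g = bdf_quot k + smult g (one_minus_X * bdf_quot (k - 1))"

text \<open>The factor of \<open>A v\<close> on the right-hand side of the scheme, after all powers
  of \<tau> have cancelled.\<close>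

definition correction :: "nat => nat => real => nat => real" where
  "correction k m \<beta> n = (\<beta> * (\<Sum>j=0..n. coeff ((one_minus_X * bdf_quot k) ^ m) j * real (n - j) ^ m)
      + (1 - \<beta>) * (\<Sum>j=0..n - 1. coeff ((one_minus_X * sbdf_quot k) ^ m) j * real (n + m - 1 - j) ^ m)) / fact m"

abbreviation complex_poly :: "real poly => complex poly" where
  "complex_poly \<equiv> map_poly complex_of_real"

lemma complex_poly_add: "complex_poly (p + q) = complex_poly p + complex_poly q"
  by (intro poly_eqI) (simp add: coeff_map_poly)

lemma complex_poly_diff: "complex_poly (p - q) = complex_poly p - complex_poly q"
  by (intro poly_eqI) (simp add: coeff_map_poly)

lemma complex_poly_mult: "complex_poly (p * q) = complex_poly p * complex_poly q"
  by (intro poly_eqI) (simp add: coeff_map_poly coeff_mult)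

lemma complex_poly_smult: "complex_poly (smult c p) = smult (of_real c) (complex_poly p)"
  by (intro poly_eqI) (simp add: coeff_map_poly)

lemma complex_poly_power: "complex_poly (p ^ n) = complex_poly p ^ n" by (induction n) (simp_all add: complex_poly_mult)

lemma complex_poly_sum: "complex_poly (sum f A) = (\<Sum>x\<in>A. complex_poly (f x))"
  by (induction A rule: infinite_finite_induct) (simp_all add: complex_poly_add)

lemma complex_poly_one_minus_X: "complex_poly one_minus_X = one_minus_X" by (simp add: map_poly_pCons)

lemma complex_poly_bdf_quot: "complex_poly (bdf_quot k) = bdf_quot k"
  unfolding bdf_quot_def by (simp add: complex_poly_sum complex_poly_smult complex_poly_power complex_poly_one_minus_X)

lemma complex_poly_sbdf_quot: "complex_poly (sbdf_quot k) = sbdf_quot k" unfolding sbdf_quot_def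
  by (simp only: complex_poly_diff complex_poly_mult complex_poly_bdf_quot complex_poly_one_minus_X)

lemma complex_poly_wsbdf_quot: "complex_poly (wsbdf_quot k g) = wsbdf_quot k (of_real g)" unfolding wsbdf_quot_def
  by (simp only: complex_poly_add complex_poly_smult complex_poly_mult complex_poly_bdf_quot complex_poly_one_minus_X)

lemma poly_bdf_quot: "(1 - xi) * poly (bdf_quot k) xi = bdf_sum k (1 - xi)" for xi :: "'a::field_char_0"
proof -
  have "(1 - xi) * (1 - xi) ^ (j - 1) = (1 - xi) ^ j" if "j \<in> {1..k}" for j using that by (cases j) auto
  thus ?thesis unfolding bdf_quot_def bdf_sum_def
    by (simp add: poly_sum sum_distrib_left poly_power mult.left_commute divide_inverse mult.commute)
qed

lemma poly_bdf_quot_1: "1 <= k ==> poly (bdf_quot k) 1 = (1 :: 'a::field_char_0)"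
proof -
  assume k: "1 <= k"
  have "poly (bdf_quot k) (1::'a) = (\<Sum>j=1..k. 1 / of_nat j * 0 ^ (j - 1))"
    unfolding bdf_quot_def by (simp add: poly_sum poly_power)
  also have "... = (\<Sum>j=1..k. if j = 1 then 1 else 0)" by (intro sum.cong) auto
  also have "... = 1" using k by simp finally show ?thesis .
qed

lemma poly_wsbdf_quot:
  "(1 - xi) * poly (wsbdf_quot k (of_real g)) xi = wsbdf_symbol k g (1 - xi)"
  unfolding wsbdf_quot_def wsbdf_symbol_def poly_bdf_quot[symmetric] by (simp add: algebra_simps)

lemma pderiv_sum: "pderiv (sum f A) = (\<Sum>x\<in>A. pderiv (f x))"
  by (induction A rule: infinite_finite_induct) (simp_all add: pderiv_add)

lemma pderiv_bdf_poly:
  "poly (pderiv (one_minus_X * bdf_quot k)) xi = - (\<Sum>i<k. (1 - xi) ^ i)" for xi :: "'a::field_char_0"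
proof -
  have "one_minus_X * bdf_quot k = (\<Sum>j=1..k. smult (1 / of_nat j) (one_minus_X ^ j :: 'a poly))"
    unfolding bdf_quot_def sum_distrib_left mult_smult_right
  proof (intro sum.cong refl)
    fix j assume "j \<in> {1..k}"
    thus "smult (1 / of_nat j) (one_minus_X * one_minus_X ^ (j - 1)) = smult (1 / of_nat j) (one_minus_X ^ j :: 'a poly)"
      by (cases j) auto
  qed
  also have "poly (pderiv ...) xi = (\<Sum>j=1..k. - ((1 - xi) ^ (j - 1)))" unfolding pderiv_sum poly_sum
    by (intro sum.cong refl) (auto simp: pderiv_smult pderiv_power poly_power pderiv_pCons)
  finally show ?thesis by (simp add: sum.atLeast1_atMost_eq sum_negf)
qed

text \<open>The second sum of the scheme takes powers of \<open>n + m - 1 - j\<close>, which calls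
  for the generating function of \<open>(n + m)^m\<close>: drop the first \<open>m\<close> terms of
  the series of \<open>n^m\<close> and divide by \<open>X^m\<close>. The numerator stays a
  polynomial.\<close>

definition shifted_euler_poly :: "nat => complex poly" where
  "shifted_euler_poly m = poly_shift m (euler_poly m - one_minus_X ^ (m + 1) * (\<Sum>i<m. monom (of_nat i ^ m) i))"

lemma fps_shifted_euler_poly:
  "fps_of_poly (shifted_euler_poly m) = (1 - fps_X) ^ (m + 1) * Abs_fps (%n. of_nat (n + m) ^ m)"
proof -
  let ?S = "Abs_fps (%n. of_nat (n + m) ^ m) :: complex fps"
  have tail: "Abs_fps (%n. of_nat n ^ m) = fps_of_poly (\<Sum>i<m. monom (of_nat i ^ m) i) + ?S * fps_X ^ m"
    by (rule fps_ext) (auto simp: coeff_sum fps_X_power_mult_right_nth sum.delta not_less if_distrib[of of_nat] of_nat_diff cong: if_cong)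
  have "fps_of_poly (shifted_euler_poly m)
      = fps_shift m (fps_of_poly (euler_poly m - one_minus_X ^ (m + 1) * (\<Sum>i<m. monom (of_nat i ^ m) i)))"
    unfolding shifted_euler_poly_def by (intro fps_ext) (simp add: coeff_poly_shift)
  also have "... = fps_shift m (((1 - fps_X) ^ (m + 1) * ?S) * fps_X ^ m)"
    unfolding fps_of_poly_diff fps_euler_poly fps_of_poly_mult fps_of_poly_power fps_of_poly_one_minus_X
      tail by (simp add: algebra_simps)
  also have "... = (1 - fps_X) ^ (m + 1) * ?S" by simp finally show ?thesis .
qed

lemma poly_shifted_euler_poly:
  "xi ^ m * poly (shifted_euler_poly m) xi = poly (euler_poly m) xi - (1 - xi) ^ (m + 1) * (\<Sum>i<m. of_nat i ^ m * xi ^ i)"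
proof -
  let ?T = "\<Sum>i<m. monom (of_nat i ^ m) i :: complex poly"
  have "fps_of_poly (monom 1 m * shifted_euler_poly m + one_minus_X ^ (m + 1) * ?T) = fps_of_poly (euler_poly m)"
    unfolding fps_of_poly_add fps_of_poly_mult fps_of_poly_power fps_of_poly_monom' fps_shifted_euler_poly
      fps_of_poly_one_minus_X fps_euler_poly
  proof -
    have tail: "Abs_fps (%n. of_nat n ^ m) = fps_of_poly ?T + Abs_fps (%n. of_nat (n + m) ^ m) * fps_X ^ m"
      by (rule fps_ext) (auto simp: coeff_sum fps_X_power_mult_right_nth sum.delta not_less of_nat_diff cong: if_cong)
    show "fps_X ^ m * ((1 - fps_X) ^ (m + 1) * Abs_fps (%n. of_nat (n + m) ^ m)) + (1 - fps_X) ^ (m + 1) * fps_of_poly ?T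
        = (1 - fps_X) ^ (m + 1) * Abs_fps (%n. of_nat n ^ m)" unfolding tail by (simp add: algebra_simps)
  qed
  hence "monom 1 m * shifted_euler_poly m + one_minus_X ^ (m + 1) * ?T = euler_poly m"
    by (simp only: fps_of_poly_eq_iff)
  from arg_cong[OF this, of "%p. poly p xi"] show ?thesis
    by (simp add: poly_monom poly_power poly_sum algebra_simps)
qed

lemma poly_euler_poly_1: "poly (euler_poly m) 1 = fact m" by (induction m) auto

section \<open>The scalar scheme as an instance of the abstract symbol\<close>

locale wsbdf =
  fixes k m :: nat and \<beta> :: real
  assumes m: "1 <= m" "m <= k" and k7: "k <= 7" and \<beta>: "3 <= \<beta>"
begin

definition g where "g = \<beta> - 1"
definition Q :: "complex poly" where "Q = [:of_real (1 + g), - of_real g:]"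
text \<open>This is \<open>1 - X\<close> times the generating function of \<open>correction\<close>:
  the \<open>m\<close> factors \<open>1 - X\<close> of the difference symbol cancel all but one of
  the \<open>m + 1\<close> poles of the Eulerian series.\<close>

definition G :: "complex poly" where
  "G = smult (1 / fact m) (smult (of_real \<beta>) (bdf_quot k ^ m * euler_poly m)
        + smult (of_real (1 - \<beta>)) ([:0, 1:] * (sbdf_quot k ^ m * shifted_euler_poly m)))"
text \<open>The polynomial \<open>(G - Q) / (1 - X)\<close>; both \<open>G\<close> and
  \<open>Q\<close> have the value 1 at 1. The series of \<open>1 + W\<close> has the numerator
  \<open>(D - z G) / (1 - X)\<close>, and this is \<open>P0 - z h\<close>.\<close>

definition h :: "complex poly" where "h = - synthetic_div (G - Q) 1"

lemma g2: "2 <= g" and k1: "1 <= k" using \<beta> m by (auto simp: g_def)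

lemma poly_Q: "poly Q xi = 1 + of_real g * (1 - xi)" by (simp add: Q_def algebra_simps)

sublocale one_step_symbol "wsbdf_quot k (of_real g)" Q h k "min k (m + 1)"
proof
  fix b :: real and xi :: complex
  assume b: "0 <= b" "b < 1" and xi: "cmod xi <= 1"
  let ?Q = "1 + of_real g * (1 - xi) :: complex"
  have "?Q ~= 0" by (rule shift_weight_nonzero) (use xi g2 in auto)
  show "of_real b * ((1 - xi) * poly (wsbdf_quot k (of_real g)) xi) + of_real (1 - b) * poly Q xi ~= 0"
    unfolding poly_wsbdf_quot poly_Q
  proof (cases "b = 0 \<or> xi = 1")
    case True
    thus "of_real b * wsbdf_symbol k g (1 - xi) + of_real (1 - b) * ?Q ~= 0"
      using \<open>?Q ~= 0\<close> b by (auto simp: wsbdf_symbol_zero)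
  next
    case False
    hence "of_real b * (wsbdf_symbol k g (1 - xi) + of_real ((1 - b) / b) * ?Q) ~= 0"
      using symbol_nonzero_in_disc[OF xi _ k1 k7 g2, of "(1 - b) / b"] b by simp
    moreover have "of_real b * (wsbdf_symbol k g (1 - xi) + of_real ((1 - b) / b) * ?Q)
       = of_real b * wsbdf_symbol k g (1 - xi) + of_real (1 - b) * ?Q" using False by (simp add: distrib_left)
    ultimately show "of_real b * wsbdf_symbol k g (1 - xi) + of_real (1 - b) * ?Q ~= 0" by metis
  qed
next
  fix xi :: complex assume xi: "cmod xi <= 1"
  show "poly (wsbdf_quot k (of_real g)) xi ~= 0"
  proof (cases "xi = 1")
    case True
    thus ?thesis using poly_bdf_quot_1[OF k1, where 'a = complex] by (simp add: wsbdf_quot_def)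
  next
    case False
    hence "wsbdf_symbol k g (1 - xi) ~= 0" using symbol_nonzero_in_disc[OF xi False k1 k7 g2, of 0] by simp
    thus ?thesis unfolding poly_wsbdf_quot[symmetric] by simp
  qed
qed (rule k1)

lemma G_1: "poly G 1 = 1"
proof -
  have e: "poly (shifted_euler_poly m) 1 = fact m" using poly_shifted_euler_poly[of 1 m] poly_euler_poly_1[of m] by simp
  have "poly (sbdf_quot k) (1::complex) = 1" unfolding sbdf_quot_def by (simp add: poly_bdf_quot_1[OF k1])
  thus ?thesis unfolding G_def by (simp add: e poly_bdf_quot_1[OF k1] poly_euler_poly_1 poly_power field_simps)
qed

lemma h_mult: "one_minus_X * h = G - Q"
proof -
  have "[:-1, 1:] * synthetic_div (G - Q) 1 + [:poly (G - Q) 1:] = G - Q" by (rule synthetic_div_correct')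
  moreover have "poly (G - Q) 1 = 0" by (simp add: G_1 poly_Q)
  moreover have "one_minus_X * h = [:-1, 1:] * synthetic_div (G - Q) 1" unfolding h_def by simp
  ultimately show ?thesis by simp
qed

lemma N_mult: "one_minus_X * N z = D z - smult (of_real z) G"
proof -
  have "one_minus_X * N z = one_minus_X * wsbdf_quot k (of_real g) - smult (of_real z) (one_minus_X * h)"
    unfolding N_def right_diff_distrib mult_smult_right ..
  thus ?thesis unfolding h_mult D_def by (simp add: smult_diff_right)
qed

lemma d_eq: "d z = of_real (bdf_sum k (1 - exp z) + z + g * (1 - exp z) * (bdf_sum (k - 1) (1 - exp z) + z))"
proof -
  have "d z = wsbdf_symbol k g (1 - of_real (exp z)) + of_real z * (1 + of_real g * (1 - of_real (exp z)))"
    unfolding D_def by (simp add: poly_Q algebra_simps flip: poly_wsbdf_quot)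
  also have "... = wsbdf_symbol k g (of_real (1 - exp z)) + of_real (z * (1 + g * (1 - exp z)))" by simp
  finally show ?thesis unfolding wsbdf_symbol_def bdf_sum_of_real by (simp add: algebra_simps)
qed

text \<open>The lower order of the sum with \<open>k - 1\<close> is restored by its factor
  \<open>1 - exp z\<close>.\<close>

lemma d_bound:
  assumes "0 < z" "z <= 1"
  shows "cmod (d z) <= (2 ^ k + g * 2 ^ k) * z ^ (k + 1)"
proof -
  have "cmod (d z) <= \<bar>bdf_sum k (1 - exp z) + z\<bar> + \<bar>g * (1 - exp z) * (bdf_sum (k - 1) (1 - exp z) + z)\<bar>"
    unfolding d_eq norm_of_real by (rule abs_triangle_ineq)
  also have "\<bar>g * (1 - exp z) * (bdf_sum (k - 1) (1 - exp z) + z)\<bar> <= g * (2 * z) * (2 ^ (k - 1) * z ^ (k - 1 + 1))"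
    unfolding abs_mult using assms g2 abs_one_minus_exp_le[of z] bdf_sum_exp_bound[of z "k - 1"]
    by (intro mult_mono) auto
  also have "... = g * 2 ^ k * z ^ (k + 1)" using k1 by (cases k) auto
  also have "\<bar>bdf_sum k (1 - exp z) + z\<bar> <= 2 ^ k * z ^ (k + 1)"
    using assms by (intro bdf_sum_exp_bound) auto finally show ?thesis by (simp add: algebra_simps)
qed

text \<open>The quotient of the division by \<open>X - c\<close>, evaluated at \<open>c\<close>, is
  the derivative at \<open>c\<close>, and the derivative of the BDF polynomial is a finite geometric
  sum. The outcome is the value of \<open>Q\<close> at \<open>exp z\<close> up to order
  \<open>z^k\<close>.\<close>

lemma poly_E_exp:
  "poly (E z) (of_real (exp z)) = of_real (1 + g * (1 - exp z) - (1 + g) * (1 - exp z) ^ k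
      + g * exp z * (bdf_sum (k - 1) (1 - exp z) + z))"
proof -
  define om where "om = complex_of_real (exp z)"
  have sd: "poly (synthetic_div p c) c = poly (pderiv p) c" for p :: "complex poly" and c
  proof -
    have "poly (pderiv ([:- c, 1:] * synthetic_div p c + [:poly p c:])) c = poly (synthetic_div p c) c"
      unfolding pderiv_add pderiv_mult by (simp add: pderiv_pCons)
    thus ?thesis unfolding synthetic_div_correct' by simp
  qed
  have D: "D z = one_minus_X * bdf_quot k + smult (of_real g) (one_minus_X * (one_minus_X * bdf_quot (k - 1))) + smult (of_real z) Q"
  proof -
    have "D z = one_minus_X * wsbdf_quot k (of_real g) + smult (of_real z) Q" by (rule D_def)
    thus ?thesis by (simp only: wsbdf_quot_def distrib_left mult_smult_right)
  qed
  have pd: "poly (pderiv (D z)) om = - (\<Sum>i<k. (1 - om) ^ i)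
     + of_real g * ((1 - om) * - (\<Sum>i<k - 1. (1 - om) ^ i) - bdf_sum (k - 1) (1 - om)) - of_real z * of_real g"
    unfolding D pderiv_add pderiv_smult pderiv_mult[of one_minus_X "one_minus_X * bdf_quot (k - 1)"] poly_add poly_smult poly_mult
      pderiv_bdf_poly poly_bdf_quot[symmetric] by (simp add: pderiv_pCons Q_def)
  have s: "om * (\<Sum>i<n. (1 - om) ^ i) = 1 - (1 - om) ^ n" for n
    using one_diff_power_eq[of "1 - om" n] by simp
  have "poly (E z) om = om * (\<Sum>i<k. (1 - om) ^ i)
     + of_real g * (1 - om) * (om * (\<Sum>i<k - 1. (1 - om) ^ i)) + of_real g * om * (bdf_sum (k - 1) (1 - om) + of_real z)"
    unfolding E_def poly_smult sd om_def[symmetric] pd by (simp add: algebra_simps)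
  also have "... = 1 - (1 - om) ^ k
     + of_real g * (1 - om) * (1 - (1 - om) ^ (k - 1)) + of_real g * om * (bdf_sum (k - 1) (1 - om) + of_real z)"
    unfolding s ..
  also have "of_real g * (1 - om) * (1 - (1 - om) ^ (k - 1)) = of_real g * (1 - om) - of_real g * (1 - om) ^ k"
    using k1 by (cases k) (auto simp: algebra_simps)
  finally have "poly (E z) om = 1 - (1 - om) ^ k + (of_real g * (1 - om) - of_real g * (1 - om) ^ k)
     + of_real g * om * (bdf_sum (k - 1) (of_real (1 - exp z)) + of_real z)" by (simp add: om_def)
  thus ?thesis unfolding om_def bdf_sum_of_real by (simp add: algebra_simps)
qed

text \<open>Since \<open>G / (1 - xi)\<close> generates the correction, this is the consistency of
  the right-hand side at the exact root. The summands with \<beta> and with 1 - \<beta> each reduce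
  to \<open>corrected_weight_bound\<close>, and the two main terms add up to the negative of
  \<open>Q\<close>.\<close>

lemma G_bound:
  obtains C where "0 < C" "!!z::real. 0 < z ==> z <= 1 / 2 ==>
    cmod (of_real z * poly G (of_real (exp z)) / (1 - of_real (exp z)) + poly Q (of_real (exp z))) <= C * z ^ min k (m + 1)"
proof -
  obtain Ce where Ce: "0 < Ce" "!!z::real. 0 < z ==> z <= 1 / 2 ==>
    cmod (poly (euler_poly m) (of_real (exp z)) / (1 - of_real (exp z)) ^ (m + 1) - fact m / (- of_real z) ^ (m + 1)) <= Ce"
    using euler_poly_exp_bound by blast
  define C1 where "C1 = (2::real) ^ k * 4"
  define C2 where "C2 = Ce + (\<Sum>i<m. real i ^ m * 2 ^ i)"
  define B where "B = C1 * (real m * (1 + C1) ^ m) + (1 + C1) ^ m * C2"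
  have C2: "0 <= Ce" "0 <= C2" "Ce <= C2" using Ce(1) by (auto simp: C2_def intro!: sum_nonneg add_nonneg_nonneg)
  have C1: "0 <= C1" "2 ^ k <= C1" by (auto simp: C1_def)
  have B: "0 <= B" unfolding B_def using C1 C2 by auto
  show ?thesis
  proof (rule that[of "\<bar>\<beta>\<bar> * B + \<bar>1 - \<beta>\<bar> * 2 * B + 1"])
    show "0 < \<bar>\<beta>\<bar> * B + \<bar>1 - \<beta>\<bar> * 2 * B + 1" using B by (intro add_nonneg_pos add_nonneg_nonneg mult_nonneg_nonneg) auto
    fix z :: real assume z: "0 < z" "z <= 1 / 2"
    \<comment> \<open>\<open>S\<close> is the symbol of \<open>rho_s\<close> divided by
      \<open>exp z\<close>: that part of the scheme acts one step earlier, and after this shift its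
      symbol approximates \<open>- z\<close> like \<open>L\<close> does.\<close>
    define om Z x L S a a' where "om = complex_of_real (exp z)" and "Z = complex_of_real z" and "x = 1 - om"
      and "L = bdf_sum k x" and "S = (bdf_sum k x - x * bdf_sum (k - 1) x) / om"
      and "a = poly (euler_poly m) om / x ^ (m + 1)" and "a' = a - (\<Sum>i<m. of_nat i ^ m * om ^ i)"
    have x: "x = of_real (1 - exp z)" by (simp add: x_def om_def)
    have x0: "x ~= 0" using z unfolding x of_real_eq_0_iff by simp
    have om0: "om ~= 0" by (simp add: om_def)
    have exp2: "1 <= exp z" "exp z <= 2" using z abs_one_minus_exp_le[of z] by auto
    have om2: "cmod om <= 2" "1 <= cmod om" using exp2 by (auto simp: om_def)
    have LZ: "cmod (L + Z) <= C1 * z ^ (k + 1)"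
    proof -
      have "cmod (L + Z) = \<bar>bdf_sum k (1 - exp z) + z\<bar>"
        unfolding L_def Z_def x bdf_sum_of_real of_real_add[symmetric] norm_of_real ..
      also have "... <= 2 ^ k * z ^ (k + 1)" using z by (intro bdf_sum_exp_bound) auto
      also have "... <= C1 * z ^ (k + 1)" using C1 z by (intro mult_right_mono) auto finally show ?thesis .
    qed
    have SZ: "cmod (S + Z) <= C1 * z ^ (k + 1)"
    proof -
      \<comment> \<open>Because \<open>exp z = 1 - x\<close>, the term \<open>z exp z\<close>
        distributes \<open>z\<close> over both truncated logarithms.\<close>
      define r where "r = (bdf_sum k (1 - exp z) + z) - (1 - exp z) * (bdf_sum (k - 1) (1 - exp z) + z)"
      have "S + Z = of_real r / om"
        using om0 unfolding S_def r_def Z_def x bdf_sum_of_real by (simp add: om_def field_simps)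
      hence "cmod (S + Z) = \<bar>r\<bar> / exp z" by (simp add: norm_divide om_def)
      also have "... <= \<bar>r\<bar> / 1" using exp2 by (intro divide_left_mono) auto
      also have "\<bar>r\<bar> <= \<bar>bdf_sum k (1 - exp z) + z\<bar> + \<bar>1 - exp z\<bar> * \<bar>bdf_sum (k - 1) (1 - exp z) + z\<bar>"
        unfolding r_def abs_mult[symmetric] by (rule abs_triangle_ineq4)
      also have "... <= 2 ^ k * z ^ (k + 1) + (2 * z) * (2 ^ (k - 1) * z ^ (k - 1 + 1))"
        using z abs_one_minus_exp_le[of z] bdf_sum_exp_bound[of z k] bdf_sum_exp_bound[of z "k - 1"]
        by (intro add_mono mult_mono) auto
      also have "... = 2 ^ k * 2 * z ^ (k + 1)" using k1 by (cases k) auto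
      also have "... <= C1 * z ^ (k + 1)" using z by (intro mult_right_mono) (auto simp: C1_def)
      finally show ?thesis by simp
    qed
    have a: "cmod (a - fact m / (- Z) ^ (m + 1)) <= Ce"
      using Ce(2)[OF z] by (simp add: a_def om_def Z_def x_def)
    have a'_bd: "cmod (a' - fact m / (- Z) ^ (m + 1)) <= C2"
    proof -
      have "cmod (\<Sum>i<m. of_nat i ^ m * om ^ i) <= (\<Sum>i<m. real i ^ m * 2 ^ i)"
      proof (rule sum_norm_le)
        fix i
        have "cmod om ^ i <= 2 ^ i" using om2 by (intro power_mono) auto
        thus "cmod (of_nat i ^ m * om ^ i) <= real i ^ m * 2 ^ i"
          unfolding norm_mult norm_power norm_of_nat by (intro mult_left_mono) auto
      qed
      moreover have "a' - fact m / (- Z) ^ (m + 1) = (a - fact m / (- Z) ^ (m + 1)) - (\<Sum>i<m. of_nat i ^ m * om ^ i)"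
        by (simp add: a'_def)
      hence "cmod (a' - fact m / (- Z) ^ (m + 1)) = cmod ((a - fact m / (- Z) ^ (m + 1)) - (\<Sum>i<m. of_nat i ^ m * om ^ i))"
        by (simp only:)
      ultimately show ?thesis
        using a norm_triangle_ineq4[of "a - fact m / (- Z) ^ (m + 1)" "\<Sum>i<m. of_nat i ^ m * om ^ i"]
        unfolding C2_def by linarith
    qed
    define R1 R2 where "R1 = Z * L ^ m * a / fact m + 1" and "R2 = Z * S ^ m * a' / fact m + 1"
    have R1: "cmod R1 <= B * z ^ min k (m + 1)" unfolding R1_def B_def Z_def
      by (rule corrected_weight_bound) (use z C1 C2 LZ a in \<open>auto simp: Z_def\<close>)
    have R2: "cmod R2 <= B * z ^ min k (m + 1)" unfolding R2_def B_def Z_def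
      by (rule corrected_weight_bound) (use z C1 C2 SZ a'_bd in \<open>auto simp: Z_def\<close>)
    have Lq: "poly (bdf_quot k) om = L / x"
      using poly_bdf_quot[of om k] x0 by (simp add: L_def x_def field_simps)
    have Lq': "poly (bdf_quot (k - 1)) om = bdf_sum (k - 1) x / x"
      using poly_bdf_quot[of om "k - 1"] x0 by (simp add: x_def field_simps)
    have Sq: "poly (sbdf_quot k) om = om * S / x"
    proof -
      have "poly (sbdf_quot k) om = poly (bdf_quot k) om - x * poly (bdf_quot (k - 1)) om"
        by (simp add: sbdf_quot_def x_def algebra_simps)
      moreover have "om * S = bdf_sum k x - x * bdf_sum (k - 1) x" using om0 by (simp add: S_def)
      ultimately show ?thesis unfolding Lq Lq' L_def using x0 by (simp add: diff_divide_distrib)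
    qed
    have eA: "poly (euler_poly m) om = a * x ^ (m + 1)" using x0 by (simp add: a_def)
    have eS: "poly (shifted_euler_poly m) om = a' * x ^ (m + 1) / om ^ m"
      using poly_shifted_euler_poly[of om m] om0 unfolding eA x_def[symmetric] a'_def by (simp add: field_simps)
    have "poly G om = (of_real \<beta> * ((L / x) ^ m * (a * x ^ (m + 1)))
        + of_real (1 - \<beta>) * (om * ((om * S / x) ^ m * (a' * x ^ (m + 1) / om ^ m)))) / fact m"
      unfolding G_def by (simp add: poly_power Lq Sq eA eS)
    also have "... = (of_real \<beta> * (L ^ m * a) + of_real (1 - \<beta>) * om * (S ^ m * a')) * x / fact m"
    proof -
      have e1: "(L / x) ^ m * (a * x ^ (m + 1)) = L ^ m * a * x" unfolding power_divide using x0 by simp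
      have e2: "(om * S / x) ^ m * (a' * x ^ (m + 1) / om ^ m) = S ^ m * a' * x"
        unfolding power_divide power_mult_distrib using x0 om0 by simp
      show ?thesis unfolding e1 e2 by (simp add: algebra_simps)
    qed
    finally have Gom: "poly G om = (of_real \<beta> * (L ^ m * a) + of_real (1 - \<beta>) * om * (S ^ m * a')) * x / fact m" .
    have "Z * poly G om / x = of_real \<beta> * (R1 - 1) + of_real (1 - \<beta>) * om * (R2 - 1)"
      unfolding Gom R1_def R2_def using x0 by (simp add: field_simps)
    hence "Z * poly G om / x + poly Q om = of_real \<beta> * R1 + of_real (1 - \<beta>) * om * R2"
      unfolding Q_def g_def by (simp add: algebra_simps)
    hence "cmod (Z * poly G om / x + poly Q om) <= \<bar>\<beta>\<bar> * cmod R1 + \<bar>1 - \<beta>\<bar> * cmod om * cmod R2"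
      by (metis norm_triangle_ineq norm_mult norm_of_real)
    also have "... <= \<bar>\<beta>\<bar> * (B * z ^ min k (m + 1)) + \<bar>1 - \<beta>\<bar> * 2 * (B * z ^ min k (m + 1))"
      using R1 R2 om2 by (intro add_mono mult_mono) auto
    also have "... <= (\<bar>\<beta>\<bar> * B + \<bar>1 - \<beta>\<bar> * 2 * B + 1) * z ^ min k (m + 1)"
      using z by (simp add: algebra_simps)
    finally show "cmod (of_real z * poly G (of_real (exp z)) / (1 - of_real (exp z)) + poly Q (of_real (exp z)))
      <= (\<bar>\<beta>\<bar> * B + \<bar>1 - \<beta>\<bar> * 2 * B + 1) * z ^ min k (m + 1)"
      by (simp only: Z_def om_def x_def)
  qed
qed

text \<open>At \<open>exp z\<close> the numerator is \<open>(d - z G) / (1 - exp z)\<close>. So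
  \<open>Mw\<close> splits into the consistency error of the right-hand side, the deviation of
  \<open>E\<close> from \<open>Q\<close>, and \<open>d / (1 - exp z)\<close>, where the division
  costs one power and leaves \<open>z^k\<close>.\<close>

lemma Mw_bound:
  obtains C where "0 < C" "!!z::real. 0 < z ==> z <= 1 / 2 ==> cmod (Mw z) <= C * z ^ min k (m + 1)"
proof -
  obtain CG where CG: "0 < CG" "!!z::real. 0 < z ==> z <= 1 / 2 ==>
    cmod (of_real z * poly G (of_real (exp z)) / (1 - of_real (exp z)) + poly Q (of_real (exp z))) <= CG * z ^ min k (m + 1)"
    using G_bound by blast
  define C where "C = CG + (1 + g) * 2 ^ k + g * 2 * 2 ^ k + (2 ^ k + g * 2 ^ k)"
  show ?thesis
  proof (rule that[of C])
    show "0 < C" unfolding C_def using CG(1) g2 by (auto intro!: add_pos_nonneg)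
    fix z :: real assume z: "0 < z" "z <= 1 / 2"
    define om where "om = complex_of_real (exp z)"
    define e where "e = - ((1 + g) * (1 - exp z) ^ k) + g * exp z * (bdf_sum (k - 1) (1 - exp z) + z)"
    have "1 + z <= exp z" by (rule exp_ge_add_one_self)
    hence x: "z <= \<bar>1 - exp z\<bar>" using z by linarith
    have x0: "1 - om ~= 0" using z by (simp add: om_def)
    have "1 - om = of_real (1 - exp z)" by (simp add: om_def)
    hence cx: "cmod (1 - om) = \<bar>1 - exp z\<bar>" by (simp only: norm_of_real)
    have "(1 - om) * poly (N z) om = poly (one_minus_X * N z) om" by (simp add: algebra_simps)
    also have "... = d z - of_real z * poly G om" unfolding N_mult by (simp add: om_def)
    finally have "poly (N z) om = (d z - of_real z * poly G om) / (1 - om)"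
      using x0 by (simp only: nonzero_eq_divide_eq mult.commute not_False_eq_True)
    hence N: "poly (N z) om = d z / (1 - om) - of_real z * poly G om / (1 - om)"
      by (simp only: diff_divide_distrib)
    have "poly (E z) om = poly Q om + of_real e" unfolding om_def poly_E_exp e_def poly_Q by simp
    hence "Mw z = (of_real z * poly G om / (1 - om) + poly Q om) + of_real e - d z / (1 - om)"
      unfolding M_def poly_diff om_def[symmetric] N by simp
    hence "cmod (Mw z) <= cmod (of_real z * poly G om / (1 - om) + poly Q om) + \<bar>e\<bar> + cmod (d z) / \<bar>1 - exp z\<bar>"
      using norm_triangle_ineq4[of "(of_real z * poly G om / (1 - om) + poly Q om) + of_real e" "d z / (1 - om)"]
        norm_triangle_ineq[of "of_real z * poly G om / (1 - om) + poly Q om" "of_real e"]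
      by (simp add: norm_divide cx)
    also have "... <= CG * z ^ min k (m + 1) + ((1 + g) * 2 ^ k + g * 2 * 2 ^ k) * z ^ min k (m + 1)
        + (2 ^ k + g * 2 ^ k) * z ^ min k (m + 1)"
    proof (intro add_mono)
      show "cmod (of_real z * poly G om / (1 - om) + poly Q om) <= CG * z ^ min k (m + 1)"
        unfolding om_def by (rule CG(2)[OF z])
      have zk: "z ^ k <= z ^ min k (m + 1)" using z by (intro power_decreasing) auto
      have "\<bar>e\<bar> <= \<bar>- ((1 + g) * (1 - exp z) ^ k)\<bar> + \<bar>g * exp z * (bdf_sum (k - 1) (1 - exp z) + z)\<bar>"
        unfolding e_def by (rule abs_triangle_ineq)
      also have "... = (1 + g) * \<bar>1 - exp z\<bar> ^ k + g * exp z * \<bar>bdf_sum (k - 1) (1 - exp z) + z\<bar>"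
        using g2 by (simp add: abs_mult power_abs)
      also have "... <= (1 + g) * (2 * z) ^ k + g * 2 * (2 ^ (k - 1) * z ^ (k - 1 + 1))"
        using g2 z abs_one_minus_exp_le[of z] bdf_sum_exp_bound[of z "k - 1"]
        by (intro add_mono mult_mono power_mono) auto
      also have "... <= ((1 + g) * 2 ^ k + g * 2 * 2 ^ k) * z ^ k"
      proof -
        have "g * 2 * (2 ^ (k - 1) * z ^ (k - 1 + 1)) <= g * 2 * (2 ^ k * z ^ k)"
        proof -
          have "(2::real) ^ (k - 1) * z ^ k <= 2 ^ k * z ^ k" using z by (intro mult_right_mono power_increasing) auto
          thus ?thesis using g2 k1 by (intro mult_left_mono) auto
        qed
        thus ?thesis by (simp add: power_mult_distrib algebra_simps)
      qed
      also have "... <= ((1 + g) * 2 ^ k + g * 2 * 2 ^ k) * z ^ min k (m + 1)"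
        using zk g2 by (intro mult_left_mono) auto finally show "\<bar>e\<bar> <= ..." .
      have "cmod (d z) / \<bar>1 - exp z\<bar> <= ((2 ^ k + g * 2 ^ k) * z ^ (k + 1)) / z"
        using d_bound[of z] z x g2 by (intro frac_le) auto
      also have "... = (2 ^ k + g * 2 ^ k) * z ^ k" using z by simp
      also have "... <= (2 ^ k + g * 2 ^ k) * z ^ min k (m + 1)" using zk g2 by (intro mult_left_mono) auto
      finally show "cmod (d z) / \<bar>1 - exp z\<bar> <= ..." .
    qed
    also have "... = C * z ^ min k (m + 1)" unfolding C_def by (simp add: algebra_simps)
    finally show "cmod (Mw z) <= C * z ^ min k (m + 1)" .
  qed
qed

section \<open>From generating functions back to the recursion\<close>

lemma Y_error_bound:
  obtains C where "0 < C"
    "!!z n. 0 < z ==> 1 <= n ==>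
       cmod (of_real (exp (- z * real n)) - Y z $ n) <= C * (1 / real n ^ (m + 1) + 1 / real n ^ k)"
proof -
  obtain C1 where C1: "0 < C1" "!!z::real. 0 < z ==> z <= 1 / 2 ==> cmod (Mw z) <= C1 * z ^ min k (m + 1)"
    using Mw_bound by blast
  define C0 where "C0 = C1 + (2 ^ k + g * 2 ^ k)"
  have C0: "0 < C0" "C1 <= C0" "2 ^ k + g * 2 ^ k <= C0" using C1(1) g2 by (auto simp: C0_def intro!: add_pos_nonneg)
  obtain C where C: "0 < C" "!!z n. 0 < z ==> 1 <= n ==>
       cmod (of_real (exp (- z * real n)) - Y z $ n) <= C * (1 / real n ^ k + 1 / real n ^ min k (m + 1))"
  proof (rule error_bound[of C0 "1 / 2"])
    fix z :: real assume z: "0 < z" "z <= 1 / 2"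
    show "cmod (d z) <= C0 * z ^ (k + 1)"
    proof -
      have "(2 ^ k + g * 2 ^ k) * z ^ (k + 1) <= C0 * z ^ (k + 1)"
        by (rule mult_right_mono[OF C0(3)]) (use z in auto)
      thus ?thesis using d_bound[of z] z by linarith
    qed
    show "cmod (Mw z) <= C0 * z ^ min k (m + 1)"
    proof -
      have "C1 * z ^ min k (m + 1) <= C0 * z ^ min k (m + 1)" by (rule mult_right_mono[OF C0(2)]) (use z in auto)
      thus ?thesis using C1(2)[OF z] by linarith
    qed
  qed (use C0 in auto)
  show ?thesis
  proof (rule that[of "2 * C"])
    fix z :: real and n :: nat assume zn: "0 < z" "1 <= n"
    have "1 / real n ^ min k (m + 1) <= 1 / real n ^ (m + 1) + 1 / real n ^ k" by (cases "k <= m + 1") auto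
    moreover have "0 <= 1 / real n ^ (m + 1)" "0 <= 1 / real n ^ k" by auto
    moreover have "q + a <= 2 * (p + q)" if "a <= p + q" "0 <= p" "0 <= q" for a p q :: real
    proof -
      have "q + a <= q + (p + q)" using that(1) by simp
      also have "... <= 2 * (p + q)" using that(2) by simp finally show ?thesis .
    qed
    ultimately have "1 / real n ^ k + 1 / real n ^ min k (m + 1) <= 2 * (1 / real n ^ (m + 1) + 1 / real n ^ k)"
      by blast
    hence "C * (1 / real n ^ k + 1 / real n ^ min k (m + 1)) <= C * (2 * (1 / real n ^ (m + 1) + 1 / real n ^ k))"
      using C(1) by (intro mult_left_mono) auto
    from order_trans[OF C(2)[OF zn] this]
    show "cmod (of_real (exp (- z * real n)) - Y z $ n) <= 2 * C * (1 / real n ^ (m + 1) + 1 / real n ^ k)"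
      by (simp only: mult.assoc mult.left_commute)
  qed (use C in simp)
qed

text \<open>The value at \<open>n = 0\<close> is set to 0 by hand: truncated subtraction leaves a
  term with \<open>(m - 1)^m\<close> in \<open>correction\<close> there, whereas the generating
  series has no constant term, because \<open>0^m = 0\<close> for \<open>m \<ge> 1\<close>.\<close>

lemma fps_correction:
  "(1 - fps_X) * Abs_fps (%n. if n = 0 then 0 else complex_of_real (correction k m \<beta> n)) = fps_of_poly G"
proof -
  let ?B = "(one_minus_X * bdf_quot k) ^ m :: complex poly" and ?S = "(one_minus_X * sbdf_quot k) ^ m :: complex poly"
  let ?F1 = "fps_of_poly ?B * Abs_fps (%n. of_nat n ^ m)"
  let ?F2 = "fps_X * (fps_of_poly ?S * Abs_fps (%n. of_nat (n + m) ^ m))"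
  have cB: "coeff ?B j = of_real (coeff ((one_minus_X * bdf_quot k) ^ m) j)" for j by (subst coeff_map_poly[symmetric])
      (simp_all add: complex_poly_power complex_poly_mult complex_poly_one_minus_X complex_poly_bdf_quot del: mult_pCons_left)
  have cS: "coeff ?S j = of_real (coeff ((one_minus_X * sbdf_quot k) ^ m) j)" for j by (subst coeff_map_poly[symmetric])
      (simp_all add: complex_poly_power complex_poly_mult complex_poly_one_minus_X complex_poly_sbdf_quot del: mult_pCons_left)
  have corr: "Abs_fps (%n. if n = 0 then 0 else complex_of_real (correction k m \<beta> n))
      = fps_const (1 / fact m) * (fps_const (of_real \<beta>) * ?F1 + fps_const (of_real (1 - \<beta>)) * ?F2)"
  proof (rule fps_ext)
    fix n
    have F1: "?F1 $ n = of_real (\<Sum>j=0..n. coeff ((one_minus_X * bdf_quot k) ^ m) j * real (n - j) ^ m)"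
      unfolding fps_mult_nth by (simp add: cB del: mult_pCons_left)
    show "Abs_fps (%n. if n = 0 then 0 else complex_of_real (correction k m \<beta> n)) $ n
      = (fps_const (1 / fact m) * (fps_const (of_real \<beta>) * ?F1 + fps_const (of_real (1 - \<beta>)) * ?F2)) $ n"
    proof (cases n)
      case 0
      have "?F1 $ 0 = 0" unfolding fps_mult_nth using m by (simp del: mult_pCons_left)
      thus ?thesis using 0 by (simp del: mult_pCons_left)
    next
      case (Suc l)
      have "?F2 $ n = (\<Sum>j=0..l. coeff ?S j * of_nat (l - j + m) ^ m)"
        unfolding Suc fps_X_mult_nth fps_mult_nth[of "fps_of_poly ?S"] fps_nth_Abs_fps fps_of_poly_nth
        by (simp only: nat.distinct if_False diff_Suc_1)
      also have "... = of_real (\<Sum>j=0..n - 1. coeff ((one_minus_X * sbdf_quot k) ^ m) j * real (n + m - 1 - j) ^ m)"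
        unfolding of_real_sum cS using Suc
        by (intro sum.cong) (auto simp: of_nat_diff algebra_simps simp del: mult_pCons_left)
      finally have F2: "?F2 $ n = ..." .
      show ?thesis unfolding fps_mult_left_const_nth fps_add_nth F1 F2 fps_nth_Abs_fps correction_def using Suc
        by (simp del: mult_pCons_left)
    qed
  qed
  have B: "fps_of_poly ?B = (1 - fps_X) ^ m * fps_of_poly (bdf_quot k) ^ m"
    by (simp only: fps_of_poly_power fps_of_poly_mult fps_of_poly_one_minus_X power_mult_distrib)
  have S: "fps_of_poly ?S = (1 - fps_X) ^ m * fps_of_poly (sbdf_quot k) ^ m"
    by (simp only: fps_of_poly_power fps_of_poly_mult fps_of_poly_one_minus_X power_mult_distrib)
  have "fps_of_poly G = fps_const (1 / fact m) * (fps_const (of_real \<beta>) * (fps_of_poly (bdf_quot k) ^ m * fps_of_poly (euler_poly m))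
      + fps_const (of_real (1 - \<beta>)) * (fps_X * (fps_of_poly (sbdf_quot k) ^ m * fps_of_poly (shifted_euler_poly m))))"
    unfolding G_def fps_of_poly_smult fps_of_poly_add fps_of_poly_mult fps_of_poly_power fps_of_poly_fps_X ..
  also have "... = (1 - fps_X) * (fps_const (1 / fact m) * (fps_const (of_real \<beta>) * ?F1 + fps_const (of_real (1 - \<beta>)) * ?F2))"
    unfolding fps_euler_poly fps_shifted_euler_poly B S by (simp add: algebra_simps)
  finally show ?thesis unfolding corr ..
qed

lemma fps_nth_N: "fps_of_poly (N z) $ i = (\<Sum>j=0..i. coeff (D z) j) - of_real z * (if i = 0 then 0 else of_real (correction k m \<beta> i))"
proof -
  let ?c = "Abs_fps (%n. if n = 0 then 0 else complex_of_real (correction k m \<beta> n))"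
  let ?g = "Abs_fps (%n. 1) :: complex fps"
  have g: "?g * (1 - fps_X) = 1" by (rule fps_ext) (auto simp: right_diff_distrib)
  have "(1 - fps_X) * fps_of_poly (N z) = fps_of_poly (one_minus_X * N z)"
    by (simp only: fps_of_poly_mult fps_of_poly_one_minus_X)
  also have "... = fps_of_poly (D z) - fps_const (of_real z) * ((1 - fps_X) * ?c)"
    unfolding N_mult fps_correction by (simp only: fps_of_poly_diff fps_of_poly_smult)
  finally have "?g * ((1 - fps_X) * fps_of_poly (N z)) = ?g * (fps_of_poly (D z) - fps_const (of_real z) * ((1 - fps_X) * ?c))"
    by (rule arg_cong)
  also have "... = fps_of_poly (D z) * ?g - fps_const (of_real z) * ((?g * (1 - fps_X)) * ?c)"
    by (simp add: algebra_simps) finally have "fps_of_poly (N z) = fps_of_poly (D z) * ?g - fps_const (of_real z) * ?c"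
    unfolding mult.assoc[symmetric] g by simp
  thus ?thesis by (simp only: fps_sub_nth fps_mult_left_const_nth fps_nth_Abs_fps) (simp add: fps_mult_nth)
qed

text \<open>The shift by 1 produces the partial sums of \<open>D\<close> that occur in the
  coefficients of \<open>N\<close>. As only the first \<open>n\<close> steps are given, the
  sequences are compared by induction in a triangular system whose diagonal entry
  \<open>coeff (D z) 0\<close> is nonzero.\<close>

lemma scheme_eq_Y:
  fixes V :: "nat => real"
  assumes z: "0 < z" and V0: "V 0 = 0" and V: "!!i. 1 <= i ==> i <= n ==>
      (\<Sum>j=0..i. coeff (one_minus_X * wsbdf_quot k g) j * V (i - j)) + z * (\<beta> * V i + (1 - \<beta>) * V (i - 1))
       = - z * correction k m \<beta> i"
  shows "Y z $ n = of_real (V n + 1)"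
proof -
  define U where "U i = complex_of_real (V i + 1) - Y z $ i" for i
  have D0: "coeff (D z) 0 ~= 0" using D_nonzero[OF z, of 0] by (simp add: poly_0_coeff_0)
  hence DY: "fps_of_poly (D z) * Y z = fps_of_poly (N z)"
    unfolding Y_def using inverse_mult_eq_1'[of "fps_of_poly (D z)"] by (simp add: fps_divide_unit mult.left_commute)
  have Dc: "coeff (D z) j = of_real (coeff (one_minus_X * wsbdf_quot k g) j + z * (if j = 0 then \<beta> else if j = 1 then 1 - \<beta> else 0))" for j
  proof -
    have "coeff (one_minus_X * wsbdf_quot k (complex_of_real g)) j = of_real (coeff (one_minus_X * wsbdf_quot k g) j)"
      by (subst coeff_map_poly[symmetric])
        (simp_all add: complex_poly_mult complex_poly_one_minus_X complex_poly_wsbdf_quot del: mult_pCons_left)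
    moreover have "coeff Q j = of_real (if j = 0 then \<beta> else if j = 1 then 1 - \<beta> else 0)"
      unfolding Q_def by (auto simp: coeff_pCons g_def split: nat.splits)
    moreover have "D z = one_minus_X * wsbdf_quot k (of_real g) + smult (of_real z) Q" by (rule D_def)
    ultimately show ?thesis by (simp only: coeff_add coeff_smult of_real_add of_real_mult)
  qed
  have DV: "(\<Sum>j=0..i. coeff (D z) j * of_real (V (i - j))) = - of_real z * (if i = 0 then 0 else of_real (correction k m \<beta> i))"
    if "i <= n" for i
  proof (cases "i = 0")
    case False
    have s: "(\<Sum>j=0..i. (if j = 0 then \<beta> else if j = 1 then 1 - \<beta> else 0) * V (i - j)) = \<beta> * V i + (1 - \<beta>) * V (i - 1)"
    proof -
      have "(\<Sum>j=0..i. (if j = 0 then \<beta> else if j = 1 then 1 - \<beta> else 0) * V (i - j))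
        = (\<Sum>j\<in>{0, 1}. (if j = 0 then \<beta> else if j = 1 then 1 - \<beta> else 0) * V (i - j))"
        using False by (intro sum.mono_neutral_right) auto
      thus ?thesis by simp
    qed
    have "(\<Sum>j=0..i. coeff (D z) j * of_real (V (i - j)))
       = of_real ((\<Sum>j=0..i. coeff (one_minus_X * wsbdf_quot k g) j * V (i - j))
          + z * (\<Sum>j=0..i. (if j = 0 then \<beta> else if j = 1 then 1 - \<beta> else 0) * V (i - j)))"
      unfolding Dc of_real_mult[symmetric] of_real_sum[symmetric]
      by (simp only: distrib_right sum.distrib sum_distrib_left mult.assoc)
    also have "... = of_real (- z * correction k m \<beta> i)" unfolding s using V[of i] False that by simp
    finally show ?thesis using False by simp
  qed (use V0 in simp)
  have DU: "(\<Sum>j=0..i. coeff (D z) j * U (i - j)) = 0" if "i <= n" for i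
  proof -
    have "(\<Sum>j=0..i. coeff (D z) j * U (i - j)) = (\<Sum>j=0..i. coeff (D z) j * of_real (V (i - j)))
        + (\<Sum>j=0..i. coeff (D z) j) - (fps_of_poly (D z) * Y z) $ i"
      unfolding fps_mult_nth U_def by (simp add: algebra_simps sum.distrib sum_subtractf)
    thus ?thesis unfolding DY fps_nth_N DV[OF that] by simp
  qed
  have "U i = 0" if "i <= n" for i using that
  proof (induction i rule: less_induct)
    case (less i)
    have "(\<Sum>j=0..i. coeff (D z) j * U (i - j)) = coeff (D z) 0 * U i + (\<Sum>j=Suc 0..i. coeff (D z) j * U (i - j))"
      by (subst sum.atLeast_Suc_atMost) auto
    also have "(\<Sum>j=Suc 0..i. coeff (D z) j * U (i - j)) = 0" using less by (intro sum.neutral) auto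
    finally show ?case using DU[OF less.prems] D0 by simp
  qed
  from this[of n] show ?thesis by (simp add: U_def)
qed

theorem scalar_error_bound:
  obtains C where "0 < C"
    "!!z n V. 0 < z ==> 1 <= n ==> V 0 = 0 ==>
      (!!i. 1 <= i ==> i <= n ==>
        (\<Sum>j=0..i. coeff (one_minus_X * wsbdf_quot k g) j * V (i - j)) + z * (\<beta> * V i + (1 - \<beta>) * V (i - 1))
         = - z * correction k m \<beta> i) ==>
      \<bar>exp (- z * real n) - 1 - V n\<bar> <= C * (1 / real n ^ (m + 1) + 1 / real n ^ k)"
proof -
  obtain C where C: "0 < C"
    "!!z n. 0 < z ==> 1 <= n ==>
       cmod (of_real (exp (- z * real n)) - Y z $ n) <= C * (1 / real n ^ (m + 1) + 1 / real n ^ k)"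
    using Y_error_bound by blast
  show ?thesis
  proof (rule that[OF C(1)])
    fix z :: real and n :: nat and V :: "nat => real"
    assume z: "0 < z" "1 <= n" and V: "V 0 = 0"
      "!!i. 1 <= i ==> i <= n ==>
        (\<Sum>j=0..i. coeff (one_minus_X * wsbdf_quot k g) j * V (i - j)) + z * (\<beta> * V i + (1 - \<beta>) * V (i - 1))
         = - z * correction k m \<beta> i"
    have Y: "Y z $ n = of_real (V n + 1)" by (rule scheme_eq_Y[where n = n]) (use z V in auto)
    have "complex_of_real (exp (- z * real n)) - Y z $ n = of_real (exp (- z * real n) - 1 - V n)" unfolding Y by simp
    hence "cmod (of_real (exp (- z * real n)) - Y z $ n) = \<bar>exp (- z * real n) - 1 - V n\<bar>"
      by (simp only: norm_of_real)
    thus "\<bar>exp (- z * real n) - 1 - V n\<bar> <= C * (1 / real n ^ (m + 1) + 1 / real n ^ k)"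
      using C(2)[OF z] by metis
  qed
qed

end

section \<open>A functional calculus for positive contractions\<close>

lemma quadratic_nonneg_imp_zero:
  fixes a b :: real
  assumes "!!c. 0 <= 2 * c * a + c\<^sup>2 * b" "0 <= b"
  shows "a = 0"
proof (rule ccontr)
  assume "a ~= 0"
  define c where "c = - a / (b + 1)"
  have a: "a = - (c * (b + 1))" using assms(2) by (simp add: c_def)
  have "2 * c * a + c\<^sup>2 * b = c\<^sup>2 * (- b - 2)" unfolding a by (simp add: algebra_simps power2_eq_square)
  moreover have "c ~= 0" using a \<open>a ~= 0\<close> by auto
  ultimately have "2 * c * a + c\<^sup>2 * b < 0" using assms(2) by (simp add: mult_less_0_iff)
  thus False using assms(1)[of c] by simp
qed

text \<open>Minimization of \<open>|s|^2 - 2 L s\<close> over \<open>S\<close>. The parallelogram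
  law makes a minimizing sequence Cauchy; its limit lies in the closure of \<open>S\<close>.\<close>

lemma riesz_subspace:
  fixes S :: "'h::{real_inner, complete_space} set" and L :: "'h => real"
  assumes S: "subspace S"
    and add: "!!x y. x \<in> S ==> y \<in> S ==> L (x + y) = L x + L y"
    and scale: "!!c x. x \<in> S ==> L (c *\<^sub>R x) = c * L x"
    and bound: "!!x. x \<in> S ==> \<bar>L x\<bar> <= C * norm x"
  obtains y where "y \<in> closure S" "!!x. x \<in> S ==> L x = inner y x"
proof -
  define J where "J s = (norm s)\<^sup>2 - 2 * L s" for s
  have Jlow: "- C\<^sup>2 <= J s" if "s \<in> S" for s
  proof -
    have "2 * L s <= 2 * (C * norm s)" using bound[OF that] by simp
    moreover have "0 <= (norm s)\<^sup>2 + C\<^sup>2 - 2 * norm s * C" by (simp flip: power2_diff)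
    moreover have "2 * (C * norm s) = 2 * norm s * C" by simp
    ultimately show ?thesis unfolding J_def by linarith
  qed
  define d where "d = Inf (J ` S)"
  have bdd: "bdd_below (J ` S)" using Jlow by (intro bdd_belowI2)
  have S0: "0 \<in> S" using S by (rule subspace_0)
  have d_le: "d <= J s" if "s \<in> S" for s unfolding d_def using that bdd by (intro cInf_lower) auto
  have "\<exists>s\<in>S. J s < d + 1 / real (Suc n)" for n
    using cInf_lessD[of "J ` S" "d + 1 / real (Suc n)"] S0 unfolding d_def by auto
  then obtain s where s: "!!n. s n \<in> S" "!!n. J (s n) < d + 1 / real (Suc n)" by metis
  have par: "(norm (x - y))\<^sup>2 <= 2 * (J x + J y - 2 * d)" if "x \<in> S" "y \<in> S" for x y
  proof -
    have "x + y \<in> S" using S that by (intro subspace_add)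
    hence h: "(1 / 2) *\<^sub>R (x + y) \<in> S" using S by (intro subspace_scale)
    have "J ((1 / 2) *\<^sub>R (x + y)) = (norm (x + y))\<^sup>2 / 4 - (L x + L y)"
    proof -
      have "(norm ((1 / 2) *\<^sub>R (x + y)))\<^sup>2 = (norm (x + y))\<^sup>2 / 4"
        unfolding norm_scaleR by (simp add: power_mult_distrib power_divide)
      thus ?thesis unfolding J_def scale[OF \<open>x + y \<in> S\<close>] add[OF that]
        by (simp only:) (simp add: field_simps)
    qed
    hence "4 * d <= (norm (x + y))\<^sup>2 - 4 * (L x + L y)" using d_le[OF h] by simp
    moreover have "(norm (x - y))\<^sup>2 + (norm (x + y))\<^sup>2 = 2 * (norm x)\<^sup>2 + 2 * (norm y)\<^sup>2"
      by (simp add: power2_norm_eq_inner inner_simps inner_commute)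
    ultimately show ?thesis by (simp add: J_def)
  qed
  have "Cauchy s"
  proof (rule CauchyI)
    fix e :: real assume e: "0 < e"
    obtain M where M: "1 / real (Suc M) < e\<^sup>2 / 4" using reals_Archimedean[of "e\<^sup>2 / 4"] e by (auto simp: inverse_eq_divide)
    have "norm (s i - s j) < e" if "M <= i" "M <= j" for i j
    proof -
      have "1 / real (Suc i) <= 1 / real (Suc M)" "1 / real (Suc j) <= 1 / real (Suc M)"
        using that by (auto intro!: divide_left_mono)
      hence "(norm (s i - s j))\<^sup>2 < e\<^sup>2" using par[OF s(1) s(1), of i j] s(2)[of i] s(2)[of j] M
        unfolding ring_distribs by linarith
      thus ?thesis using e by (intro power_less_imp_less_base[of "norm (s i - s j)" 2 e]) auto
    qed
    thus "\<exists>M. \<forall>m\<ge>M. \<forall>n\<ge>M. norm (s m - s n) < e" by blast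
  qed
  then obtain y where y: "s \<longlonglongrightarrow> y" using convergent_eq_Cauchy convergent_def by blast
  have "L t = inner y t" if t: "t \<in> S" for t
  proof -
    have "0 <= 2 * c * (inner y t - L t) + c\<^sup>2 * (norm t)\<^sup>2" for c
    proof -
      have "0 <= 1 / real (Suc n) + 2 * c * (inner (s n) t - L t) + c\<^sup>2 * (norm t)\<^sup>2" for n
      proof -
        have ct: "c *\<^sub>R t \<in> S" using S t by (intro subspace_scale)
        have "d <= J (s n + c *\<^sub>R t)" using S s(1) ct by (intro d_le subspace_add)
        also have "... = J (s n) + 2 * c * (inner (s n) t - L t) + c\<^sup>2 * (norm t)\<^sup>2"
          unfolding J_def add[OF s(1) ct] scale[OF t] power2_norm_eq_inner
          by (simp add: inner_simps inner_commute power2_eq_square algebra_simps)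
        finally show ?thesis using s(2)[of n] by linarith
      qed
      moreover have "(%n. 1 / real (Suc n) + 2 * c * (inner (s n) t - L t) + c\<^sup>2 * (norm t)\<^sup>2)
          \<longlonglongrightarrow> 0 + 2 * c * (inner y t - L t) + c\<^sup>2 * (norm t)\<^sup>2"
        using LIMSEQ_inverse_real_of_nat by (intro tendsto_intros y) (simp add: inverse_eq_divide)
      ultimately show ?thesis by (intro tendsto_lowerbound[where F = sequentially]) (auto simp: add.assoc)
    qed
    hence "inner y t - L t = 0" by (rule quadratic_nonneg_imp_zero) simp
    thus ?thesis by simp
  qed
  moreover have "y \<in> closure S" using s(1) y unfolding closure_sequential by blast
  ultimately show ?thesis using that by blast
qed

text \<open>For functionals given on parameters \<open>s\<close>, such as test functions or pairs of
  a graph, instead of on the vectors \<open>T s\<close>: the bound forces \<open>L\<close> to depend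
  on \<open>T s\<close> only.\<close>

lemma riesz_image:
  fixes T :: "'s => 'h::{real_inner, complete_space}" and L :: "'s => real"
  assumes "S ~= {}"
    and lin: "!!s t c. s \<in> S ==> t \<in> S ==> \<exists>u\<in>S. T u = T s + c *\<^sub>R T t \<and> L u = L s + c * L t"
    and bound: "!!s. s \<in> S ==> \<bar>L s\<bar> <= C * norm (T s)"
  obtains y where "y \<in> closure (T ` S)" "!!s. s \<in> S ==> L s = inner y (T s)"
proof -
  have wd: "L s = L t" if st: "s \<in> S" "t \<in> S" "T s = T t" for s t
  proof -
    obtain u where u: "u \<in> S" "T u = T s + (- 1) *\<^sub>R T t" "L u = L s + (- 1) * L t" using lin st(1,2) by metis
    thus ?thesis using bound[OF u(1)] st(3) by simp
  qed
  define L' where "L' x = L (SOME s. s \<in> S \<and> T s = x)" for x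
  have L': "L' (T s) = L s" if "s \<in> S" for s
    unfolding L'_def by (rule wd) (use someI[of "%t. t \<in> S \<and> T t = T s" s] that in auto)
  have add: "\<exists>u\<in>S. T u = x + c *\<^sub>R y \<and> L u = L' x + c * L' y" if xy: "x \<in> T ` S" "y \<in> T ` S" for x y c
    using xy lin[of _ _ c] L' by force
  obtain s where s: "s \<in> S" using assms(1) by blast
  have 0: "0 \<in> T ` S" using lin[OF s s, of "- 1"] by force
  have "L' 0 = 0" using bound L' 0 by force
  have sub: "subspace (T ` S)" unfolding subspace_def using add[of _ _ 1] add[OF 0] 0 by (auto simp: image_iff; metis)
  show ?thesis
  proof (rule riesz_subspace[OF sub, of L' C])
    show "L' (x + y) = L' x + L' y" if "x \<in> T ` S" "y \<in> T ` S" for x y using add[OF that, of 1] L' by force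
    show "L' (c *\<^sub>R x) = c * L' x" if "x \<in> T ` S" for x c using add[OF 0 that, of c] L' \<open>L' 0 = 0\<close> by force
    show "\<bar>L' x\<bar> <= C * norm x" if "x \<in> T ` S" for x using that bound L' by auto
  qed (use that L' in auto)
qed

text \<open>Certificates of nonnegativity on \<open>[0, 1]\<close> that keep their meaning when the
  variable is replaced by a symmetric operator between 0 and 1.\<close>

inductive interval_pos :: "real poly => bool" where
  base: "interval_pos (q * q * [:0, 1:] ^ i * [:1, -1:] ^ j)"
| add: "interval_pos p ==> interval_pos r ==> interval_pos (p + r)"

lemma interval_pos_mult:
  assumes "interval_pos p" "interval_pos r"
  shows "interval_pos (p * r)"
proof -
  have base_mult: "interval_pos ((q * q * [:0, 1:] ^ i * [:1, -1:] ^ j) * r)" if "interval_pos r" for q i j r using that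
  proof induction
    case (base q' i' j')
    have "(q * q * [:0, 1:] ^ i * [:1, -1:] ^ j) * (q' * q' * [:0, 1:] ^ i' * [:1, -1:] ^ j')
      = (q * q') * (q * q') * [:0, 1:] ^ (i + i') * [:1, -1:] ^ (j + j')" unfolding power_add by (simp only: mult_ac)
    thus ?case using interval_pos.base[of "q * q'" "i + i'" "j + j'"] by argo
  next
    case (add p r)
    thus ?case by (simp only: distrib_left interval_pos.add)
  qed
  show ?thesis using assms(1)
  proof induction
    case (base q i j)
    show ?case by (rule base_mult[OF assms(2)])
  next
    case (add p r)
    thus ?case by (simp only: distrib_right interval_pos.add)
  qed
qed

lemma interval_pos_const: "0 <= c ==> interval_pos [:c:]"
  using interval_pos.base[of "[:sqrt c:]" 0 0] by simp

lemma interval_pos_X: "interval_pos [:0, 1:]" using interval_pos.base[of 1 1 0] by simp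

lemma interval_pos_one_minus_X: "interval_pos [:1, -1:]" using interval_pos.base[of 1 0 1] by simp

lemma nonreal_root_dvd:
  fixes p :: "real poly" and z :: complex
  assumes root: "poly (map_poly of_real p) z = 0" and "Im z ~= 0"
  shows "[:(cmod z)\<^sup>2, - 2 * Re z, 1:] dvd p"
proof -
  let ?m = "[:(cmod z)\<^sup>2, - 2 * Re z, 1:]"
  define r where "r = p mod ?m"
  have "degree r < 2 \<or> r = 0" unfolding r_def using degree_mod_less[of ?m p] by auto
  hence deg: "degree r <= 1" by auto
  have r_eq: "r = [:coeff r 0, coeff r 1:]"
    by (rule poly_eqI) (use deg in \<open>auto simp: coeff_pCons coeff_eq_0 split: nat.splits\<close>)
  have hom: "map_poly complex_of_real (a + b * c) = map_poly of_real a + map_poly of_real b * map_poly of_real c" for a b c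
    by (intro poly_eqI) (simp add: coeff_map_poly coeff_mult)
  have "poly (map_poly of_real ?m) z = of_real ((cmod z)\<^sup>2) - (z + cnj z) * z + z * z"
    by (simp add: map_poly_pCons complex_add_cnj algebra_simps power2_eq_square)
  also have "... = 0" unfolding complex_norm_square by (simp add: algebra_simps)
  finally have "poly (map_poly of_real (r + ?m * (p div ?m))) z = poly (map_poly of_real r) z" unfolding hom by simp
  moreover have "r + ?m * (p div ?m) = p" unfolding r_def by (rule mod_mult_div_eq)
  ultimately have "poly (map_poly of_real r) z = 0" using root by simp
  hence e: "of_real (coeff r 0) + z * of_real (coeff r 1) = 0" by (subst (asm) r_eq) (simp add: map_poly_pCons)
  hence "Im z * coeff r 1 = 0" by (simp add: complex_eq_iff)
  hence "coeff r 1 = 0" using assms(2) by simp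
  hence "coeff r 0 = 0" using e by simp
  hence "r = 0" using r_eq \<open>coeff r 1 = 0\<close> by simp
  thus ?thesis unfolding r_def by (simp add: dvd_eq_mod_eq_0)
qed

text \<open>Factor over the complex numbers: every real root lies outside \<open>[0, 1]\<close>.\<close>

lemma interval_pos_if_positive:
  fixes p :: "real poly"
  assumes "!!t. 0 <= t ==> t <= 1 ==> 0 < poly p t"
  shows "interval_pos p" using assms
proof (induction "degree p" arbitrary: p rule: less_induct)
  case less
  show ?case
  proof (cases "degree p = 0")
    case True
    then obtain c where "p = [:c:]" by (rule degree_eq_zeroE)
    thus ?thesis using less.prems[of 0] by (auto intro: interval_pos_const)
  next
    case False
    hence "p ~= 0" by auto
    have "degree (map_poly complex_of_real p) = degree p" using \<open>p ~= 0\<close> by (intro map_poly_degree_eq) auto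
    then obtain z where z: "poly (map_poly complex_of_real p) z = 0"
      using Fundamental_Theorem_Algebra.fundamental_theorem_of_algebra[of "map_poly complex_of_real p"] False
      by (metis constant_degree)
    show ?thesis
    proof (cases "Im z = 0")
      case False
      let ?m = "[:(cmod z)\<^sup>2, - 2 * Re z, 1:]"
      obtain q where q: "p = ?m * q" using nonreal_root_dvd[OF z False] by (auto elim: dvdE)
      have m_eq: "?m = [:- Re z, 1:] * [:- Re z, 1:] + [:(Im z)\<^sup>2:]"
        unfolding cmod_power2 by (simp add: power2_eq_square)
      have mpos: "0 < poly ?m t" for t
      proof -
        have "poly ?m t = (t - Re z) * (t - Re z) + (Im z)\<^sup>2" unfolding m_eq by (simp add: algebra_simps)
        moreover have "0 < (Im z)\<^sup>2" using False by simp
        ultimately show ?thesis using zero_le_square[of "t - Re z"] by linarith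
      qed
      have "q ~= 0" using q \<open>p ~= 0\<close> by auto
      hence "degree p = degree ?m + degree q" unfolding q by (intro degree_mult_eq) auto
      hence "interval_pos q"
      proof (intro less.hyps)
        fix t :: real assume "0 <= t" "t <= 1"
        hence "0 < poly ?m t * poly q t" using less.prems[of t] unfolding q poly_mult by simp
        thus "0 < poly q t" using mpos[of t] zero_less_mult_pos by blast
      qed auto
      moreover have "interval_pos ?m" unfolding m_eq using interval_pos.base[of "[:- Re z, 1:]" 0 0]
        by (intro interval_pos.add interval_pos_const) auto
      ultimately show ?thesis unfolding q by (rule interval_pos_mult[rotated])
    next
      case True
      define r where "r = Re z"
      have "z = of_real r" using True by (simp add: r_def complex_eq_iff)
      hence "complex_of_real (poly p r) = 0" using z
        by (simp add: poly_altdef coeff_map_poly \<open>degree (map_poly complex_of_real p) = degree p\<close>)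
      hence "poly p r = 0" by simp
      hence r: "r < 0 \<or> 1 < r" using less.prems[of r] by force
      obtain q where q: "p = [:- r, 1:] * q" using \<open>poly p r = 0\<close> by (metis dvdE poly_eq_0_iff_dvd)
      have "q ~= 0" using q \<open>p ~= 0\<close> by auto
      hence deg: "degree p = Suc (degree q)" unfolding q by (subst degree_mult_eq) auto
      have val: "0 < (t - r) * poly q t" if "0 <= t" "t <= 1" for t
        using less.prems[OF that] unfolding q by (simp add: algebra_simps)
      \<comment> \<open>For a root \<open>r < 0\<close> the linear factor is
        \<open>(- r) + t\<close>; for \<open>r > 1\<close> both factors change sign and it becomes
        \<open>(r - 1) + (1 - t)\<close>.\<close>
      show ?thesis
      proof (cases "r < 0")
        case True
        have "interval_pos q" by (rule less.hyps) (use deg val True in \<open>auto simp: zero_less_mult_iff\<close>)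
        moreover have "interval_pos [:- r, 1:]"
          using interval_pos.add[OF interval_pos_const[of "- r"] interval_pos_X] True by simp
        ultimately show ?thesis unfolding q by (rule interval_pos_mult[rotated])
      next
        case False
        have "interval_pos (- q)"
          by (rule less.hyps) (use deg val False r in \<open>force simp: zero_less_mult_iff\<close>)+
        moreover have "interval_pos [:r, -1:]"
          using interval_pos.add[OF interval_pos_const[of "r - 1"] interval_pos_one_minus_X] False r by simp
        moreover have "p = [:r, -1:] * (- q)" unfolding q by simp
        ultimately show ?thesis using interval_pos_mult by metis
      qed
    qed
  qed
qed

section \<open>Polynomials and continuous functions of a bounded operator\<close>

locale positive_contraction =
  fixes B :: "'h::{real_inner, complete_space} => 'h"
  assumes lin: "linear B" and sym: "inner (B x) y = inner x (B y)" and nonneg: "0 <= inner (B x) x"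
    and le_one: "inner (B x) x <= inner x x"
begin

definition pop :: "real poly => 'h => 'h" where
  "pop p = fold_coeffs (%a f x. a *\<^sub>R x + B (f x)) p (%x. 0)"

lemma pop_0 [simp]: "pop 0 x = 0" by (simp add: pop_def)

lemma pop_pCons [simp]: "pop (pCons a p) x = a *\<^sub>R x + B (pop p x)"
  using linear_0[OF lin] by (cases "p = 0 \<and> a = 0") (auto simp: pop_def)

lemma pop_1: "pop 1 x = x" unfolding one_pCons by (simp add: linear_0[OF lin])

lemma pop_add: "pop (p + q) x = pop p x + pop q x"
  by (induction p q rule: poly_induct2) (simp_all add: linear_add[OF lin] algebra_simps)

lemma pop_smult: "pop (smult c p) x = c *\<^sub>R pop p x"
  by (induction p) (simp_all add: linear_scale[OF lin] scaleR_add_right)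

lemma pop_diff: "pop (p - q) x = pop p x - pop q x" using pop_add[of "p - q" q x] by (simp add: algebra_simps)

lemma pop_mult: "pop (p * q) x = pop p (pop q x)" by (induction p) (simp_all add: pop_add pop_smult)

lemma linear_pop: "linear (pop p)"
proof (rule linearI)
  show "pop p (x + y) = pop p x + pop p y" for x y by (induction p) (simp_all add: linear_add[OF lin] algebra_simps)
  show "pop p (c *\<^sub>R x) = c *\<^sub>R pop p x" for c x
    by (induction p) (simp_all add: linear_scale[OF lin] algebra_simps)
qed

lemma pop_commute_B: "pop p (B x) = B (pop p x)"
  using pop_mult[of p "[:0, 1:]" x] pop_mult[of "[:0, 1:]" p x] by (simp add: linear_0[OF lin] mult.commute)

lemma pop_sym: "inner (pop p x) y = inner x (pop p y)"
  by (induction p arbitrary: x y) (simp_all add: inner_add_left inner_add_right sym pop_commute_B)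

text \<open>By symmetry, the square and the even parts of the powers move to both sides of the inner
  product; what remains is 1, \<open>B\<close>, \<open>1 - B\<close> or
  \<open>B (1 - B)\<close>.\<close>

lemma interval_pos_op:
  assumes "interval_pos p"
  shows "0 <= inner (pop p x) x" using assms
proof (induction arbitrary: x)
  case (base q i j)
  define i' j' where "i' = i div 2" and "j' = j div 2"
  have B1: "0 <= inner (x - B x) x" for x using le_one[of x] by (simp add: inner_diff_left)
  have s: "0 <= inner (pop ([:0, 1:] ^ (i mod 2) * [:1, -1:] ^ (j mod 2)) y) y" for y
  proof -
    have "i mod 2 = 0 \<or> i mod 2 = 1" "j mod 2 = 0 \<or> j mod 2 = 1" by auto
    \<comment> \<open>The identity behind this is
      \<open>t (1 - t) = (1 - t) t (1 - t) + t (1 - t) t\<close>.\<close>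
    moreover have "0 <= inner (B (y - B y)) y"
    proof -
      have "inner (B (y - B y)) y = inner (B (y - B y)) (y - B y) + inner (B (y - B y)) (B y)"
        by (simp add: inner_diff_right)
      also have "inner (B (y - B y)) (B y) = inner (B y - B (B y)) (B y)" by (simp add: linear_diff[OF lin])
      finally show ?thesis using nonneg[of "y - B y"] B1[of "B y"] by linarith
    qed
    ultimately show ?thesis using nonneg[of y] B1[of y]
      by (elim disjE) (simp_all add: linear_0[OF lin] linear_diff[OF lin] linear_neg[OF lin] pop_1)
  qed
  let ?r = "q * [:0, 1:] ^ i' * [:1, -1:] ^ j'" and ?s = "[:0, 1:] ^ (i mod 2) * [:1, -1:] ^ (j mod 2) :: real poly"
  have ij: "i = i' + i' + i mod 2" "j = j' + j' + j mod 2" unfolding i'_def j'_def by presburger+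
  have "[:0, 1:] ^ i = [:0, 1:] ^ i' * [:0, 1:] ^ i' * ([:0, 1:] ^ (i mod 2) :: real poly)"
    "[:1, -1:] ^ j = [:1, -1:] ^ j' * [:1, -1:] ^ j' * ([:1, -1:] ^ (j mod 2) :: real poly)"
    using ij(1)[THEN arg_cong, of "%i. [:0, 1:] ^ i :: real poly"]
      ij(2)[THEN arg_cong, of "%i. [:1, -1:] ^ i :: real poly"] by (simp_all only: power_add)
  hence "q * q * [:0, 1:] ^ i * [:1, -1:] ^ j = ?r * (?s * ?r)" by (simp only: mult_ac)
  hence "inner (pop (q * q * [:0, 1:] ^ i * [:1, -1:] ^ j) x) x = inner (pop ?s (pop ?r x)) (pop ?r x)"
    by (simp only: pop_mult[of ?r "?s * ?r"] pop_mult[of ?s ?r] pop_sym[of ?r])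
  thus ?case using s by simp
next
  case (add p r)
  thus ?case by (simp add: pop_add inner_add_left)
qed

text \<open>Certificates exist for strictly positive polynomials, hence the perturbation by a
  constant \<open>e\<close> that tends to 0.\<close>

lemma pop_nonneg:
  assumes "!!t. 0 <= t ==> t <= 1 ==> 0 <= poly p t"
  shows "0 <= inner (pop p x) x"
proof -
  have "0 <= inner (pop p x) x + e * (inner x x + 1)" if "0 < e" for e
  proof -
    have "interval_pos (p + [:e:])" by (rule interval_pos_if_positive) (use assms that in \<open>auto intro: add_nonneg_pos\<close>)
    hence "0 <= inner (pop (p + [:e:]) x) x" by (rule interval_pos_op)
    thus ?thesis using that by (simp add: pop_add inner_add_left linear_0[OF lin] distrib_left)
  qed
  note * = this
  have "0 <= inner (pop p x) x + e" if "0 < e" for e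
  proof -
    have n: "0 < inner x x + 1" by (intro add_nonneg_pos) auto
    hence "0 <= inner (pop p x) x + e / (inner x x + 1) * (inner x x + 1)" using that by (intro *) auto
    thus ?thesis using n by simp
  qed
  thus ?thesis by (rule field_le_epsilon)
qed

text \<open>Positivity of \<open>M^2 - p^2\<close> at \<open>B\<close> gives the supremum bound
  without any spectral theory.\<close>

lemma pop_bound:
  assumes "!!t. 0 <= t ==> t <= 1 ==> \<bar>poly p t\<bar> <= M"
  shows "norm (pop p x) <= M * norm x"
proof -
  have M: "0 <= M" using assms[of 0] by simp
  have "0 <= inner (pop ([:M\<^sup>2:] - p * p) x) x"
  proof (rule pop_nonneg)
    fix t :: real assume "0 <= t" "t <= 1"
    from assms[OF this] have "\<bar>poly p t\<bar> ^ 2 <= M ^ 2" by (intro power_mono) auto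
    thus "0 <= poly ([:M\<^sup>2:] - p * p) t" by (simp add: power2_eq_square)
  qed
  hence "inner (pop p x) (pop p x) <= M\<^sup>2 * inner x x"
  proof -
    have "pop [:M\<^sup>2:] x = M\<^sup>2 *\<^sub>R x" by (simp add: linear_0[OF lin])
    hence "inner (pop ([:M\<^sup>2:] - p * p) x) x = M\<^sup>2 * inner x x - inner (pop p x) (pop p x)"
      by (simp only: pop_diff pop_mult inner_diff_left inner_scaleR_left pop_sym[of p "pop p x" x])
    with \<open>0 <= inner (pop ([:M\<^sup>2:] - p * p) x) x\<close> show ?thesis by linarith
  qed
  hence "(norm (pop p x))\<^sup>2 <= (M * norm x)\<^sup>2" unfolding power_mult_distrib power2_norm_eq_inner .
  thus ?thesis by (rule power2_le_imp_le) (use M in simp)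
qed

text \<open>A selected Weierstrass approximation with an explicit rate. By \<open>Phi_approx\<close>
  the limit is the same for every approximating sequence.\<close>

definition approx :: "(real => real) => nat => real poly" where
  "approx f n = (SOME p. \<forall>t\<in>{0..1}. \<bar>poly p t - f t\<bar> <= 1 / real (Suc n))"

definition Phi :: "(real => real) => 'h => 'h" where
  "Phi f x = lim (%n. pop (approx f n) x)"

lemma approx:
  assumes "continuous_on {0..1} f" "t \<in> {0..1}"
  shows "\<bar>poly (approx f n) t - f t\<bar> <= 1 / real (Suc n)"
proof -
  obtain g where g: "real_polynomial_function g" "!!t. t \<in> {0..1} ==> \<bar>f t - g t\<bar> < 1 / real (Suc n)"
    using Stone_Weierstrass_real_polynomial_function[of "{0..1::real}" f "1 / real (Suc n)"] assms(1) by auto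
  from g(1) obtain a N where "g = (%t. \<Sum>i\<le>N. a i * t ^ i)"
    unfolding real_polynomial_function_iff_sum by blast
  hence "poly (\<Sum>i\<le>N. monom (a i) i) t = g t" for t by (simp add: poly_sum poly_monom)
  hence "\<forall>t\<in>{0..1}. \<bar>poly (\<Sum>i\<le>N. monom (a i) i) t - f t\<bar> <= 1 / real (Suc n)"
    using g(2) by (simp add: abs_minus_commute less_imp_le)
  hence "\<forall>t\<in>{0..1}. \<bar>poly (approx f n) t - f t\<bar> <= 1 / real (Suc n)"
    unfolding approx_def by (rule someI)
  thus ?thesis using assms(2) by blast
qed

lemma lim_inverse_Suc: "(%n. 1 / real (Suc n)) \<longlonglongrightarrow> 0"
  using LIMSEQ_inverse_real_of_nat by (simp add: inverse_eq_divide)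

lemma Phi_approx:
  assumes f: "continuous_on {0..1} f" and p: "!!t. t \<in> {0..1} ==> \<bar>poly p t - f t\<bar> <= eps"
  shows "norm (pop p x - Phi f x) <= eps * norm x"
proof -
  have *: "norm (pop q x - pop (approx f n) x) <= (e + 1 / real (Suc n)) * norm x"
    if "!!t. t \<in> {0..1} ==> \<bar>poly q t - f t\<bar> <= e" for q e n
    unfolding pop_diff[symmetric]
  proof (rule pop_bound)
    fix t :: real assume "0 <= t" "t <= 1"
    thus "\<bar>poly (q - approx f n) t\<bar> <= e + 1 / real (Suc n)" using that[of t] approx[OF f, of t n] by simp
  qed
  have "Cauchy (%n. pop (approx f n) x)"
  proof (rule CauchyI)
    fix e :: real assume "0 < e"
    have "(%n. 1 / real (Suc n) * norm x) \<longlonglongrightarrow> 0" by (rule tendsto_mult_left_zero[OF lim_inverse_Suc])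
    from order_tendstoD(2)[OF this, of "e / 2"] obtain M
      where M: "!!n. M <= n ==> 1 / real (Suc n) * norm x < e / 2"
      using \<open>0 < e\<close> by (auto simp: eventually_sequentially)
    have "norm (pop (approx f i) x - pop (approx f j) x) < e" if "M <= i" "M <= j" for i j
      using *[OF approx[OF f, of _ i], of j] M[OF that(1)] M[OF that(2)] unfolding distrib_right by linarith
    thus "\<exists>M. \<forall>m\<ge>M. \<forall>n\<ge>M. norm (pop (approx f m) x - pop (approx f n) x) < e" by blast
  qed
  hence lim: "(%n. pop (approx f n) x) \<longlonglongrightarrow> Phi f x"
    unfolding Phi_def by (simp add: convergent_LIMSEQ_iff[symmetric] Cauchy_convergent_iff)
  have "(%n. norm (pop p x - pop (approx f n) x)) \<longlonglongrightarrow> norm (pop p x - Phi f x)"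
    by (intro tendsto_intros lim)
  moreover have "(%n. (eps + 1 / real (Suc n)) * norm x) \<longlonglongrightarrow> (eps + 0) * norm x"
    using LIMSEQ_inverse_real_of_nat by (intro tendsto_intros) (simp add: inverse_eq_divide)
  ultimately show ?thesis
    using LIMSEQ_le[of "%n. norm (pop p x - pop (approx f n) x)" _ "%n. (eps + 1 / real (Suc n)) * norm x"] *[OF p]
    by auto
qed

lemma pop_tendsto_Phi:
  assumes f: "continuous_on {0..1} f" and p: "!!n t. t \<in> {0..1} ==> \<bar>poly (p n) t - f t\<bar> <= e n"
    and e: "e \<longlonglongrightarrow> 0"
  shows "(%n. pop (p n) x) \<longlonglongrightarrow> Phi f x"
proof (rule Lim_null_comparison[THEN LIM_zero_cancel])
  show "eventually (%n. norm (pop (p n) x - Phi f x) <= e n * norm x) sequentially"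
    using Phi_approx[OF f p] by auto
qed (rule tendsto_mult_left_zero[OF e])

lemma pop_approx_tendsto: "continuous_on {0..1} f ==> (%n. pop (approx f n) x) \<longlonglongrightarrow> Phi f x"
  by (rule pop_tendsto_Phi[OF _ approx lim_inverse_Suc])

lemma Phi_bound:
  assumes f: "continuous_on {0..1} f" and M: "!!t. t \<in> {0..1} ==> \<bar>f t\<bar> <= M"
  shows "norm (Phi f x) <= M * norm x" using Phi_approx[of f 0 M x] assms by simp

lemma Phi_poly: "Phi (poly p) x = pop p x" using Phi_approx[of "poly p" p 0 x] by (simp add: continuous_on_poly)

lemma Phi_cong:
  assumes "continuous_on {0..1} f" "!!t. t \<in> {0..1} ==> f t = g t"
  shows "Phi f x = Phi g x"
proof -
  have "approx f n = approx g n" for n unfolding approx_def using assms(2) by (intro arg_cong[of _ _ Eps] ext) auto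
  thus ?thesis by (simp add: Phi_def)
qed

lemma Phi_id: "Phi (%t. t) x = B x"
proof -
  have "poly [:0, 1:] = (%t::real. t)" by auto
  thus ?thesis using Phi_poly[of "[:0, 1:]" x] linear_0[OF lin] by simp
qed

lemma Phi_const: "Phi (%t. c) x = c *\<^sub>R x"
proof -
  have "poly [:c:] = (%t::real. c)" by auto
  thus ?thesis using Phi_poly[of "[:c:]" x] linear_0[OF lin] by simp
qed

lemma Phi_add:
  assumes "continuous_on {0..1} f" "continuous_on {0..1} g"
  shows "Phi (%t. f t + g t) x = Phi f x + Phi g x"
proof (rule LIMSEQ_unique)
  let ?p = "%n. approx f n + approx g n"
  show "(%n. pop (?p n) x) \<longlonglongrightarrow> Phi f x + Phi g x"
    unfolding pop_add by (intro tendsto_intros pop_approx_tendsto assms)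
  show "(%n. pop (?p n) x) \<longlonglongrightarrow> Phi (%t. f t + g t) x"
  proof (rule pop_tendsto_Phi)
    show "\<bar>poly (?p n) t - (f t + g t)\<bar> <= 1 / real (Suc n) + 1 / real (Suc n)" if "t \<in> {0..1}" for n t
      using approx[OF assms(1) that, of n] approx[OF assms(2) that, of n] by simp
  qed (use tendsto_add[OF lim_inverse_Suc lim_inverse_Suc] in \<open>auto intro!: continuous_intros assms\<close>)
qed

lemma continuous_bounded_unit:
  assumes "continuous_on {0..1::real} (f :: real => real)"
  obtains M where "0 < M" "!!t. t \<in> {0..1} ==> \<bar>f t\<bar> <= M"
proof -
  have "compact (f ` {0..1})" using assms by (intro compact_continuous_image) auto
  then obtain M where "0 < M" "\<forall>v\<in>f ` {0..1}. norm v <= M" using compact_imp_bounded bounded_pos by metis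
  thus ?thesis by (intro that[of M]) auto
qed

lemma Phi_mult:
  assumes f: "continuous_on {0..1} f" and g: "continuous_on {0..1} g"
  shows "Phi (%t. f t * g t) x = Phi f (Phi g x)"
proof (rule LIMSEQ_unique)
  have c: "continuous_on {0..1} (%t. f t * g t)" by (intro continuous_intros assms)
  obtain M where M: "0 < M" "!!t. t \<in> {0..1} ==> \<bar>f t\<bar> <= M" using continuous_bounded_unit[OF f] by blast
  obtain M' where M': "0 < M'" "!!t. t \<in> {0..1} ==> \<bar>g t\<bar> <= M'" using continuous_bounded_unit[OF g] by blast
  let ?p = "%n. approx f n * approx g n"
  show "(%n. pop (?p n) x) \<longlonglongrightarrow> Phi (%t. f t * g t) x"
  proof (rule pop_tendsto_Phi[OF c])
    fix n and t :: real assume t: "t \<in> {0..1}"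
    let ?a = "poly (approx f n) t" and ?b = "poly (approx g n) t"
    have a: "\<bar>?a - f t\<bar> <= 1 / real (Suc n)" and b: "\<bar>?b - g t\<bar> <= 1 / real (Suc n)"
      using approx[OF f t] approx[OF g t] by auto
    have "1 / real (Suc n) <= 1" by simp
    hence b': "\<bar>?b\<bar> <= M' + 1" using b M'(2)[OF t] by linarith
    have "?a * ?b - f t * g t = (?a - f t) * ?b + f t * (?b - g t)" by (simp add: algebra_simps)
    hence "\<bar>?a * ?b - f t * g t\<bar> <= \<bar>?a - f t\<bar> * \<bar>?b\<bar> + \<bar>f t\<bar> * \<bar>?b - g t\<bar>"
      unfolding abs_mult[symmetric] by (metis abs_triangle_ineq)
    also have "... <= 1 / real (Suc n) * (M' + 1) + M * (1 / real (Suc n))"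
      using a b b' M(2)[OF t] M(1) by (intro add_mono mult_mono) auto
    finally show "\<bar>poly (?p n) t - f t * g t\<bar> <= ..." by simp
  next
    show "(%n. 1 / real (Suc n) * (M' + 1) + M * (1 / real (Suc n))) \<longlonglongrightarrow> 0"
      using tendsto_add[OF tendsto_mult_left_zero[OF lim_inverse_Suc] tendsto_mult_right_zero[OF lim_inverse_Suc]]
      by (simp only: add_0)
  qed
  have "(%n. pop (approx f n) (pop (approx g n) x) - pop (approx f n) (Phi g x)) \<longlonglongrightarrow> 0"
  proof (rule Lim_null_comparison)
    have "norm (pop (approx f n) (pop (approx g n) x) - pop (approx f n) (Phi g x)) <= (M + 1) * norm (pop (approx g n) x - Phi g x)" for n
      unfolding linear_diff[OF linear_pop, symmetric]
    proof (rule pop_bound)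
      fix t :: real assume "0 <= t" "t <= 1"
      hence "\<bar>poly (approx f n) t - f t\<bar> <= 1 / real (Suc n)" "\<bar>f t\<bar> <= M" using approx[OF f] M(2) by auto
      moreover have "1 / real (Suc n) <= 1" by simp
      ultimately show "\<bar>poly (approx f n) t\<bar> <= M + 1" by linarith
    qed
    thus "eventually (%n. norm (pop (approx f n) (pop (approx g n) x) - pop (approx f n) (Phi g x))
        <= (M + 1) * norm (pop (approx g n) x - Phi g x)) sequentially" by simp
    have "(%n. (M + 1) * norm (pop (approx g n) x - Phi g x)) \<longlonglongrightarrow> (M + 1) * norm (Phi g x - Phi g x)"
      by (intro tendsto_intros pop_approx_tendsto g)
    thus "(%n. (M + 1) * norm (pop (approx g n) x - Phi g x)) \<longlonglongrightarrow> 0" by simp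
  qed
  from tendsto_add[OF this pop_approx_tendsto[OF f, of "Phi g x"]]
  show "(%n. pop (?p n) x) \<longlonglongrightarrow> Phi f (Phi g x)" by (simp add: pop_mult)
qed

end

section \<open>Evolution equation and scheme for a dissipative graph\<close>

text \<open>The operator is given by its graph, so its domain needs no type of its own. For a
  symmetric nonpositive operator, \<open>dense_range\<close> amounts to essential self-adjointness;
  \<open>dense_domain\<close> makes the resolvent injective.\<close>

locale dissipative_graph =
  fixes G :: "('h::{real_inner, complete_space} \<times> 'h) set"
  assumes subspace: "subspace G"
    and symmetric: "(x, a) \<in> G ==> (y, b) \<in> G ==> inner a y = inner x b"
    and nonpos: "(x, a) \<in> G ==> inner a x <= 0"
    and dense_range: "(!!x a. (x, a) \<in> G ==> inner w (x - a) = 0) ==> w = 0"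
    and dense_domain: "(!!x a. (x, a) \<in> G ==> inner w x = 0) ==> w = 0"
begin

lemma norm_le_range: "(x, a) \<in> G ==> norm x <= norm (x - a)"
proof -
  assume "(x, a) \<in> G"
  from nonpos[OF this] have "inner x x <= inner (x - a) (x - a)"
    using inner_ge_zero[of a] by (simp add: inner_diff_left inner_diff_right inner_commute del: inner_ge_zero)
  thus ?thesis by (simp add: norm_le)
qed

abbreviation (input) "R \<equiv> (%(x, a). x - a) ` G"

lemma subspace_range: "subspace R"
proof (rule linear_subspace_image[OF linearI subspace])
qed (auto simp: algebra_simps)

text \<open>This is \<open>(1 - A)\<^sup>-\<^sup>1\<close> for the closure \<open>A\<close> of the operator with graph \<open>G\<close>; Riesz' theorem provides it
  without forming the closure.\<close>

definition B :: "'h => 'h" where "B y = (SOME z. \<forall>x a. (x, a) \<in> G --> inner z (x - a) = inner y x)"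

lemma inner_B: "(x, a) \<in> G ==> inner (B y) (x - a) = inner y x"
proof -
  obtain z where "!!p. p \<in> G ==> inner y (fst p) = inner z (fst p - snd p)"
  proof (rule riesz_image[of G "%p. fst p - snd p" "%p. inner y (fst p)" "norm y"])
    show "G ~= {}" using subspace_0[OF subspace] by blast
    show "\<exists>r\<in>G. fst r - snd r = fst p - snd p + c *\<^sub>R (fst q - snd q) \<and> inner y (fst r) = inner y (fst p) + c * inner y (fst q)"
      if "p \<in> G" "q \<in> G" for p q c
      using subspace_add[OF subspace that(1) subspace_scale[OF subspace that(2), of c]]
      by (intro bexI[of _ "p + c *\<^sub>R q"]) (auto simp: algebra_simps inner_add_right)
    show "\<bar>inner y (fst p)\<bar> <= norm y * norm (fst p - snd p)" if "p \<in> G" for p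
      using Cauchy_Schwarz_ineq2[of y "fst p"] mult_left_mono[OF norm_le_range[of "fst p" "snd p"], of "norm y"] that by simp
  qed blast
  hence "\<exists>z. \<forall>x a. (x, a) \<in> G --> inner z (x - a) = inner y x" by force
  from someI_ex[OF this] show "(x, a) \<in> G ==> inner (B y) (x - a) = inner y x" unfolding B_def by blast
qed

lemma B_eq: "(!!x a. (x, a) \<in> G ==> inner z (x - a) = inner y x) ==> B y = z"
  using dense_range[of "B y - z"] by (simp add: inner_diff_left inner_B)

lemma B_graph: "(x, a) \<in> G ==> B (x - a) = x"
  by (rule B_eq) (simp add: inner_diff_left inner_diff_right symmetric)

text \<open>Every vector is its own Riesz representative in the closure of the range of
  \<open>1 - A\<close>. So a closed property needs checking on the range only, where
  \<open>B (x - a) = x\<close>.\<close>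

lemma range_induct:
  assumes "closed S" "!!x a. (x, a) \<in> G ==> x - a \<in> S"
  shows "w \<in> S"
proof -
  obtain w' where w': "w' \<in> closure R" "!!s. s \<in> R ==> inner w s = inner w' s"
    by (rule riesz_subspace[OF subspace_range, of "inner w" "norm w"]) (auto simp: inner_add_right Cauchy_Schwarz_ineq2)
  have "w - w' = 0" by (rule dense_range) (use w'(2) in \<open>force simp: inner_diff_left\<close>)
  moreover have "closure R \<subseteq> S" using assms by (intro closure_minimal) auto
  ultimately show ?thesis using w'(1) by auto
qed

lemma linear_B: "linear B" by (intro linearI B_eq) (simp_all add: inner_add_left inner_B)

lemma bounded_linear_B: "bounded_linear B"
proof (rule bounded_linear_intro[where K = 1])
  fix y
  \<comment> \<open>The set turns out to be everything; membership of \<open>B y\<close> itself is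
    the estimate.\<close>
  have "B y \<in> {w. inner (B y) w <= norm y * norm w}"
  proof (rule range_induct)
    fix x a assume g: "(x, a) \<in> G"
    have "inner y x <= norm y * norm (x - a)"
      using norm_cauchy_schwarz[of y x] mult_left_mono[OF norm_le_range[OF g], of "norm y"] by simp
    thus "x - a \<in> {w. inner (B y) w <= norm y * norm w}" by (simp add: inner_B[OF g])
  qed (intro closed_Collect_le continuous_intros)
  hence "norm (B y) * norm (B y) <= norm y * norm (B y)" by (simp add: dot_square_norm power2_eq_square)
  thus "norm (B y) <= norm y * 1" by (cases "B y = 0") auto
qed (simp_all add: linear_add[OF linear_B] linear_scale[OF linear_B])

sublocale positive_contraction B
proof (rule positive_contraction.intro[OF linear_B])
  note [continuous_intros] = bounded_linear.continuous_on[OF bounded_linear_B]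
  fix x y
  have "y \<in> {y. inner (B x) y = inner x (B y)}"
    by (rule range_induct) (auto simp: inner_B B_graph intro!: closed_Collect_eq continuous_intros)
  thus "inner (B x) y = inner x (B y)" by simp
  have "x \<in> {x. 0 <= inner (B x) x}"
  proof (rule range_induct)
    show "x - a \<in> {x. 0 <= inner (B x) x}" if "(x, a) \<in> G" for x a
      using nonpos[OF that] inner_ge_zero[of x] by (simp add: B_graph[OF that] inner_diff_right inner_commute del: inner_ge_zero)
  qed (intro closed_Collect_le continuous_intros)
  thus "0 <= inner (B x) x" by simp
  have "x \<in> {x. inner (B x) x <= inner x x}"
  proof (rule range_induct)
    show "x - a \<in> {x. inner (B x) x <= inner x x}" if "(x, a) \<in> G" for x a
      using nonpos[OF that] inner_ge_zero[of a]
      by (simp add: B_graph[OF that] inner_diff_left inner_diff_right inner_commute del: inner_ge_zero)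
  qed (intro closed_Collect_le continuous_intros)
  thus "inner (B x) x <= inner x x" by simp
qed

lemma B_injective: "B y = 0 ==> y = 0"
proof (rule dense_domain)
  fix x a assume "B y = 0" "(x, a) \<in> G"
  hence "inner y (B (x - a)) = 0" using sym[of y "x - a"] by simp
  thus "inner y x = 0" using B_graph[OF \<open>(x, a) \<in> G\<close>] by simp
qed

text \<open>The hypothesis says that \<open>p\<close> is \<open>A q\<close> in the sense of duality,
  and \<open>B A = B - 1\<close>. Evolution equation and scheme both enter the functional calculus
  through this bounded form.\<close>

lemma weak_equation:
  assumes "!!x a. (x, a) \<in> G ==> inner p x = inner q a"
  shows "B p = B q - q"
proof -
  have "B p - B q + q = 0"
  proof (rule dense_range)
    fix x a assume g: "(x, a) \<in> G"
    have "inner (B p - B q + q) (x - a) = inner p (B (x - a)) - inner q (B (x - a)) + inner q (x - a)"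
      by (simp add: inner_add_left inner_diff_left sym)
    also have "... = 0" using assms[OF g] B_graph[OF g] by (simp add: inner_diff_right)
    finally show "inner (B p - B q + q) (x - a) = 0" .
  qed
  thus ?thesis by (simp add: algebra_simps)
qed

lemma Phi_sym: "continuous_on {0..1} f ==> inner (Phi f x) y = inner x (Phi f y)"
proof (rule LIMSEQ_unique)
  assume f: "continuous_on {0..1} f"
  show "(%n. inner (pop (approx f n) x) y) \<longlonglongrightarrow> inner (Phi f x) y" by (intro tendsto_intros pop_approx_tendsto f)
  show "(%n. inner (pop (approx f n) x) y) \<longlonglongrightarrow> inner x (Phi f y)"
    unfolding pop_sym by (intro tendsto_intros pop_approx_tendsto f)
qed

lemma Phi_scale: "continuous_on {0..1} f ==> Phi (%t. c * f t) x = c *\<^sub>R Phi f x"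
  by (subst Phi_mult) (auto simp: Phi_const)

lemma Phi_diff: "continuous_on {0..1} f ==> continuous_on {0..1} g ==> Phi (%t. f t - g t) x = Phi f x - Phi g x"
  using Phi_add[of f "%t. (-1) * g t" x] Phi_scale[of g "-1" x] by (simp add: continuous_on_minus)

lemma Phi_sum:
  assumes "!!i. i \<in> I ==> continuous_on {0..1} (f i)"
  shows "Phi (%t. \<Sum>i\<in>I. f i t) x = (\<Sum>i\<in>I. Phi (f i) x)" using assms
proof (induction I rule: infinite_finite_induct)
  case (insert i I)
  thus ?case by (simp add: Phi_add continuous_on_sum)
qed (simp_all add: Phi_const)

lemma Phi_B: "continuous_on {0..1} f ==> Phi (%t. t * f t) x = B (Phi f x)"
  by (subst Phi_mult) (auto simp: Phi_id intro!: continuous_intros)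

lemma Phi_B': "continuous_on {0..1} f ==> Phi (%t. f t * t) x = Phi f (B x)"
  by (subst Phi_mult) (auto simp: Phi_id intro!: continuous_intros)

lemma Phi_commute_B: "continuous_on {0..1} f ==> Phi f (B x) = B (Phi f x)"
  using Phi_B[of f x] Phi_B'[of f x] by (simp add: mult.commute)

end

section \<open>The heat semigroup as a function of the resolvent\<close>

lemma exp_neg_diff_le: "\<bar>exp (- x) - exp (- y)\<bar> <= \<bar>x - y\<bar>" if "0 <= x" "0 <= y" for x y :: real
proof -
  have *: "exp (- x) - exp (- y) <= y - x" "0 <= exp (- x) - exp (- y)" if "0 <= x" "x <= y" for x y :: real
  proof -
    have "1 + (x - y) <= exp (x - y)" by (rule exp_ge_add_one_self)
    hence "1 - exp (x - y) <= y - x" by linarith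
    hence "exp (- x) * (1 - exp (x - y)) <= 1 * (y - x)" using that by (intro mult_mono) auto
    moreover have "exp (- x) * exp (x - y) = exp (- y)" by (simp flip: exp_add)
    ultimately show "exp (- x) - exp (- y) <= y - x" by (simp add: algebra_simps)
  qed (use that in simp)
  show ?thesis using *[of x y] *[of y x] that by (cases "x <= y") auto
qed

lemma exp_neg_taylor: "\<bar>exp (- x') - exp (- x) + (x' - x) * exp (- x)\<bar> <= (x' - x)\<^sup>2" if "0 <= x" "0 <= x'" for x x' :: real
proof -
  have "\<exists>c. min x x' <= c \<and> c <= max x x' \<and> exp (- x') - exp (- x) = - (x' - x) * exp (- c)"
  proof (cases x x' rule: linorder_cases)
    case less
    have "((%x. exp (- x)) has_real_derivative - exp (- t)) (at t)" for t :: real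
      by (auto intro!: derivative_eq_intros)
    from MVT2[OF less this] obtain c where "x < c" "c < x'" "exp (- x') - exp (- x) = (x' - x) * - exp (- c)" by auto
    thus ?thesis by (intro exI[of _ c]) (auto simp: left_diff_distrib)
  next
    case greater
    have "((%x. exp (- x)) has_real_derivative - exp (- t)) (at t)" for t :: real
      by (auto intro!: derivative_eq_intros)
    from MVT2[OF greater this] obtain c where "x' < c" "c < x" "exp (- x) - exp (- x') = (x - x') * - exp (- c)" by auto
    thus ?thesis by (intro exI[of _ c]) (auto simp: algebra_simps)
  qed auto
  then obtain c where c: "min x x' <= c" "c <= max x x'" "exp (- x') - exp (- x) = - (x' - x) * exp (- c)" by blast
  have "\<bar>exp (- x') - exp (- x) + (x' - x) * exp (- x)\<bar> = \<bar>x' - x\<bar> * \<bar>exp (- x) - exp (- c)\<bar>"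
    unfolding c(3) abs_mult[symmetric] by (simp add: algebra_simps)
  also have "... <= \<bar>x' - x\<bar> * \<bar>x - c\<bar>" using exp_neg_diff_le[of x c] that c by (intro mult_left_mono) auto
  also have "... <= \<bar>x' - x\<bar> * \<bar>x' - x\<bar>" using c by (intro mult_left_mono) auto
  finally show ?thesis by (simp add: power2_eq_square abs_mult_self_eq)
qed

text \<open>The spectral variable \<open>b\<close> is an eigenvalue of \<open>(1 - A)\<^sup>-\<^sup>1\<close>, so that \<open>1 / b - 1\<close> is one of \<open>- A\<close>.\<close>

definition heat_symbol :: "real => real => real" where
  "heat_symbol r b = (if b = 0 then 0 else exp (- (r * (1 / b - 1))))"

lemma heat_symbol_bounds: "0 <= r ==> b \<in> {0..1} ==> 0 <= heat_symbol r b \<and> heat_symbol r b <= 1"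
  unfolding heat_symbol_def by (auto intro!: mult_nonneg_nonneg)

text \<open>As \<open>b\<close> tends to 0, the eigenvalue of \<open>- A\<close> tends to infinity;
  the bound \<open>exp (- (r / b)) \<le> b / r\<close> yields the limit 0.\<close>

lemma continuous_heat_symbol:
  assumes "0 < r"
  shows "continuous_on {0..1} (heat_symbol r)" unfolding continuous_on_eq_continuous_within
proof
  fix b :: real assume b: "b \<in> {0..1}"
  show "continuous (at b within {0..1}) (heat_symbol r)"
  proof (cases "b = 0")
    case False
    have "continuous (at b within {0..1}) (%b. exp (- (r * (1 / b - 1))))"
      using False by (intro continuous_intros) auto
    moreover have "eventually (%b. b ~= 0) (at b within {0..1})"
      using False by (intro eventually_neq_at_within) 
    hence "eventually (%x. exp (- (r * (1 / x - 1))) = heat_symbol r x) (at b within {0..1})"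
      by eventually_elim (simp add: heat_symbol_def)
    ultimately show ?thesis
      unfolding continuous_within using False by (auto simp: heat_symbol_def intro: Lim_transform_eventually)
  next
    case True
    have "heat_symbol r x <= x * (exp r / r)" if "0 <= x" for x
    proof (cases "x = 0")
      case False
      hence x: "0 < x" using that by simp
      have "1 + r / x <= exp (r / x)" by (rule exp_ge_add_one_self)
      hence "r / x <= exp (r / x)" by linarith
      hence "1 / exp (r / x) <= 1 / (r / x)" using assms x by (intro divide_left_mono mult_pos_pos) auto
      hence "exp (- (r / x)) <= x / r" by (simp add: exp_minus inverse_eq_divide)
      hence "exp r * exp (- (r / x)) <= exp r * (x / r)" by (intro mult_left_mono) auto
      moreover have "- (r * (1 / x - 1)) = r + - (r / x)" by (simp add: algebra_simps)
      hence "heat_symbol r x = exp r * exp (- (r / x))" using x by (simp only: heat_symbol_def exp_add) simp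
      ultimately show ?thesis by (simp add: mult.commute)
    qed (simp add: heat_symbol_def)
    hence "eventually (%x. norm (heat_symbol r x) <= x * (exp r / r)) (at 0 within {0..1})"
    proof -
      assume *: "!!x. 0 <= x ==> heat_symbol r x <= x * (exp r / r)"
      have "eventually (%x. x \<in> {0..1}) (at 0 within {0..1::real})" by (simp add: eventually_at_filter)
      thus ?thesis
      proof eventually_elim
        case (elim x)
        thus ?case using *[of x] heat_symbol_bounds[of r x] assms by simp
      qed
    qed
    moreover have "((%x. x * (exp r / r)) \<longlongrightarrow> 0) (at 0 within {0..1})"
      by (rule tendsto_mult_left_zero) (rule tendsto_ident_at)
    ultimately have "(heat_symbol r \<longlongrightarrow> 0) (at 0 within {0..1})" by (rule Lim_null_comparison)
    thus ?thesis unfolding continuous_within True by (simp add: heat_symbol_def)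
  qed
qed

text \<open>For \<open>r = 0\<close> the symbol itself jumps at \<open>b = 0\<close>. One factor
  \<open>b\<close> removes the jump, so that the final time \<open>t = s\<close> can be included
  below.\<close>

lemma continuous_mult_heat_symbol:
  assumes "0 <= r"
  shows "continuous_on {0..1} (%b. b * heat_symbol r b)"
proof (cases "r = 0")
  case True
  have "(%b. b * heat_symbol r b) = (%b. b)" by (auto simp: True heat_symbol_def)
  thus ?thesis by (simp only: continuous_on_id)
next
  case False
  thus ?thesis using assms by (intro continuous_intros continuous_heat_symbol) auto
qed

text \<open>The second-order remainder carries two factors \<open>y = 1 / b - 1\<close>, and the two
  factors \<open>b\<close> turn them into \<open>1 - b\<close>. Differentiation in time is therefore
  uniform over the spectrum.\<close>

lemma heat_symbol_taylor:
  assumes "0 <= r" "0 <= r'" "b \<in> {0..1}"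
  shows "\<bar>b * (b * heat_symbol r' b) - b * (b * heat_symbol r b) + (r' - r) * ((1 - b) * (b * heat_symbol r b))\<bar> <= (r' - r)\<^sup>2"
proof (cases "b = 0")
  case False
  define y where "y = 1 / b - 1"
  have y: "0 <= y" "b * y = 1 - b" using assms(3) False by (auto simp: y_def field_simps)
  have "b * (b * heat_symbol r' b) - b * (b * heat_symbol r b) + (r' - r) * ((1 - b) * (b * heat_symbol r b))
    = (b * b) * (exp (- (r' * y)) - exp (- (r * y)) + (r' * y - r * y) * exp (- (r * y)))"
  proof -
    have "(r' - r) * ((1 - b) * (b * exp (- (r * y)))) = (b * b) * ((r' * y - r * y) * exp (- (r * y)))"
      unfolding y(2)[symmetric] by (simp add: algebra_simps)
    thus ?thesis using False by (simp add: heat_symbol_def y_def[symmetric] distrib_left right_diff_distrib mult.assoc)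
  qed
  also have "\<bar>...\<bar> <= (b * b) * (r' * y - r * y)\<^sup>2"
    unfolding abs_mult using exp_neg_taylor[of "r * y" "r' * y"] assms y by (intro mult_mono) auto
  also have "... = ((r' - r) * (1 - b))\<^sup>2" unfolding y(2)[symmetric] by (simp add: power2_eq_square algebra_simps)
  also have "... <= (r' - r)\<^sup>2 * 1"
    unfolding power_mult_distrib using assms(3) by (intro mult_left_mono power_le_one) auto finally show ?thesis by simp
qed (simp add: heat_symbol_def)

context dissipative_graph
begin

text \<open>Duality: the pairing of \<open>u t\<close> with \<open>B^2 exp ((s - t) A) y\<close> is
  constant in \<open>t\<close>, since the derivatives of the two factors cancel. The regularisation
  by \<open>B^2\<close> makes the second factor differentiable in norm up to \<open>t = s\<close>,
  and injectivity of \<open>B\<close> removes it at the end.\<close>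

lemma evolution_representation:
  assumes s: "0 < s" and cont: "continuous_on {0..s} u" and u0: "u 0 = v"
    and deriv: "!!t. 0 < t ==> t < s ==> \<exists>D. (u has_vector_derivative D) (at t within {0..s}) \<and>
        (\<forall>x a. (x, a) \<in> G --> inner D x = inner (u t) a)"
  shows "u s = Phi (heat_symbol s) v"
proof -
  \<comment> \<open>\<open>K\<close> is the time derivative of \<open>F\<close>: the operator
    \<open>- A\<close> corresponds to \<open>1 / b - 1\<close>, which \<open>b^2\<close> turns into
    \<open>b (1 - b)\<close>.\<close>
  define F where "F t b = b * (b * heat_symbol (s - t) b)" for t b
  define K where "K t b = (1 - b) * (b * heat_symbol (s - t) b)" for t b
  have contH: "continuous_on {0..1} (%b. b * heat_symbol (s - t) b)" if "t <= s" for t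
    using that by (intro continuous_mult_heat_symbol) simp
  have contF: "continuous_on {0..1} (F t)" and contK: "continuous_on {0..1} (K t)" if "t <= s" for t
    unfolding F_def K_def using contH[OF that] by (auto intro!: continuous_intros)
  have dF: "((%t. Phi (F t) y) has_vector_derivative Phi (K t) y) (at t within {0..s})" if t: "t \<in> {0..s}" for t y
    unfolding has_vector_derivative_def has_derivative_within'
  proof (intro conjI allI impI)
    show "bounded_linear (%h. h *\<^sub>R Phi (K t) y)" by (rule bounded_linear_scaleR_left)
    fix e :: real assume e: "0 < e"
    define del where "del = e / (norm y + 1)"
    have n: "0 < norm y + 1" by (intro add_nonneg_pos) auto
    have est: "norm (Phi (F t') y - Phi (F t) y - (t' - t) *\<^sub>R Phi (K t) y) <= (t' - t)\<^sup>2 * norm y" if t': "t' \<in> {0..s}" for t'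
    proof -
      have c: "continuous_on {0..1} (%b. F t' b - F t b - (t' - t) * K t b)"
        using t t' by (intro continuous_intros contF contK) auto
      have "Phi (F t') y - Phi (F t) y - (t' - t) *\<^sub>R Phi (K t) y = Phi (%b. F t' b - F t b - (t' - t) * K t b) y"
        using t t' by (subst Phi_diff Phi_scale | intro continuous_intros contF contK | simp)+
      also have "norm ... <= (t' - t)\<^sup>2 * norm y"
      proof (rule Phi_bound[OF c])
        fix b :: real assume "b \<in> {0..1}"
        thus "\<bar>F t' b - F t b - (t' - t) * K t b\<bar> <= (t' - t)\<^sup>2"
          using heat_symbol_taylor[of "s - t" "s - t'" b] t t'
          unfolding F_def K_def by (simp add: algebra_simps power2_commute[of t t'])
      qed finally show ?thesis .
    qed
    show "\<exists>d>0. \<forall>t'\<in>{0..s}. 0 < norm (t' - t) \<and> norm (t' - t) < d -->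
        norm (Phi (F t') y - Phi (F t) y - (t' - t) *\<^sub>R Phi (K t) y) / norm (t' - t) < e"
    proof (intro exI[of _ del] conjI ballI impI)
      show "0 < del" using e n by (simp add: del_def)
      fix t' assume t': "t' \<in> {0..s}" and d: "0 < norm (t' - t) \<and> norm (t' - t) < del"
      have "norm (Phi (F t') y - Phi (F t) y - (t' - t) *\<^sub>R Phi (K t) y) / norm (t' - t) <= ((t' - t)\<^sup>2 * norm y) / norm (t' - t)"
        using d by (intro divide_right_mono est t') auto
      also have "... = norm (t' - t) * norm y"
      proof -
        have "(t' - t)\<^sup>2 = norm (t' - t) * norm (t' - t)" by (simp add: power2_eq_square)
        moreover have "(a * a) * c / a = a * c" if "a ~= 0" for a c :: real using that by simp
        ultimately show ?thesis using d by (metis less_irrefl)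
      qed
      also have "... <= norm (t' - t) * (norm y + 1)" by (intro mult_left_mono) auto
      also have "... < del * (norm y + 1)" using d n by (intro mult_strict_right_mono) auto
      also have "... = e" using n by (simp add: del_def)
      finally show "norm (Phi (F t') y - Phi (F t) y - (t' - t) *\<^sub>R Phi (K t) y) / norm (t' - t) < e" .
    qed
  qed
  have "B (B (u s - Phi (heat_symbol s) v)) = 0"
  proof -
    have "inner (B (B (u s - Phi (heat_symbol s) v))) y = 0" for y
    proof -
      define phi where "phi t = inner (u t) (Phi (F t) y)" for t
      have contw: "continuous_on {0..s} (%t. Phi (F t) y)"
        unfolding continuous_on_eq_continuous_within using dF has_vector_derivative_continuous by blast
      have contphi: "continuous_on {0..s} phi" unfolding phi_def by (intro continuous_intros cont contw)
      have "(phi has_real_derivative 0) (at t)" if t: "0 < t" "t < s" for t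
      proof -
        obtain D where D: "(u has_vector_derivative D) (at t within {0..s})"
          "!!x a. (x, a) \<in> G ==> inner D x = inner (u t) a" using deriv[OF t] by blast
        have BD: "B D = B (u t) - u t" by (rule weak_equation) (rule D(2))
        have ts: "t \<in> {0..s}" "t <= s" using t by auto
        have "(phi has_vector_derivative inner (u t) (Phi (K t) y) + inner D (Phi (F t) y)) (at t within {0..s})"
          unfolding phi_def by (rule bounded_bilinear.has_vector_derivative[OF bounded_bilinear_inner D(1) dF[OF ts(1)]])
        moreover have "inner (u t) (Phi (K t) y) + inner D (Phi (F t) y) = 0"
        proof -
          let ?H = "%b. b * heat_symbol (s - t) b"
          have "Phi (F t) y = B (Phi ?H y)" unfolding F_def by (rule Phi_B[OF contH[OF ts(2)]])
          hence "inner D (Phi (F t) y) = inner (B (u t) - u t) (Phi ?H y)" using BD sym[of D] by simp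
          moreover have "Phi (K t) y = Phi ?H y - B (Phi ?H y)"
          proof -
            have "Phi (K t) y = Phi (%b. ?H b - b * ?H b) y"
              by (rule Phi_cong[OF contK[OF ts(2)]]) (simp add: K_def algebra_simps)
            also have "... = Phi ?H y - Phi (%b. b * ?H b) y"
              using contH[OF ts(2)] by (intro Phi_diff) (auto intro!: continuous_intros)
            also have "Phi (%b. b * ?H b) y = B (Phi ?H y)" by (rule Phi_B[OF contH[OF ts(2)]])
            finally show ?thesis .
          qed
          ultimately show ?thesis by (simp add: inner_diff_left inner_diff_right sym)
        qed
        moreover have "at t within {0..s} = at t" using t by (intro at_within_interior) auto
        ultimately show ?thesis by (simp add: has_real_derivative_iff_has_vector_derivative)
      qed
      hence "phi s = phi 0" using DERIV_isconst2[OF s contphi, of s] s by auto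
      moreover have "phi s = inner (B (B (u s))) y"
      proof -
        have F_s: "F s b = b * b" for b by (simp add: F_def heat_symbol_def)
        have "Phi (F s) y = B (B y)" unfolding F_s[abs_def] using Phi_B[of "%t. t" y] by (simp add: Phi_id)
        thus ?thesis by (simp add: phi_def sym)
      qed
      moreover have "phi 0 = inner (B (B (Phi (heat_symbol s) v))) y"
      proof -
        let ?h = "heat_symbol s"
        note ch = continuous_heat_symbol[OF s]
        have "F 0 = (%b. b * (b * ?h b))" by (rule ext) (simp add: F_def)
        hence "Phi (F 0) y = B (Phi (%b. b * ?h b) y)"
          using ch by (simp only:) (rule Phi_B, intro continuous_intros)
        also have "... = B (B (Phi ?h y))" by (simp only: Phi_B[OF ch])
        finally have "phi 0 = inner v (B (B (Phi ?h y)))" by (simp only: phi_def u0)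
        also have "... = inner (Phi ?h (B (B v))) y" by (simp only: sym[symmetric] Phi_sym[OF ch])
        also have "... = inner (B (B (Phi ?h v))) y" by (simp only: Phi_commute_B[OF ch]) finally show ?thesis .
      qed
      ultimately show ?thesis by (simp add: linear_diff[OF lin] inner_diff_left)
    qed
    from this[of "B (B (u s - Phi (heat_symbol s) v))"] show ?thesis by simp
  qed
  from B_injective[OF B_injective[OF this]] have "u s - Phi (heat_symbol s) v = 0" .
  thus ?thesis by simp
qed

end

text \<open>The scalar scheme for the eigenvalue \<open>1 - 1 / b\<close> of \<open>A\<close>,
  multiplied by \<open>b\<close> and solved for the newest value. In this form \<open>b = 0\<close>
  is no exception, and the symbol is continuous on all of \<open>[0, 1]\<close>.\<close>

fun scheme_symbol :: "(nat => real) => (nat => real) => real => real => nat => real => real" where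
  "scheme_symbol w c \<beta> \<tau> 0 b = 0"
| "scheme_symbol w c \<beta> \<tau> (Suc n) b =
     - (b * (\<Sum>j\<in>{1..Suc n}. w j * scheme_symbol w c \<beta> \<tau> (Suc n - j) b)
        + \<tau> * (1 - b) * ((1 - \<beta>) * scheme_symbol w c \<beta> \<tau> n b + c (Suc n))) / (b * w 0 + \<tau> * (1 - b) * \<beta>)"

lemma scheme_symbol_denominator:
  fixes b :: real
  assumes "0 < w" "0 < \<tau>" "0 < \<beta>" "b \<in> {0..1}"
  shows "0 < b * w + \<tau> * (1 - b) * \<beta>"
proof (cases "b = 0")
  case False
  thus ?thesis using assms by (intro add_pos_nonneg mult_pos_pos mult_nonneg_nonneg) auto
qed (use assms in auto)

lemma continuous_scheme_symbol:
  assumes "0 < w 0" "0 < \<tau>" "0 < \<beta>"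
  shows "continuous_on {0..1} (scheme_symbol w c \<beta> \<tau> n)"
proof (induction n rule: less_induct)
  case (less n)
  show ?case
  proof (cases n)
    case 0
    have "scheme_symbol w c \<beta> \<tau> n = (%b. 0)" by (rule ext) (simp add: 0)
    thus ?thesis by simp
  next
    case (Suc k)
    have "scheme_symbol w c \<beta> \<tau> n = (%b. - (b * (\<Sum>j\<in>{1..Suc k}. w j * scheme_symbol w c \<beta> \<tau> (Suc k - j) b)
        + \<tau> * (1 - b) * ((1 - \<beta>) * scheme_symbol w c \<beta> \<tau> k b + c (Suc k))) / (b * w 0 + \<tau> * (1 - b) * \<beta>))"
      unfolding Suc by (rule ext) simp
    moreover have "continuous_on {0..1} ..."
      using less.IH Suc scheme_symbol_denominator[OF assms] by (intro continuous_intros) (auto simp: less_imp_neq[symmetric])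
    ultimately show ?thesis by (simp only:)
  qed
qed

lemma scheme_symbol_recursion:
  fixes b :: real
  assumes "0 < w 0" "0 < \<tau>" "0 < \<beta>" "b \<in> {0..1}" "1 <= i"
  shows "b * (\<Sum>j=0..i. w j * scheme_symbol w c \<beta> \<tau> (i - j) b)
    + \<tau> * (1 - b) * (\<beta> * scheme_symbol w c \<beta> \<tau> i b + (1 - \<beta>) * scheme_symbol w c \<beta> \<tau> (i - 1) b) = - (\<tau> * (1 - b)) * c i"
proof -
  obtain k where i: "i = Suc k" using assms(5) by (cases i) auto
  let ?f = "%n. scheme_symbol w c \<beta> \<tau> n b"
  let ?r = "b * (\<Sum>j=1..i. w j * ?f (i - j)) + \<tau> * (1 - b) * ((1 - \<beta>) * ?f (i - 1) + c i)"
  have "(b * w 0 + \<tau> * (1 - b) * \<beta>) * ?f i = - ?r"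
    using scheme_symbol_denominator[OF assms(1-4)] unfolding i by (simp del: sum.cl_ivl_Suc)
  moreover have "(\<Sum>j=0..i. w j * ?f (i - j)) = w 0 * ?f i + (\<Sum>j=1..i. w j * ?f (i - j))"
    by (subst sum.atLeast_Suc_atMost) auto
  ultimately show ?thesis by (simp only:) algebra
qed

text \<open>Applying \<open>B\<close> to the weak equation expresses the denominator, taken as a
  function of \<open>B\<close>, applied to \<open>V i\<close> through earlier values. The
  denominator is positive on \<open>[0, 1]\<close>, so the functional calculus inverts it.\<close>

lemma (in dissipative_graph) scheme_representation:
  assumes w: "0 < w 0" "0 < \<tau>" "0 < \<beta>" and V0: "V 0 = 0"
    and V: "!!i x a. 1 <= i ==> i <= n ==> (x, a) \<in> G ==>
      inner (\<Sum>j=0..i. w j *\<^sub>R V (i - j)) x = inner (\<tau> *\<^sub>R (\<beta> *\<^sub>R V i + (1 - \<beta>) *\<^sub>R V (i - 1) + c i *\<^sub>R v)) a"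
    and "i <= n"
  shows "V i = Phi (scheme_symbol w c \<beta> \<tau> i) v" using assms(6)
proof (induction i rule: less_induct)
  case (less i)
  let ?f = "%n. scheme_symbol w c \<beta> \<tau> n"
  note cf = continuous_scheme_symbol[of w \<tau> \<beta> c, OF w]
  show ?case
  proof (cases "i = 0")
    case True
    have "?f 0 = (%b. 0)" by (rule ext) simp
    thus ?thesis using True V0 Phi_const[of 0 v] by simp
  next
    case False
    hence i: "1 <= i" by simp
    let ?den = "%b. b * w 0 + \<tau> * (1 - b) * \<beta>"
    have cden: "continuous_on {0..1} ?den" "continuous_on {0..1} (%b. 1 / ?den b)"
      using scheme_symbol_denominator[OF w] by (auto intro!: continuous_intros simp: less_imp_neq[symmetric])
    have Phi_den: "Phi ?den y = w 0 *\<^sub>R B y + (\<tau> * \<beta>) *\<^sub>R (y - B y)" for y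
    proof -
      have "?den = poly [:\<tau> * \<beta>, w 0 - \<tau> * \<beta>:]" by (rule ext) (simp add: algebra_simps)
      thus ?thesis using linear_0[OF lin] by (simp only: Phi_poly) (simp add: linear_scale[OF lin] linear_diff[OF lin] algebra_simps)
    qed
    define p q where "p = (\<Sum>j=0..i. w j *\<^sub>R V (i - j))"
      and "q = \<tau> *\<^sub>R (\<beta> *\<^sub>R V i + (1 - \<beta>) *\<^sub>R V (i - 1) + c i *\<^sub>R v)"
    have Bp: "B p = B q - q" by (rule weak_equation) (use V[OF i less.prems] in \<open>simp add: p_def q_def\<close>)
    define S where "S = (\<Sum>j=1..i. w j *\<^sub>R V (i - j))"
    define r where "r = (1 - \<beta>) *\<^sub>R V (i - 1) + c i *\<^sub>R v"
    have p: "p = w 0 *\<^sub>R V i + S" unfolding p_def S_def by (subst sum.atLeast_Suc_atMost) auto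
    have q: "q = (\<tau> * \<beta>) *\<^sub>R V i + \<tau> *\<^sub>R r" unfolding q_def r_def by (simp add: scaleR_add_right add.assoc)
    have "Phi ?den (V i) = - (B S + \<tau> *\<^sub>R (r - B r))"
      using Bp unfolding p q Phi_den by (simp add: linear_add[OF lin] linear_scale[OF lin] algebra_simps)
    moreover have "Phi ?den (Phi (?f i) v) = - (B S + \<tau> *\<^sub>R (r - B r))"
    proof -
      let ?s = "%b. \<Sum>j=1..i. w j * ?f (i - j) b"
      let ?r = "%b. (1 - \<beta>) * ?f (i - 1) b + c i"
      have cs: "continuous_on {0..1} ?s" "continuous_on {0..1} ?r" by (intro continuous_intros cf)+
      have S: "Phi ?s v = S"
      proof -
        have "Phi ?s v = (\<Sum>j=1..i. Phi (%b. w j * ?f (i - j) b) v)" by (intro Phi_sum continuous_intros cf)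
        also have "... = S" unfolding S_def
        proof (rule sum.cong[OF refl])
          fix j assume "j \<in> {1..i}"
          hence "V (i - j) = Phi (?f (i - j)) v" using less i by auto
          thus "Phi (%b. w j * ?f (i - j) b) v = w j *\<^sub>R V (i - j)" by (simp add: Phi_scale cf)
        qed finally show ?thesis .
      qed
      have r: "Phi ?r v = r"
      proof -
        have "V (i - 1) = Phi (?f (i - 1)) v" using less i by auto
        thus ?thesis unfolding r_def
          by (subst Phi_add) (auto intro!: continuous_intros cf simp: Phi_const Phi_scale[OF cf])
      qed
      have "Phi ?den (Phi (?f i) v) = Phi (%b. ?den b * ?f i b) v"
        by (rule Phi_mult[symmetric]) (intro cden cf)+
      also have "... = Phi (%b. (-1) * (b * ?s b + \<tau> * (?r b - b * ?r b))) v"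
      proof (rule Phi_cong)
        show "continuous_on {0..1} (%b. ?den b * ?f i b)" by (intro continuous_on_mult cden cf)
        fix b :: real assume b: "b \<in> {0..1}"
        obtain k where k: "i = Suc k" using i by (cases i) auto
        have "?den b * ?f i b = - (b * ?s b + \<tau> * (1 - b) * ?r b)"
          using scheme_symbol_denominator[OF w b] unfolding k by (simp del: sum.cl_ivl_Suc)
        thus "?den b * ?f i b = (-1) * (b * ?s b + \<tau> * (?r b - b * ?r b))" by (simp add: algebra_simps)
      qed
      also have "... = (-1) *\<^sub>R Phi (%b. b * ?s b + \<tau> * (?r b - b * ?r b)) v"
        by (rule Phi_scale) (intro continuous_intros cs)
      also have "Phi (%b. b * ?s b + \<tau> * (?r b - b * ?r b)) v = Phi (%b. b * ?s b) v + Phi (%b. \<tau> * (?r b - b * ?r b)) v"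
        by (rule Phi_add) (intro continuous_intros cs)+
      also have "Phi (%b. \<tau> * (?r b - b * ?r b)) v = \<tau> *\<^sub>R Phi (%b. ?r b - b * ?r b) v"
        by (rule Phi_scale) (intro continuous_intros cs)
      also have "Phi (%b. ?r b - b * ?r b) v = Phi ?r v - Phi (%b. b * ?r b) v"
        by (rule Phi_diff) (intro continuous_intros cs)+
      also have "Phi (%b. b * ?r b) v = B (Phi ?r v)" by (rule Phi_B[OF cs(2)])
      also have "Phi (%b. b * ?s b) v = B (Phi ?s v)" by (rule Phi_B[OF cs(1)])
      finally show ?thesis unfolding S r by simp
    qed
    ultimately have eq: "Phi ?den (V i) = Phi ?den (Phi (?f i) v)" by simp
    have inv: "Phi (%b. 1 / ?den b) (Phi ?den y) = y" for y
    proof -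
      have "Phi (%b. 1 / ?den b) (Phi ?den y) = Phi (%b. 1 / ?den b * ?den b) y"
        by (rule Phi_mult[symmetric]) (intro cden)+
      also have "... = Phi (%b. 1) y"
      proof (rule Phi_cong)
        show "continuous_on {0..1} (%b. 1 / ?den b * ?den b)" by (intro continuous_on_mult cden)
        show "1 / ?den b * ?den b = 1" if "b \<in> {0..1}" for b using scheme_symbol_denominator[OF w that] by simp
      qed finally show ?thesis by (simp add: Phi_const)
    qed
    show ?thesis using arg_cong[OF eq, of "Phi (%b. 1 / ?den b)"] unfolding inv .
  qed
qed

text \<open>The error is a single continuous function of \<open>B\<close> applied to
  \<open>v\<close>. The scalar bound covers \<open>0 < b < 1\<close>; the endpoints, which stand for
  an infinite eigenvalue and for the eigenvalue 0, follow by continuity.\<close>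

theorem (in dissipative_graph) scheme_error:
  assumes w: "0 < w 0" "0 < \<tau>" "0 < \<beta>" and n: "1 <= n"
    and scalar: "!!z W. 0 < z ==> W 0 = 0 ==>
      (!!i. 1 <= i ==> i <= n ==>
        (\<Sum>j=0..i. w j * W (i - j)) + z * (\<beta> * W i + (1 - \<beta>) * W (i - 1)) = - z * c i) ==>
      \<bar>exp (- z * real n) - 1 - W n\<bar> <= M"
    and cont: "continuous_on {0..real n * \<tau>} u" and u0: "u 0 = v"
    and deriv: "!!t. 0 < t ==> t < real n * \<tau> ==> \<exists>D. (u has_vector_derivative D) (at t within {0..real n * \<tau>}) \<and>
        (\<forall>x a. (x, a) \<in> G --> inner D x = inner (u t) a)" and V0: "V 0 = 0"
    and V: "!!i x a. 1 <= i ==> i <= n ==> (x, a) \<in> G ==>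
      inner (\<Sum>j=0..i. w j *\<^sub>R V (i - j)) x = inner (\<tau> *\<^sub>R (\<beta> *\<^sub>R V i + (1 - \<beta>) *\<^sub>R V (i - 1) + c i *\<^sub>R v)) a"
  shows "norm (u (real n * \<tau>) - v - V n) <= M * norm v"
proof -
  let ?s = "real n * \<tau>" and ?f = "scheme_symbol w c \<beta> \<tau> n"
  have s: "0 < ?s" using n w by simp
  note ch = continuous_heat_symbol[OF s] and cf = continuous_scheme_symbol[of w \<tau> \<beta> c n, OF w]
  let ?e = "%b. heat_symbol ?s b - 1 - ?f b"
  have ce: "continuous_on {0..1} ?e" by (intro continuous_intros ch cf)
  have "u ?s - v - V n = Phi (heat_symbol ?s) v - v - Phi ?f v"
    using evolution_representation[OF s cont u0 deriv] scheme_representation[OF w V0 V, of n n] by simp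
  also have "... = Phi ?e v" by (subst Phi_diff | intro continuous_intros ch cf | simp add: Phi_const)+
  finally have "norm (u ?s - v - V n) = norm (Phi ?e v)" by simp
  also have "... <= M * norm v"
  proof (rule Phi_bound[OF ce])
    have inner: "\<bar>?e b\<bar> <= M" if "b \<in> {0<..<1}" for b
    proof -
      \<comment> \<open>The eigenvalue \<open>1 / b - 1\<close> of \<open>- A\<close> times
        \<tau>.\<close>
      define z where "z = \<tau> * (1 - b) / b"
      have z: "0 < z" "b * z = \<tau> * (1 - b)" using that w by (auto simp: z_def)
      have "\<bar>exp (- z * real n) - 1 - ?f b\<bar> <= M"
      proof (rule scalar[OF z(1)])
        fix i assume "1 <= i" "i <= n"
        let ?g = "%i. scheme_symbol w c \<beta> \<tau> i b"
        have bi: "b \<in> {0..1}" using that by auto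
        have "b * ((\<Sum>j=0..i. w j * ?g (i - j)) + z * (\<beta> * ?g i + (1 - \<beta>) * ?g (i - 1)))
          = b * (\<Sum>j=0..i. w j * ?g (i - j)) + (b * z) * (\<beta> * ?g i + (1 - \<beta>) * ?g (i - 1))"
          by (simp only: distrib_left mult.assoc)
        also have "... = - (b * z) * c i"
          unfolding z(2) by (rule scheme_symbol_recursion[of w, OF w bi \<open>1 <= i\<close>])
        also have "... = b * (- z * c i)" by simp
        finally show "(\<Sum>j=0..i. w j * ?g (i - j)) + z * (\<beta> * ?g i + (1 - \<beta>) * ?g (i - 1)) = - z * c i"
          using that by (simp only: mult_cancel_left greaterThanLessThan_iff) auto
      qed simp
      moreover have "heat_symbol ?s b = exp (- z * real n)" using that by (simp add: heat_symbol_def z_def field_simps)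
      ultimately show ?thesis by simp
    qed
    fix b :: real assume b: "b \<in> {0..1}"
    have "b \<in> closure {0<..<1::real}" using b by (simp add: closure_greaterThanLessThan)
    moreover have "closure {0<..<1::real} = {0..1}" by (simp add: closure_greaterThanLessThan)
    ultimately show "\<bar>?e b\<bar> <= M"
      using continuous_on_closure_norm_le[of "{0<..<1}" ?e M b] ce inner by auto
  qed finally show ?thesis .
qed

section \<open>The Hilbert space of square-integrable functions\<close>

text \<open>Functions live on the whole space, so that translations are isometries; functions on
  \<Omega> are those that vanish outside. The general target type admits gradients in the same
  construction.\<close>

definition sq_int :: "('a::euclidean_space => 'b::euclidean_space) => bool" where
  "sq_int f \<longleftrightarrow> f \<in> borel_measurable borel \<and> integrable lborel (%x. (norm (f x))\<^sup>2)"

lemma sq_int_measurable [measurable_dest]: "sq_int f ==> f \<in> borel_measurable borel"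
  by (simp add: sq_int_def)

lemma sq_int_bound:
  assumes "sq_int f" "g \<in> borel_measurable borel" "AE x in lborel. norm (g x) <= C * norm (f x)"
  shows "sq_int g" unfolding sq_int_def
proof
  show "integrable lborel (%x. (norm (g x))\<^sup>2)"
  proof (rule Bochner_Integration.integrable_bound)
    show "integrable lborel (%x. C\<^sup>2 * (norm (f x))\<^sup>2)" using assms(1) by (simp add: sq_int_def)
    show "AE x in lborel. norm ((norm (g x))\<^sup>2) <= norm (C\<^sup>2 * (norm (f x))\<^sup>2)" using assms(3)
    proof eventually_elim
      case (elim x)
      hence "(norm (g x))\<^sup>2 <= (C * norm (f x))\<^sup>2" by (intro power_mono) auto
      thus ?case by (simp add: power_mult_distrib)
    qed
  qed (use assms(2) in measurable)
qed (fact assms(2))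

lemma sq_int_add: "sq_int f ==> sq_int g ==> sq_int (%x. f x + g x)"
  unfolding sq_int_def
proof (elim conjE, intro conjI)
  assume f: "f \<in> borel_measurable borel" "integrable lborel (%x. (norm (f x))\<^sup>2)"
    and g: "g \<in> borel_measurable borel" "integrable lborel (%x. (norm (g x))\<^sup>2)"
  show "integrable lborel (%x. (norm (f x + g x))\<^sup>2)"
  proof (rule Bochner_Integration.integrable_bound)
    show "integrable lborel (%x. 2 * (norm (f x))\<^sup>2 + 2 * (norm (g x))\<^sup>2)" using f g by simp
    have "(norm (f x + g x))\<^sup>2 <= 2 * (norm (f x))\<^sup>2 + 2 * (norm (g x))\<^sup>2" for x
    proof -
      have "(norm (f x + g x))\<^sup>2 <= (norm (f x) + norm (g x))\<^sup>2" by (intro power_mono norm_triangle_ineq) auto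
      moreover have "0 <= (norm (f x) - norm (g x))\<^sup>2" by simp
      ultimately show ?thesis by (simp add: power2_sum power2_diff)
    qed
    thus "AE x in lborel. norm ((norm (f x + g x))\<^sup>2) <= norm (2 * (norm (f x))\<^sup>2 + 2 * (norm (g x))\<^sup>2)" by simp
  qed (use f g in measurable)
qed auto

lemma sq_int_scaleR: "sq_int f ==> sq_int (%x. c *\<^sub>R f x)"
  by (rule sq_int_bound[where f = f and C = "\<bar>c\<bar>"]) auto

lemma sq_int_0: "sq_int (%x. 0)" by (simp add: sq_int_def)

lemma sq_int_uminus: "sq_int f ==> sq_int (%x. - f x)" using sq_int_scaleR[of f "-1"] by simp

lemma sq_int_diff: "sq_int f ==> sq_int g ==> sq_int (%x. f x - g x)"
  using sq_int_add[of f "%x. (-1) *\<^sub>R g x"] sq_int_scaleR[of g "-1"] by simp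

lemma sq_int_inner: "sq_int f ==> sq_int g ==> integrable lborel (%x. inner (f x) (g x))"
proof (rule Bochner_Integration.integrable_bound)
  assume f: "sq_int f" and g: "sq_int g"
  thus "integrable lborel (%x. (norm (f x))\<^sup>2 + (norm (g x))\<^sup>2)" by (simp add: sq_int_def)
  show "(%x. inner (f x) (g x)) \<in> borel_measurable lborel" using f g by (auto simp: sq_int_def)
  have "\<bar>inner (f x) (g x)\<bar> <= (norm (f x))\<^sup>2 + (norm (g x))\<^sup>2" for x
  proof -
    have "\<bar>inner (f x) (g x)\<bar> <= norm (f x) * norm (g x)" by (rule Cauchy_Schwarz_ineq2)
    moreover have "0 <= (norm (f x) - norm (g x))\<^sup>2" "0 <= (norm (f x))\<^sup>2" "0 <= (norm (g x))\<^sup>2" by auto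
    ultimately show ?thesis unfolding power2_diff by linarith
  qed
  thus "AE x in lborel. norm (inner (f x) (g x)) <= norm ((norm (f x))\<^sup>2 + (norm (g x))\<^sup>2)" by simp
qed

definition l2_rel :: "('a::euclidean_space => 'b::euclidean_space) => ('a => 'b) => bool" where
  "l2_rel f g \<longleftrightarrow> sq_int f \<and> sq_int g \<and> (AE x in lborel. f x = g x)"

lemma l2_rel_sym: "l2_rel f g ==> l2_rel g f" unfolding l2_rel_def by (auto elim: eventually_mono)

lemma l2_rel_trans: "l2_rel f g ==> l2_rel g h ==> l2_rel f h"
  unfolding l2_rel_def by (auto elim: eventually_elim2)

lemma l2_rel_refl: "l2_rel f f \<longleftrightarrow> sq_int f" by (simp add: l2_rel_def)

\<comment> \<open>The relation is reflexive on square-integrable functions only, hence a partial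
  quotient.\<close>
quotient_type (overloaded) ('a, 'b) l2 = "'a::euclidean_space => 'b::euclidean_space" / partial: l2_rel
proof (rule part_equivpI)
  show "\<exists>x. l2_rel x x" using sq_int_0 l2_rel_refl by blast
  show "symp l2_rel" by (rule sympI) (rule l2_rel_sym)
  show "transp l2_rel" by (rule transpI) (rule l2_rel_trans)
qed

abbreviation cls :: "('a::euclidean_space => 'b::euclidean_space) => ('a, 'b) l2" where "cls \<equiv> abs_l2"

definition repr :: "('a::euclidean_space, 'b::euclidean_space) l2 => 'a => 'b" where
  "repr x = rep_l2 x"

lemma repr: "sq_int (repr x)" "cls (repr x) = x"
  using Quotient3_rep_reflp[OF Quotient3_l2, of x] Quotient3_abs_rep[OF Quotient3_l2, of x]
  by (simp_all add: repr_def l2_rel_refl)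

lemma cls_eq_iff: "sq_int f ==> sq_int g ==> cls f = cls g \<longleftrightarrow> (AE x in lborel. f x = g x)"
  using Quotient3_rel[OF Quotient3_l2, of f g] by (simp add: l2_rel_def)

lemma repr_cls: "sq_int f ==> AE x in lborel. repr (cls f) x = f x"
  using repr[of "cls f"] cls_eq_iff by blast

lemma cls_cong2:
  assumes "sq_int f" "sq_int g" "sq_int (%x. h (repr (cls f) x) (repr (cls g) x))" "sq_int (%x. h (f x) (g x))"
  shows "cls (%x. h (repr (cls f) x) (repr (cls g) x)) = cls (%x. h (f x) (g x))"
proof -
  have "AE x in lborel. h (repr (cls f) x) (repr (cls g) x) = h (f x) (g x)"
    using repr_cls[OF assms(1)] repr_cls[OF assms(2)] by eventually_elim simp
  thus ?thesis using assms by (simp add: cls_eq_iff)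
qed

instantiation l2 :: (euclidean_space, euclidean_space) "{zero, plus, minus, uminus, scaleR, inverse}"
begin
definition zero_l2 :: "('a, 'b) l2" where "zero_l2 = cls (%x. 0)"
definition plus_l2 :: "('a, 'b) l2 => ('a, 'b) l2 => ('a, 'b) l2" where
  "plus_l2 x y = cls (%t. repr x t + repr y t)"
definition minus_l2 :: "('a, 'b) l2 => ('a, 'b) l2 => ('a, 'b) l2" where
  "minus_l2 x y = cls (%t. repr x t - repr y t)"
definition scaleR_l2 :: "real => ('a, 'b) l2 => ('a, 'b) l2" where
  "scaleR_l2 c x = cls (%t. c *\<^sub>R repr x t)"
definition uminus_l2 :: "('a, 'b) l2 => ('a, 'b) l2" where "uminus_l2 x = (-1) *\<^sub>R x"
instance ..
end

lemma cls_add: "sq_int f ==> sq_int g ==> cls (%x. f x + g x) = cls f + cls g"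
  unfolding plus_l2_def by (rule cls_cong2[where h = "(+)", symmetric]) (auto intro: sq_int_add repr)

lemma cls_diff: "sq_int f ==> sq_int g ==> cls (%x. f x - g x) = cls f - cls g"
  unfolding minus_l2_def by (rule cls_cong2[where h = "(-)", symmetric]) (auto intro: sq_int_diff repr)

lemma cls_scaleR: "sq_int f ==> cls (%x. c *\<^sub>R f x) = c *\<^sub>R cls f"
  unfolding scaleR_l2_def
  by (rule cls_cong2[where h = "%u v. c *\<^sub>R u" and g = f, symmetric]) (auto intro: sq_int_scaleR repr)

lemma cls_0: "cls (%x. 0) = 0" by (simp add: zero_l2_def)

lemma l2_cases: obtains f where "sq_int f" "x = cls f" using repr[of x] by metis

instantiation l2 :: (euclidean_space, euclidean_space) real_inner
begin

definition inner_l2 :: "('a, 'b) l2 => ('a, 'b) l2 => real" where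
  "inner_l2 x y = (LINT t|lborel. inner (repr x t) (repr y t))"
definition norm_l2 :: "('a, 'b) l2 => real" where "norm_l2 x = sqrt (inner x x)"
definition sgn_l2 :: "('a, 'b) l2 => ('a, 'b) l2" where "sgn_l2 x = x /\<^sub>R norm x"
definition dist_l2 :: "('a, 'b) l2 => ('a, 'b) l2 => real" where "dist_l2 x y = norm (x - y)"
definition uniformity_l2 :: "(('a, 'b) l2 \<times> ('a, 'b) l2) filter" where
  "uniformity_l2 = (INF e\<in>{0<..}. principal {(x, y). dist x y < e})"
definition open_l2 :: "('a, 'b) l2 set => bool" where
  "open_l2 U \<longleftrightarrow> (\<forall>x\<in>U. eventually (%(x', y). x' = x --> y \<in> U) uniformity)"

lemma inner_cls: "sq_int f ==> sq_int g ==> inner (cls f) (cls g) = (LINT x|lborel. inner (f x) (g x))"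
proof -
  assume f: "sq_int f" and g: "sq_int g"
  have "AE x in lborel. inner (repr (cls f) x) (repr (cls g) x) = inner (f x) (g x)"
    using repr_cls[OF f] repr_cls[OF g] by eventually_elim simp
  thus ?thesis unfolding inner_l2_def
    using sq_int_measurable[OF f] sq_int_measurable[OF g] sq_int_measurable[OF repr(1)[of "cls f"]]
      sq_int_measurable[OF repr(1)[of "cls g"]] by (intro integral_cong_AE) auto
qed

instance
proof
  fix x y z :: "('a, 'b) l2" and a b r :: real
  obtain f where f: "sq_int f" "x = cls f" by (rule l2_cases)
  obtain g where g: "sq_int g" "y = cls g" by (rule l2_cases)
  obtain h where h: "sq_int h" "z = cls h" by (rule l2_cases)
  note defs = f(2) g(2) h(2) cls_0[symmetric] cls_add[symmetric] cls_diff[symmetric] cls_scaleR[symmetric]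
    sq_int_add sq_int_diff sq_int_scaleR sq_int_0 f(1) g(1) h(1) uminus_l2_def
  show "x + y + z = x + (y + z)" by (simp add: defs add.assoc)
  show "x + y = y + x" by (simp add: defs add.commute)
  show "0 + x = x" by (simp add: defs)
  show "- x + x = 0" by (simp add: defs sq_int_uminus)
  show "x - y = x + - y" by (simp add: defs sq_int_uminus)
  show "a *\<^sub>R (x + y) = a *\<^sub>R x + a *\<^sub>R y" by (simp add: defs scaleR_add_right)
  show "(a + b) *\<^sub>R x = a *\<^sub>R x + b *\<^sub>R x" by (simp add: defs scaleR_add_left)
  show "a *\<^sub>R b *\<^sub>R x = (a * b) *\<^sub>R x" by (simp add: defs)
  show "1 *\<^sub>R x = x" by (simp add: defs)
  show "dist x y = norm (x - y)" by (simp add: dist_l2_def)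
  show "sgn x = x /\<^sub>R norm x" by (simp add: sgn_l2_def)
  show "(uniformity :: (('a, 'b) l2 \<times> ('a, 'b) l2) filter) = (INF e\<in>{0<..}. principal {(x, y). dist x y < e})"
    by (rule uniformity_l2_def)
  show "open U = (\<forall>x\<in>U. \<forall>\<^sub>F (x', y) in uniformity. x' = x --> y \<in> U)" for U :: "('a, 'b) l2 set"
    by (rule open_l2_def)
  show "inner x y = inner y x" by (simp add: inner_l2_def inner_commute)
  show "inner (x + y) z = inner x z + inner y z" unfolding f(2) g(2) h(2) cls_add[OF f(1) g(1), symmetric]
    by (simp add: inner_cls f g h sq_int_add inner_add_left sq_int_inner)
  show "inner (r *\<^sub>R x) y = r * inner x y"
    unfolding f(2) g(2) cls_scaleR[OF f(1), symmetric] by (simp add: inner_cls f g sq_int_scaleR)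
  show "0 <= inner x x" unfolding inner_l2_def by (simp add: integral_nonneg)
  show "norm x = sqrt (inner x x)" by (simp add: norm_l2_def)
  have "(LINT x|lborel. inner (f x) (f x)) = 0 \<longleftrightarrow> (AE x in lborel. inner (f x) (f x) = 0)"
    by (rule integral_nonneg_eq_0_iff_AE) (use sq_int_inner[OF f(1) f(1)] in auto)
  thus "inner x x = 0 \<longleftrightarrow> x = 0"
    unfolding f(2) cls_0[symmetric] by (simp add: inner_cls cls_eq_iff f sq_int_0)
qed

end

lemma norm_cls: "sq_int f ==> (norm (cls f))\<^sup>2 = (LINT x|lborel. (norm (f x))\<^sup>2)"
  by (simp add: power2_norm_eq_inner inner_cls)

lemma norm_cls_nn: "sq_int f ==> ennreal ((norm (cls f))\<^sup>2) = (\<integral>\<^sup>+x. ennreal ((norm (f x))\<^sup>2) \<partial>lborel)"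
  by (simp add: norm_cls sq_int_def nn_integral_eq_integral)

text \<open>Along a subsequence with \<open>\<parallel>x\<^sub>k\<^sub>+\<^sub>1 - x\<^sub>k\<parallel>\<^sup>2 \<le> 4\<^sup>-\<^sup>k\<close>, the series \<open>\<Sum> 2\<^sup>k |x\<^sub>k\<^sub>+\<^sub>1 - x\<^sub>k|\<^sup>2\<close> is
  integrable, hence finite almost everywhere, and the subsequence converges pointwise there.\<close>

instance l2 :: (euclidean_space, euclidean_space) complete_space
proof
  fix X :: "nat => ('a, 'b) l2" assume C: "Cauchy X"
  have "\<exists>N. \<forall>m\<ge>N. \<forall>n\<ge>N. norm (X m - X n) < (1/2) ^ k" for k :: nat
    by (rule CauchyD[OF C]) simp
  then obtain N0 where N0: "!!k m n. N0 k <= m ==> N0 k <= n ==> norm (X m - X n) < (1/2) ^ k" by metis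
  \<comment> \<open>Monotone and at least \<open>N0 k\<close>, so it selects a subsequence that
    converges with the prescribed speed.\<close>
  define N where "N k = (\<Sum>i\<le>k. N0 i) + k" for k
  have N: "N0 k <= N k" "k <= N k" "N k <= N (Suc k)" for k
    unfolding N_def using member_le_sum[of k "{..k}" N0] by auto
  have Nmono: "N i <= N j" if "i <= j" for i j using N(3) that lift_Suc_mono_le[of N] by blast
  define f where "f k = repr (X (N k))" for k
  have f: "sq_int (f k)" "cls (f k) = X (N k)" for k unfolding f_def by (rule repr)+
  note [measurable] = sq_int_measurable[OF f(1)]
  have diff: "(\<integral>\<^sup>+x. ennreal ((norm (f j x - f i x))\<^sup>2) \<partial>lborel) = ennreal ((norm (X (N j) - X (N i)))\<^sup>2)" for i j
    using norm_cls_nn[OF sq_int_diff[OF f(1) f(1)], of j i] by (simp add: cls_diff f)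
  define g where "g k x = 2 ^ k * (norm (f (Suc k) x - f k x))\<^sup>2" for k x
  have [measurable]: "g k \<in> borel_measurable borel" for k unfolding g_def by measurable
  have "(\<integral>\<^sup>+x. (\<Sum>k. ennreal (g k x)) \<partial>lborel) = (\<Sum>k. \<integral>\<^sup>+x. ennreal (g k x) \<partial>lborel)"
    by (rule nn_integral_suminf) measurable
  also have "... <= (\<Sum>k. ennreal ((1/2) ^ k))"
  proof (rule suminf_le)
    fix k
    have "(\<integral>\<^sup>+x. ennreal (g k x) \<partial>lborel) = ennreal (2 ^ k) * (\<integral>\<^sup>+x. ennreal ((norm (f (Suc k) x - f k x))\<^sup>2) \<partial>lborel)"
      unfolding g_def by (subst nn_integral_cmult[symmetric]) (auto simp: ennreal_mult)
    also have "... = ennreal (2 ^ k * (norm (X (N (Suc k)) - X (N k)))\<^sup>2)" unfolding diff by (simp add: ennreal_mult)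
    also have "... <= ennreal (2 ^ k * ((1/2) ^ k)\<^sup>2)"
      using N0[of k "N (Suc k)" "N k"] N[of k] by (intro ennreal_leI mult_left_mono power_mono) auto
    also have "2 ^ k * ((1/2) ^ k)\<^sup>2 = (1/2 :: real) ^ k"
      by (simp add: power2_eq_square power_one_over field_simps)
    finally show "(\<integral>\<^sup>+x. ennreal (g k x) \<partial>lborel) <= ennreal ((1/2) ^ k)" .
  qed auto
  also have "... < top" by (subst suminf_ennreal2) auto
  finally have "AE x in lborel. (\<Sum>k. ennreal (g k x)) ~= \<infinity>"
    by (intro nn_integral_noteq_infinite) auto
  hence conv: "AE x in lborel. convergent (%k. f k x)"
  proof eventually_elim
    case (elim x)
    have g0: "0 <= g k x" for k by (simp add: g_def)
    have sg: "summable (%k. g k x)" by (rule summable_suminf_not_top) (use elim g0 in auto)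
    have sh: "summable (%k. (1/2::real) ^ k)" by simp
    have "summable (%k. norm (f (Suc k) x - f k x))"
    proof (rule summable_comparison_test')
      show "summable (%k. g k x + (1/2) ^ k)" by (rule summable_add[OF sg sh])
      fix k :: nat
      let ?h = "norm (f (Suc k) x - f k x)" and ?a = "2 ^ k :: real"
      \<comment> \<open>The inequality of arithmetic and geometric mean:
        \<open>h \<le> 2^k h^2 + 2^-k\<close>, which makes the increments themselves
        summable.\<close>
      have "0 <= (?a * ?h - 1)\<^sup>2" by simp
      hence "2 * (?a * ?h) <= ?a * g k x + 1" by (simp add: g_def power2_eq_square algebra_simps)
      moreover have "0 <= ?a * ?h" by simp
      moreover have "?a * (g k x + (1/2) ^ k) = ?a * g k x + 1" by (simp add: distrib_left power_one_over)
      ultimately have "?a * ?h <= ?a * (g k x + (1/2) ^ k)" by linarith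
      thus "norm ?h <= g k x + (1/2) ^ k" by simp
    qed
    hence "summable (%k. f (Suc k) x - f k x)" by (rule summable_norm_cancel)
    hence "convergent (%n. f n x - f 0 x)" using sum_lessThan_telescope[of "%n. f n x"] by (simp add: summable_iff_convergent)
    from convergent_add[OF this convergent_const[of "f 0 x"]] show ?case by simp
  qed
  define F where "F x = (if convergent (%k. f k x) then lim (%k. f k x) else 0)" for x
  have [measurable]: "F \<in> borel_measurable borel"
  proof -
    have "Measurable.pred borel (%x. Cauchy (%k. f k x))" by measurable
    hence [measurable]: "Measurable.pred borel (%x. convergent (%k. f k x))"
      by (simp add: Cauchy_convergent_iff)
    show ?thesis unfolding F_def[abs_def] by (intro measurable_If borel_measurable_lim_metric) measurable
  qed
  have lim: "AE x in lborel. (%k. f k x) \<longlonglongrightarrow> F x"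
    using conv by eventually_elim (simp add: F_def convergent_LIMSEQ_iff)
  \<comment> \<open>Fatou's lemma, with the first of the two indices tending to infinity.\<close>
  have bound: "(\<integral>\<^sup>+x. ennreal ((norm (F x - f k x))\<^sup>2) \<partial>lborel) <= ennreal (((1/2) ^ k)\<^sup>2)" for k
  proof -
    have "(\<integral>\<^sup>+x. ennreal ((norm (F x - f k x))\<^sup>2) \<partial>lborel)
      = (\<integral>\<^sup>+x. liminf (%j. ennreal ((norm (f j x - f k x))\<^sup>2)) \<partial>lborel)"
    proof (rule nn_integral_cong_AE, use lim in eventually_elim)
      case (elim x)
      have "(%j. ennreal ((norm (f j x - f k x))\<^sup>2)) \<longlonglongrightarrow> ennreal ((norm (F x - f k x))\<^sup>2)"
        by (intro tendsto_intros elim)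
      thus ?case using lim_imp_Liminf[OF sequentially_bot] by metis
    qed
    also have "... <= liminf (%j. \<integral>\<^sup>+x. ennreal ((norm (f j x - f k x))\<^sup>2) \<partial>lborel)"
      by (rule nn_integral_liminf) measurable
    also have "... <= ennreal (((1/2) ^ k)\<^sup>2)" unfolding diff
    proof (rule Liminf_le)
      show "eventually (%j. ennreal ((norm (X (N j) - X (N k)))\<^sup>2) <= ennreal (((1/2) ^ k)\<^sup>2)) sequentially"
        using eventually_ge_at_top[of k]
      proof eventually_elim
        case (elim j)
        thus ?case using N0[of k "N j" "N k"] N(1)[of k] Nmono[OF elim] by (intro ennreal_leI power_mono) auto
      qed
    qed simp finally show ?thesis .
  qed
  have "sq_int (%x. F x - f 0 x)" unfolding sq_int_def using bound[of 0]
    by (auto simp: integrable_iff_bounded intro: le_less_trans)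
  from sq_int_add[OF this f(1)[of 0]] have F: "sq_int F" by simp
  have "norm (cls F - X (N k)) <= (1/2) ^ k" for k
  proof -
    have "ennreal ((norm (cls F - X (N k)))\<^sup>2) <= ennreal (((1/2) ^ k)\<^sup>2)"
      using bound[of k] norm_cls_nn[OF sq_int_diff[OF F f(1)[of k]]] by (simp add: cls_diff F f)
    hence "(norm (cls F - X (N k)))\<^sup>2 <= ((1/2) ^ k)\<^sup>2" by (subst (asm) ennreal_le_iff) auto
    thus ?thesis by (rule power2_le_imp_le) simp
  qed
  hence le: "norm (X n - cls F) <= 2 * (1/2) ^ k" if "N k <= n" for n k
    using N0[of k n "N k"] N(1)[of k] that norm_triangle_ineq[of "X n - X (N k)" "X (N k) - cls F"]
    by (simp add: norm_minus_commute) (smt (verit, ccfv_threshold) norm_minus_commute)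
  have "X \<longlonglongrightarrow> cls F"
  proof (rule LIMSEQ_I)
    fix e :: real assume "0 < e"
    then obtain k where "(1/2 :: real) ^ k < e / 2" using real_arch_pow_inv[of "e / 2" "1/2"] by auto
    hence "\<forall>n\<ge>N k. norm (X n - cls F) < e" using le[of k] by (smt (verit) field_sum_of_halves)
    thus "\<exists>no. \<forall>n\<ge>no. norm (X n - cls F) < e" by blast
  qed
  thus "convergent X" by (auto simp: convergent_def)
qed

section \<open>Smooth functions and test functions\<close>

lemma partialI: "(f has_derivative f') (at x) ==> partial a f x = f' a"
  unfolding partial_def by (metis frechet_derivative_at)

lemma partial_has_derivative: "f differentiable_on UNIV ==> (f has_derivative (%a. partial a f x)) (at x)"
  unfolding partial_def by (simp add: differentiable_on_def frechet_derivative_works[symmetric])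

lemma differentiable_onI_real: "(!!x. (f has_derivative f' x) (at x)) ==> f differentiable_on UNIV"
  unfolding differentiable_on_def differentiable_def by auto

lemma partial_eq_sum:
  assumes "f differentiable_on UNIV"
  shows "partial a f x = (\<Sum>i\<in>Basis. inner a i * partial i f x)"
proof -
  have l: "linear (%a. partial a f x)" using partial_has_derivative[OF assms] has_derivative_linear by blast
  have "partial a f x = partial (\<Sum>i\<in>Basis. inner a i *\<^sub>R i) f x" by (simp add: euclidean_representation)
  also have "... = (\<Sum>i\<in>Basis. inner a i * partial i f x)"
    using linear_sum[OF l, of "%i. inner a i *\<^sub>R i" Basis] linear_scale[OF l] by simp
  finally show ?thesis .
qed

lemma C_diff_lower: "C_diff (Suc n) f ==> C_diff n f"
proof (induction n arbitrary: f)
  case 0 thus ?case by (simp add: differentiable_imp_continuous_on)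
next
  case (Suc n)
  thus ?case by (metis C_diff.simps(2))
qed

lemma C_diff_SucI:
  assumes "!!x. (f has_derivative f' x) (at x)" "!!i. i \<in> Basis ==> C_diff n (%x. f' x i)"
  shows "C_diff (Suc n) f"
proof -
  have "partial i f = (%x. f' x i)" for i using partialI[OF assms(1)] by auto
  thus ?thesis using differentiable_onI_real[OF assms(1)] assms(2) by simp
qed

lemma C_diff_const: "C_diff n (%x. c)"
proof (induction n arbitrary: c)
  case (Suc n)
  show ?case by (rule C_diff_SucI[where f' = "%x a. 0"]) (auto intro: Suc derivative_eq_intros)
qed simp

lemma C_diff_add: "C_diff n f ==> C_diff n g ==> C_diff n (%x. f x + g x)"
proof (induction n arbitrary: f g)
  case 0 thus ?case by (simp add: continuous_on_add)
next
  case (Suc n)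
  show ?case by (rule C_diff_SucI[where f' = "%x a. partial a f x + partial a g x"])
      (use Suc in \<open>auto intro!: has_derivative_add partial_has_derivative\<close>)
qed

lemma C_diff_mult: "C_diff n f ==> C_diff n g ==> C_diff n (%x. f x * g x)"
proof (induction n arbitrary: f g)
  case 0 thus ?case by (simp add: continuous_on_mult)
next
  case (Suc n)
  note l = Suc.prems[THEN C_diff_lower]
  show ?case by (rule C_diff_SucI[where f' = "%x a. f x * partial a g x + partial a f x * g x"])
      (use Suc l in \<open>auto intro!: has_derivative_mult partial_has_derivative C_diff_add\<close>)
qed

lemma C_diff_affine: "C_diff n (%x. c + inner e x)"
proof (cases n)
  case (Suc n)
  show ?thesis unfolding Suc
    by (rule C_diff_SucI[where f' = "%x a. inner e a"]) (auto intro!: C_diff_const derivative_eq_intros)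
qed (auto intro!: continuous_intros)

lemma C_diff_compose: "C_diff n h ==> C_diff n f ==> C_diff n (%x. h (f x :: real))"
proof (induction n arbitrary: h)
  case 0 thus ?case using continuous_on_compose2[of UNIV h UNIV f] by simp
next
  case (Suc n)
  have h: "(h has_real_derivative partial 1 h t) (at t)" for t
  proof -
    have d: "(h has_derivative (%a. partial a h t)) (at t)"
      using partial_has_derivative[of h t] Suc.prems(1) by simp
    hence l: "linear (%a. partial a h t)" by (rule has_derivative_linear)
    have "partial a h t = partial 1 h t * a" for a
    proof -
      have "partial (a *\<^sub>R 1) h t = a *\<^sub>R partial 1 h t" by (rule linear_scale[OF l])
      thus ?thesis by (simp add: mult.commute[of a])
    qed
    hence "(%a. partial a h t) = (*) (partial 1 h t)" by (rule ext)
    thus ?thesis using d unfolding has_field_derivative_def by simp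
  qed
  have df: "f differentiable_on UNIV" using Suc.prems(2) by simp
  show ?case
  proof (rule C_diff_SucI[where f' = "%x a. partial 1 h (f x) * partial a f x"])
    show "((%x. h (f x)) has_derivative (%a. partial 1 h (f x) * partial a f x)) (at x)" for x
      using DERIV_compose_FDERIV[OF h partial_has_derivative[OF df, of x]] by (simp add: mult.commute)
    show "C_diff n (%x. partial 1 h (f x) * partial i f x)" if "i \<in> Basis" for i
      using Suc.prems that by (intro C_diff_mult, intro Suc.IH[where h = "partial 1 h"])
        (auto simp del: C_diff.simps(2) intro: C_diff_lower, auto)
  qed
qed

lemma C_diff_inverse: "C_diff n f ==> (!!x. f x ~= 0) ==> C_diff n (%x. inverse (f x))"
proof (induction n)
  case 0 thus ?case by (auto intro: continuous_on_inverse)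
next
  case (Suc n)
  have df: "f differentiable_on UNIV" using Suc.prems(1) by simp
  show ?case
  proof (rule C_diff_SucI[where f' = "%x a. (- 1) * (inverse (f x) * partial a f x * inverse (f x))"])
    show "((%x. inverse (f x)) has_derivative (%a. (- 1) * (inverse (f x) * partial a f x * inverse (f x)))) (at x)" for x
      using Deriv.has_derivative_inverse[OF Suc.prems(2) partial_has_derivative[OF df, of x]] by simp
    show "C_diff n (%x. (- 1) * (inverse (f x) * partial i f x * inverse (f x)))" if "i \<in> Basis" for i
      using that Suc C_diff_lower[OF Suc.prems(1)] by (intro C_diff_mult C_diff_const) auto
  qed
qed

lemma C_diff_shift: "C_diff n f ==> C_diff n (%x. f (x + c))"
proof (induction n arbitrary: f)
  case 0 thus ?case using continuous_on_compose2[of UNIV f UNIV "%x. x + c"] by (simp add: continuous_intros)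
next
  case (Suc n)
  have "((%x. f (x + c)) has_derivative (%a. partial a f (x + c))) (at x)" for x
    by (rule has_derivative_compose[where f = "%x. x + c" and f' = "%a. a", simplified])
      (use Suc partial_has_derivative in \<open>auto intro!: derivative_eq_intros\<close>)
  thus ?case by (rule C_diff_SucI) (use Suc in auto)
qed

definition smooth :: "('a::euclidean_space => real) => bool" where
  "smooth f \<longleftrightarrow> (\<forall>n. C_diff n f)"

lemma smooth_const: "smooth (%x. c)"
  and smooth_add: "smooth f ==> smooth g ==> smooth (%x. f x + g x)"
  and smooth_mult: "smooth f ==> smooth g ==> smooth (%x. f x * g x)"
  and smooth_affine: "smooth (%x. c + inner e x)"
  and smooth_compose: "smooth h ==> smooth f ==> smooth (%x. h (f x))"
  and smooth_inverse: "smooth f ==> (!!x. f x ~= 0) ==> smooth (%x. inverse (f x))"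
  and smooth_shift: "smooth f ==> smooth (%x. f (x + a))"
  by (simp_all add: smooth_def C_diff_const C_diff_add C_diff_mult C_diff_affine C_diff_compose
      C_diff_inverse C_diff_shift)

lemma smooth_diff: "smooth f ==> smooth g ==> smooth (%x. f x - g x)"
  using smooth_add[of f "%x. (- 1) * g x"] smooth_mult[OF smooth_const, of g "- 1"] by simp

lemma smooth_sum: "(!!j. j \<in> J ==> smooth (f j)) ==> smooth (%x. \<Sum>j\<in>J. f j x)"
  by (induction J rule: infinite_finite_induct) (auto intro: smooth_const smooth_add)

lemma smooth_prod: "(!!j. j \<in> J ==> smooth (f j)) ==> smooth (%x. \<Prod>j\<in>J. f j x)"
  by (induction J rule: infinite_finite_induct) (auto intro: smooth_const smooth_mult)

lemmas smooth_intros = smooth_const smooth_add smooth_diff smooth_mult smooth_affine smooth_inverse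
  smooth_sum smooth_prod

lemma smooth_differentiable: "smooth f ==> f differentiable_on UNIV"
  unfolding smooth_def by (metis C_diff.simps(2))

lemma smooth_continuous: "smooth f ==> continuous_on S f"
  using smooth_differentiable differentiable_imp_continuous_on continuous_on_subset by blast

lemma smooth_partial:
  assumes "smooth f" shows "smooth (partial a f)"
proof -
  have "smooth (partial i f)" if "i \<in> Basis" for i using assms that unfolding smooth_def by (metis C_diff.simps(2))
  hence "smooth (%x. \<Sum>i\<in>Basis. inner a i * partial i f x)"
    by (intro smooth_sum smooth_mult smooth_const)
  moreover have "partial a f = (%x. \<Sum>i\<in>Basis. inner a i * partial i f x)"
    by (rule ext, rule partial_eq_sum[OF smooth_differentiable[OF assms]])
  ultimately show ?thesis by (simp only:)
qed

definition grad :: "('a::euclidean_space => real) => 'a => 'a" where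
  "grad f x = (\<Sum>i\<in>Basis. partial i f x *\<^sub>R i)"

lemma gradI: "(f has_derivative (%a. inner v a)) (at x) ==> grad f x = v"
  unfolding grad_def by (simp add: partialI euclidean_representation)

lemma inner_grad: "smooth f ==> inner (grad f x) a = partial a f x"
  using partial_eq_sum[OF smooth_differentiable, of f a x]
  by (simp add: grad_def inner_sum_left inner_commute[of a] mult.commute)

lemma smooth_has_derivative: "smooth f ==> (f has_derivative (%a. inner (grad f x) a)) (at x)"
  using partial_has_derivative[OF smooth_differentiable] by (simp add: inner_grad)

lemma continuous_grad: "smooth f ==> continuous_on S (grad f)"
  unfolding grad_def[abs_def] by (intro continuous_intros smooth_continuous smooth_partial)

lemma grad_const: "grad (%x. c) x = 0" by (intro gradI) simp

lemma grad_affine: "grad (%x. c + inner e x) x = e" by (intro gradI) (auto intro!: derivative_eq_intros)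

lemma grad_add: "smooth f ==> smooth g ==> grad (%x. f x + g x) x = grad f x + grad g x"
  by (intro gradI) (auto intro!: derivative_eq_intros smooth_has_derivative simp: inner_add_left)

lemma grad_mult: "smooth f ==> smooth g ==> grad (%x. f x * g x) x = f x *\<^sub>R grad g x + g x *\<^sub>R grad f x"
  by (intro gradI) (auto intro!: derivative_eq_intros smooth_has_derivative simp: inner_add_left)

lemma grad_sum: "(!!j. j \<in> J ==> smooth (f j)) ==> grad (%x. \<Sum>j\<in>J. f j x) x = (\<Sum>j\<in>J. grad (f j) x)"
  by (intro gradI) (auto intro!: has_derivative_sum smooth_has_derivative simp: inner_sum_left)

lemma grad_inverse:
  "smooth f ==> f x ~= 0 ==> grad (%x. inverse (f x)) x = (- (inverse (f x))\<^sup>2) *\<^sub>R grad f x"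
  by (intro gradI) (auto intro!: derivative_eq_intros smooth_has_derivative simp: power2_eq_square)

lemma grad_compose:
  assumes "smooth h" "smooth f" shows "grad (%x. h (f x)) x = partial 1 h (f x) *\<^sub>R grad f x"
proof (intro gradI)
  have "(h has_real_derivative partial 1 h (f x)) (at (f x))"
    using smooth_has_derivative[OF assms(1), of "f x"] inner_grad[OF assms(1), of "f x" 1]
    by (simp add: has_field_derivative_def)
  from DERIV_compose_FDERIV[OF this smooth_has_derivative[OF assms(2)]]
  show "((%x. h (f x)) has_derivative (%a. inner (partial 1 h (f x) *\<^sub>R grad f x) a)) (at x)"
    by (simp add: mult.commute)
qed

section \<open>A smooth step function\<close>

lemma poly_times_exp_tendsto_0: "((%y::real. poly p y * exp (- y)) \<longlongrightarrow> 0) at_top"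
proof -
  have "((%y. \<Sum>i\<le>degree p. coeff p i * (y ^ i / exp y)) \<longlongrightarrow> (\<Sum>i\<le>degree p. coeff p i * 0)) at_top"
    by (intro tendsto_intros tendsto_power_div_exp_0)
  thus ?thesis by (simp add: poly_altdef sum_distrib_right exp_minus divide_inverse mult.assoc)
qed

text \<open>This class is closed under differentiation, which replaces \<open>p\<close> by
  \<open>X^2 (p - p')\<close>. Smoothness of all members is then a single induction.\<close>

definition flat :: "real poly => real => real" where
  "flat p t = (if t > 0 then poly p (1 / t) * exp (- (1 / t)) else 0)"

lemma flat_has_derivative: "(flat p has_real_derivative flat ([:0, 0, 1:] * (p - pderiv p)) t) (at t)"
proof -
  consider "t < 0" | "t > 0" | "t = 0" by linarith
  thus ?thesis
  proof cases
    case 1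
    have "((%t. 0) has_real_derivative flat ([:0, 0, 1:] * (p - pderiv p)) t) (at t)" using 1 by (simp add: flat_def)
    thus ?thesis by (rule DERIV_cong_ev[THEN iffD1, rotated -1, OF _ refl _ refl])
        (use eventually_nhds_in_open[of "{..<0}" t] 1 in \<open>auto elim!: eventually_mono simp: flat_def\<close>)
  next
    case 2
    have "((%t. poly p (1 / t) * exp (- (1 / t))) has_real_derivative flat ([:0, 0, 1:] * (p - pderiv p)) t) (at t)"
      using 2 by (auto intro!: derivative_eq_intros DERIV_chain2[OF poly_DERIV]
          simp: flat_def power2_eq_square field_simps)
    thus ?thesis by (rule DERIV_cong_ev[THEN iffD1, rotated -1, OF _ refl _ refl])
        (use eventually_nhds_in_open[of "{0<..}" t] 2 in \<open>auto elim!: eventually_mono simp: flat_def\<close>)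
  next
    case 3
    have "((%h. poly (pCons 0 p) (inverse h) * exp (- inverse h)) \<longlongrightarrow> 0) (at_right 0)"
      by (rule filterlim_compose[OF poly_times_exp_tendsto_0 filterlim_inverse_at_top_right])
    hence "((%h. (flat p h - flat p 0) / h) \<longlongrightarrow> 0) (at_right 0)"
      by (rule Lim_transform_eventually) (auto simp: flat_def eventually_at_filter field_simps)
    moreover have "((%h. (flat p h - flat p 0) / h) \<longlongrightarrow> 0) (at_left 0)"
      by (rule Lim_transform_eventually[OF tendsto_const]) (auto simp: flat_def eventually_at_filter)
    ultimately have "((%h. (flat p h - flat p 0) / h) \<longlongrightarrow> 0) (at 0)"
      by (simp add: filterlim_at_split)
    thus ?thesis using 3 by (simp add: has_field_derivative_iff flat_def)
  qed
qed

lemma smooth_flat: "smooth (flat p)"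
proof -
  have "C_diff n (flat p)" for n p
  proof (induction n arbitrary: p)
    case 0
    show ?case using flat_has_derivative DERIV_isCont continuous_at_imp_continuous_on by (metis C_diff.simps(1))
  next
    case (Suc n)
    show ?case by (rule C_diff_SucI[where f' = "%t a. flat ([:0, 0, 1:] * (p - pderiv p)) t * a"])
        (use flat_has_derivative Suc in \<open>auto simp: has_field_derivative_def\<close>)
  qed
  thus ?thesis by (simp add: smooth_def)
qed

definition step :: "real => real" where
  "step t = flat 1 t * inverse (flat 1 t + flat 1 (1 + (- 1) * t))"

lemma flat_1: "0 <= flat 1 t" "0 < flat 1 t + flat 1 (1 + (- 1) * t)" by (auto simp: flat_def add_pos_pos)

lemma smooth_step: "smooth step" unfolding step_def[abs_def]
proof (intro smooth_mult smooth_flat smooth_inverse smooth_add)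
  show "smooth (%t. flat 1 (1 + (- 1) * t))"
    using smooth_affine[of 1 "- 1 :: real"] by (intro smooth_compose[OF smooth_flat]) simp
  show "flat 1 t + flat 1 (1 + (- 1) * t) ~= 0" for t using flat_1(2)[of t] by linarith
qed

lemma step_le_0: "t <= 0 ==> step t = 0" and step_ge_1: "1 <= t ==> step t = 1"
  by (simp_all add: step_def flat_def)

lemma step_bounds: "0 <= step t" "step t <= 1" using flat_1[of t] flat_1(1)[of "1 + (- 1) * t"]
  by (auto simp: step_def field_simps simp del: mult_minus1)

section \<open>Test functions\<close>

lemma test_smooth: "phi \<in> test_functions \<Omega> ==> smooth phi"
  by (simp add: test_functions_def smooth_def)

lemma testI:
  assumes "smooth phi" "compact K" "K \<subseteq> \<Omega>" "!!x. x \<notin> K ==> phi x = 0"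
  shows "phi \<in> test_functions \<Omega>"
proof -
  have "closure {x. phi x ~= 0} \<subseteq> K" using assms by (intro closure_minimal) (auto simp: compact_imp_closed)
  thus ?thesis using assms unfolding test_functions_def smooth_def
    by (auto intro: bounded_subset[OF compact_imp_bounded])
qed

lemma test_support:
  assumes "phi \<in> test_functions \<Omega>"
  obtains K where "compact K" "K \<subseteq> \<Omega>" "!!x. x \<notin> K ==> phi x = 0"
  using assms closure_subset[of "{x. phi x ~= 0}"] unfolding test_functions_def by blast

lemma test_mult: "phi \<in> test_functions \<Omega> ==> smooth f ==> (%x. f x * phi x) \<in> test_functions \<Omega>"
  by (frule test_smooth, erule test_support, rule testI) (auto intro: smooth_mult)

lemma test_0: "(%x. 0) \<in> test_functions \<Omega>" by (rule testI[where K = "{}"]) (auto intro: smooth_const)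

lemma test_add:
  assumes "phi \<in> test_functions \<Omega>" "psi \<in> test_functions \<Omega>"
  shows "(%x. phi x + psi x) \<in> test_functions \<Omega>"
proof -
  obtain K where "compact K" "K \<subseteq> \<Omega>" "!!x. x \<notin> K ==> phi x = 0" using test_support[OF assms(1)] by blast
  moreover obtain L where "compact L" "L \<subseteq> \<Omega>" "!!x. x \<notin> L ==> psi x = 0" using test_support[OF assms(2)] by blast
  ultimately show ?thesis
    using assms[THEN test_smooth] by (intro testI[where K = "K \<union> L"]) (auto intro: smooth_add)
qed

lemma test_scale: "phi \<in> test_functions \<Omega> ==> (%x. c * phi x) \<in> test_functions \<Omega>"
  by (intro test_mult smooth_const)

lemma partial_eq_0:
  assumes "closed K" "!!x. x \<notin> K ==> f x = 0" "x \<notin> K"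
  shows "partial a f x = 0"
proof (rule partialI[where f' = "%a. 0"])
  show "(f has_derivative (%a. 0)) (at x)"
    by (rule has_derivative_transform_within_open[of "%x. 0" _ _ UNIV "- K"]) (use assms in auto)
qed

lemma test_partial: "phi \<in> test_functions \<Omega> ==> partial a phi \<in> test_functions \<Omega>"
  by (frule test_smooth, erule test_support, rule testI) (auto intro: smooth_partial partial_eq_0 compact_imp_closed)

lemma sq_int_compact:
  fixes f :: "'a::euclidean_space => 'b::euclidean_space"
  assumes "continuous_on UNIV f" "compact K" "!!x. x \<notin> K ==> f x = 0"
  shows "sq_int f" unfolding sq_int_def
proof
  show "f \<in> borel_measurable borel" using assms(1) by (rule borel_measurable_continuous_onI)
  have "integrable lborel (%x. indicator K x *\<^sub>R (norm (f x))\<^sup>2)"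
    using assms by (intro borel_integrable_compact continuous_intros) (auto intro: continuous_on_subset)
  also have "(%x. indicator K x *\<^sub>R (norm (f x))\<^sup>2) = (%x. (norm (f x))\<^sup>2)"
    using assms(3) by (fastforce simp: indicator_def)
  finally show "integrable lborel (%x. (norm (f x))\<^sup>2)" .
qed

lemma test_sq_int: "phi \<in> test_functions \<Omega> ==> sq_int phi"
  by (frule test_smooth, erule test_support, rule sq_int_compact) (auto intro: smooth_continuous)

lemma grad_sq_int: "phi \<in> test_functions \<Omega> ==> sq_int (grad phi)"
  by (frule test_smooth, erule test_support, rule sq_int_compact, erule continuous_grad)
    (auto intro!: partial_eq_0 compact_imp_closed sum.neutral simp: grad_def)

section \<open>Pointwise operators and translations on square-integrable functions\<close>

lemma norm_cls_mono:
  assumes "sq_int f" "sq_int g" "AE y in lborel. norm (f y) <= norm (g y)"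
  shows "norm (cls f) <= norm (cls g)"
proof (rule power2_le_imp_le)
  show "(norm (cls f))\<^sup>2 <= (norm (cls g))\<^sup>2"
    using assms unfolding norm_cls[OF assms(1)] norm_cls[OF assms(2)]
    by (intro integral_mono_AE) (auto simp: sq_int_def elim!: eventually_mono intro: power_mono)
qed simp

lemma cls_dominated:
  fixes f :: "nat => 'a::euclidean_space => 'b::euclidean_space" and w :: "'a => 'c::euclidean_space"
  assumes f: "!!n. sq_int (f n)" and g: "sq_int g" and w: "sq_int w"
    and bd: "!!n. AE y in lborel. norm (f n y) <= norm (w y)"
    and lim: "AE y in lborel. (%n. f n y) \<longlonglongrightarrow> g y"
  shows "(%n. cls (f n)) \<longlonglongrightarrow> cls g"
proof -
  note [measurable] = sq_int_measurable[OF f] sq_int_measurable[OF g] sq_int_measurable[OF w]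
  have gw: "AE y in lborel. norm (g y) <= norm (w y)"
    using lim AE_all_countable[of "%n y. norm (f n y) <= norm (w y)" lborel, THEN iffD2, OF allI, OF bd]
  proof eventually_elim
    case (elim y)
    show ?case by (rule tendsto_upperbound[OF tendsto_norm[OF elim(1)]]) (use elim in auto)
  qed
  have "(%n. LINT y|lborel. (norm (f n y - g y))\<^sup>2) \<longlonglongrightarrow> (LINT y|(lborel :: 'a measure). 0)"
  proof (rule integral_dominated_convergence)
    show "integrable lborel (%y. 4 * (norm (w y))\<^sup>2)" using w by (simp add: sq_int_def)
    show "AE y in lborel. (%n. (norm (f n y - g y))\<^sup>2) \<longlonglongrightarrow> 0"
      using lim by eventually_elim (auto intro!: tendsto_eq_intros)
    show "AE y in lborel. norm ((norm (f n y - g y))\<^sup>2) <= 4 * (norm (w y))\<^sup>2" for n using bd[of n] gw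
    proof eventually_elim
      case (elim y)
      have "norm (f n y - g y) <= 2 * norm (w y)" using elim norm_triangle_ineq4[of "f n y" "g y"] by linarith
      hence "(norm (f n y - g y))\<^sup>2 <= (2 * norm (w y))\<^sup>2" by (intro power_mono) auto
      thus ?case by (simp add: power_mult_distrib)
    qed
  qed measurable
  hence "(%n. (norm (cls (f n) - cls g))\<^sup>2) \<longlonglongrightarrow> 0"
    using norm_cls[OF sq_int_diff[OF f g]] by (simp add: cls_diff f g)
  hence "(%n. sqrt ((norm (cls (f n) - cls g))\<^sup>2)) \<longlonglongrightarrow> sqrt 0" by (rule tendsto_real_sqrt)
  thus ?thesis by (simp add: LIM_zero_iff tendsto_norm_zero_iff)
qed

text \<open>One notion for multiplication by a function, multiplication by a vector field, and the
  inner product with a field. Compactness of the closure of \<Omega> times the unit sphere bounds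
  the fibre maps uniformly.\<close>

definition pw_op :: "('a::euclidean_space => 'b::euclidean_space => 'c::euclidean_space) => bool" where
  "pw_op B \<longleftrightarrow> continuous_on UNIV (%(y, v). B y v) \<and> (\<forall>y. linear (B y))"

lemma pw_op_mult: "continuous_on UNIV f ==> pw_op (%y v. f y *\<^sub>R v)"
  and pw_op_times: "continuous_on UNIV f ==> pw_op (%y v. f y * (v::real))"
  and pw_op_vec: "continuous_on UNIV g ==> pw_op (%y v. v *\<^sub>R g y)"
  and pw_op_inner: "continuous_on UNIV g ==> pw_op (%y v. inner (g y) v)" unfolding pw_op_def
  by (auto intro!: continuous_intros continuous_on_compose2[of UNIV _ UNIV fst] linearI
      simp: case_prod_beta' algebra_simps inner_add_right)

lemma pw_op_id: "pw_op (%y v. v)"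
  unfolding pw_op_def by (auto intro!: continuous_intros linearI simp: case_prod_beta')

locale bounded_open =
  fixes \<Omega> :: "'a::euclidean_space set"
  assumes bounded_dom: "bounded \<Omega>" and open_dom: "open \<Omega>"
begin

text \<open>With the value 0 outside \<Omega>, bounds on \<Omega> control the operator, and
  multiplication by 1 becomes the projection onto functions supported in \<Omega>.\<close>

definition mulop :: "('a => 'b::euclidean_space => 'c::euclidean_space) => ('a, 'b) l2 => ('a, 'c) l2" where
  "mulop B x = cls (%y. if y \<in> \<Omega> then B y (repr x y) else 0)"

lemma pw_op_bound:
  fixes B :: "'a => 'b::euclidean_space => 'c::euclidean_space"
  assumes "pw_op B" obtains C where "0 <= C" "!!y v. y \<in> \<Omega> ==> norm (B y v) <= C * norm v"
proof -
  have "compact (closure \<Omega> \<times> (sphere 0 1 :: 'b set))"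
    using bounded_dom by (intro compact_Times compact_sphere) auto
  hence "compact ((%(y, v). B y v) ` (closure \<Omega> \<times> sphere 0 1))"
    using assms unfolding pw_op_def by (intro compact_continuous_image) (auto intro: continuous_on_subset)
  then obtain C where C: "0 < C" "!!z. z \<in> (%(y, v). B y v) ` (closure \<Omega> \<times> sphere 0 1) ==> norm z <= C"
    using compact_imp_bounded bounded_pos by metis
  have "norm (B y v) <= C * norm v" if "y \<in> \<Omega>" for y v
  proof (cases "v = 0")
    case False
    have l: "linear (B y)" using assms by (simp add: pw_op_def)
    have "norm (B y (v /\<^sub>R norm v)) <= C"
      using False that closure_subset[of \<Omega>] by (intro C(2) image_eqI[where x = "(y, v /\<^sub>R norm v)"]) auto
    thus ?thesis using False by (simp add: linear_scale[OF l] field_simps)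
  next
    case True
    thus ?thesis using assms linear_0[of "B y"] by (simp add: pw_op_def)
  qed
  thus ?thesis using C that[of C] by simp
qed

lemma pw_op_measurable:
  assumes "pw_op B" "f \<in> borel_measurable borel"
  shows "(%y. if y \<in> \<Omega> then B y (f y) else 0) \<in> borel_measurable borel"
proof -
  have [measurable]: "\<Omega> \<in> sets borel" using open_dom by simp
  have "(%(y, v). B y v) \<in> borel_measurable (borel \<Otimes>\<^sub>M borel)"
    using assms(1) unfolding pw_op_def borel_prod by (auto intro: borel_measurable_continuous_onI)
  from measurable_compose[OF measurable_Pair[OF measurable_ident assms(2)] this]
  have [measurable]: "(%y. B y (f y)) \<in> borel_measurable borel" by simp
  show ?thesis by measurable
qed

lemma sq_int_mulop:
  assumes "pw_op B" "sq_int f" shows "sq_int (%y. if y \<in> \<Omega> then B y (f y) else 0)"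
proof -
  obtain C where C: "0 <= C" "!!y v. y \<in> \<Omega> ==> norm (B y v) <= C * norm v" using pw_op_bound[OF assms(1)] by blast
  show ?thesis
    by (rule sq_int_bound[OF assms(2) pw_op_measurable[OF assms(1) sq_int_measurable[OF assms(2)]], where C = C])
      (use C in auto)
qed

lemma mulop_cls:
  assumes "pw_op B" "sq_int f" shows "mulop B (cls f) = cls (%y. if y \<in> \<Omega> then B y (f y) else 0)"
  unfolding mulop_def using repr_cls[OF assms(2)] assms sq_int_mulop[OF assms] sq_int_mulop[OF assms(1) repr(1)]
  by (subst cls_eq_iff) (auto elim!: eventually_mono)

lemma mulop_add:
  assumes "pw_op B" shows "mulop B (x + y) = mulop B x + mulop B y"
proof -
  obtain f where f: "sq_int f" "x = cls f" by (rule l2_cases)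
  obtain g where g: "sq_int g" "y = cls g" by (rule l2_cases)
  have l: "linear (B t)" for t using assms by (simp add: pw_op_def)
  have "mulop B (x + y) = cls (%t. (if t \<in> \<Omega> then B t (f t) else 0) + (if t \<in> \<Omega> then B t (g t) else 0))"
    unfolding f(2) g(2) cls_add[OF f(1) g(1), symmetric]
    by (simp add: mulop_cls assms f g sq_int_add) (rule arg_cong[where f = cls], auto simp: linear_add[OF l])
  thus ?thesis by (simp add: mulop_cls assms f g cls_add sq_int_mulop)
qed

lemma bounded_linear_mulop:
  assumes "pw_op B" shows "bounded_linear (mulop B)"
proof -
  obtain C where C: "0 <= C" "!!y v. y \<in> \<Omega> ==> norm (B y v) <= C * norm v" using pw_op_bound[OF assms] by blast
  have l: "linear (B t)" for t using assms by (simp add: pw_op_def)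
  show ?thesis
  proof (rule bounded_linear_intro[where K = C])
    fix r :: real and x :: "('a, 'b) l2"
    obtain f where f: "sq_int f" "x = cls f" by (rule l2_cases)
    have "mulop B (r *\<^sub>R x) = cls (%t. r *\<^sub>R (if t \<in> \<Omega> then B t (f t) else 0))"
      unfolding f(2) cls_scaleR[OF f(1), symmetric]
      by (simp add: mulop_cls assms f sq_int_scaleR) (rule arg_cong[where f = cls], auto simp: linear_scale[OF l])
    thus "mulop B (r *\<^sub>R x) = r *\<^sub>R mulop B x" by (simp add: mulop_cls assms f cls_scaleR sq_int_mulop)
    have "norm (mulop B x) <= norm (cls (%y. C *\<^sub>R f y))" unfolding f(2) mulop_cls[OF assms f(1)]
      by (rule norm_cls_mono[OF sq_int_mulop[OF assms f(1)] sq_int_scaleR[OF f(1)]]) (use C in auto)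
    thus "norm (mulop B x) <= norm x * C" using C by (simp add: f cls_scaleR mult.commute)
  qed (rule mulop_add[OF assms])
qed

lemma inner_mulop:
  assumes "pw_op B" "pw_op C" "!!y v w. y \<in> \<Omega> ==> inner (B y v) w = inner v (C y w)"
  shows "inner (mulop B x) z = inner x (mulop C z)"
proof -
  obtain f where f: "sq_int f" "x = cls f" by (rule l2_cases)
  obtain g where g: "sq_int g" "z = cls g" by (rule l2_cases)
  show ?thesis unfolding f(2) g(2)
    by (simp add: mulop_cls inner_cls sq_int_mulop f g assms) (rule Bochner_Integration.integral_cong, auto simp: assms)
qed

lemma mulop_mulop:
  assumes "pw_op B" "pw_op C" "pw_op D" "!!y v. y \<in> \<Omega> ==> B y (C y v) = D y v"
  shows "mulop B (mulop C x) = mulop D x"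
proof -
  obtain f where f: "sq_int f" "x = cls f" by (rule l2_cases)
  show ?thesis unfolding f(2)
    by (simp add: mulop_cls sq_int_mulop f assms) (rule arg_cong[where f = cls], auto simp: assms)
qed

lemma mulop_plus:
  assumes "pw_op B" "pw_op C" "pw_op D" "!!y v. y \<in> \<Omega> ==> B y v + C y v = D y v"
  shows "mulop B x + mulop C x = mulop D x"
proof -
  obtain f where f: "sq_int f" "x = cls f" by (rule l2_cases)
  show ?thesis unfolding f(2)
    by (simp add: mulop_cls sq_int_mulop f assms cls_add[symmetric]) (rule arg_cong[where f = cls], auto simp: assms)
qed

lemma mulop_tendsto:
  assumes B: "!!n. pw_op (B n)" "pw_op C"
    and bd: "!!n y v. y \<in> \<Omega> ==> norm (B n y v) <= M * norm v"
    and lim: "!!y v. y \<in> \<Omega> ==> (%n. B n y v) \<longlonglongrightarrow> C y v"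
  shows "(%n. mulop (B n) x) \<longlonglongrightarrow> mulop C x"
proof -
  obtain f where f: "sq_int f" "x = cls f" by (rule l2_cases)
  show ?thesis unfolding f(2) mulop_cls[OF B(1) f(1)] mulop_cls[OF B(2) f(1)]
  proof (rule cls_dominated)
    show "sq_int (%y. M *\<^sub>R f y)" by (rule sq_int_scaleR[OF f(1)])
    show "AE y in lborel. norm (if y \<in> \<Omega> then B n y (f y) else 0) <= norm (M *\<^sub>R f y)" for n
    proof (rule AE_I2)
      fix y
      have "M * norm (f y) <= \<bar>M\<bar> * norm (f y)" by (intro mult_right_mono) auto
      thus "norm (if y \<in> \<Omega> then B n y (f y) else 0) <= norm (M *\<^sub>R f y)" using bd[of y n "f y"] by auto
    qed
  qed (use lim sq_int_mulop[OF B(1) f(1)] sq_int_mulop[OF B(2) f(1)] in auto)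
qed

lemma norm_mulop_mono:
  assumes "pw_op B" "pw_op C" "!!y. y \<in> \<Omega> ==> norm (B y (repr x y)) <= norm (C y (repr z y))"
  shows "norm (mulop B x) <= norm (mulop C z)"
  unfolding mulop_def using assms by (intro norm_cls_mono sq_int_mulop repr) auto

end

section \<open>Translations and difference quotients\<close>

lemma distr_lborel_shift: "distr lborel borel (%y. y + a) = (lborel :: 'a::euclidean_space measure)"
proof -
  have "(%y. y + a) = (+) a" by (auto simp: add.commute)
  thus ?thesis using lborel_distr_plus[of a] by simp
qed

lemma lborel_shift:
  fixes f :: "'a::euclidean_space => 'b::{banach, second_countable_topology}" and a :: 'a
  shows "integrable lborel f ==> integrable lborel (%y. f (y + a))"
    and "f \<in> borel_measurable borel ==> (LINT y|lborel. f (y + a)) = (LINT y|lborel. f y)"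
proof -
  note d = distr_lborel_shift[of a]
  show "integrable lborel (%y. f (y + a))" if "integrable lborel f"
    using that integrable_distr[of "%y. y + a" lborel borel f] by (simp add: d)
  show "(LINT y|lborel. f (y + a)) = (LINT y|lborel. f y)" if "f \<in> borel_measurable borel"
    using that integral_distr[of "%y. y + a" lborel borel f] by (simp add: d)
qed

lemma AE_shift:
  fixes a :: "'a::euclidean_space"
  assumes "AE y in lborel. P y" shows "AE y in lborel. P (y + a)"
proof -
  have "AE y in distr lborel borel (%y. y + a). P y" using assms unfolding distr_lborel_shift .
  thus ?thesis by (intro AE_distrD[of "%y. y + a" lborel borel]) simp
qed

definition shift :: "'a::euclidean_space => ('a, 'b::euclidean_space) l2 => ('a, 'b) l2" where
  "shift a x = cls (%y. repr x (y + a))"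

lemma sq_int_shift: "sq_int f ==> sq_int (%y. f (y + a))"
  unfolding sq_int_def using lborel_shift(1)[of "%x. (norm (f x))\<^sup>2" a]
  by (auto intro: measurable_compose[of "%y. y + a" borel borel f])

lemma shift_cls: "sq_int f ==> shift a (cls f) = cls (%y. f (y + a))"
  unfolding shift_def using AE_shift[OF repr_cls[of f], of a] by (subst cls_eq_iff) (auto intro!: sq_int_shift repr)

lemma shift_add: "shift a (x + y) = shift a x + shift a y"
  by (rule l2_cases[of x], rule l2_cases[of y]) (simp add: cls_add[symmetric] shift_cls sq_int_add sq_int_shift)

lemma shift_scaleR: "shift a (r *\<^sub>R x) = r *\<^sub>R shift a x"
  by (rule l2_cases[of x]) (simp add: cls_scaleR[symmetric] shift_cls sq_int_scaleR sq_int_shift)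

lemma shift_diff: "shift a (x - y) = shift a x - shift a y"
  by (rule l2_cases[of x], rule l2_cases[of y]) (simp add: cls_diff[symmetric] shift_cls sq_int_diff sq_int_shift)

lemma shift_shift: "shift a (shift b x) = shift (a + b) x"
  by (rule l2_cases[of x]) (simp add: shift_cls sq_int_shift ac_simps)

lemma shift_0: "shift 0 x = x" by (rule l2_cases[of x]) (simp add: shift_cls)

lemma inner_shift: "inner (shift a x) (shift a y) = inner x y"
proof -
  obtain f where f: "sq_int f" "x = cls f" by (rule l2_cases)
  obtain g where g: "sq_int g" "y = cls g" by (rule l2_cases)
  show ?thesis
    using lborel_shift(2)[of "%y. inner (f y) (g y)" a] f g sq_int_measurable[OF f(1)] sq_int_measurable[OF g(1)]
    by (simp add: shift_cls inner_cls sq_int_shift)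
qed

lemma norm_shift: "norm (shift a x) = norm x" by (simp add: norm_eq_sqrt_inner inner_shift)

lemma inner_shift_left: "inner (shift a x) y = inner x (shift (- a) y)"
  using inner_shift[of "- a" "shift a x" y] by (simp add: shift_shift shift_0)

lemma bounded_linear_shift: "bounded_linear (shift a)"
  by (rule bounded_linear_intro[where K = 1]) (simp_all add: shift_add shift_scaleR norm_shift)

text \<open>Dominated convergence: the quotients are bounded by the maximum of the derivative, and
  they vanish outside one ball as long as the step stays bounded.\<close>

lemma difference_quotient_tendsto:
  assumes "phi \<in> test_functions \<Omega>"
  shows "((%h. (shift (h *\<^sub>R a) (cls phi) - cls phi) /\<^sub>R h) \<longlongrightarrow> cls (partial a phi)) (at 0)"
  unfolding tendsto_at_iff_sequentially comp_def
proof (intro allI impI)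
  fix X :: "nat => real" assume X: "\<forall>i. X i \<in> UNIV - {0}" "X \<longlonglongrightarrow> 0"
  obtain K where K: "compact K" "!!x. x \<notin> K ==> phi x = 0" using test_support[OF assms] by metis
  have sm: "smooth phi" using assms by (rule test_smooth)
  obtain N where N: "!!n. norm (X n) <= N" using convergent_imp_Bseq[OF convergentI[OF X(2)]] unfolding Bseq_def by blast
  obtain R where R: "!!x. x \<in> K ==> norm x <= R" using compact_imp_bounded[OF K(1)] bounded_iff by metis
  have "compact (partial a phi ` K)" using K(1) sm by (intro compact_continuous_image smooth_continuous smooth_partial)
  then obtain M0 where M0: "!!x. x \<in> K ==> \<bar>partial a phi x\<bar> <= M0" using compact_imp_bounded bounded_iff by (metis imageI real_norm_def)
  define M where "M = max M0 0"
  have M: "\<bar>partial a phi x\<bar> <= M" for x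
    using M0[of x] partial_eq_0[OF compact_imp_closed[OF K(1)], of phi x a] K(2) by (cases "x \<in> K") (auto simp: M_def)
  have lip: "\<bar>phi (x + h *\<^sub>R a) - phi x\<bar> <= M * \<bar>h\<bar>" for x h
  proof -
    have "norm (phi (x + h *\<^sub>R a) - phi (x + 0 *\<^sub>R a)) <= M * norm (h - 0)"
    proof (rule differentiable_bound[where f = "%t. phi (x + t *\<^sub>R a)" and S = UNIV and f' = "%t s. s * partial a phi (x + t *\<^sub>R a)"])
      fix t
      have "((%t. phi (x + t *\<^sub>R a)) has_derivative (%s. inner (grad phi (x + t *\<^sub>R a)) (s *\<^sub>R a))) (at t)"
        by (rule has_derivative_compose[OF _ smooth_has_derivative[OF sm]]) (auto intro!: derivative_eq_intros)
      thus "((%t. phi (x + t *\<^sub>R a)) has_derivative (%s. s * partial a phi (x + t *\<^sub>R a))) (at t within UNIV)"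
        by (simp add: inner_grad[OF sm])
      show "onorm (%s. s * partial a phi (x + t *\<^sub>R a)) <= M"
        by (rule onorm_bound) (use M[of "x + t *\<^sub>R a"] in \<open>auto simp: M_def abs_mult mult.commute[of "max M0 0"] intro!: mult_left_mono\<close>)
    qed auto
    thus ?thesis by simp
  qed
  have q: "sq_int (%y. (phi (y + h *\<^sub>R a) - phi y) /\<^sub>R h)" for h
    by (intro sq_int_scaleR sq_int_diff sq_int_shift test_sq_int[OF assms])
  have "(%n. cls (%y. (phi (y + X n *\<^sub>R a) - phi y) /\<^sub>R X n)) \<longlonglongrightarrow> cls (partial a phi)"
  proof (rule cls_dominated[OF q test_sq_int[OF test_partial[OF assms]]])
    let ?w = "%y. indicator (cball 0 (R + N * norm a)) y * M"
    have "integrable lborel (%x. indicator (cball 0 (R + N * norm a)) x *\<^sub>R (M * M))"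
      by (intro borel_integrable_compact) auto
    also have "(%x. indicator (cball 0 (R + N * norm a)) x *\<^sub>R (M * M)) = (%y. (norm (?w y))\<^sup>2)"
      by (auto simp: power2_eq_square abs_mult indicator_def) finally show "sq_int ?w" unfolding sq_int_def
      by (intro conjI borel_measurable_times borel_measurable_indicator borel_measurable_const) auto
    show "AE y in lborel. norm ((phi (y + X n *\<^sub>R a) - phi y) /\<^sub>R X n) <= norm (?w y)" for n
    proof (rule AE_I2)
      fix y
      show "norm ((phi (y + X n *\<^sub>R a) - phi y) /\<^sub>R X n) <= norm (?w y)"
      proof (cases "norm y <= R + N * norm a")
        case True
        thus ?thesis using lip[of y "X n"] X(1) by (simp add: M_def field_simps abs_mult)
      next
        case False
        have "norm (X n *\<^sub>R a) <= N * norm a" using N[of n] by (simp add: mult_right_mono)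
        moreover have "norm y <= norm (y + X n *\<^sub>R a) + norm (X n *\<^sub>R a)" using norm_triangle_ineq4[of "y + X n *\<^sub>R a" "X n *\<^sub>R a"] by simp
        moreover have "0 <= N" using N[of n] norm_ge_zero[of "X n"] by linarith
        moreover have "0 <= N * norm a" using \<open>0 <= N\<close> by simp
        ultimately have "\<not> norm y <= R" "\<not> norm (y + X n *\<^sub>R a) <= R" using False by linarith+
        hence "y \<notin> K" "y + X n *\<^sub>R a \<notin> K" using R by blast+
        thus ?thesis using K by simp
      qed
    qed
    show "AE y in lborel. (%n. (phi (y + X n *\<^sub>R a) - phi y) /\<^sub>R X n) \<longlonglongrightarrow> partial a phi y"
    proof (rule AE_I2)
      fix y
      have "((%t. phi (y + t *\<^sub>R a)) has_derivative (%s. inner (grad phi (y + 0 *\<^sub>R a)) (s *\<^sub>R a))) (at 0)"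
        by (rule has_derivative_compose[OF _ smooth_has_derivative[OF sm]]) (auto intro!: derivative_eq_intros)
      hence "((%t. phi (y + t *\<^sub>R a)) has_real_derivative partial a phi y) (at 0)"
        by (simp add: inner_grad[OF sm] has_field_derivative_def mult_commute_abs)
      hence "((%h. (phi (y + h *\<^sub>R a) - phi y) / h) \<longlongrightarrow> partial a phi y) (at 0)"
        by (simp add: DERIV_def)
      thus "(%n. (phi (y + X n *\<^sub>R a) - phi y) /\<^sub>R X n) \<longlonglongrightarrow> partial a phi y"
        using X unfolding tendsto_at_iff_sequentially comp_def by (auto simp: divide_inverse_commute)
    qed
  qed
  thus "(%i. (shift (X i *\<^sub>R a) (cls phi) - cls phi) /\<^sub>R X i) \<longlonglongrightarrow> cls (partial a phi)"
    by (simp only: shift_cls cls_scaleR cls_diff test_sq_int[OF assms] sq_int_shift sq_int_diff)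
qed

text \<open>Telescoping \<open>n\<close> translations by \<open>a / n\<close> bounds the left side
  by \<open>n\<close> times one small difference, and that product tends to the norm of the
  derivative.\<close>

lemma norm_shift_diff_le:
  assumes "phi \<in> test_functions \<Omega>"
  shows "norm (shift a (cls phi) - cls phi) <= norm (cls (partial a phi))"
proof -
  let ?x = "cls phi"
  have step: "norm (shift (real n *\<^sub>R c) ?x - ?x) <= real n * norm (shift c ?x - ?x)" for n c
  proof (induction n)
    case (Suc n)
    have "shift (real (Suc n) *\<^sub>R c) ?x - ?x = shift c (shift (real n *\<^sub>R c) ?x - ?x) + (shift c ?x - ?x)"
      by (simp add: shift_diff shift_shift algebra_simps)
    hence "norm (shift (real (Suc n) *\<^sub>R c) ?x - ?x) <= norm (shift (real n *\<^sub>R c) ?x - ?x) + norm (shift c ?x - ?x)"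
      using norm_triangle_ineq norm_shift by metis
    thus ?case using Suc by (simp add: algebra_simps)
  qed (simp add: shift_0)
  have "(%n. inverse (real (Suc n))) \<longlonglongrightarrow> 0" by (rule LIMSEQ_inverse_real_of_nat)
  hence "filterlim (%n. inverse (real (Suc n))) (at 0) sequentially" by (simp add: filterlim_at)
  from tendsto_norm[OF filterlim_compose[OF difference_quotient_tendsto[OF assms, of a] this]]
  have lim: "(%n. norm ((shift (inverse (real (Suc n)) *\<^sub>R a) ?x - ?x) /\<^sub>R inverse (real (Suc n)))) \<longlonglongrightarrow> norm (cls (partial a phi))" .
  show ?thesis
  proof (rule tendsto_lowerbound[OF lim])
    show "\<forall>\<^sub>F n in sequentially. norm (shift a ?x - ?x) <= norm ((shift (inverse (real (Suc n)) *\<^sub>R a) ?x - ?x) /\<^sub>R inverse (real (Suc n)))"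
    proof (intro always_eventually allI)
      fix n
      show "norm (shift a ?x - ?x) <= norm ((shift (inverse (real (Suc n)) *\<^sub>R a) ?x - ?x) /\<^sub>R inverse (real (Suc n)))"
        using step[of "Suc n" "inverse (real (Suc n)) *\<^sub>R a"] by (simp add: mult.commute del: of_nat_Suc)
    qed
  qed simp
qed

text \<open>The adjoint of a translation is the opposite translation, so the limit of the difference
  quotients moves the derivative over with a minus sign.\<close>

lemma integration_by_parts:
  assumes "phi \<in> test_functions \<Omega>" "psi \<in> test_functions \<Omega>'"
  shows "inner (cls (partial a phi)) (cls psi) = - inner (cls phi) (cls (partial a psi))"
proof (rule LIM_unique)
  have "((%h. inner ((shift (h *\<^sub>R a) (cls phi) - cls phi) /\<^sub>R h) (cls psi)) \<longlongrightarrow> inner (cls (partial a phi)) (cls psi)) (at 0)"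
    by (intro tendsto_intros difference_quotient_tendsto[OF assms(1)])
  also have "(%h. inner ((shift (h *\<^sub>R a) (cls phi) - cls phi) /\<^sub>R h) (cls psi))
      = (%h. - inner (cls phi) ((shift ((- h) *\<^sub>R a) (cls psi) - cls psi) /\<^sub>R (- h)))"
    by (simp add: inner_diff_left inner_diff_right inner_shift_left algebra_simps)
  finally show "((%h. - inner (cls phi) ((shift ((- h) *\<^sub>R a) (cls psi) - cls psi) /\<^sub>R (- h))) \<longlongrightarrow> inner (cls (partial a phi)) (cls psi)) (at 0)" .
  have "filterlim (%h::real. - h) (at 0) (at 0)" by (auto simp: filterlim_at eventually_at_filter intro!: tendsto_eq_intros)
  from filterlim_compose[OF difference_quotient_tendsto[OF assms(2), of a] this]
  show "((%h. - inner (cls phi) ((shift ((- h) *\<^sub>R a) (cls psi) - cls psi) /\<^sub>R (- h))) \<longlongrightarrow> - inner (cls phi) (cls (partial a psi))) (at 0)"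
    by (intro tendsto_intros)
qed

section \<open>Weak solutions of the Dirichlet problem\<close>

definition lapl :: "('a::euclidean_space => real) => 'a => real" where
  "lapl f x = (\<Sum>i\<in>Basis. partial i (partial i f) x)"

lemma smooth_lapl: "smooth f ==> smooth (lapl f)"
  unfolding lapl_def[abs_def] by (intro smooth_sum smooth_partial)

lemma test_zero_outside: "phi \<in> test_functions \<Omega> ==> y \<notin> \<Omega> ==> phi y = 0"
  by (erule test_support) auto

lemma grad_zero_outside: "phi \<in> test_functions \<Omega> ==> y \<notin> \<Omega> ==> grad phi y = 0"
  by (simp add: grad_def test_zero_outside[OF test_partial])

lemma sq_int_test_scaleR:
  assumes "phi \<in> test_functions \<Omega>" "continuous_on UNIV g"
  shows "sq_int (%y. phi y *\<^sub>R g y)"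
proof -
  obtain K where "compact K" "!!x. x \<notin> K ==> phi x = 0" using test_support[OF assms(1)] by metis
  thus ?thesis
    using assms by (intro sq_int_compact[of _ K]) (auto intro!: continuous_intros smooth_continuous test_smooth)
qed

lemma sq_int_sum:
  assumes "!!i. i \<in> I ==> sq_int (f i)" shows "sq_int (%y. \<Sum>i\<in>I. f i y)"
  using assms
proof (induction I rule: infinite_finite_induct)
  case (insert j I)
  hence "sq_int (f j)" "sq_int (%y. \<Sum>i\<in>I. f i y)" by simp_all
  from sq_int_add[OF this] show ?case using insert by simp
qed (simp_all add: sq_int_0)

lemma cls_sum:
  assumes "!!i. i \<in> I ==> sq_int (f i)" shows "cls (%y. \<Sum>i\<in>I. f i y) = (\<Sum>i\<in>I. cls (f i))"
  using assms
proof (induction I rule: infinite_finite_induct)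
  case (insert j I)
  have s: "sq_int (f j)" "sq_int (%y. \<Sum>i\<in>I. f i y)" by (intro sq_int_sum insert.prems insertI1 insertI2; assumption)+
  have "cls (%y. \<Sum>i\<in>I. f i y) = (\<Sum>i\<in>I. cls (f i))" by (intro insert.IH insert.prems insertI2)
  thus ?case using cls_add[OF s] by (simp only: sum.insert[OF insert.hyps])
qed (simp_all add: cls_0)

context bounded_open
begin

abbreviation "tests \<equiv> test_functions \<Omega>"

text \<open>The gradient is carried along as second component. The inner product of the product
  space is then that of \<open>H1\<close>, and completeness is inherited.\<close>

definition H10_graph :: "(('a, real) l2 \<times> ('a, 'a) l2) set" where
  "H10_graph = closure ((%phi. (cls phi, cls (grad phi))) ` tests)"

definition smul :: "('a => real) => ('a, 'b::euclidean_space) l2 => ('a, 'b) l2" where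
  "smul zeta = mulop (%y v. zeta y *\<^sub>R v)"

definition vmul :: "('a => 'b::euclidean_space) => ('a, real) l2 => ('a, 'b) l2" where
  "vmul g = mulop (%y v. v *\<^sub>R g y)"

definition dotm :: "('a => 'b::euclidean_space) => ('a, 'b) l2 => ('a, real) l2" where
  "dotm g = mulop (%y v. inner (g y) v)"

abbreviation "restr \<equiv> smul (%x. 1)"

lemma H10_graph_test: "phi \<in> tests ==> (cls phi, cls (grad phi)) \<in> H10_graph"
  unfolding H10_graph_def by (rule subsetD[OF closure_subset], rule imageI)

text \<open>Closure induction: identities and bounds pass from test functions to the limit.\<close>

lemma H10_graph_closed:
  assumes "(u, U) \<in> H10_graph" "closed {z. P (fst z) (snd z)}"
    "!!phi. phi \<in> tests ==> P (cls phi) (cls (grad phi))"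
  shows "P u U"
proof -
  have "H10_graph \<subseteq> {z. P (fst z) (snd z)}"
    unfolding H10_graph_def by (rule closure_minimal[OF _ assms(2)]) (use assms(3) in auto)
  thus ?thesis using assms(1) by auto
qed

lemma grad_cls:
  assumes "phi \<in> tests" "psi \<in> tests"
  shows "cls (grad (%x. phi x + psi x)) = cls (grad phi) + cls (grad psi)"
    and "cls (grad (%x. c * phi x)) = c *\<^sub>R cls (grad phi)"
proof -
  note s = assms[THEN test_smooth]
  have "grad (%x. phi x + psi x) = (%x. grad phi x + grad psi x)" by (rule ext) (rule grad_add[OF s])
  thus "cls (grad (%x. phi x + psi x)) = cls (grad phi) + cls (grad psi)"
    by (simp add: cls_add assms[THEN grad_sq_int])
  have "grad (%x. c * phi x) = (%x. c *\<^sub>R grad phi x)" by (rule ext) (simp add: grad_mult smooth_const s grad_const)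
  thus "cls (grad (%x. c * phi x)) = c *\<^sub>R cls (grad phi)"
    by (simp add: cls_scaleR assms[THEN grad_sq_int])
qed

lemma subspace_closure:
  fixes S :: "'h::real_normed_vector set"
  assumes "subspace S" shows "subspace (closure S)" unfolding subspace_def
proof (intro conjI ballI allI)
  show "0 \<in> closure S" using subspace_0[OF assms] closure_subset by blast
  fix x assume "x \<in> closure S"
  then obtain f where f: "!!n. f n \<in> S" "f \<longlonglongrightarrow> x" unfolding closure_sequential by blast
  show "c *\<^sub>R x \<in> closure S" for c unfolding closure_sequential
    by (rule exI[of _ "%n. c *\<^sub>R f n"]) (use f subspace_scale[OF assms] in \<open>auto intro!: tendsto_intros\<close>)
  fix y assume "y \<in> closure S"
  then obtain g where g: "!!n. g n \<in> S" "g \<longlonglongrightarrow> y" unfolding closure_sequential by blast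
  show "x + y \<in> closure S" unfolding closure_sequential
    by (rule exI[of _ "%n. f n + g n"]) (use f g subspace_add[OF assms] in \<open>auto intro!: tendsto_intros\<close>)
qed

lemma subspace_test_graph: "subspace ((%phi. (cls phi, cls (grad phi))) ` tests)"
  unfolding subspace_def
proof (intro conjI ballI allI)
  have "cls (grad (%x::'a. 0)) = 0" by (simp add: grad_const[abs_def] cls_0)
  thus "0 \<in> (%phi. (cls phi, cls (grad phi))) ` tests"
    by (intro image_eqI[OF _ test_0]) (simp add: cls_0 zero_prod_def)
  fix x assume "x \<in> (%phi. (cls phi, cls (grad phi))) ` tests"
  then obtain phi where x: "phi \<in> tests" "x = (cls phi, cls (grad phi))" by auto
  show "c *\<^sub>R x \<in> (%phi. (cls phi, cls (grad phi))) ` tests" for c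
    using x grad_cls(2)[OF x(1) x(1)] cls_scaleR[OF test_sq_int[OF x(1)], of c]
    by (intro image_eqI[OF _ test_scale[OF x(1), of c]]) simp
  fix y assume "y \<in> (%phi. (cls phi, cls (grad phi))) ` tests"
  then obtain psi where y: "psi \<in> tests" "y = (cls psi, cls (grad psi))" by auto
  show "x + y \<in> (%phi. (cls phi, cls (grad phi))) ` tests" using x y grad_cls(1)[OF x(1) y(1)]
    by (intro image_eqI[OF _ test_add[OF x(1) y(1)]]) (simp add: cls_add test_sq_int)
qed

lemma subspace_H10_graph: "subspace (H10_graph)"
  unfolding H10_graph_def by (rule subspace_closure[OF subspace_test_graph])

lemma closed_H10_graph: "closed (H10_graph)" by (simp add: H10_graph_def)

lemma weak_gradient:
  assumes "(u, U) \<in> H10_graph" "phi \<in> test_functions \<Omega>'"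
  shows "inner u (cls (partial a phi)) = - inner U (cls (%y. phi y *\<^sub>R a))"
proof (rule H10_graph_closed[OF assms(1)])
  show "closed {z. inner (fst z) (cls (partial a phi)) = - inner (snd z) (cls (%y. phi y *\<^sub>R a))}"
    by (intro closed_Collect_eq continuous_intros)
  fix psi assume p: "psi \<in> tests"
  show "inner (cls psi) (cls (partial a phi)) = - inner (cls (grad psi)) (cls (%y. phi y *\<^sub>R a))"
    using integration_by_parts[OF p assms(2), of a] inner_grad[OF test_smooth[OF p]]
    by (simp add: inner_cls test_sq_int[OF p] test_sq_int[OF assms(2)] grad_sq_int[OF p] test_sq_int[OF test_partial[OF p]]
        sq_int_test_scaleR[OF assms(2) continuous_on_const] mult.commute)
qed

lemma norm_shift_diff_le_grad:
  assumes "(u, U) \<in> H10_graph"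
  shows "norm (shift a u - u) <= norm a * norm U"
proof (rule H10_graph_closed[OF assms])
  show "closed {z. norm (shift a (fst z) - fst z) <= norm a * norm (snd z :: ('a, 'a) l2)}"
    by (intro closed_Collect_le continuous_intros bounded_linear.continuous_on[OF bounded_linear_shift])
  fix phi assume p: "phi \<in> tests"
  have "norm (cls (partial a phi)) <= norm (cls (%y. norm a *\<^sub>R grad phi y))"
  proof (rule norm_cls_mono[OF test_sq_int[OF test_partial[OF p]] sq_int_scaleR[OF grad_sq_int[OF p]]])
    have "norm (partial a phi y) <= norm (norm a *\<^sub>R grad phi y)" for y
      using Cauchy_Schwarz_ineq2[of "grad phi y" a] by (simp add: inner_grad[OF test_smooth[OF p]] mult.commute)
    thus "AE y in lborel. norm (partial a phi y) <= norm (norm a *\<^sub>R grad phi y)" by simp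
  qed
  thus "norm (shift a (cls phi) - cls phi) <= norm a * norm (cls (grad phi))"
    using norm_shift_diff_le[OF p, of a] by (simp add: cls_scaleR grad_sq_int[OF p])
qed

text \<open>Riesz representation in the closed subspace of pairs, whose inner product is the
  bilinear form of \<open>1 - A\<close>.\<close>

lemma weak_solution:
  obtains u U where "(u, U) \<in> H10_graph"
    "!!phi \<Phi>. (phi, \<Phi>) \<in> H10_graph ==> inner u phi + inner U \<Phi> = inner x phi"
proof -
  have "\<bar>inner x (fst z)\<bar> <= norm x * norm z" for z :: "('a, real) l2 \<times> ('a, 'a) l2"
    using Cauchy_Schwarz_ineq2[of x "fst z"] norm_fst_le[of "fst z" "snd z"]
      mult_left_mono[of "norm (fst z)" "norm z" "norm x"] by simp
  then obtain z where z: "z \<in> closure (H10_graph)" "!!y. y \<in> H10_graph ==> inner x (fst y) = inner z y"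
    by (rule riesz_subspace[OF subspace_H10_graph, of "%z. inner x (fst z)", rotated 2])
      (auto simp: inner_add_right)
  show ?thesis
  proof
    show "(fst z, snd z) \<in> H10_graph" using z(1) unfolding closure_closed[OF closed_H10_graph] by simp
    show "inner (fst z) phi + inner (snd z) \<Phi> = inner x phi" if "(phi, \<Phi>) \<in> H10_graph" for phi \<Phi>
      using z(2)[OF that] by (simp add: inner_prod_def)
  qed
qed

text \<open>The divergence of \<open>U\<close> is \<open>g\<close> as a distribution on \<Omega>;
  with \<open>U\<close> the gradient of \<open>u\<close> this is Poisson's equation.\<close>

definition weak_lap :: "('a, 'a) l2 => ('a, real) l2 => bool" where
  "weak_lap U g \<longleftrightarrow> (\<forall>phi\<in>tests. inner U (cls (grad phi)) = - inner g (cls phi))"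

lemma weak_lap_H10:
  assumes "weak_lap U g" "(phi, \<Phi>) \<in> H10_graph"
  shows "inner U \<Phi> = - inner g phi"
proof (rule H10_graph_closed[OF assms(2)])
  show "closed {z. inner U (snd z) = - inner g (fst z)}" by (intro closed_Collect_eq continuous_intros)
qed (use assms(1) in \<open>simp add: weak_lap_def\<close>)

lemmas bounded_linear_smul = bounded_linear_mulop[OF pw_op_mult, folded smul_def]
  and bounded_linear_vmul = bounded_linear_mulop[OF pw_op_vec, folded vmul_def]
  and bounded_linear_dotm = bounded_linear_mulop[OF pw_op_inner, folded dotm_def]

lemma smul_cls:
  assumes "continuous_on UNIV zeta" "sq_int f" "!!y. y \<notin> \<Omega> ==> f y = 0"
  shows "smul zeta (cls f) = cls (%y. zeta y *\<^sub>R f y)"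
  unfolding smul_def mulop_cls[OF pw_op_mult[OF assms(1)] assms(2)]
  by (rule arg_cong[where f = cls]) (use assms(3) in auto)

lemma vmul_cls:
  assumes "continuous_on UNIV g" "sq_int f" "!!y. y \<notin> \<Omega> ==> f y = 0"
  shows "vmul g (cls f) = cls (%y. f y *\<^sub>R g y)"
  unfolding vmul_def mulop_cls[OF pw_op_vec[OF assms(1)] assms(2)]
  by (rule arg_cong[where f = cls]) (use assms(3) in auto)

lemma dotm_cls:
  assumes "continuous_on UNIV g" "sq_int f" "!!y. y \<notin> \<Omega> ==> f y = 0"
  shows "dotm g (cls f) = cls (%y. inner (g y) (f y))"
  unfolding dotm_def mulop_cls[OF pw_op_inner[OF assms(1)] assms(2)]
  by (rule arg_cong[where f = cls]) (use assms(3) in auto)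

lemma inner_smul: "continuous_on UNIV zeta ==> inner (smul zeta x) y = inner x (smul zeta y)"
  unfolding smul_def by (rule inner_mulop) (auto intro: pw_op_mult)

lemma inner_vmul: "continuous_on UNIV g ==> inner (vmul g x) y = inner x (dotm g y)"
  unfolding vmul_def dotm_def by (rule inner_mulop) (auto intro: pw_op_vec pw_op_inner simp: inner_commute)

lemma H10_graph_supp:
  assumes "(u, U) \<in> H10_graph" shows "restr u = u" and "restr U = U"
proof -
  have "restr u = u \<and> restr U = U"
  proof (rule H10_graph_closed[OF assms])
    show "closed {z. restr (fst z :: ('a, real) l2) = fst z \<and> restr (snd z :: ('a, 'a) l2) = snd z}"
      by (intro closed_Collect_conj closed_Collect_eq continuous_intros bounded_linear.continuous_on[OF bounded_linear_smul])
    fix phi assume p: "phi \<in> tests"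
    show "restr (cls phi) = cls phi \<and> restr (cls (grad phi)) = cls (grad phi)"
      using test_zero_outside[OF p] grad_zero_outside[OF p]
      by (simp add: smul_cls test_sq_int[OF p] grad_sq_int[OF p] continuous_on_const)
  qed
  thus "restr u = u" and "restr U = U" by auto
qed

lemma cls_grad_mult:
  assumes p: "phi \<in> tests" and z: "smooth zeta"
  shows "cls (grad (%y. zeta y * phi y)) = smul zeta (cls (grad phi)) + cls (%y. phi y *\<^sub>R grad zeta y)"
proof -
  have g: "grad (%y. zeta y * phi y) = (%y. zeta y *\<^sub>R grad phi y + phi y *\<^sub>R grad zeta y)"
    by (rule ext) (rule grad_mult[OF z test_smooth[OF p]])
  note s = sq_int_test_scaleR[OF p continuous_grad[OF z]]
  have "sq_int (%y. zeta y *\<^sub>R grad phi y)"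
    using sq_int_diff[OF grad_sq_int[OF test_mult[OF p z]] s] by (simp add: g)
  thus ?thesis using grad_zero_outside[OF p] by (simp add: g smul_cls smooth_continuous z grad_sq_int[OF p] cls_add s)
qed

lemma H10_graph_mult:
  assumes "(u, U) \<in> H10_graph" "smooth zeta"
  shows "(smul zeta u, smul zeta U + vmul (grad zeta) u) \<in> H10_graph"
proof (rule H10_graph_closed[OF assms(1)])
  note c = smooth_continuous[OF assms(2)] continuous_grad[OF assms(2)]
  show "closed {z. (smul zeta (fst z), smul zeta (snd z) + vmul (grad zeta) (fst z)) \<in> H10_graph}"
    by (rule closed_vimage[OF closed_H10_graph, unfolded vimage_def])
      (intro continuous_intros bounded_linear.continuous_on[OF bounded_linear_smul] bounded_linear.continuous_on[OF bounded_linear_vmul] c)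
  fix phi assume p: "phi \<in> tests"
  have "smul zeta (cls phi) = cls (%y. zeta y * phi y)"
    using test_zero_outside[OF p] by (simp add: smul_cls test_sq_int[OF p] c)
  moreover have "smul zeta (cls (grad phi)) + vmul (grad zeta) (cls phi) = cls (grad (%y. zeta y * phi y))"
    using test_zero_outside[OF p] cls_grad_mult[OF p assms(2)] by (simp add: vmul_cls test_sq_int[OF p] c)
  ultimately show "(smul zeta (cls phi), smul zeta (cls (grad phi)) + vmul (grad zeta) (cls phi)) \<in> H10_graph"
    using H10_graph_test[OF test_mult[OF p assms(2)]] by simp
qed

text \<open>The Leibniz rule for the Laplacian of a product in weak form. The terms with derivatives
  of \<open>zeta\<close> arise by moving them between \<open>phi\<close> and \<open>u\<close> with
  the weak gradient of \<open>u\<close>.\<close>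

lemma weak_lap_mult:
  assumes u: "(u, U) \<in> H10_graph" and g: "weak_lap U g" and z: "smooth zeta"
  shows "weak_lap (smul zeta U + vmul (grad zeta) u)
    (smul zeta g + 2 *\<^sub>R dotm (grad zeta) U + smul (lapl zeta) u)" unfolding weak_lap_def
proof
  fix phi assume p: "phi \<in> tests"
  note c = smooth_continuous[OF z] continuous_grad[OF z] smooth_continuous[OF smooth_lapl[OF z]]
  note ps = test_smooth[OF p]
  have t: "(%y. phi y * partial i zeta y) \<in> tests" for i
    using test_mult[OF p smooth_partial[OF z], of i] by (simp add: mult.commute)
  have s1: "sq_int (%y. phi y *\<^sub>R grad zeta y)" and s2: "sq_int (%y. phi y * lapl zeta y)"
    using sq_int_test_scaleR[OF p c(2)] sq_int_test_scaleR[OF p c(3)] by simp_all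
  have s3: "sq_int (%y. inner (grad zeta y) (grad phi y))"
    using sq_int_sum[of Basis "%i y. partial i phi y *\<^sub>R partial i zeta y", OF sq_int_test_scaleR[OF test_partial[OF p] smooth_continuous[OF smooth_partial[OF z]]]]
    by (simp add: grad_def inner_sum_right inner_sum_left inner_Basis if_distrib sum.delta mult.commute cong: if_cong)
  note e1 = cls_grad_mult[OF p z]
  have div: "(\<Sum>i\<in>Basis. partial i (%y. phi y * partial i zeta y) y) = inner (grad zeta y) (grad phi y) + phi y * lapl zeta y" for y
  proof -
    have "partial i (%y. phi y * partial i zeta y) y = phi y * partial i (partial i zeta) y + partial i zeta y * partial i phi y" for i
      using inner_grad[OF smooth_mult[OF ps smooth_partial[OF z]], of i y i]
      by (simp add: grad_mult ps smooth_partial z inner_add_left inner_grad)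
    thus ?thesis
      by (simp add: sum.distrib lapl_def sum_distrib_left grad_def[of phi] inner_sum_right inner_grad z mult.commute)
  qed
  \<comment> \<open>The weak gradient of \<open>u\<close>, tested with \<open>phi\<close> times each
    partial derivative of \<open>zeta\<close> and summed over the coordinates.\<close>
  have e2: "inner u (cls (%y. inner (grad zeta y) (grad phi y))) + inner u (cls (%y. phi y * lapl zeta y))
      = - inner U (cls (%y. phi y *\<^sub>R grad zeta y))"
  proof -
    have "(\<Sum>i\<in>Basis. inner u (cls (partial i (%y. phi y * partial i zeta y))))
        = (\<Sum>i\<in>Basis. - inner U (cls (%y. (phi y * partial i zeta y) *\<^sub>R i)))"
      by (intro sum.cong refl weak_gradient[OF u t])
    hence "inner u (cls (%y. \<Sum>i\<in>Basis. partial i (%y. phi y * partial i zeta y) y))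
        = - inner U (cls (%y. \<Sum>i\<in>Basis. (phi y * partial i zeta y) *\<^sub>R i))"
      by (simp add: cls_sum test_sq_int[OF test_partial[OF t]] sq_int_test_scaleR[OF t continuous_on_const]
          inner_sum_right sum_negf)
    moreover have "(\<Sum>i\<in>Basis. (phi y * partial i zeta y) *\<^sub>R i) = phi y *\<^sub>R grad zeta y" for y
      by (simp add: grad_def scaleR_sum_right)
    ultimately show ?thesis by (simp add: div cls_add s2 s3 inner_add_right)
  qed
  have "inner (smul zeta U) (cls (grad phi)) = inner U (cls (grad (%y. zeta y * phi y))) - inner U (cls (%y. phi y *\<^sub>R grad zeta y))"
    by (simp add: inner_smul c e1 inner_add_right)
  also have "inner U (cls (grad (%y. zeta y * phi y))) = - inner (smul zeta g) (cls phi)"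
    using g test_mult[OF p z] test_zero_outside[OF p] unfolding weak_lap_def
    by (simp add: inner_smul c smul_cls test_sq_int[OF p])
  finally have i1: "inner (smul zeta U) (cls (grad phi)) = - inner (smul zeta g) (cls phi) - inner U (cls (%y. phi y *\<^sub>R grad zeta y))" .
  have i2: "inner (dotm (grad zeta) U) (cls phi) = inner U (cls (%y. phi y *\<^sub>R grad zeta y))"
    using inner_vmul[OF c(2), of "cls phi" U] vmul_cls[OF c(2) test_sq_int[OF p] test_zero_outside[OF p]]
    by (simp add: inner_commute)
  have i3: "inner (vmul (grad zeta) u) (cls (grad phi)) = inner u (cls (%y. inner (grad zeta y) (grad phi y)))"
    using inner_vmul[OF c(2), of u "cls (grad phi)"] dotm_cls[OF c(2) grad_sq_int[OF p] grad_zero_outside[OF p]] by simp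
  have i4: "inner (smul (lapl zeta) u) (cls phi) = inner u (cls (%y. phi y * lapl zeta y))"
    using inner_smul[OF c(3), of u "cls phi"] smul_cls[OF c(3) test_sq_int[OF p] test_zero_outside[OF p]]
    by (simp add: mult.commute)
  show "inner (smul zeta U + vmul (grad zeta) u) (cls (grad phi))
      = - inner (smul zeta g + 2 *\<^sub>R dotm (grad zeta) U + smul (lapl zeta) u) (cls phi)"
    unfolding inner_add_left inner_scaleR_left i1 i2 i3 i4 using e2 by linarith
qed

end

text \<open>The measures whose densities are the positive and the negative part agree on boxes, an
  intersection-stable generator, hence everywhere.\<close>

lemma integral_boxes_zero:
  fixes f :: "'a::euclidean_space => real"
  assumes f: "integrable lborel f" and z: "!!a b. (LINT x|lborel. f x * indicator (box a b) x) = 0"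
  shows "AE x in lborel. f x = 0"
proof -
  have [measurable]: "f \<in> borel_measurable borel" using borel_measurable_integrable[OF f] by simp
  let ?P = "%x. ennreal (f x)" and ?N = "%x. ennreal (- f x)"
  have "density lborel ?P = density lborel ?N"
  proof (rule measure_eqI_generator_eq)
    let ?E = "range (%(a, b). box a b :: 'a set)"
    show "Int_stable ?E" by (auto simp: Int_stable_def box_Int_box)
    show "?E \<subseteq> Pow UNIV" "sets (density lborel ?P) = sigma_sets UNIV ?E" "sets (density lborel ?N) = sigma_sets UNIV ?E"
      by (simp_all add: borel_eq_box)
    let ?A = "%n::nat. box (- (real n *\<^sub>R One)) (real n *\<^sub>R One) :: 'a set"
    show "range ?A \<subseteq> ?E" "(\<Union>i. ?A i) = UNIV" unfolding UN_box_eq_UNIV by auto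
    have fin: "(\<integral>\<^sup>+x. ?P x \<partial>lborel) < \<infinity>"
      using f by (simp add: real_integrable_def less_top)
    show "emeasure (density lborel ?P) (?A i) ~= \<infinity>" for i
    proof -
      have "(\<integral>\<^sup>+x. ?P x * indicator (?A i) x \<partial>lborel) <= (\<integral>\<^sup>+x. ?P x \<partial>lborel)"
        by (intro nn_integral_mono) (auto split: split_indicator)
      thus ?thesis using fin by (subst emeasure_density) auto
    qed
    fix X assume "X \<in> ?E"
    then obtain a b where X: "X = box a b" by auto
    have i: "integrable lborel (%x. f x * indicator X x)"
      using f by (intro integrable_real_mult_indicator) (auto simp: X)
    have "(\<integral>\<^sup>+x. ennreal (f x * indicator X x) \<partial>lborel) = (\<integral>\<^sup>+x. ennreal (- (f x * indicator X x)) \<partial>lborel)"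
    proof -
      have "enn2real (\<integral>\<^sup>+x. ennreal (f x * indicator X x) \<partial>lborel) = enn2real (\<integral>\<^sup>+x. ennreal (- (f x * indicator X x)) \<partial>lborel)"
        using real_lebesgue_integral_def[OF i] z[of a b] by (simp add: X)
      thus ?thesis using i unfolding real_integrable_def infinity_ennreal_def less_top by (metis ennreal_enn2real)
    qed
    moreover have "?P x * indicator X x = ennreal (f x * indicator X x)" "?N x * indicator X x = ennreal (- (f x * indicator X x))" for x
      by (auto split: split_indicator)
    ultimately show "emeasure (density lborel ?P) X = emeasure (density lborel ?N) X" by (simp add: emeasure_density X)
  qed
  hence "AE x in lborel. ?P x = ?N x"
    using sigma_finite_measure.density_unique_iff[OF sigma_finite_lborel, of ?P ?N] by simp
  thus ?thesis
  proof eventually_elim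
    case (elim x)
    thus "f x = 0" by (cases "0 <= f x") (auto simp: ennreal_neg ennreal_eq_0_iff)
  qed
qed

text \<open>Redundant half-spaces and parallel faces are permitted; the estimates near the edges
  treat every pair of faces.\<close>

locale polytope_domain =
  fixes J :: "('a::euclidean_space \<times> real) set" and \<Omega> :: "'a set"
  assumes finite_J: "finite J" and unit_normal: "!!j. j \<in> J ==> norm (fst j) = 1"
    and domain: "\<Omega> = {x. \<forall>j\<in>J. inner (fst j) x < snd j}" and bdd: "bounded \<Omega>" and nonempty: "\<Omega> ~= {}"
begin

lemma open_domain: "open \<Omega>"
proof -
  have "\<Omega> = (\<Inter>j\<in>J. {x. inner (fst j) x < snd j})" using domain by auto
  thus ?thesis using finite_J by (auto intro!: open_INT open_halfspace_lt)
qed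

sublocale bounded_open \<Omega> by unfold_locales (rule bdd open_domain)+

text \<open>The intersection of \<Omega> with a box is again a finite intersection of half-spaces,
  so products of smooth steps approximate its indicator by test functions.\<close>

lemma test_dense:
  fixes x :: "('a, real) l2"
  assumes s: "restr x = x" and o: "!!phi. phi \<in> tests ==> inner x (cls phi) = 0"
  shows "x = 0"
proof -
  obtain f where f: "sq_int f" "x = cls f" by (rule l2_cases)
  have [measurable]: "\<Omega> \<in> sets borel" using open_domain by simp
  have iO: "sq_int (indicator \<Omega> :: 'a => real)"
  proof -
    have "emeasure lborel \<Omega> < \<infinity>" by (rule emeasure_bounded_finite[OF bdd])
    hence "integrable lborel (indicator \<Omega> :: 'a => real)" by (intro integrable_real_indicator) auto
    moreover have "(%x. (norm (indicator \<Omega> x :: real))\<^sup>2) = indicator \<Omega>" by (auto simp: indicator_def)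
    ultimately show ?thesis by (simp add: sq_int_def)
  qed
  have f0: "AE y in lborel. f y = (if y \<in> \<Omega> then f y else 0)"
  proof -
    have "cls f = cls (%y. if y \<in> \<Omega> then f y else 0)"
      using s f(1) by (simp add: f(2) smul_def mulop_cls[OF pw_op_id] cong: if_cong)
    thus ?thesis using sq_int_mulop[OF pw_op_id f(1)] f(1) by (subst (asm) cls_eq_iff) auto
  qed
  have "(LINT y|lborel. f y * indicator \<Omega> y * indicator (box a b) y) = 0" for a b
  proof -
    define F where "F = J \<union> (%i. (- i, - inner a i)) ` Basis \<union> (%i. (i, inner b i)) ` Basis"
    have fin: "finite F" using finite_J by (simp add: F_def)
    have box: "y \<in> \<Omega> \<inter> box a b \<longleftrightarrow> (\<forall>j\<in>F. 0 < snd j - inner (fst j) y)" for y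
      unfolding domain by (auto simp: F_def box_def ball_Un inner_commute)
    \<comment> \<open>The offset \<open>- 1\<close> makes a step vanish already at distance
      \<open>1 / n\<close> from its face, so the support is compact inside \<Omega>.\<close>
    define phi where "phi n y = (\<Prod>j\<in>F. step ((real n * snd j - 1) + inner (- real n *\<^sub>R fst j) y))" for n :: nat and y
    have arg: "(real n * snd j - 1) + inner (- real n *\<^sub>R fst j) y = real n * (snd j - inner (fst j) y) - 1" for n j y
      by (simp add: algebra_simps)
    have b: "0 <= phi n y" "phi n y <= 1" for n y
      unfolding phi_def using step_bounds by (auto intro!: prod_nonneg prod_le_1)
    have t: "phi (Suc n) \<in> tests" for n
    proof (rule testI)
      let ?K = "{y. \<forall>j\<in>F. 1 <= real (Suc n) * (snd j - inner (fst j) y)}"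
      show "smooth (phi (Suc n))" unfolding phi_def[abs_def]
        by (intro smooth_prod smooth_compose[OF smooth_step] smooth_affine)
      have sub: "?K \<subseteq> \<Omega> \<inter> box a b"
      proof
        fix y assume "y \<in> ?K"
        have "0 < snd j - inner (fst j) y" if "j \<in> F" for j
        proof (rule ccontr)
          assume "\<not> ?thesis"
          hence "real (Suc n) * (snd j - inner (fst j) y) <= 0" by (intro mult_nonneg_nonpos) auto
          moreover have "1 <= real (Suc n) * (snd j - inner (fst j) y)" using \<open>y \<in> ?K\<close> that by blast
          ultimately show False by linarith
        qed
        thus "y \<in> \<Omega> \<inter> box a b" using box by blast
      qed
      have "?K = (\<Inter>j\<in>F. {y. 1 <= real (Suc n) * (snd j - inner (fst j) y)})" by auto
      hence "closed ?K" by (auto intro!: closed_INT closed_Collect_le continuous_intros simp del: of_nat_Suc)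
      thus "compact ?K" using sub bdd by (auto simp: compact_eq_bounded_closed intro: bounded_subset)
      show "?K \<subseteq> \<Omega>" using sub by auto
      show "phi (Suc n) y = 0" if y: "y \<notin> ?K" for y
      proof -
        obtain j where j: "j \<in> F" "real (Suc n) * (snd j - inner (fst j) y) < 1" using y by auto
        have "step ((real (Suc n) * snd j - 1) + inner (- real (Suc n) *\<^sub>R fst j) y) = 0"
          unfolding arg using j(2) by (intro step_le_0) simp
        thus ?thesis unfolding phi_def using j(1) fin by (intro prod_zero) auto
      qed
    qed
    have lim: "(%n. phi (Suc n) y) \<longlonglongrightarrow> indicator (\<Omega> \<inter> box a b) y" for y
    proof (cases "y \<in> \<Omega> \<inter> box a b")
      case True
      have "\<forall>\<^sub>F n in sequentially. \<forall>j\<in>F. 2 <= real n * (snd j - inner (fst j) y)" using fin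
      proof (rule eventually_ball_finite, intro ballI)
        fix j assume "j \<in> F"
        hence "0 < snd j - inner (fst j) y" using True box by blast
        hence "filterlim (%n. real n * (snd j - inner (fst j) y)) at_top sequentially"
          by (intro filterlim_at_top_mult_tendsto_pos[OF tendsto_const _ filterlim_real_sequentially])
        thus "\<forall>\<^sub>F n in sequentially. 2 <= real n * (snd j - inner (fst j) y)" by (simp add: filterlim_at_top)
      qed
      hence "\<forall>\<^sub>F n in sequentially. phi n y = 1"
      proof eventually_elim
        case (elim n)
        thus ?case unfolding phi_def arg by (intro prod.neutral ballI step_ge_1) fastforce
      qed
      hence "(%n. phi n y) \<longlonglongrightarrow> 1" by (rule tendsto_eventually)
      from LIMSEQ_Suc[OF this] show ?thesis using True by simp
    next
      case False
      hence "\<not> (\<forall>j\<in>F. 0 < snd j - inner (fst j) y)" using box[of y] by blast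
      then obtain j where j: "j \<in> F" "snd j - inner (fst j) y <= 0" by (auto simp: not_less)
      have "phi n y = 0" for n
      proof -
        have "real n * (snd j - inner (fst j) y) <= 0" using j(2) by (simp add: mult_nonneg_nonpos)
        hence "step ((real n * snd j - 1) + inner (- real n *\<^sub>R fst j) y) = 0"
          unfolding arg by (intro step_le_0) linarith
        thus ?thesis unfolding phi_def using j(1) fin by (intro prod_zero) auto
      qed
      thus ?thesis using False by (auto simp: indicator_def)
    qed
    have iB: "sq_int (indicator (\<Omega> \<inter> box a b) :: 'a => real)"
      by (rule sq_int_bound[OF iO, where C = 1]) (auto simp: indicator_def)
    have "(%n. cls (phi (Suc n))) \<longlonglongrightarrow> cls (indicator (\<Omega> \<inter> box a b))"
      by (rule cls_dominated[OF test_sq_int[OF t] iB iO])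
        (use lim b test_zero_outside[OF t] in \<open>auto simp: indicator_def\<close>)
    hence "(%n. inner x (cls (phi (Suc n)))) \<longlonglongrightarrow> inner x (cls (indicator (\<Omega> \<inter> box a b)))"
      by (intro tendsto_intros)
    hence "inner x (cls (indicator (\<Omega> \<inter> box a b))) = 0" using o[OF t] by (simp add: LIMSEQ_const_iff)
    thus ?thesis by (simp add: f(2) inner_cls f(1) iB indicator_inter_arith mult.assoc)
  qed
  moreover have "integrable lborel (%y. f y * indicator \<Omega> y)" using sq_int_inner[OF f(1) iO] by simp
  ultimately have "AE y in lborel. f y * indicator \<Omega> y = 0" by (intro integral_boxes_zero)
  hence "AE y in lborel. f y = 0" using f0 by eventually_elim (auto split: if_splits)
  thus ?thesis unfolding f(2) cls_0[symmetric] by (simp add: cls_eq_iff f sq_int_0)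
qed

end

section \<open>A Hardy inequality near the edges\<close>

text \<open>With the vector field \<open>F = A d (d / s, - 1)\<close> one has
  \<open>p |\<nabla>f|\<^sup>2 + f \<nabla>f \<cdot> \<nabla>p - div (f\<^sup>2 p F) = p |\<nabla>f + f (\<nabla>p / (2 p) - F)|\<^sup>2 + p f\<^sup>2 (- div F - |F|\<^sup>2) - f\<^sup>2 |\<nabla>p|\<^sup>2 / (4 p)\<close>;
  the parameter \<open>kap > 0\<close> in \<open>A = 1 / (s\<^sup>2 + d\<^sup>2) + kap / s\<^sup>2\<close> provides the gain over the critical constant of the Hardy inequality in
  codimension two, and is available because \<open>|d| / s\<close> is bounded, that is, because the wedge is
  strictly smaller than a half-space.\<close>

lemma hardy_pointwise:
  fixes X Y f s d eps kap :: real
  assumes s: "0 < s" and k: "0 < kap" "kap * d\<^sup>2 <= s\<^sup>2 / 2" and e: "0 < eps"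
    and u: "u = inverse s" and rr: "rr = inverse (s\<^sup>2 + d\<^sup>2)" and p: "p = inverse (s\<^sup>2 + d\<^sup>2 + eps\<^sup>2)"
    and A: "A = rr + kap * u\<^sup>2"
  shows "kap / 2 * (p * f)\<^sup>2 <= p * (X\<^sup>2 + Y\<^sup>2) - 2 * p\<^sup>2 * f * (s * X + d * Y)
    - (2 * f * X * (p * A * d\<^sup>2 * u) + f\<^sup>2 * (- 2 * s * p\<^sup>2 * A * d\<^sup>2 * u + p * (- 2 * s * rr\<^sup>2 - 2 * kap * u ^ 3) * d\<^sup>2 * u - p * A * d\<^sup>2 * u\<^sup>2))
    - (2 * f * Y * (- p * A * d) + f\<^sup>2 * (2 * d * p\<^sup>2 * A * d + p * (2 * d * rr\<^sup>2) * d - p * A))"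
proof -
  let ?Fs = "A * d\<^sup>2 * u" and ?Fd = "- A * d"
  define D where "D = (- 2 * s * rr\<^sup>2 - 2 * kap * u ^ 3) * d\<^sup>2 * u - A * d\<^sup>2 * u\<^sup>2 + 2 * d * rr\<^sup>2 * d - A"
  define S where "S = ?Fs\<^sup>2 + ?Fd\<^sup>2"
  define r2 where "r2 = s\<^sup>2 + d\<^sup>2"
  \<comment> \<open>Here \<open>t = 1 + (d / s)^2\<close>. In this variable
    \<open>r2 (- D - S)\<close> becomes \<open>1 + kap t^2 (1 - kap (t - 1))\<close>, and the
    hypothesis on \<open>kap\<close> keeps the last bracket at least \<open>1 / 2\<close>.\<close>
  define t where "t = r2 * u\<^sup>2"
  have pos: "0 < r2" "0 < p" "0 < u" "s * u = 1" "r2 * rr = 1" using s e u rr p by (auto simp: r2_def add_pos_nonneg)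
  have dt: "d\<^sup>2 * u\<^sup>2 = t - 1"
  proof -
    have "s\<^sup>2 * u\<^sup>2 = 1" using pos(4) by (metis power_mult_distrib power_one)
    thus ?thesis by (simp add: t_def r2_def algebra_simps)
  qed
  have "kap * (t - 1) <= 1 / 2"
  proof -
    have "kap * d\<^sup>2 * u\<^sup>2 <= s\<^sup>2 / 2 * u\<^sup>2" using k(2) by (intro mult_right_mono) auto
    also have "... = 1 / 2" using pos(4) by (simp add: power_mult_distrib[symmetric])
    finally show ?thesis using dt by (simp add: mult.assoc)
  qed
  moreover have t1: "1 <= t" using dt by (metis diff_ge_0_iff_ge zero_le_mult_iff zero_le_power2)
  ultimately have "1 * (1 / 2) <= t\<^sup>2 * (1 - kap * (t - 1))" by (intro mult_mono one_le_power) auto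
  from mult_left_mono[OF this, of kap] have k2: "1 + kap / 2 <= 1 + kap * (t\<^sup>2 * (1 - kap * (t - 1)))" using k(1) by simp
  have "r2 * (- D - S) = 1 + kap * (t\<^sup>2 * (1 - kap * (t - 1)))"
  proof -
    have rA: "r2 * A = 1 + kap * t" using pos(5) by (simp add: A t_def algebra_simps)
    have "D = - 2 * (s * u) * rr\<^sup>2 * d\<^sup>2 - 2 * kap * u\<^sup>2 * (d\<^sup>2 * u\<^sup>2) - A * (d\<^sup>2 * u\<^sup>2) + 2 * rr\<^sup>2 * d\<^sup>2 - A"
      by (simp add: D_def algebra_simps power2_eq_square power3_eq_cube)
    also have "... = - 2 * kap * u\<^sup>2 * (t - 1) - A * t" unfolding pos(4) dt by (simp add: algebra_simps)
    finally have Deq: "D = - 2 * kap * u\<^sup>2 * (t - 1) - A * t" .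
    have rD: "r2 * (- D) = 2 * kap * t * (t - 1) + (r2 * A) * t" unfolding Deq by (simp add: t_def algebra_simps)
    have rS: "r2 * S = (r2 * A)\<^sup>2 * (t - 1)"
    proof -
      have "S = A\<^sup>2 * d\<^sup>2 * (d\<^sup>2 * u\<^sup>2 + 1)" by (simp add: S_def power_mult_distrib algebra_simps power2_eq_square)
      also have "... = A\<^sup>2 * d\<^sup>2 * (r2 * u\<^sup>2)" unfolding dt by (simp add: t_def)
      finally have "r2 * S = (r2 * A)\<^sup>2 * (d\<^sup>2 * u\<^sup>2)" by (simp add: power_mult_distrib power2_eq_square)
      thus ?thesis unfolding dt .
    qed
    show ?thesis unfolding right_diff_distrib rD rS rA by (simp add: algebra_simps power2_eq_square)
  qed
  hence main: "1 + kap / 2 <= r2 * (- D - S)" using k2 by simp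
  have pr: "p * r2 <= 1" using pos e by (simp add: p r2_def field_simps add_pos_pos)
  have "(1 + kap / 2) * p <= - D - S"
  proof -
    have "(1 + kap / 2) * p <= (1 + kap / 2) * rr"
      using k(1) e s by (intro mult_left_mono) (auto simp: p rr intro!: le_imp_inverse_le add_pos_nonneg)
    also have "... <= r2 * (- D - S) * rr" using main pos(1,5) by (intro mult_right_mono) (auto simp: rr r2_def)
    also have "... = (r2 * rr) * (- D - S)" by (simp only: mult_ac)
    also have "... = - D - S" by (simp only: pos(5) mult_1) finally show ?thesis .
  qed
  moreover have "p\<^sup>2 * r2 <= p" using mult_left_mono[OF pr, of p] pos by (simp add: power2_eq_square mult.assoc)
  ultimately have "kap / 2 * p <= (- D - S) - p\<^sup>2 * r2" by (simp add: algebra_simps)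
  hence "p * f\<^sup>2 * (kap / 2 * p) <= p * f\<^sup>2 * ((- D - S) - p\<^sup>2 * r2)"
    using pos by (intro mult_left_mono) auto
  moreover have "0 <= p * (X + f * (- s * p - ?Fs))\<^sup>2 + p * (Y + f * (- d * p - ?Fd))\<^sup>2" using pos by simp
  ultimately show ?thesis by (simp add: r2_def D_def S_def algebra_simps power2_eq_square)
qed

lemma smooth_minus: "smooth f ==> smooth (%x. - f x)"
  using smooth_mult[OF smooth_const, of f "- 1"] by simp

lemma grad_minus: "smooth f ==> grad (%x. - f x) x = - grad f x"
  using grad_mult[OF smooth_const, of f "- 1" x] by (simp add: grad_const)

lemma inverse_has_derivative:
  "smooth f ==> f x ~= 0 ==>
    ((%x. inverse (f x)) has_derivative (%a. inner ((- (inverse (f x))\<^sup>2) *\<^sub>R grad f x) a)) (at x)"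
  by (auto intro!: derivative_eq_intros smooth_has_derivative simp: power2_eq_square)

text \<open>Coordinates in the plane orthogonal to an edge: \<open>s\<close> along the axis of the
  wedge, \<open>d\<close> across it. The bound on \<open>|d| / s\<close> confines \<Omega> to an
  opening angle below \<open>pi\<close>. The edge is \<open>s = d = 0\<close>, \<open>r2\<close> is
  the squared distance to it, and \<open>p eps\<close> regularises \<open>1 / r2\<close>.\<close>

locale wedge = bounded_open \<Omega> for \<Omega> :: "'a::euclidean_space set" +
  fixes e e' :: 'a and s0 d0 C :: real
  assumes orthonormal: "norm e = 1" "norm e' = 1" "inner e e' = 0"
    and s_pos: "!!x. x \<in> \<Omega> ==> 0 < s0 + inner e x"
    and d_le: "!!x. x \<in> \<Omega> ==> \<bar>d0 + inner e' x\<bar> <= C * (s0 + inner e x)"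
begin

definition s :: "'a => real" where "s x = s0 + inner e x"
definition d :: "'a => real" where "d x = d0 + inner e' x"
definition r2 :: "'a => real" where "r2 x = s x * s x + d x * d x"
definition p :: "real => 'a => real" where "p eps x = inverse (r2 x + eps\<^sup>2)"

lemma ee: "inner e e = 1" "inner e' e' = 1" "inner e e' = 0" "inner e' e = 0"
  using orthonormal by (simp_all add: norm_eq_1 inner_commute)

lemma smooth_s: "smooth s" and smooth_d: "smooth d" and smooth_r2: "smooth r2"
  unfolding s_def[abs_def] d_def[abs_def] r2_def[abs_def] by (intro smooth_intros)+

lemma grad_s: "grad s x = e" and grad_d: "grad d x = e'" unfolding s_def[abs_def] d_def[abs_def] by (rule grad_affine)+

lemma grad_r2: "grad r2 x = (2 * s x) *\<^sub>R e + (2 * d x) *\<^sub>R e'"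
proof -
  have "grad r2 x = grad (%x. s x * s x + d x * d x) x" by (simp add: r2_def[abs_def])
  thus ?thesis by (simp add: grad_add grad_mult smooth_mult smooth_s smooth_d grad_s grad_d scaleR_2[symmetric])
qed

lemma r2_nonneg: "0 <= r2 x" by (simp add: r2_def)

lemma p_pos: "0 < eps ==> 0 < p eps x"
  using r2_nonneg[of x] by (simp add: p_def add_nonneg_pos)

lemma smooth_p: "0 < eps ==> smooth (p eps)" unfolding p_def[abs_def] using r2_nonneg
  by (intro smooth_inverse smooth_add smooth_r2 smooth_const) (metis add_nonneg_pos order_less_irrefl zero_less_power)

lemma grad_p: "0 < eps ==> grad (p eps) x = (- 2 * (p eps x)\<^sup>2) *\<^sub>R (s x *\<^sub>R e + d x *\<^sub>R e')"
proof -
  assume e: "0 < eps"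
  have "grad (p eps) x = (- (p eps x)\<^sup>2) *\<^sub>R grad (%x. r2 x + eps\<^sup>2) x"
    unfolding p_def[abs_def] using r2_nonneg[of x] e
    by (intro grad_inverse smooth_add smooth_r2 smooth_const) (metis add_nonneg_pos order_less_irrefl zero_less_power)
  thus ?thesis by (simp add: grad_add smooth_r2 smooth_const grad_const grad_r2 algebra_simps)
qed

lemma norm_grad_p:
  assumes "0 < eps" shows "(norm (grad (p eps) x))\<^sup>2 <= 4 * (p eps x) ^ 3"
proof -
  have "(norm (grad (p eps) x))\<^sup>2 = 4 * (p eps x) ^ 3 * (p eps x * r2 x)"
    unfolding grad_p[OF assms] power2_norm_eq_inner r2_def
    by (simp add: inner_add_left inner_add_right ee algebra_simps power2_eq_square power3_eq_cube)
  also have "... <= 4 * (p eps x) ^ 3 * 1" using p_pos[OF assms, of x] r2_nonneg[of x] assms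
    by (intro mult_left_mono) (auto simp: p_def field_simps add_nonneg_pos) finally show ?thesis by simp
qed

text \<open>Replacing \<open>1 / s\<close> away from the support of the test function by a function that is smooth everywhere.\<close>

lemma test_inverse_s:
  assumes "phi \<in> tests"
  obtains c u rr where "smooth u" "smooth rr" "!!x. phi x ~= 0 ==> c < s x" "0 < c"
    "!!x. c < s x ==> u x = inverse (s x)" "!!x. c < s x ==> rr x = inverse (r2 x)"
proof -
  obtain K where K: "compact K" "K \<subseteq> \<Omega>" "!!x. x \<notin> K ==> phi x = 0" using test_support[OF assms] by metis
  obtain c where c: "0 < c" "!!x. x \<in> K ==> c < s x"
  proof (cases "K = {}")
    case False
    have "continuous_on K s" by (rule smooth_continuous[OF smooth_s])
    then obtain z where z: "z \<in> K" "!!x. x \<in> K ==> s z <= s x" using continuous_attains_inf[OF K(1) False] by metis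
    moreover have "0 < s z" using z(1) K(2) s_pos by (auto simp: s_def)
    ultimately show ?thesis using that[of "s z / 2"] by fastforce
  qed (use that[of 1] in auto)
  define \<sigma> where "\<sigma> x = step (- 1 + inner (2 / c) (s x))" for x
  have \<sigma>1: "smooth \<sigma>" unfolding \<sigma>_def[abs_def]
    by (rule smooth_compose[OF smooth_compose[OF smooth_step smooth_affine] smooth_s])
  have \<sigma>: "\<sigma> x <= 1" "s x <= 0 ==> \<sigma> x = 0" "c < s x ==> \<sigma> x = 1" for x
    unfolding \<sigma>_def[abs_def] using c(1)
    by (auto intro!: step_bounds step_le_0 step_ge_1 simp: field_simps divide_nonpos_pos)
  have nz: "s x * s x + (1 - \<sigma> x) ~= 0" "r2 x + (1 - \<sigma> x) ~= 0" for x
  proof -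
    have "0 < s x * s x + (1 - \<sigma> x)"
      using \<sigma>(1,2)[of x] by (cases "s x = 0") (auto intro!: add_pos_nonneg simp: not_real_square_gt_zero zero_less_mult_iff)
    moreover have "s x * s x <= r2 x" by (simp add: r2_def)
    ultimately show "s x * s x + (1 - \<sigma> x) ~= 0" "r2 x + (1 - \<sigma> x) ~= 0" by linarith+
  qed
  show ?thesis
  proof (rule that)
    show "smooth (%x. s x * inverse (s x * s x + (1 - \<sigma> x)))" "smooth (%x. inverse (r2 x + (1 - \<sigma> x)))"
      using nz by (auto intro!: smooth_mult smooth_inverse smooth_add smooth_diff smooth_const smooth_s smooth_r2 \<sigma>1)
    show "s x * inverse (s x * s x + (1 - \<sigma> x)) = inverse (s x)" "inverse (r2 x + (1 - \<sigma> x)) = inverse (r2 x)"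
      if "c < s x" for x using that \<sigma>(3)[OF that] c(1) by (auto simp: field_simps)
  qed (use c K in auto)
qed

text \<open>\<open>hardy_pointwise\<close>, integrated. The divergence terms vanish by integration
  by parts in the directions \<open>e\<close> and \<open>e'\<close>, applied to \<open>phi\<close>
  and the test functions \<open>hs phi\<close> and \<open>hd phi\<close>.\<close>

lemma hardy_test:
  assumes phi: "phi \<in> tests" and k: "0 < kap" "kap * C\<^sup>2 <= 1 / 2" and e: "0 < eps"
  shows "kap / 2 * (norm (cls (%x. p eps x * phi x)))\<^sup>2 <= inner (cls (grad phi)) (cls (grad (%x. p eps x * phi x)))"
proof -
  obtain c u rr where sm: "smooth u" "smooth rr" and c: "!!x. phi x ~= 0 ==> c < s x" "0 < c"
    and u: "!!x. c < s x ==> u x = inverse (s x)" and rr: "!!x. c < s x ==> rr x = inverse (r2 x)"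
    using test_inverse_s[OF phi] by metis
  note sp = smooth_p[OF e] and ps = test_smooth[OF phi]
  define A where "A x = rr x + kap * (u x * u x)" for x
  have sA: "smooth A" unfolding A_def[abs_def] by (intro smooth_intros sm)
  have op: "open {x. c < s x}" by (intro open_Collect_less continuous_intros smooth_continuous smooth_s)
  have gu: "grad u x = (- (u x * u x)) *\<^sub>R e" if "c < s x" for x
  proof (rule gradI)
    have "((%x. inverse (s x)) has_derivative (%a. inner ((- (u x * u x)) *\<^sub>R e) a)) (at x)"
      using inverse_has_derivative[OF smooth_s, of x] that c(2) by (simp add: grad_s u power2_eq_square)
    thus "(u has_derivative (%a. inner ((- (u x * u x)) *\<^sub>R e) a)) (at x)"
      by (rule has_derivative_transform_within_open[OF _ op]) (use that u in auto)
  qed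
  have grr: "grad rr x = (- (rr x * rr x)) *\<^sub>R grad r2 x" if "c < s x" for x
  proof (rule gradI)
    have "0 < r2 x" using that c(2) by (auto simp: r2_def intro!: add_pos_nonneg mult_pos_pos)
    hence "((%x. inverse (r2 x)) has_derivative (%a. inner ((- (rr x * rr x)) *\<^sub>R grad r2 x) a)) (at x)"
      using inverse_has_derivative[OF smooth_r2, of x] that by (simp add: rr power2_eq_square)
    thus "(rr has_derivative (%a. inner ((- (rr x * rr x)) *\<^sub>R grad r2 x) a)) (at x)"
      by (rule has_derivative_transform_within_open[OF _ op]) (use that rr in auto)
  qed
  define hs hd where "hs x = p eps x * (A x * (d x * (d x * u x)))" and "hd x = - (p eps x * (A x * d x))" for x
  have shs: "smooth hs" and shd: "smooth hd"
    unfolding hs_def[abs_def] hd_def[abs_def] by (intro smooth_minus smooth_mult sp sA smooth_d sm)+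
  have gA: "inner (grad A x) e = - 2 * s x * (rr x)\<^sup>2 - 2 * kap * u x ^ 3" "inner (grad A x) e' = - 2 * d x * (rr x)\<^sup>2"
    if "c < s x" for x
  proof -
    have "grad A x = grad rr x + kap *\<^sub>R (u x *\<^sub>R grad u x + u x *\<^sub>R grad u x)"
      unfolding A_def[abs_def] using sm by (simp add: grad_add grad_mult smooth_mult smooth_const grad_const)
    thus "inner (grad A x) e = - 2 * s x * (rr x)\<^sup>2 - 2 * kap * u x ^ 3" "inner (grad A x) e' = - 2 * d x * (rr x)\<^sup>2"
      by (simp_all add: gu grr that grad_r2 inner_add_left inner_diff_left ee power2_eq_square power3_eq_cube)
  qed
  have dhs: "inner (grad hs x) e = - 2 * s x * (p eps x)\<^sup>2 * A x * (d x)\<^sup>2 * u x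
      + p eps x * (- 2 * s x * (rr x)\<^sup>2 - 2 * kap * u x ^ 3) * (d x)\<^sup>2 * u x - p eps x * A x * (d x)\<^sup>2 * (u x)\<^sup>2" if "c < s x" for x
    unfolding hs_def[abs_def] using sm sA sp
    by (simp add: grad_mult smooth_mult smooth_d grad_d gu gA grad_p[OF e] that inner_add_left ee)
      (simp add: algebra_simps power2_eq_square inner_add_left gA that ee)
  have dhd: "inner (grad hd x) e' = 2 * d x * (p eps x)\<^sup>2 * A x * d x + p eps x * (2 * d x * (rr x)\<^sup>2) * d x - p eps x * A x" if "c < s x" for x
    unfolding hd_def[abs_def] using sm sA sp
    by (simp add: grad_minus grad_mult smooth_mult smooth_d grad_d gA grad_p[OF e] that inner_add_left ee)
      (simp add: algebra_simps power2_eq_square inner_add_left gA that ee)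
  have ths: "(%x. hs x * phi x) \<in> tests" and thd: "(%x. hd x * phi x) \<in> tests"
    and tp: "(%x. p eps x * phi x) \<in> tests" using test_mult[OF phi] shs shd sp by blast+
  have pw: "kap / 2 * (p eps x * phi x)\<^sup>2 <= inner (grad phi x) (grad (%x. p eps x * phi x) x)
      - (partial e phi x * (hs x * phi x) + phi x * partial e (%x. hs x * phi x) x)
      - (partial e' phi x * (hd x * phi x) + phi x * partial e' (%x. hd x * phi x) x)" for x
  proof (cases "phi x = 0")
    case True
    thus ?thesis using p_pos[OF e, of x] by (simp add: grad_mult sp ps)
  next
    case False
    hence cs: "c < s x" and xO: "x \<in> \<Omega>" using c test_zero_outside[OF phi] by auto
    define X Y where "X = inner (grad phi x) e" and "Y = inner (grad phi x) e'"
    \<comment> \<open>Only the two components of the gradient in the plane of the wedge enter the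
      estimate.\<close>
    have bessel: "X\<^sup>2 + Y\<^sup>2 <= (norm (grad phi x))\<^sup>2"
    proof -
      have "0 <= (norm (grad phi x - X *\<^sub>R e - Y *\<^sub>R e'))\<^sup>2" by simp
      thus ?thesis unfolding power2_norm_eq_inner X_def Y_def
        by (simp add: inner_diff_left inner_diff_right ee inner_commute[of e "grad _ _"] inner_commute[of e' "grad _ _"]
            power2_eq_square algebra_simps)
    qed
    have k': "kap * (d x)\<^sup>2 <= (s x)\<^sup>2 / 2"
    proof -
      have "(d x)\<^sup>2 <= (C * s x)\<^sup>2" using power_mono[OF d_le[OF xO], of 2] by (simp add: s_def d_def)
      hence "kap * (d x)\<^sup>2 <= (kap * C\<^sup>2) * (s x)\<^sup>2" using k(1) by (simp add: power_mult_distrib)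
      also have "... <= 1 / 2 * (s x)\<^sup>2" using k(2) by (intro mult_right_mono) auto
      finally show ?thesis by simp
    qed
    have "kap / 2 * (p eps x * phi x)\<^sup>2 <= p eps x * (X\<^sup>2 + Y\<^sup>2) - 2 * (p eps x)\<^sup>2 * phi x * (s x * X + d x * Y)
      - (2 * phi x * X * hs x + (phi x)\<^sup>2 * inner (grad hs x) e) - (2 * phi x * Y * hd x + (phi x)\<^sup>2 * inner (grad hd x) e')"
      unfolding dhs[OF cs] dhd[OF cs]
      using hardy_pointwise[OF _ k(1) k' e u[OF cs] rr[OF cs, unfolded r2_def, folded power2_eq_square]
          p_def[of eps x, unfolded r2_def, folded power2_eq_square] A_def[of x, folded power2_eq_square], of "phi x" X Y] cs c(2)
      by (simp add: hs_def hd_def power2_eq_square mult.assoc)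
    also have "... <= p eps x * (norm (grad phi x))\<^sup>2 - 2 * (p eps x)\<^sup>2 * phi x * (s x * X + d x * Y)
      - (2 * phi x * X * hs x + (phi x)\<^sup>2 * inner (grad hs x) e) - (2 * phi x * Y * hd x + (phi x)\<^sup>2 * inner (grad hd x) e')"
      using mult_left_mono[OF bessel, of "p eps x"] p_pos[OF e, of x] by simp
    also have "... = inner (grad phi x) (grad (%x. p eps x * phi x) x)
      - (partial e phi x * (hs x * phi x) + phi x * inner (grad (%x. hs x * phi x) x) e)
      - (partial e' phi x * (hd x * phi x) + phi x * inner (grad (%x. hd x * phi x) x) e')"
      by (simp add: grad_mult sp ps shs shd grad_p[OF e] inner_add_left inner_add_right inner_grad[OF ps, symmetric] X_def Y_def power2_norm_eq_inner)
        (simp add: algebra_simps power2_eq_square)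
    finally show ?thesis using inner_grad[OF test_smooth[OF ths]] inner_grad[OF test_smooth[OF thd]] by simp
  qed
  note ti = test_sq_int[OF phi] test_sq_int[OF tp] test_sq_int[OF ths] test_sq_int[OF thd] grad_sq_int[OF phi] grad_sq_int[OF tp]
    test_sq_int[OF test_partial[OF phi]] test_sq_int[OF test_partial[OF ths]] test_sq_int[OF test_partial[OF thd]]
  note ii = sq_int_inner[OF ti(2) ti(2), simplified] sq_int_inner[OF ti(5) ti(6)] sq_int_inner[OF ti(7) ti(3), simplified]
    sq_int_inner[OF ti(1) ti(8), simplified] sq_int_inner[OF ti(7) ti(4), simplified] sq_int_inner[OF ti(1) ti(9), simplified]
  have "(LINT x|lborel. kap / 2 * (p eps x * phi x)\<^sup>2) <= (LINT x|lborel. inner (grad phi x) (grad (%x. p eps x * phi x) x)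
      - (partial e phi x * (hs x * phi x) + phi x * partial e (%x. hs x * phi x) x)
      - (partial e' phi x * (hd x * phi x) + phi x * partial e' (%x. hd x * phi x) x))"
    by (rule integral_mono[OF _ _ pw])
      (use ii(1) in \<open>simp add: power2_eq_square\<close>, intro Bochner_Integration.integrable_diff Bochner_Integration.integrable_add ii)
  also have "... = inner (cls (grad phi)) (cls (grad (%x. p eps x * phi x)))
      - (inner (cls (partial e phi)) (cls (%x. hs x * phi x)) + inner (cls phi) (cls (partial e (%x. hs x * phi x))))
      - (inner (cls (partial e' phi)) (cls (%x. hd x * phi x)) + inner (cls phi) (cls (partial e' (%x. hd x * phi x))))"
    by (simp add: inner_cls ti ii Bochner_Integration.integral_diff Bochner_Integration.integral_add)
  also have "... = inner (cls (grad phi)) (cls (grad (%x. p eps x * phi x)))"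
    using integration_by_parts[OF phi ths, of e] integration_by_parts[OF phi thd, of e'] by simp
  finally show ?thesis by (simp add: norm_cls ti(2))
qed

lemma hardy:
  assumes u: "(u, U) \<in> H10_graph" and k: "0 < kap" "kap * C\<^sup>2 <= 1 / 2" and e: "0 < eps"
  shows "kap / 2 * (norm (smul (p eps) u))\<^sup>2 <= inner U (smul (p eps) U + vmul (grad (p eps)) u)"
proof (rule H10_graph_closed[OF u])
  note c = smooth_continuous[OF smooth_p[OF e]] continuous_grad[OF smooth_p[OF e]]
  show "closed {z. kap / 2 * (norm (smul (p eps) (fst z :: ('a, real) l2)))\<^sup>2
      <= inner (snd z) (smul (p eps) (snd z) + vmul (grad (p eps)) (fst z))}"
    by (intro closed_Collect_le continuous_intros bounded_linear.continuous_on[OF bounded_linear_smul]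
        bounded_linear.continuous_on[OF bounded_linear_vmul] c)
  fix phi assume phi: "phi \<in> tests"
  have "smul (p eps) (cls phi) = cls (%y. p eps y * phi y)"
    using test_zero_outside[OF phi] by (simp add: smul_cls test_sq_int[OF phi] c)
  thus "kap / 2 * (norm (smul (p eps) (cls phi)))\<^sup>2
      <= inner (cls (grad phi)) (smul (p eps) (cls (grad phi)) + vmul (grad (p eps)) (cls phi))"
    using hardy_test[OF phi k e] cls_grad_mult[OF phi smooth_p[OF e]] test_zero_outside[OF phi]
    by (simp add: vmul_cls test_sq_int[OF phi] c)
qed

text \<open>Testing the equation with \<open>p u\<close>, the Hardy inequality bounds
  \<open>p u\<close> by the data. The weighted energy follows once the term with
  \<open>grad p\<close> is absorbed, using Young's inequality and
  \<open>|grad p|^2 \<le> 4 p^3\<close>. The point is that \<open>M\<close> does not depend on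
  \<open>eps\<close>.\<close>

lemma weighted_bounds:
  obtains M where "!!eps u U g. 0 < eps ==> (u, U) \<in> H10_graph ==> weak_lap U g ==>
    norm (smul (p eps) u) <= M * norm g \<and> inner U (smul (p eps) U) <= M * (norm g)\<^sup>2"
proof -
  \<comment> \<open>The summand 1 keeps the denominator positive when \<open>C = 0\<close>.\<close>
  define kap where "kap = 1 / (2 * (C\<^sup>2 + 1))"
  have "0 < C\<^sup>2 + 1" by (intro add_nonneg_pos) auto
  hence k: "0 < kap" "kap * C\<^sup>2 <= 1 / 2" by (simp_all add: kap_def divide_le_eq)
  define M1 where "M1 = 2 / kap"
  have M1: "0 <= M1" using k by (simp add: M1_def)
  define M where "M = max M1 (2 * M1 + 4 * M1\<^sup>2)"
  have "norm (smul (p eps) u) <= M * norm g \<and> inner U (smul (p eps) U) <= M * (norm g)\<^sup>2"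
    if e: "0 < eps" and u: "(u, U) \<in> H10_graph" and g: "weak_lap U g" for eps u U g
  proof -
    note c = smooth_continuous[OF smooth_p[OF e]] continuous_grad[OF smooth_p[OF e]]
    let ?n = "norm (smul (p eps) u)" and ?V = "vmul (grad (p eps)) u"
    have eq: "inner U (smul (p eps) U + ?V) = - inner g (smul (p eps) u)"
      by (rule weak_lap_H10[OF g H10_graph_mult[OF u smooth_p[OF e]]])
    have cs: "\<bar>inner g (smul (p eps) u)\<bar> <= norm g * ?n" by (rule Cauchy_Schwarz_ineq2)
    have "kap / 2 * ?n\<^sup>2 <= norm g * ?n" using hardy[OF u k e] eq cs by linarith
    hence "?n * (kap / 2 * ?n) <= ?n * norm g" by (simp add: power2_eq_square algebra_simps)
    hence "?n = 0 \<or> kap / 2 * ?n <= norm g" using norm_ge_zero[of "smul (p eps) u"] by (metis less_eq_real_def mult_le_cancel_left_pos)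
    hence n: "?n <= M1 * norm g" using k(1) M1 by (auto simp: M1_def field_simps)
    obtain f where f: "sq_int f" "u = cls f" by (rule l2_cases)
    obtain h where h: "sq_int h" "U = cls h" by (rule l2_cases)
    have "\<bar>inner U ?V\<bar> <= 1 / 2 * inner U (smul (p eps) U) + 2 * ?n\<^sup>2"
    proof -
      let ?a = "%y. if y \<in> \<Omega> then f y *\<^sub>R grad (p eps) y else 0" and ?b = "%y. if y \<in> \<Omega> then p eps y *\<^sub>R h y else 0"
        and ?d = "%y. if y \<in> \<Omega> then p eps y *\<^sub>R f y else 0"
      have sq: "sq_int ?a" "sq_int ?b" "sq_int ?d"
        using sq_int_mulop[OF pw_op_vec[OF c(2)] f(1)] sq_int_mulop[OF pw_op_mult[OF c(1)] h(1)]
          sq_int_mulop[OF pw_op_mult[OF c(1)] f(1)] by auto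
      have pw: "\<bar>inner (h y) (?a y)\<bar> <= 1 / 2 * inner (h y) (?b y) + 2 * (norm (?d y))\<^sup>2" for y
      proof (cases "y \<in> \<Omega>")
        case True
        define P where "P = p eps y"
        have P: "0 < P" using p_pos[OF e] by (simp add: P_def)
        define w where "w = inner (h y) (?a y)"
        have "w\<^sup>2 <= (norm (h y))\<^sup>2 * (norm (?a y))\<^sup>2"
          using Cauchy_Schwarz_ineq[of "h y" "?a y"] by (simp add: w_def power2_norm_eq_inner)
        also have "(norm (?a y))\<^sup>2 <= (f y)\<^sup>2 * (4 * P ^ 3)"
          using norm_grad_p[OF e, of y] True by (simp add: power_mult_distrib P_def mult_left_mono)
        also have "(norm (h y))\<^sup>2 * ((f y)\<^sup>2 * (4 * P ^ 3)) <= (1 / 2 * (P * (norm (h y))\<^sup>2) + 2 * (P * f y)\<^sup>2)\<^sup>2"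
        proof -
          have "0 <= (1 / 2 * (P * (norm (h y))\<^sup>2) - 2 * (P * f y)\<^sup>2)\<^sup>2" by simp
          thus ?thesis by (simp add: power2_eq_square power3_eq_cube algebra_simps)
        qed
        finally have "w\<^sup>2 <= (1 / 2 * (P * (norm (h y))\<^sup>2) + 2 * (P * f y)\<^sup>2)\<^sup>2" by (simp add: mult_left_mono)
        hence "\<bar>w\<bar> <= 1 / 2 * (P * (norm (h y))\<^sup>2) + 2 * (P * f y)\<^sup>2"
          using P power2_le_imp_le[of "\<bar>w\<bar>"] by simp
        thus ?thesis using True by (simp add: w_def P_def power2_norm_eq_inner abs_mult power_mult_distrib)
      qed simp
      have "\<bar>inner U ?V\<bar> = \<bar>LINT y|lborel. inner (h y) (?a y)\<bar>"
        by (simp add: h f vmul_def mulop_cls[OF pw_op_vec[OF c(2)] f(1)] inner_cls sq)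
      also have "... <= (LINT y|lborel. \<bar>inner (h y) (?a y)\<bar>)" by (rule integral_abs_bound)
      also have "... <= (LINT y|lborel. 1 / 2 * inner (h y) (?b y) + 2 * (norm (?d y))\<^sup>2)"
        using sq_int_inner[OF h(1) sq(1)] sq_int_inner[OF h(1) sq(2)] sq(3)
        by (intro integral_mono pw) (auto simp: sq_int_def)
      also have "... = 1 / 2 * inner U (smul (p eps) U) + 2 * ?n\<^sup>2"
      proof -
        have "inner U (smul (p eps) U) = (LINT y|lborel. inner (h y) (?b y))"
          unfolding smul_def h(2) mulop_cls[OF pw_op_mult[OF c(1)] h(1)] by (rule inner_cls[OF h(1) sq(2)])
        moreover have "?n\<^sup>2 = (LINT y|lborel. (norm (?d y))\<^sup>2)"
          unfolding smul_def f(2) mulop_cls[OF pw_op_mult[OF c(1)] f(1)] by (rule norm_cls[OF sq(3)])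
        moreover have "integrable lborel (%y. (norm (?d y))\<^sup>2)" using sq(3) unfolding sq_int_def by blast
        ultimately show ?thesis using sq_int_inner[OF h(1) sq(2)]
          by (subst Bochner_Integration.integral_add) (simp_all del: real_scaleR_def if_distrib real_norm_def)
      qed finally show ?thesis .
    qed
    hence "inner U (smul (p eps) U) <= 2 * (norm g * ?n) + 4 * ?n\<^sup>2"
      using eq cs by (simp add: inner_add_right)
    also have "... <= 2 * (norm g * (M1 * norm g)) + 4 * (M1 * norm g)\<^sup>2"
      using n by (intro add_mono mult_left_mono power_mono) auto
    also have "... = (2 * M1 + 4 * M1\<^sup>2) * (norm g)\<^sup>2" by (simp add: algebra_simps power2_eq_square)
    also have "... <= M * (norm g)\<^sup>2" by (intro mult_right_mono) (auto simp: M_def)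
    finally show ?thesis using n mult_right_mono[of M1 M "norm g"] by (simp add: M_def)
  qed
  thus ?thesis using that by blast
qed

end

section \<open>Square-integrable second derivatives away from the edges\<close>

lemma partial_shift: "smooth f ==> partial a (%y. f (y + c)) x = partial a f (x + c)"
  by (rule partialI, rule has_derivative_compose[where f = "%y. y + c" and f' = "%a. a"])
    (auto intro!: derivative_eq_intros partial_has_derivative smooth_differentiable)

lemma test_shift_UNIV:
  assumes "phi \<in> test_functions \<Omega>" shows "(%y. phi (y + c)) \<in> test_functions UNIV"
proof -
  obtain K where K: "compact K" "!!x. x \<notin> K ==> phi x = 0" using test_support[OF assms] by metis
  have "compact ((%x. x - c) ` K)" using K(1) by (intro compact_continuous_image continuous_intros)
  thus ?thesis by (intro testI[where K = "(%x. x - c) ` K"] smooth_shift test_smooth[OF assms])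
      (auto intro!: K(2) simp: image_iff algebra_simps)
qed

text \<open>By testing: a difference quotient in direction \<open>a\<close> commutes with the
  derivative in direction \<open>b\<close>, which moves onto the test function. The difference of
  the two sides is itself a test function and serves as the final one.\<close>

lemma partial_commute:
  assumes p: "phi \<in> test_functions \<Omega>"
  shows "cls (partial a (partial b phi)) = cls (partial b (partial a phi))"
proof -
  have eq: "inner (cls psi) (cls (partial a (partial b phi))) = inner (cls psi) (cls (partial b (partial a phi)))"
    if q: "psi \<in> test_functions \<Omega>" for psi
  proof (rule LIM_unique)
    have "((%h. inner (cls psi) ((shift (h *\<^sub>R a) (cls (partial b phi)) - cls (partial b phi)) /\<^sub>R h)) \<longlongrightarrow>
        inner (cls psi) (cls (partial a (partial b phi)))) (at 0)"
      by (intro tendsto_intros difference_quotient_tendsto[OF test_partial[OF p]])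
    moreover have "inner (cls psi) ((shift (h *\<^sub>R a) (cls (partial b phi)) - cls (partial b phi)) /\<^sub>R h)
        = - inner (cls (partial b psi)) ((shift (h *\<^sub>R a) (cls phi) - cls phi) /\<^sub>R h)" for h
    proof -
      have "shift (h *\<^sub>R a) (cls (partial b phi)) = cls (partial b (%y. phi (y + h *\<^sub>R a)))"
        unfolding shift_cls[OF test_sq_int[OF test_partial[OF p]]]
        by (rule arg_cong[where f = cls], rule ext) (simp add: partial_shift[OF test_smooth[OF p]])
      hence "inner (cls psi) (shift (h *\<^sub>R a) (cls (partial b phi))) = - inner (cls (partial b psi)) (shift (h *\<^sub>R a) (cls phi))"
        using integration_by_parts[OF q test_shift_UNIV[OF p], of b "h *\<^sub>R a"] by (simp add: shift_cls test_sq_int[OF p])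
      thus ?thesis using integration_by_parts[OF q p, of b] by (simp add: inner_diff_right algebra_simps)
    qed
    ultimately show "((%h. - inner (cls (partial b psi)) ((shift (h *\<^sub>R a) (cls phi) - cls phi) /\<^sub>R h)) \<longlongrightarrow>
        inner (cls psi) (cls (partial a (partial b phi)))) (at 0)" by simp
    have "((%h. - inner (cls (partial b psi)) ((shift (h *\<^sub>R a) (cls phi) - cls phi) /\<^sub>R h)) \<longlongrightarrow>
        - inner (cls (partial b psi)) (cls (partial a phi))) (at 0)"
      by (intro tendsto_intros difference_quotient_tendsto[OF p])
    thus "((%h. - inner (cls (partial b psi)) ((shift (h *\<^sub>R a) (cls phi) - cls phi) /\<^sub>R h)) \<longlongrightarrow>
        inner (cls psi) (cls (partial b (partial a phi)))) (at 0)"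
      using integration_by_parts[OF q test_partial[OF p], of b a] by simp
  qed
  let ?psi = "%x. partial a (partial b phi) x + (- 1) * partial b (partial a phi) x"
  have t: "?psi \<in> test_functions \<Omega>" by (intro test_add test_scale test_partial p)
  have c: "cls ?psi = cls (partial a (partial b phi)) - cls (partial b (partial a phi))"
    using cls_diff[OF test_sq_int test_sq_int, OF test_partial test_partial, OF test_partial test_partial, OF p p] by simp
  have "inner (cls ?psi) (cls ?psi) = 0" by (subst (2) c) (simp only: inner_diff_right eq[OF t] diff_self)
  hence "cls ?psi = 0" by (simp only: inner_eq_zero_iff)
  thus ?thesis unfolding c by (simp only: right_minus_eq)
qed

lemma partial_add: "smooth f ==> partial (a + b) f x = partial a f x + partial b f x"
  and partial_scale: "smooth f ==> partial (c *\<^sub>R a) f x = c * partial a f x"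
  by (simp_all add: inner_grad[symmetric] inner_add_right)

lemma partial_fun_add: "smooth f ==> smooth g ==> partial a (%x. f x + g x) x = partial a f x + partial a g x"
  and partial_fun_scale: "smooth f ==> partial a (%x. c * f x) x = c * partial a f x"
  using smooth_mult[OF smooth_const, of f c]
  by (simp_all add: inner_grad[symmetric] smooth_add grad_add grad_mult smooth_const grad_const inner_add_left)

context bounded_open
begin

text \<open>Square-integrability of the second derivatives in dual form, which is stable under sums
  and involves no choice of representatives; Riesz' theorem later recovers the derivatives.\<close>

definition regular :: "('a, real) l2 => bool" where
  "regular w \<longleftrightarrow> (\<forall>a b. \<exists>C. \<forall>phi\<in>tests. \<bar>inner w (cls (partial a (partial b phi)))\<bar> <= C * norm (cls phi))"

lemma regular_add:
  assumes "regular w" "regular w'" shows "regular (w + w')" unfolding regular_def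
proof (intro allI)
  fix a b
  obtain C C' where C: "!!phi. phi \<in> tests ==> \<bar>inner w (cls (partial a (partial b phi)))\<bar> <= C * norm (cls phi)"
    "!!phi. phi \<in> tests ==> \<bar>inner w' (cls (partial a (partial b phi)))\<bar> <= C' * norm (cls phi)"
    using assms unfolding regular_def by metis
  show "\<exists>C. \<forall>phi\<in>tests. \<bar>inner (w + w') (cls (partial a (partial b phi)))\<bar> <= C * norm (cls phi)"
  proof (rule exI[of _ "C + C'"], rule ballI)
    fix phi assume "phi \<in> tests"
    from C[OF this] show "\<bar>inner (w + w') (cls (partial a (partial b phi)))\<bar> <= (C + C') * norm (cls phi)"
      unfolding inner_add_left ring_distribs by linarith
  qed
qed

lemma regular_sum: "finite I ==> (!!i. i \<in> I ==> regular (w i)) ==> regular (\<Sum>i\<in>I. w i)"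
proof (induction I rule: finite_induct)
  case empty
  show ?case unfolding regular_def by (auto intro!: exI[of _ 0])
qed (auto intro: regular_add)

text \<open>Tangential derivatives are controlled by difference quotients, the second normal derivative by the equation.\<close>

lemma tangential_regularity:
  assumes w: "(w, W) \<in> H10_graph" and lap: "weak_lap W G" and nu: "norm nu = 1" and c: "0 < c"
    and sh: "!!a. inner a nu = 0 ==> norm a < c ==> (shift a w, shift a W) \<in> H10_graph"
  shows "regular w"
proof -
  \<comment> \<open>The second difference of \<open>w\<close> is an admissible test element. On one
    side it produces the squared norm of the first difference of \<open>W\<close>, on the other a
    first difference of \<open>w - shift (- a) w\<close>, which is bounded by that norm; one power
    cancels.\<close>
  have diff: "norm (shift a W - W) <= norm a * norm G" if a: "inner a nu = 0" "norm a < c" for a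
  proof -
    let ?n = "norm (shift a W - W)"
    have m: "(shift (- a) w, shift (- a) W) \<in> H10_graph" using sh[of "- a"] a by simp
    note sub = subspace_diff[OF subspace_H10_graph]
    from sub[OF w m] have d: "(w - shift (- a) w, W - shift (- a) W) \<in> H10_graph" by simp
    from sub[OF w sh[OF a]] have d': "(w - shift a w, W - shift a W) \<in> H10_graph" by simp
    from subspace_add[OF subspace_H10_graph d d']
    have "inner W (W - shift (- a) W + (W - shift a W)) = - inner G (w - shift (- a) w + (w - shift a w))"
      by (intro weak_lap_H10[OF lap]) simp
    moreover have "?n\<^sup>2 = inner W (W - shift (- a) W + (W - shift a W))"
      unfolding power2_norm_eq_inner using inner_shift[of a W W] inner_shift_left[of a W W]
      by (simp add: inner_diff_left inner_diff_right inner_add_right inner_commute)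
    moreover have "w - shift (- a) w + (w - shift a w) = - (shift a (w - shift (- a) w) - (w - shift (- a) w))"
      by (simp add: shift_diff shift_shift shift_0)
    ultimately have "?n\<^sup>2 = inner G (shift a (w - shift (- a) w) - (w - shift (- a) w))"
      by (simp only: inner_minus_right minus_minus)
    also have "... <= norm G * norm (shift a (w - shift (- a) w) - (w - shift (- a) w))" by (rule norm_cauchy_schwarz)
    also have "... <= norm G * (norm a * norm (W - shift (- a) W))"
      by (intro mult_left_mono norm_shift_diff_le_grad[OF d]) auto
    also have "norm (W - shift (- a) W) = ?n"
      using norm_shift[of a "W - shift (- a) W"] by (simp add: shift_diff shift_shift shift_0)
    finally have "?n * ?n <= ?n * (norm a * norm G)" by (simp add: power2_eq_square mult_ac)
    thus ?thesis by (cases "?n = 0") (auto dest: mult_left_le_imp_le)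
  qed
  define bd where "bd a b \<longleftrightarrow> (\<exists>C. \<forall>phi\<in>tests. \<bar>inner w (cls (partial a (partial b phi)))\<bar> <= C * norm (cls phi))" for a b
  note t2 = test_sq_int[OF test_partial[OF test_partial]]
  have sym: "bd a b ==> bd b a" for a b unfolding bd_def using partial_commute by metis
  have add: "bd (a + r *\<^sub>R a') b" if ab: "bd a b" "bd a' b" for a a' b and r :: real
  proof -
    obtain C C' where C: "!!phi. phi \<in> tests ==> \<bar>inner w (cls (partial a (partial b phi)))\<bar> <= C * norm (cls phi)"
      "!!phi. phi \<in> tests ==> \<bar>inner w (cls (partial a' (partial b phi)))\<bar> <= C' * norm (cls phi)"
      using ab unfolding bd_def by metis
    show ?thesis unfolding bd_def
    proof (rule exI[of _ "C + \<bar>r\<bar> * C'"], rule ballI)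
      fix phi assume p: "phi \<in> tests"
      have "partial (a + r *\<^sub>R a') (partial b phi) = (%x. partial a (partial b phi) x + r *\<^sub>R partial a' (partial b phi) x)"
        by (rule ext) (simp add: partial_add partial_scale smooth_partial test_smooth[OF p])
      hence "inner w (cls (partial (a + r *\<^sub>R a') (partial b phi)))
          = inner w (cls (partial a (partial b phi))) + r * inner w (cls (partial a' (partial b phi)))"
        by (simp only: cls_add cls_scaleR sq_int_scaleR t2[OF p] inner_add_right inner_scaleR_right)
      also have "\<bar>...\<bar> <= C * norm (cls phi) + \<bar>r\<bar> * (C' * norm (cls phi))"
        using C[OF p] by (intro order_trans[OF abs_triangle_ineq] add_mono) (auto simp: abs_mult intro: mult_left_mono)
      finally show "\<bar>inner w (cls (partial (a + r *\<^sub>R a') (partial b phi)))\<bar> <= (C + \<bar>r\<bar> * C') * norm (cls phi)"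
        by (simp add: algebra_simps)
    qed
  qed
  \<comment> \<open>For tangential \<open>a\<close>, the derivative falling on the test function is
    the limit of difference quotients, and these move onto the component of \<open>W\<close> along
    \<open>b\<close>.\<close>
  have tang: "bd b a" if a: "inner a nu = 0" for a b unfolding bd_def
  proof (rule exI[of _ "norm a * norm b * norm G"], rule ballI)
    fix phi assume p: "phi \<in> tests"
    obtain f where f: "sq_int f" "W = cls f" by (rule l2_cases)
    have fb: "sq_int (%y. inner (f y) b)"
    proof (rule sq_int_bound[OF f(1), where C = "norm b"])
      show "(%y. inner (f y) b) \<in> borel_measurable borel" using sq_int_measurable[OF f(1)] by simp
      have "norm (inner (f y) b) <= norm b * norm (f y)" for y
        using Cauchy_Schwarz_ineq2[of "f y" b] by (simp add: mult.commute)
      thus "AE y in lborel. norm (inner (f y) b) <= norm b * norm (f y)" by simp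
    qed
    let ?Wb = "cls (%y. inner (f y) b)"
    have W: "inner W (cls (%y. g y *\<^sub>R b)) = inner ?Wb (cls g)" if "sq_int g" for g
    proof -
      have "g \<in> borel_measurable borel" by (rule sq_int_measurable[OF that])
      hence "sq_int (%y. g y *\<^sub>R b)"
        by (intro sq_int_bound[OF that, where C = "norm b"]) (auto simp: mult.commute)
      thus ?thesis by (simp add: f inner_cls fb that mult.commute)
    qed
    have Wb: "norm (shift a' ?Wb - ?Wb) <= norm b * norm (shift a' W - W)" for a'
    proof -
      have "norm (cls (%y. inner (f (y + a')) b - inner (f y) b)) <= norm (cls (%y. norm b *\<^sub>R (f (y + a') - f y)))"
      proof (intro norm_cls_mono sq_int_diff sq_int_scaleR fb f(1) sq_int_shift[OF fb, of a'] sq_int_shift[OF f(1), of a'])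
        have "norm (inner (f (y + a')) b - inner (f y) b) <= norm (norm b *\<^sub>R (f (y + a') - f y))" for y
          using Cauchy_Schwarz_ineq2[of "f (y + a') - f y" b] by (simp add: inner_diff_left mult.commute)
        thus "AE y in lborel. norm (inner (f (y + a')) b - inner (f y) b) <= norm (norm b *\<^sub>R (f (y + a') - f y))" by simp
      qed
      thus ?thesis
        by (simp only: f(2) shift_cls fb f(1) cls_diff cls_scaleR sq_int_diff sq_int_shift[OF fb] sq_int_shift[OF f(1)]
            norm_scaleR abs_norm_cancel)
    qed
    have "inner w (cls (partial b (partial a phi))) = - inner ?Wb (cls (partial a phi))"
      using weak_gradient[OF w test_partial[OF p], of b] W[OF test_sq_int[OF test_partial[OF p]]] by simp
    moreover have "\<bar>inner ?Wb (cls (partial a phi))\<bar> <= norm a * norm b * norm G * norm (cls phi)"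
    proof (rule tendsto_upperbound)
      show "((%h. \<bar>inner ?Wb ((shift (h *\<^sub>R a) (cls phi) - cls phi) /\<^sub>R h)\<bar>) \<longlongrightarrow> \<bar>inner ?Wb (cls (partial a phi))\<bar>) (at 0)"
        by (intro tendsto_intros difference_quotient_tendsto[OF p])
      have "\<forall>\<^sub>F h::real in at 0. \<bar>h\<bar> < c / (norm a + 1)"
        using c by (intro order_tendstoD[of _ 0] tendsto_eq_intros) (auto intro!: divide_pos_pos add_nonneg_pos)
      moreover have "\<forall>\<^sub>F h::real in at 0. h ~= 0" by (simp add: eventually_at_filter)
      ultimately show "\<forall>\<^sub>F h in at 0. \<bar>inner ?Wb ((shift (h *\<^sub>R a) (cls phi) - cls phi) /\<^sub>R h)\<bar> <= norm a * norm b * norm G * norm (cls phi)"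
      proof eventually_elim
        case (elim h)
        have "\<bar>h\<bar> * norm a <= \<bar>h\<bar> * (norm a + 1)" by (intro mult_left_mono) auto
        also have "... < c" using elim by (simp add: pos_less_divide_eq add_nonneg_pos)
        finally have "norm (shift (- h *\<^sub>R a) W - W) <= \<bar>h\<bar> * norm a * norm G" using diff[of "- h *\<^sub>R a"] a by simp
        hence "norm b * norm (shift (- h *\<^sub>R a) W - W) <= norm b * (\<bar>h\<bar> * norm a * norm G)" by (rule mult_left_mono) simp
        hence n: "norm (shift (- h *\<^sub>R a) ?Wb - ?Wb) <= \<bar>h\<bar> * (norm a * norm b * norm G)"
          using Wb[of "- h *\<^sub>R a"] by (simp add: mult_ac)
        have "\<bar>h\<bar> * \<bar>inner ?Wb ((shift (h *\<^sub>R a) (cls phi) - cls phi) /\<^sub>R h)\<bar> = \<bar>inner ?Wb (shift (h *\<^sub>R a) (cls phi) - cls phi)\<bar>"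
          using elim(2) by (simp add: abs_mult)
        also have "inner ?Wb (shift (h *\<^sub>R a) (cls phi) - cls phi) = inner (shift (- h *\<^sub>R a) ?Wb - ?Wb) (cls phi)"
          using inner_shift_left[of "- h *\<^sub>R a" ?Wb "cls phi"] by (simp add: inner_diff_left inner_diff_right)
        also have "\<bar>...\<bar> <= norm (shift (- h *\<^sub>R a) ?Wb - ?Wb) * norm (cls phi)" by (rule Cauchy_Schwarz_ineq2)
        also have "... <= \<bar>h\<bar> * (norm a * norm b * norm G) * norm (cls phi)" by (intro mult_right_mono n) auto
        finally show ?case using elim(2) by (simp add: mult.assoc)
      qed
    qed simp
    ultimately show "\<bar>inner w (cls (partial b (partial a phi)))\<bar> <= norm a * norm b * norm G * norm (cls phi)" by simp
  qed
  define pr where "pr x = x - inner x nu *\<^sub>R nu" for x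
  have nunu: "inner nu nu = 1" using nu by (simp add: norm_eq_1)
  have pr: "inner (pr x) nu = 0" "x = pr x + inner x nu *\<^sub>R nu" for x
    by (simp_all add: pr_def inner_diff_left nunu)
  have bt: "bd a b" "bd b a" if "inner a nu = 0" for a b using tang[OF that] sym by blast+
  have one: "bd x y" if "bd nu nu" for x y
  proof -
    have "bd nu y" using add[OF bt(1)[OF pr(1)] that, of y "inner y nu"] pr(2)[of y] sym by metis
    from add[OF bt(1)[OF pr(1)] this, of x "inner x nu"] show ?thesis using pr(2)[of x] by metis
  qed
  have "bd nu nu"
  proof -
    define Q where "Q a b phi = inner w (cls (partial a (partial b phi)))" for a b phi
    obtain C where C: "!!a b phi. inner a nu = 0 \<or> inner b nu = 0 ==> phi \<in> tests ==> \<bar>Q a b phi\<bar> <= C a b * norm (cls phi)"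
    proof -
      have "\<exists>C. inner a nu = 0 \<or> inner b nu = 0 --> (\<forall>phi\<in>tests. \<bar>Q a b phi\<bar> <= C * norm (cls phi))" for a b
        using bt[of a b] bt[of b a] unfolding bd_def Q_def by blast
      then obtain C where "!!a b. inner a nu = 0 \<or> inner b nu = 0 --> (\<forall>phi\<in>tests. \<bar>Q a b phi\<bar> <= C a b * norm (cls phi))"
        by metis
      thus ?thesis using that[of C] by blast
    qed
    define C' where "C' = norm G + (\<Sum>i\<in>Basis. C i (pr i) + \<bar>inner i nu\<bar> * C (pr i) nu)"
    have "\<bar>Q nu nu phi\<bar> <= C' * norm (cls phi)" if p: "phi \<in> tests" for phi
    proof -
      note sp = test_smooth[OF p]
      have lin: "Q a (b + r *\<^sub>R b') phi = Q a b phi + r * Q a b' phi" "Q (b + r *\<^sub>R b') a phi = Q b a phi + r * Q b' a phi" for a b b' r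
      proof -
        have e1: "partial (b + r *\<^sub>R b') (partial a phi) = (%x. partial b (partial a phi) x + r *\<^sub>R partial b' (partial a phi) x)"
          by (rule ext) (simp add: partial_add partial_scale smooth_partial sp)
        show "Q (b + r *\<^sub>R b') a phi = Q b a phi + r * Q b' a phi"
          unfolding Q_def e1 by (simp only: cls_add cls_scaleR sq_int_scaleR t2[OF p] inner_add_right inner_scaleR_right)
        thus "Q a (b + r *\<^sub>R b') phi = Q a b phi + r * Q a b' phi"
          unfolding Q_def using partial_commute[OF p] by metis
      qed
      \<comment> \<open>The trace of the second derivatives is the datum \<open>G\<close>. Splitting
        each basis vector into tangential and normal part leaves the doubly normal derivative with
        the coefficient 1.\<close>
      have "(\<Sum>i\<in>Basis. Q i i phi) = inner G (cls phi)"
      proof -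
        have s: "sq_int (%y. partial i phi y *\<^sub>R i)" for i
          by (rule sq_int_test_scaleR[OF test_partial[OF p] continuous_on_const])
        have "(\<Sum>i\<in>Basis. Q i i phi) = (\<Sum>i\<in>Basis. - inner W (cls (%y. partial i phi y *\<^sub>R i)))"
          unfolding Q_def by (intro sum.cong refl weak_gradient[OF w test_partial[OF p]])
        also have "... = - inner W (cls (grad phi))"
          unfolding grad_def[abs_def] using cls_sum[of Basis "%i y. partial i phi y *\<^sub>R i", OF s]
          by (simp add: sum_negf inner_sum_right) finally show ?thesis using lap p by (simp add: weak_lap_def)
      qed
      moreover have split: "Q i i phi = Q i (pr i) phi + inner i nu * Q (pr i) nu phi + (inner i nu)\<^sup>2 * Q nu nu phi" for i
      proof -
        have "Q i i phi = Q i (pr i) phi + inner i nu * Q i nu phi" using lin(1)[of i "pr i" "inner i nu" nu] pr(2)[of i] by simp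
        moreover have "Q i nu phi = Q (pr i) nu phi + inner i nu * Q nu nu phi" using lin(2)[of "pr i" "inner i nu" nu nu] pr(2)[of i] by simp
        ultimately show ?thesis by (simp add: algebra_simps power2_eq_square)
      qed
      moreover have "(\<Sum>i\<in>Basis. (inner i nu)\<^sup>2) = 1"
        using nunu euclidean_inner[of nu nu] by (simp add: inner_commute power2_eq_square)
      ultimately have "Q nu nu phi = inner G (cls phi) - (\<Sum>i\<in>Basis. Q i (pr i) phi + inner i nu * Q (pr i) nu phi)"
      proof -
        have "(\<Sum>i\<in>Basis. Q i i phi) = (\<Sum>i\<in>Basis. Q i (pr i) phi + inner i nu * Q (pr i) nu phi) + (\<Sum>i\<in>Basis. (inner i nu)\<^sup>2) * Q nu nu phi"
          unfolding sum_distrib_right sum.distrib[symmetric] by (intro sum.cong refl split)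
        thus ?thesis
          unfolding \<open>(\<Sum>i\<in>Basis. Q i i phi) = inner G (cls phi)\<close> \<open>(\<Sum>i\<in>Basis. (inner i nu)\<^sup>2) = 1\<close> by linarith
      qed
      also have "\<bar>...\<bar> <= norm G * norm (cls phi) + (\<Sum>i\<in>Basis. (C i (pr i) + \<bar>inner i nu\<bar> * C (pr i) nu) * norm (cls phi))"
      proof (intro order_trans[OF abs_triangle_ineq4] add_mono Cauchy_Schwarz_ineq2 order_trans[OF sum_abs] sum_mono)
        fix i :: 'a
        have "\<bar>Q i (pr i) phi\<bar> <= C i (pr i) * norm (cls phi)" using C[OF _ p] pr(1) by blast
        moreover have "\<bar>inner i nu\<bar> * \<bar>Q (pr i) nu phi\<bar> <= \<bar>inner i nu\<bar> * (C (pr i) nu * norm (cls phi))"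
          using C[OF _ p] pr(1) by (intro mult_left_mono) auto
        ultimately show "\<bar>Q i (pr i) phi + inner i nu * Q (pr i) nu phi\<bar> <= (C i (pr i) + \<bar>inner i nu\<bar> * C (pr i) nu) * norm (cls phi)"
          using abs_triangle_ineq[of "Q i (pr i) phi" "inner i nu * Q (pr i) nu phi"]
          by (simp add: abs_mult algebra_simps)
      qed
      also have "... = C' * norm (cls phi)" by (simp add: C'_def sum_distrib_right distrib_right)
      finally show ?thesis .
    qed
    thus ?thesis unfolding bd_def by (intro exI[of _ C'] ballI) (fold Q_def)
  qed
  from one[OF this, unfolded bd_def] show ?thesis unfolding regular_def by (intro allI)
qed

end

section \<open>Localisation to single faces\<close>

context polytope_domain
begin

definition l :: "'a \<times> real => 'a => real" where "l j x = snd j - inner (fst j) x"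

lemma domain_l: "x \<in> \<Omega> \<longleftrightarrow> (\<forall>j\<in>J. 0 < l j x)" by (auto simp: domain l_def)

lemma smooth_l: "smooth (l j)" using smooth_affine[of "snd j" "- fst j"] by (simp add: l_def[abs_def])

lemma l_shift: "l j (x + a) = l j x - inner (fst j) a" by (simp add: l_def inner_add_right)

text \<open>A tangential translation shorter than \<open>c\<close> keeps the support inside
  \<Omega>: faces with normal \<open>nu\<close> are moved along themselves, and the others are at
  distance at least \<open>c\<close>.\<close>

lemma regular_piece:
  assumes u: "(u, U) \<in> H10_graph" and g: "weak_lap U g" and z: "smooth zeta" and nu: "norm nu = 1" and c: "0 < c"
    and sup: "!!x i. x \<in> \<Omega> ==> zeta x ~= 0 ==> i \<in> J ==> fst i = nu \<or> c <= l i x"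
  shows "regular (smul zeta u)"
proof (rule tangential_regularity[OF H10_graph_mult[OF u z] weak_lap_mult[OF u g z] nu c])
  fix a assume a: "inner a nu = 0" "norm a < c"
  note cz = smooth_continuous[OF z] continuous_grad[OF z]
  show "(shift a (smul zeta u), shift a (smul zeta U + vmul (grad zeta) u)) \<in> H10_graph"
  proof (rule H10_graph_closed[OF u])
    show "closed {z. (shift a (smul zeta (fst z)), shift a (smul zeta (snd z) + vmul (grad zeta) (fst z))) \<in> H10_graph}"
      by (rule closed_vimage[OF closed_H10_graph, unfolded vimage_def])
        (intro continuous_intros bounded_linear.continuous_on[OF bounded_linear_smul]
          bounded_linear.continuous_on[OF bounded_linear_vmul] bounded_linear.continuous_on[OF bounded_linear_shift] cz)
    fix phi assume p: "phi \<in> tests"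
    let ?psi = "%y. zeta y * phi y"
    note t = test_mult[OF p z]
    obtain K where K: "compact K" "K \<subseteq> \<Omega>" "!!x. x \<notin> K ==> phi x = 0" using test_support[OF p] by metis
    obtain m0 where m0: "0 < m0" "!!x j. x \<in> K ==> j \<in> J ==> m0 <= l j x"
    proof -
      have "\<exists>m>0. \<forall>x\<in>K. m <= l j x" if "j \<in> J" for j
      proof (cases "K = {}")
        case False
        obtain x where "x \<in> K" "!!y. y \<in> K ==> l j x <= l j y"
          using continuous_attains_inf[OF K(1) False smooth_continuous[OF smooth_l]] by metis
        thus ?thesis using K(2) domain_l that by blast
      qed (auto intro: exI[of _ 1])
      then obtain m where m: "!!j. j \<in> J ==> 0 < m j" "!!j x. j \<in> J ==> x \<in> K ==> m j <= l j x" by metis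
      have "0 < Min (insert 1 (m ` J))" using m(1) finite_J by (subst Min_gr_iff) auto
      thus ?thesis by (rule that) (rule order_trans[OF Min_le m(2)], use finite_J in auto)
    qed
    \<comment> \<open>The shifted support keeps the distance \<open>m0\<close> to the faces with
      normal \<open>nu\<close> and at least \<open>c - norm a\<close> to the others.\<close>
    define m where "m = min m0 (c - norm a)"
    have m: "0 < m" using m0(1) a(2) by (simp add: m_def)
    define L where "L = {y. y + a \<in> K \<and> (\<forall>j\<in>J. m <= l j y)}"
    have tL: "(%y. ?psi (y + a)) \<in> tests"
    proof (rule testI[where K = L])
      show "smooth (%y. ?psi (y + a))" by (rule smooth_shift[OF test_smooth[OF t]])
      show LO: "L \<subseteq> \<Omega>" using m domain_l by (fastforce simp: L_def)
      have "L = (%y. y + a) -` K \<inter> (\<Inter>j\<in>J. {y. m <= l j y})" by (auto simp: L_def)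
      hence "closed L" using compact_imp_closed[OF K(1)]
        by (auto intro!: closed_Int closed_INT closed_vimage closed_Collect_le continuous_intros smooth_continuous smooth_l)
      thus "compact L" using LO bdd by (auto simp: compact_eq_bounded_closed intro: bounded_subset)
      show "?psi (y + a) = 0" if y: "y \<notin> L" for y
      proof (rule ccontr)
        assume n: "?psi (y + a) ~= 0"
        hence yK: "y + a \<in> K" and zn: "zeta (y + a) ~= 0" using K(3) by auto
        have "m <= l j y" if "j \<in> J" for j
        proof (cases "fst j = nu")
          case True
          thus ?thesis using m0(2)[OF yK that] a(1) by (simp add: l_shift inner_commute m_def)
        next
          case False
          hence "c <= l j (y + a)" using sup[of "y + a" j] K(2) yK zn that by blast
          moreover have "\<bar>inner (fst j) a\<bar> <= norm a"
            using Cauchy_Schwarz_ineq2[of "fst j" a] unit_normal[OF that] by simp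
          ultimately show ?thesis by (simp add: l_shift m_def)
        qed
        thus False using y yK by (simp add: L_def)
      qed
    qed
    have "smul zeta (cls phi) = cls ?psi"
      using smul_cls[OF cz(1) test_sq_int[OF p] test_zero_outside[OF p]] by simp
    moreover have "smul zeta (cls (grad phi)) + vmul (grad zeta) (cls phi) = cls (grad ?psi)"
      using cls_grad_mult[OF p z] vmul_cls[OF cz(2) test_sq_int[OF p] test_zero_outside[OF p]] by simp
    moreover have "grad (%y. ?psi (y + a)) = (%y. grad ?psi (y + a))"
      by (rule ext) (simp add: grad_def partial_shift[OF test_smooth[OF t]])
    ultimately show "(shift a (smul zeta (cls phi)), shift a (smul zeta (cls (grad phi)) + vmul (grad zeta) (cls phi))) \<in> H10_graph"
      using H10_graph_test[OF tL] by (simp add: shift_cls test_sq_int[OF t] grad_sq_int[OF t])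
  qed
qed

lemma smul_add:
  "continuous_on UNIV f ==> continuous_on UNIV g ==> smul (%x. f x + g x) u = smul f u + smul g u"
  unfolding smul_def
  by (rule mulop_plus[symmetric]) (auto intro!: pw_op_mult continuous_intros simp: scaleR_left_distrib)

lemma smul_sum:
  "finite I ==> (!!i. i \<in> I ==> continuous_on UNIV (f i)) ==> smul (%x. \<Sum>i\<in>I. f i x) u = (\<Sum>i\<in>I. smul (f i) u)"
proof (induction I rule: finite_induct)
  case empty
  have "smul (%x. 0) u = smul (%x. 0) u + smul (%x. 0) u"
    using smul_add[of "%x. 0" "%x. 0" u] by (simp add: continuous_on_const)
  thus ?case by simp
next
  case (insert j I)
  thus ?case using smul_add[of "f j" "%x. \<Sum>i\<in>I. f i x" u] by (simp add: continuous_on_sum)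
qed

text \<open>On the support of \<open>eta\<close> at most one face is closer than
  \<open>c / 2\<close>, so a smooth partition cuts \<open>eta\<close> into one piece per face and
  one piece away from all faces.\<close>

lemma regular_away_from_edges:
  assumes u: "(u, U) \<in> H10_graph" and g: "weak_lap U g" and z: "smooth eta" and c: "0 < c"
    and sup: "!!x i j. x \<in> \<Omega> ==> eta x ~= 0 ==> i \<in> J ==> j \<in> J ==> i ~= j ==> c <= l i x + l j x"
  shows "regular (smul eta u)"
proof -
  define del where "del = c / 2"
  have d: "0 < del" using c by (simp add: del_def)
  define theta where "theta j x = 1 - step (- 1 + inner (2 / del) (l j x))" for j x
  have stheta: "smooth (theta j)" for j
    unfolding theta_def[abs_def] by (intro smooth_diff smooth_const smooth_compose[OF smooth_compose[OF smooth_step smooth_affine] smooth_l])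
  have theta1: "theta j x = 1" if "l j x <= del / 2" for j x
    unfolding theta_def using that d by (simp add: step_le_0 field_simps)
  have theta0: "theta j x = 0" if "del <= l j x" for j x
    unfolding theta_def using that d by (simp add: step_ge_1 field_simps)
  define zeta where "zeta j x = eta x * theta j x" for j x
  define zeta0 where "zeta0 x = eta x * (1 - (\<Sum>j\<in>J. theta j x))" for x
  have sz: "smooth (zeta j)" "smooth zeta0" for j
    unfolding zeta_def[abs_def] zeta0_def[abs_def] by (intro smooth_mult smooth_diff smooth_sum smooth_const z stheta)+
  have "eta = (%x. zeta0 x + (\<Sum>j\<in>J. zeta j x))"
    by (rule ext) (simp add: zeta_def zeta0_def sum_distrib_left[symmetric] algebra_simps)
  hence eq: "smul eta u = smul zeta0 u + (\<Sum>j\<in>J. smul (zeta j) u)"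
    using smul_add[of zeta0 "%x. \<Sum>j\<in>J. zeta j x" u] smul_sum[OF finite_J, of zeta u]
    by (simp add: smooth_continuous sz smooth_sum)
  have "regular (smul (zeta j) u)" if j: "j \<in> J" for j
  proof (rule regular_piece[OF u g sz(1) unit_normal[OF j] d])
    fix x i assume x: "x \<in> \<Omega>" "zeta j x ~= 0" and i: "i \<in> J"
    hence "eta x ~= 0" "l j x < del" using theta0[of j x] by (auto simp: zeta_def not_le[symmetric])
    thus "fst i = fst j \<or> del <= l i x"
      using sup[OF x(1) _ i j] by (cases "i = j") (auto simp: del_def)
  qed
  moreover have "regular (smul zeta0 u)"
  proof -
    \<comment> \<open>No face is close to this piece, so any unit vector can play the
      normal.\<close>
    obtain b :: 'a where b: "b \<in> Basis" using nonempty_Basis by blast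
    show ?thesis
    proof (rule regular_piece[OF u g sz(2) norm_Basis[OF b]])
      show "0 < del / 2" using d by simp
      fix x i assume x: "x \<in> \<Omega>" "zeta0 x ~= 0" and i: "i \<in> J"
      have "del / 2 <= l i x"
      proof (rule ccontr)
        assume "\<not> ?thesis"
        hence li: "l i x <= del / 2" by simp
        have "eta x ~= 0" using x by (simp add: zeta0_def)
        hence "theta j x = 0" if "j \<in> J" "j ~= i" for j
          using sup[OF x(1) _ that(1) i that(2)] li d by (intro theta0) (simp add: del_def)
        hence "(\<Sum>j\<in>J. theta j x) = (\<Sum>j\<in>J. if j = i then 1 else 0)" using theta1[OF li] by (intro sum.cong) auto
        thus False using x(2) i finite_J by (simp add: zeta0_def)
      qed
      thus "fst i = b \<or> del / 2 <= l i x" by simp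
    qed
  qed
  ultimately show ?thesis unfolding eq by (intro regular_add regular_sum finite_J)
qed

end

section \<open>Density of the range of the resolvent\<close>

lemma partial_sum: "(!!j. j \<in> I ==> smooth (f j)) ==> partial a (%x. \<Sum>j\<in>I. f j x) x = (\<Sum>j\<in>I. partial a (f j) x)"
  by (simp add: inner_grad[symmetric] smooth_sum grad_sum inner_sum_left)

lemma lapl_sum:
  assumes "!!j. j \<in> I ==> smooth (f j)"
  shows "lapl (%x. \<Sum>j\<in>I. f j x) x = (\<Sum>j\<in>I. lapl (f j) x)"
proof -
  have "partial i (%x. \<Sum>j\<in>I. f j x) = (%x. \<Sum>j\<in>I. partial i (f j) x)" for i
    by (rule ext) (rule partial_sum[OF assms])
  thus ?thesis unfolding lapl_def using assms by (simp add: partial_sum smooth_partial) (rule sum.swap)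
qed

lemma lapl_scale:
  assumes "smooth f" shows "lapl (%x. c * f x) x = c * lapl f x"
proof -
  have "partial i (%x. c * f x) = (%x. c * partial i f x)" for i
    by (rule ext) (rule partial_fun_scale[OF assms])
  thus ?thesis unfolding lapl_def using assms by (simp add: partial_fun_scale smooth_partial sum_distrib_left)
qed

lemma partial_mult:
  "smooth f ==> smooth g ==> partial a (%x. f x * g x) x = f x * partial a g x + g x * partial a f x"
  by (simp add: inner_grad[symmetric] smooth_mult grad_mult inner_add_left)

lemma lapl_compose:
  assumes "smooth h" "smooth f"
  shows "lapl (%x. h (f x)) x = partial 1 (partial 1 h) (f x) * (norm (grad f x))\<^sup>2 + partial 1 h (f x) * lapl f x"
proof -
  have c: "partial i (%x. k (f x)) x = partial 1 k (f x) * partial i f x" if "smooth k" for i k x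
    using grad_compose[OF that assms(2)] by (simp add: inner_grad[symmetric] smooth_compose[OF that assms(2)] assms(2))
  have e: "partial i (%x. h (f x)) = (%x. partial 1 h (f x) * partial i f x)" for i by (rule ext) (rule c[OF assms(1)])
  note s = smooth_compose[OF smooth_partial[OF assms(1)] assms(2)]
  have "partial i (%x. partial 1 h (f x) * partial i f x) x
      = partial 1 (partial 1 h) (f x) * (partial i f x)\<^sup>2 + partial 1 h (f x) * partial i (partial i f) x" for i
    by (simp add: partial_mult[OF s smooth_partial[OF assms(2)]] c[OF smooth_partial[OF assms(1)]] power2_eq_square)
  moreover have "(norm (grad f x))\<^sup>2 = (\<Sum>i\<in>Basis. (partial i f x)\<^sup>2)"
    unfolding power2_norm_eq_inner by (subst euclidean_inner) (simp add: inner_grad assms(2) power2_eq_square)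
  ultimately show ?thesis unfolding lapl_def e by (simp add: sum.distrib sum_distrib_left)
qed

lemma (in wedge) p_le:
  assumes "0 < eps" shows "p eps x * r2 x <= 1" "eps\<^sup>2 * p eps x <= 1"
proof -
  have "0 < r2 x + eps\<^sup>2" using r2_nonneg[of x] assms by (intro add_nonneg_pos) auto
  thus "p eps x * r2 x <= 1" "eps\<^sup>2 * p eps x <= 1"
    using r2_nonneg[of x] by (simp_all add: p_def divide_inverse[symmetric] inverse_eq_divide divide_le_eq)
qed

text \<open>The two contributions \<open>- 4 p^2\<close> and \<open>8 p^3 r2\<close> have opposite
  signs, and \<open>p r2 \<le> 1\<close>.\<close>

lemma (in wedge) lapl_p:
  assumes "0 < eps" shows "\<bar>lapl (p eps) x\<bar> <= 4 * (p eps x)\<^sup>2"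
proof -
  note sp = smooth_p[OF assms]
  have e: "partial i (p eps) = (%x. (p eps x * p eps x) * ((- 2 * inner e i) * s x + (- 2 * inner e' i) * d x))" for i
    by (rule ext) (simp add: inner_grad[OF sp, symmetric] grad_p[OF assms] inner_add_left algebra_simps power2_eq_square)
  have q: "smooth (%x. a * s x + b * d x)" "partial i (%x. a * s x + b * d x) x = a * inner e i + b * inner e' i" for a b i x
    by (simp_all add: smooth_add smooth_mult smooth_const smooth_s smooth_d partial_fun_add partial_fun_scale
        inner_grad[symmetric] grad_s grad_d)
  define c1 c2 where "c1 = - 2 * (p eps x)\<^sup>2" and "c2 = 8 * (p eps x) ^ 3"
  have "partial i (partial i (p eps)) x = c1 * ((inner e i)\<^sup>2 + (inner e' i)\<^sup>2) + c2 * (s x * inner e i + d x * inner e' i)\<^sup>2" for i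
    unfolding e partial_mult[OF smooth_mult[OF sp sp] q(1)] partial_mult[OF sp sp] q(2)
    by (simp add: e c1_def c2_def algebra_simps power2_eq_square power3_eq_cube)
  hence "lapl (p eps) x = c1 * (\<Sum>i\<in>Basis. (inner e i)\<^sup>2 + (inner e' i)\<^sup>2) + c2 * (\<Sum>i\<in>Basis. (s x * inner e i + d x * inner e' i)\<^sup>2)"
    unfolding lapl_def sum_distrib_left sum.distrib[symmetric] by (intro sum.cong refl)
  moreover have "(\<Sum>i\<in>Basis. (inner e i)\<^sup>2 + (inner e' i)\<^sup>2) = 2"
    using ee(1,2) unfolding euclidean_inner[of e e] euclidean_inner[of e' e'] by (simp add: sum.distrib power2_eq_square)
  moreover have "(\<Sum>i\<in>Basis. (s x * inner e i + d x * inner e' i)\<^sup>2) = r2 x"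
  proof -
    have "(\<Sum>i\<in>Basis. (s x * inner e i + d x * inner e' i)\<^sup>2)
        = inner (s x *\<^sub>R e + d x *\<^sub>R e') (s x *\<^sub>R e + d x *\<^sub>R e')"
      by (subst euclidean_inner) (simp add: inner_add_left power2_eq_square)
    thus ?thesis by (simp add: inner_add_left inner_add_right ee r2_def)
  qed
  ultimately have "lapl (p eps) x = - 4 * (p eps x)\<^sup>2 + 8 * ((p eps x)\<^sup>2 * (p eps x * r2 x))"
    by (simp add: c1_def c2_def power2_eq_square power3_eq_cube)
  moreover have "0 <= p eps x * r2 x" using p_pos[OF assms, of x] r2_nonneg by simp
  moreover have "p eps x * r2 x <= 1" by (rule p_le(1)[OF assms])
  hence "(p eps x)\<^sup>2 * (p eps x * r2 x) <= (p eps x)\<^sup>2 * 1" by (rule mult_left_mono) simp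
  moreover have "0 <= (p eps x)\<^sup>2 * (p eps x * r2 x)" using calculation(2) by simp
  ultimately show ?thesis by (simp add: abs_le_iff)
qed

context bounded_open
begin

lemma smul_scale:
  assumes "continuous_on UNIV f" shows "smul (%x. c * f x) u = c *\<^sub>R smul f u"
proof -
  obtain g where g: "sq_int g" "u = cls g" by (rule l2_cases)
  have c: "continuous_on UNIV (%x. c * f x)" by (intro continuous_intros assms)
  show ?thesis unfolding smul_def g(2) mulop_cls[OF pw_op_mult[OF c] g(1)] mulop_cls[OF pw_op_mult[OF assms] g(1)]
      cls_scaleR[OF sq_int_mulop[OF pw_op_mult[OF assms] g(1)], symmetric] by (rule arg_cong[where f = cls]) auto
qed

lemma weak_lap_inner:
  assumes "(w, W) \<in> H10_graph" "weak_lap W g" "phi \<in> tests"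
  shows "inner g (cls phi) = inner w (cls (lapl phi))"
proof -
  note t = test_partial[OF assms(3)]
  have "inner w (cls (lapl phi)) = (\<Sum>i\<in>Basis. inner w (cls (partial i (partial i phi))))"
    unfolding lapl_def[abs_def] using cls_sum[of Basis "%i. partial i (partial i phi)"]
    by (simp add: test_sq_int[OF test_partial[OF t]] inner_sum_right)
  also have "... = (\<Sum>i\<in>Basis. - inner W (cls (%y. partial i phi y *\<^sub>R i)))"
    by (intro sum.cong refl weak_gradient[OF assms(1) t])
  also have "... = - inner W (cls (grad phi))"
    unfolding grad_def[abs_def] using cls_sum[of Basis "%i y. partial i phi y *\<^sub>R i"]
    by (simp add: sq_int_test_scaleR[OF t continuous_on_const] sum_negf inner_sum_right)
  finally show ?thesis using assms(2,3) by (simp add: weak_lap_def)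
qed

end

context polytope_domain
begin

text \<open>The weight \<open>p\<close> of the wedge spanned by two faces that are not parallel.\<close>

lemma pair_weight:
  assumes "i \<in> J" "j \<in> J" "fst i ~= fst j" "fst i ~= - fst j"
  obtains P :: "real => 'a => real" and c M :: real and D :: "'a => real"
  where "0 < c" "!!eps. 0 < eps ==> smooth (P eps)" "!!eps x. 0 < eps ==> 0 <= P eps x"
    "!!eps x. 0 < eps ==> (norm (grad (P eps) x))\<^sup>2 <= 4 * (P eps x) ^ 3"
    "!!eps x. 0 < eps ==> \<bar>lapl (P eps) x\<bar> <= 4 * (P eps x)\<^sup>2"
    "!!eps x. 0 < eps ==> eps\<^sup>2 * P eps x <= 1"
    "!!eps x. 0 < eps ==> x \<in> \<Omega> ==> eps\<^sup>2 * P eps x < 1 / 2 ==> eps * c <= l i x + l j x"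
    "!!eps x. 0 < eps ==> x \<in> \<Omega> ==> P eps x <= D x"
    "!!eps u U g. 0 < eps ==> (u, U) \<in> H10_graph ==> weak_lap U g ==>
      norm (smul (P eps) u) <= M * norm g \<and> inner U (smul (P eps) U) <= M * (norm g)\<^sup>2"
proof -
  define \<alpha> where "\<alpha> = norm (fst i + fst j)"
  define \<gamma> where "\<gamma> = norm (fst i - fst j)"
  define e where "e = (- inverse \<alpha>) *\<^sub>R (fst i + fst j)"
  define e' where "e' = (- inverse \<gamma>) *\<^sub>R (fst i - fst j)"
  have "fst i + fst j ~= 0" using assms(4) by (simp add: eq_neg_iff_add_eq_0)
  hence pos: "0 < \<alpha>" "0 < \<gamma>" using assms(3) by (auto simp: \<alpha>_def \<gamma>_def)
  define s0 d0 where "s0 = inverse \<alpha> * (snd i + snd j)" and "d0 = inverse \<gamma> * (snd i - snd j)"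
  have s: "s0 + inner e x = inverse \<alpha> * (l i x + l j x)"
    and d: "d0 + inner e' x = inverse \<gamma> * (l i x - l j x)" for x
    by (simp_all add: s0_def d0_def e_def e'_def l_def inner_add_left inner_diff_left algebra_simps)
  interpret w: wedge \<Omega> e e' s0 d0 "\<alpha> / \<gamma>"
  proof unfold_locales
    show "norm e = 1" "norm e' = 1" using pos by (simp_all add: e_def e'_def \<alpha>_def[symmetric] \<gamma>_def[symmetric])
    show "inner e e' = 0" using assms(1,2)[THEN unit_normal]
      by (simp add: e_def e'_def inner_add_left inner_diff_right inner_diff_left inner_add_right inner_commute norm_eq_1)
    fix x assume "x \<in> \<Omega>"
    hence l: "0 < l i x" "0 < l j x" using assms(1,2) domain_l by auto
    thus "0 < s0 + inner e x" unfolding s using pos by simp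
    have "\<bar>inverse \<gamma> * (l i x - l j x)\<bar> <= inverse \<gamma> * (l i x + l j x)"
      unfolding abs_mult using l pos by (intro mult_mono) auto
    also have "... = \<alpha> / \<gamma> * (inverse \<alpha> * (l i x + l j x))" using pos by (simp add: field_simps)
    finally show "\<bar>d0 + inner e' x\<bar> <= \<alpha> / \<gamma> * (s0 + inner e x)" unfolding s d .
  qed
  obtain M where M: "!!eps u U g. 0 < eps ==> (u, U) \<in> H10_graph ==> weak_lap U g ==>
      norm (smul (w.p eps) u) <= M * norm g \<and> inner U (smul (w.p eps) U) <= M * (norm g)\<^sup>2"
    using w.weighted_bounds by metis
  define c where "c = \<alpha> / (1 + \<alpha> / \<gamma>)"
  have c: "0 < c" using pos by (simp add: c_def add_pos_pos)
  show ?thesis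
  proof (rule that[OF c])
    fix eps :: real and x assume e: "0 < eps"
    show "smooth (w.p eps)" "0 <= w.p eps x" using w.smooth_p[OF e] w.p_pos[OF e, of x] by simp_all
    show "(norm (grad (w.p eps) x))\<^sup>2 <= 4 * (w.p eps x) ^ 3" "\<bar>lapl (w.p eps) x\<bar> <= 4 * (w.p eps x)\<^sup>2"
      by (rule w.norm_grad_p[OF e] w.lapl_p[OF e])+
    show "eps\<^sup>2 * w.p eps x <= 1" by (rule w.p_le(2)[OF e])
    assume x: "x \<in> \<Omega>"
    have sp: "0 < w.s x" using w.s_pos[OF x] by (simp add: w.s_def)
    have "0 < w.r2 x" using sp by (simp add: w.r2_def add_pos_nonneg)
    thus "w.p eps x <= inverse (w.r2 x)" unfolding w.p_def by (intro le_imp_inverse_le) auto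
    show "eps * c <= l i x + l j x" if "eps\<^sup>2 * w.p eps x < 1 / 2"
    proof -
      have "0 < w.r2 x + eps\<^sup>2" using w.r2_nonneg[of x] e by (intro add_nonneg_pos) auto
      hence "eps\<^sup>2 < w.r2 x" using that by (simp add: w.p_def divide_inverse[symmetric] divide_less_eq)
      also have "w.r2 x <= ((1 + \<alpha> / \<gamma>) * w.s x)\<^sup>2"
      proof -
        have "\<bar>w.d x\<bar>\<^sup>2 <= (\<alpha> / \<gamma> * w.s x)\<^sup>2"
          using w.d_le[OF x] unfolding w.s_def[symmetric] w.d_def[symmetric] by (intro power_mono) auto
        hence "w.d x * w.d x <= (\<alpha> / \<gamma> * w.s x) * (\<alpha> / \<gamma> * w.s x)" by (simp add: power2_eq_square)
        moreover have "0 <= 2 * w.s x * (\<alpha> / \<gamma> * w.s x)" using sp pos by simp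
        moreover have "((1 + \<alpha> / \<gamma>) * w.s x)\<^sup>2 = (w.s x)\<^sup>2 + (\<alpha> / \<gamma> * w.s x)\<^sup>2 + 2 * w.s x * (\<alpha> / \<gamma> * w.s x)"
          unfolding distrib_right mult_1 by (rule power2_sum)
        ultimately show ?thesis unfolding w.r2_def power2_eq_square by linarith
      qed finally have "eps <= (1 + \<alpha> / \<gamma>) * w.s x"
        using sp pos by (intro power2_le_imp_le[of eps]) (auto intro!: mult_nonneg_nonneg add_nonneg_nonneg)
      hence "eps * \<alpha> <= (1 + \<alpha> / \<gamma>) * (w.s x * \<alpha>)" using pos by (simp add: mult.assoc[symmetric])
      also have "w.s x * \<alpha> = l i x + l j x" using s[of x] pos by (simp add: w.s_def)
      finally show ?thesis using pos by (simp add: c_def pos_divide_le_eq add_pos_pos mult.commute)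
    qed
  qed (rule M)
qed

text \<open>The cutoff is a smooth function of \<open>eps^2\<close> times the sum of the wedge
  weights. As \<open>eps^2 p \<le> 1\<close>, both \<open>|grad eta|^2\<close> and
  \<open>|lapl eta|\<close> are bounded by a multiple of the sum of the weights, uniformly in
  \<open>eps\<close>, and these are exactly the quantities that \<open>weighted_bounds\<close>
  controls.\<close>

lemma cutoff:
  obtains eta :: "nat => 'a => real"
  where "!!n. smooth (eta n)" "!!n x. \<bar>eta n x\<bar> <= 1" "!!x. x \<in> \<Omega> ==> (%n. eta n x) \<longlonglongrightarrow> 1"
    "!!n. \<exists>c>0. \<forall>x\<in>\<Omega>. eta n x ~= 0 --> (\<forall>i\<in>J. \<forall>j\<in>J. i ~= j --> c <= l i x + l j x)"
    "!!u U g. (u, U) \<in> H10_graph ==> weak_lap U g ==>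
      \<exists>B. \<forall>n. norm (dotm (grad (eta n)) U) <= B \<and> norm (smul (lapl (eta n)) u) <= B"
proof -
  \<comment> \<open>Parallel faces form no wedge and are excluded here.\<close>
  define I where "I = {(i, j). i \<in> J \<and> j \<in> J \<and> fst i ~= fst j \<and> fst i ~= - fst j}"
  have fin: "finite I" by (rule finite_subset[of _ "J \<times> J"]) (auto simp: I_def finite_J)
  \<comment> \<open>Bundled into one predicate, so that a single choice over all pairs provides
    every property at once.\<close>
  define good where "good q P c M D \<longleftrightarrow> 0 < c \<and> (\<forall>eps>0. smooth (P eps) \<and> (\<forall>x. 0 <= P eps x \<and>
      (norm (grad (P eps) x))\<^sup>2 <= 4 * (P eps x) ^ 3 \<and> \<bar>lapl (P eps) x\<bar> <= 4 * (P eps x)\<^sup>2 \<and> eps\<^sup>2 * P eps x <= 1 \<and>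
      (x \<in> \<Omega> --> (eps\<^sup>2 * P eps x < 1 / 2 --> eps * c <= l (fst q) x + l (snd q) x) \<and> P eps x <= D x)) \<and>
      (\<forall>u U g. (u, U) \<in> H10_graph --> weak_lap U g -->
        norm (smul (P eps) u) <= M * norm g \<and> inner U (smul (P eps) U) <= M * (norm g)\<^sup>2))"
    for q and P :: "real => 'a => real" and c M :: real and D :: "'a => real"
  have "\<exists>P c M D. good q P c M D" if "q \<in> I" for q
  proof -
    have q: "fst q \<in> J" "snd q \<in> J" "fst (fst q) ~= fst (snd q)" "fst (fst q) ~= - fst (snd q)" using that by (auto simp: I_def)
    show ?thesis
    proof (rule pair_weight[OF q], goal_cases)
      case (1 P c M D)
      have "good q P c M D" unfolding good_def
        by (intro conjI allI impI) (rule 1 1(9)[THEN conjunct1] 1(9)[THEN conjunct2]; assumption)+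
      thus ?case by blast
    qed
  qed
  then obtain P c M D where good: "!!q. q \<in> I ==> good q (P q) (c q) (M q) (D q)" by metis
  have sP: "smooth (P q eps)" and P0: "0 <= P q eps x" and gP: "(norm (grad (P q eps) x))\<^sup>2 <= 4 * (P q eps x) ^ 3"
    and lP: "\<bar>lapl (P q eps) x\<bar> <= 4 * (P q eps x)\<^sup>2" and eP: "eps\<^sup>2 * P q eps x <= 1"
    if "q \<in> I" "0 < eps" for q eps x using good[OF that(1)] that(2) unfolding good_def by blast+
  have suppP: "eps\<^sup>2 * P q eps x < 1 / 2 ==> eps * c q <= l (fst q) x + l (snd q) x" and DP: "P q eps x <= D q x"
    if "q \<in> I" "0 < eps" "x \<in> \<Omega>" for q eps x using good[OF that(1)] that(2,3) unfolding good_def by blast+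
  have MP: "norm (smul (P q eps) u) <= M q * norm g" "inner U (smul (P q eps) U) <= M q * (norm g)\<^sup>2"
    if "q \<in> I" "0 < eps" "(u, U) \<in> H10_graph" "weak_lap U g" for q eps u U g
    using good[OF that(1)] that(2-) unfolding good_def by blast+
  have cpos: "0 < c q" if "q \<in> I" for q using good[OF that] unfolding good_def by blast
  \<comment> \<open>The value is 1 up to \<open>1 / 4\<close> and 0 from \<open>1 / 2\<close> on, so
    the cutoff vanishes wherever some weight is comparable with its maximum
    \<open>eps^-2\<close>.\<close>
  define h where "h t = 1 - step (- 1 + inner 4 t)" for t :: real
  have sh: "smooth h" unfolding h_def[abs_def] by (intro smooth_diff smooth_const smooth_compose[OF smooth_step smooth_affine])
  have h: "h t = 1" if "t <= 1 / 4" for t unfolding h_def using that by (simp add: step_le_0)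
  have h': "h t = 0" if "1 / 2 <= t" for t unfolding h_def using that by (simp add: step_ge_1)
  have h1: "\<bar>h t\<bar> <= 1" for t unfolding h_def using step_bounds by (auto simp: abs_le_iff)
  define F where "F eps x = (\<Sum>q\<in>I. eps\<^sup>2 * P q eps x)" for eps x
  define S where "S eps x = (\<Sum>q\<in>I. P q eps x)" for eps x
  define N where "N = real (card I)"
  have sF: "smooth (F eps)" and sS: "smooth (S eps)" if "0 < eps" for eps
    unfolding F_def[abs_def] S_def[abs_def] using that by (auto intro!: smooth_sum smooth_mult smooth_const sP)
  have F: "0 <= F eps x" "F eps x <= N" if "0 < eps" for eps x
    unfolding F_def N_def using P0[OF _ that] sum_bounded_above[of I "%q. eps\<^sup>2 * P q eps x" 1] eP[OF _ that] by (auto intro!: sum_nonneg)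
  have S0: "0 <= S eps x" if "0 < eps" for eps x unfolding S_def using P0[OF _ that] by (intro sum_nonneg) auto
  obtain H where H: "0 <= H" "!!t. 0 <= t ==> t <= N ==> \<bar>partial 1 h t\<bar> <= H" "!!t. 0 <= t ==> t <= N ==> \<bar>partial 1 (partial 1 h) t\<bar> <= H"
  proof -
    have "bounded (f ` {0..N})" if "smooth f" for f :: "real => real"
      by (intro compact_imp_bounded compact_continuous_image smooth_continuous that) simp
    from this[OF smooth_partial[OF sh], of 1] this[OF smooth_partial[OF smooth_partial[OF sh]], of 1 1]
    obtain H1 H2 where "\<forall>y\<in>partial 1 h ` {0..N}. norm y <= H1" "\<forall>y\<in>partial 1 (partial 1 h) ` {0..N}. norm y <= H2"
      unfolding bounded_iff by blast
    thus ?thesis by (intro that[of "max 0 (max H1 H2)"]) (auto simp: le_max_iff_disj)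
  qed
  have gF: "(norm (grad (F eps) x))\<^sup>2 <= 4 * N * S eps x" and lF: "\<bar>lapl (F eps) x\<bar> <= 4 * S eps x" if e: "0 < eps" for eps x
  proof -
    have pt: "(norm (grad (%x. eps\<^sup>2 * P q eps x) x))\<^sup>2 <= 4 * P q eps x" "\<bar>lapl (%x. eps\<^sup>2 * P q eps x) x\<bar> <= 4 * P q eps x" if q: "q \<in> I" for q
    proof -
      have "(norm (grad (%x. eps\<^sup>2 * P q eps x) x))\<^sup>2 = (eps\<^sup>2)\<^sup>2 * (norm (grad (P q eps) x))\<^sup>2"
        by (simp add: grad_mult[OF smooth_const sP[OF q e]] grad_const power_mult_distrib)
      also have "... <= (eps\<^sup>2)\<^sup>2 * (4 * (P q eps x) ^ 3)" by (intro mult_left_mono gP[OF q e]) simp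
      also have "... = 4 * P q eps x * (eps\<^sup>2 * P q eps x)\<^sup>2" by (simp add: power2_eq_square power3_eq_cube mult_ac)
      also have "... <= 4 * P q eps x * 1" using eP[OF q e, of x] P0[OF q e, of x] by (intro mult_left_mono power_le_one) auto
      finally show "(norm (grad (%x. eps\<^sup>2 * P q eps x) x))\<^sup>2 <= 4 * P q eps x" by simp
      have "\<bar>lapl (%x. eps\<^sup>2 * P q eps x) x\<bar> = eps\<^sup>2 * \<bar>lapl (P q eps) x\<bar>"
        by (simp add: lapl_scale[OF sP[OF q e]] abs_mult)
      also have "... <= eps\<^sup>2 * (4 * (P q eps x)\<^sup>2)" by (intro mult_left_mono lP[OF q e]) simp
      also have "... = 4 * P q eps x * (eps\<^sup>2 * P q eps x)" by (simp add: power2_eq_square mult_ac)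
      also have "... <= 4 * P q eps x * 1" using eP[OF q e, of x] P0[OF q e, of x] by (intro mult_left_mono) auto
      finally show "\<bar>lapl (%x. eps\<^sup>2 * P q eps x) x\<bar> <= 4 * P q eps x" by simp
    qed
    have sm: "smooth (%x. eps\<^sup>2 * P q eps x)" if "q \<in> I" for q by (intro smooth_mult smooth_const sP that e)
    have "norm (grad (F eps) x) <= (\<Sum>q\<in>I. norm (grad (%x. eps\<^sup>2 * P q eps x) x))"
      unfolding F_def[abs_def] by (subst grad_sum[OF sm]) (auto intro: norm_sum)
    hence "(norm (grad (F eps) x))\<^sup>2 <= (\<Sum>q\<in>I. norm (grad (%x. eps\<^sup>2 * P q eps x) x) * 1)\<^sup>2" by (intro power_mono) auto
    also have "... <= (\<Sum>q\<in>I. (norm (grad (%x. eps\<^sup>2 * P q eps x) x))\<^sup>2) * (\<Sum>q\<in>I. 1\<^sup>2)" by (rule Cauchy_Schwarz_ineq_sum)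
    also have "... <= (\<Sum>q\<in>I. 4 * P q eps x) * (\<Sum>q\<in>I. 1\<^sup>2)" by (intro mult_right_mono sum_mono pt) auto
    also have "... = 4 * N * S eps x" by (simp add: S_def N_def sum_distrib_left[symmetric])
    finally show "(norm (grad (F eps) x))\<^sup>2 <= 4 * N * S eps x" .
    have "\<bar>lapl (F eps) x\<bar> <= (\<Sum>q\<in>I. \<bar>lapl (%x. eps\<^sup>2 * P q eps x) x\<bar>)"
      unfolding F_def[abs_def] by (subst lapl_sum[OF sm]) (auto intro: sum_abs)
    also have "... <= (\<Sum>q\<in>I. 4 * P q eps x)" by (intro sum_mono pt)
    finally show "\<bar>lapl (F eps) x\<bar> <= 4 * S eps x" by (simp add: S_def sum_distrib_left)
  qed
  define E where "E n = 1 / real (Suc n)" for n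
  have E: "0 < E n" for n by (simp add: E_def)
  define eta where "eta n x = h (F (E n) x)" for n x
  have seta: "smooth (eta n)" for n unfolding eta_def[abs_def] by (rule smooth_compose[OF sh sF[OF E]])
  define K where "K = 4 * H * N + 4 * H\<^sup>2 * N + 4 * H"
  have K0: "0 <= K" using H(1) by (simp add: K_def N_def)
  have geta: "(norm (grad (eta n) x))\<^sup>2 <= K * S (E n) x" for n x
  proof -
    note Fb = F[OF E[of n], of x]
    have "(norm (grad (eta n) x))\<^sup>2 = (partial 1 h (F (E n) x))\<^sup>2 * (norm (grad (F (E n)) x))\<^sup>2"
      unfolding eta_def[abs_def] by (simp add: grad_compose[OF sh sF[OF E]] power_mult_distrib)
    also have "... <= H\<^sup>2 * (4 * N * S (E n) x)"
      using H(1) H(2)[OF Fb] gF[OF E] by (intro mult_mono) (auto simp: abs_le_square_iff[symmetric])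
    also have "... = (4 * H\<^sup>2 * N) * S (E n) x" by simp
    also have "... <= K * S (E n) x" using S0[OF E] H(1) by (intro mult_right_mono) (auto simp: K_def N_def)
    finally show ?thesis .
  qed
  have leta: "\<bar>lapl (eta n) x\<bar> <= K * S (E n) x" for n x
  proof -
    note Fb = F[OF E[of n], of x]
    have "\<bar>lapl (eta n) x\<bar> <= \<bar>partial 1 (partial 1 h) (F (E n) x)\<bar> * (norm (grad (F (E n)) x))\<^sup>2
        + \<bar>partial 1 h (F (E n) x)\<bar> * \<bar>lapl (F (E n)) x\<bar>"
      unfolding eta_def[abs_def] lapl_compose[OF sh sF[OF E]] by (rule order_trans[OF abs_triangle_ineq]) (simp add: abs_mult)
    also have "... <= H * (4 * N * S (E n) x) + H * (4 * S (E n) x)"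
      using H(1) H(2,3)[OF Fb] gF[OF E] lF[OF E] by (intro add_mono mult_mono) auto
    also have "... = (4 * H * N + 4 * H) * S (E n) x" by (simp add: algebra_simps)
    also have "... <= K * S (E n) x" using S0[OF E] H(1) by (intro mult_right_mono) (auto simp: K_def N_def)
    finally show ?thesis .
  qed
  show ?thesis
  proof (rule that[OF seta])
    show "\<bar>eta n x\<bar> <= 1" for n x unfolding eta_def by (rule h1)
    show "(%n. eta n x) \<longlonglongrightarrow> 1" if x: "x \<in> \<Omega>" for x
    proof -
      \<comment> \<open>At a fixed point of \<Omega> the weights stay below \<open>D\<close>, which
        does not depend on \<open>eps\<close>.\<close>
      have "(%n. (E n)\<^sup>2 * (\<Sum>q\<in>I. D q x)) \<longlonglongrightarrow> 0\<^sup>2 * (\<Sum>q\<in>I. D q x)"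
        unfolding E_def by (intro tendsto_intros LIMSEQ_Suc[OF lim_1_over_n])
      hence "\<forall>\<^sub>F n in sequentially. (E n)\<^sup>2 * (\<Sum>q\<in>I. D q x) < 1 / 4" by (rule order_tendstoD) simp
      hence "\<forall>\<^sub>F n in sequentially. eta n x = 1"
      proof eventually_elim
        case (elim n)
        have "F (E n) x <= (E n)\<^sup>2 * (\<Sum>q\<in>I. D q x)"
          unfolding F_def sum_distrib_left by (intro sum_mono mult_left_mono DP E x) auto
        thus ?case unfolding eta_def using elim by (intro h) simp
      qed
      thus ?thesis by (rule tendsto_eventually)
    qed
    show "\<exists>c>0. \<forall>x\<in>\<Omega>. eta n x ~= 0 --> (\<forall>i\<in>J. \<forall>j\<in>J. i ~= j --> c <= l i x + l j x)" for n
    proof -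
      have "\<exists>c>0. \<forall>x\<in>\<Omega>. eta n x ~= 0 --> c <= l i x + l j x" if ij: "i \<in> J" "j \<in> J" "i ~= j" for i j
      proof (cases "(i, j) \<in> I")
        case True
        show ?thesis
        proof (intro exI[of _ "E n * c (i, j)"] conjI ballI impI)
          show "0 < E n * c (i, j)" using E cpos[OF True] by simp
          fix x assume x: "x \<in> \<Omega>" "eta n x ~= 0"
          have "F (E n) x < 1 / 2" using x(2) h'[of "F (E n) x"] unfolding eta_def by fastforce
          moreover have "(E n)\<^sup>2 * P (i, j) (E n) x <= F (E n) x"
            unfolding F_def using P0[OF _ E] fin True by (intro member_le_sum) auto
          ultimately show "E n * c (i, j) <= l i x + l j x" using suppP[OF True E x(1)] by simp
        qed
      next
        case False
        \<comment> \<open>For parallel faces the sum of the two distances is bounded below on all of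
          \<Omega>: by the difference of the offsets for equal normals, while for opposite normals
          it is constant.\<close>
        then consider "fst i = fst j" "snd i ~= snd j" | "fst i = - fst j" using ij by (auto simp: I_def prod_eq_iff)
        thus ?thesis
        proof cases
          case 1
          show ?thesis
          proof (intro exI[of _ "\<bar>snd i - snd j\<bar>"] conjI ballI impI)
            show "0 < \<bar>snd i - snd j\<bar>" using 1 by simp
            fix x assume "x \<in> \<Omega>"
            hence "0 < l i x" "0 < l j x" using domain_l ij by auto
            thus "\<bar>snd i - snd j\<bar> <= l i x + l j x" using 1(1) by (auto simp: l_def abs_le_iff)
          qed
        next
          case 2
          obtain z where "z \<in> \<Omega>" using nonempty by blast
          hence "0 < l i z + l j z" using domain_l ij by (simp add: add_pos_pos)
          moreover have "l i x + l j x = l i z + l j z" for x using 2 by (simp add: l_def)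
          ultimately show ?thesis by (intro exI[of _ "l i z + l j z"]) (metis order_refl)
        qed
      qed
      hence "\<exists>c>0. \<forall>x\<in>\<Omega>. eta n x ~= 0 --> i ~= j --> c <= l i x + l j x" if "i \<in> J" "j \<in> J" for i j
        using that by (cases "i = j") (auto intro: exI[of _ 1])
      then obtain cc where cc: "!!i j. i \<in> J ==> j \<in> J ==> 0 < cc i j"
        "!!i j x. i \<in> J ==> j \<in> J ==> x \<in> \<Omega> ==> eta n x ~= 0 ==> i ~= j ==> cc i j <= l i x + l j x" by metis
      let ?C = "insert 1 ((%(i, j). cc i j) ` (J \<times> J))"
      have fC: "finite ?C" using finite_J by simp
      show ?thesis
      proof (intro exI[of _ "Min ?C"] conjI ballI impI)
        show "0 < Min ?C" using fC cc(1) by (subst Min_gr_iff) auto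
        show "Min ?C <= l i x + l j x" if "x \<in> \<Omega>" "eta n x ~= 0" "i \<in> J" "j \<in> J" "i ~= j" for x i j
          using cc(2)[OF that(3,4,1,2,5)] Min_le[OF fC, of "cc i j"] that(3,4) by fastforce
      qed
    qed
    fix u U g assume u: "(u, U) \<in> H10_graph" and g: "weak_lap U g"
    define B1 where "B1 = K * (\<Sum>q\<in>I. M q * (norm g)\<^sup>2)"
    define B2 where "B2 = K * (\<Sum>q\<in>I. M q * norm g)"
    have "norm (dotm (grad (eta n)) U) <= sqrt B1" for n
    proof (rule real_le_rsqrt)
      note cS = smooth_continuous[OF sS[OF E[of n]]] and cg = continuous_grad[OF seta]
      obtain f where f: "sq_int f" "U = cls f" by (rule l2_cases)
      let ?a = "%y. if y \<in> \<Omega> then inner (grad (eta n) y) (f y) else 0"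
        and ?b = "%y. if y \<in> \<Omega> then S (E n) y *\<^sub>R f y else 0"
      have sq: "sq_int ?a" "sq_int ?b"
        using sq_int_mulop[OF pw_op_inner[OF cg] f(1)] sq_int_mulop[OF pw_op_mult[OF cS] f(1)] by auto
      have "(norm (dotm (grad (eta n)) U))\<^sup>2 = (LINT y|lborel. (norm (?a y))\<^sup>2)"
        unfolding f(2) dotm_def mulop_cls[OF pw_op_inner[OF cg] f(1)] by (rule norm_cls[OF sq(1)])
      also have "... <= (LINT y|lborel. K * inner (f y) (?b y))"
      proof (rule integral_mono)
        show "integrable lborel (%y. (norm (?a y))\<^sup>2)" using sq(1) unfolding sq_int_def by blast
        show "integrable lborel (%y. K * inner (f y) (?b y))" using sq_int_inner[OF f(1) sq(2)] by (rule integrable_mult_right)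
        show "(norm (?a y))\<^sup>2 <= K * inner (f y) (?b y)" for y
        proof (cases "y \<in> \<Omega>")
          case True
          have "(inner (grad (eta n) y) (f y))\<^sup>2 <= (norm (grad (eta n) y))\<^sup>2 * (norm (f y))\<^sup>2"
            using Cauchy_Schwarz_ineq[of "grad (eta n) y" "f y"] by (simp add: power2_norm_eq_inner)
          also have "... <= K * S (E n) y * (norm (f y))\<^sup>2" by (intro mult_right_mono geta) simp
          finally show ?thesis using True by (simp add: power2_norm_eq_inner mult.assoc)
        qed simp
      qed
      also have "... = K * inner U (smul (S (E n)) U)"
        unfolding f(2) smul_def mulop_cls[OF pw_op_mult[OF cS] f(1)] inner_cls[OF f(1) sq(2)] by simp
      also have "smul (S (E n)) U = (\<Sum>q\<in>I. smul (P q (E n)) U)"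
        unfolding S_def[abs_def] by (rule smul_sum[OF fin smooth_continuous[OF sP[OF _ E]]])
      also have "K * inner U ... <= B1"
        unfolding B1_def inner_sum_right using K0 MP(2)[OF _ E u g] by (intro mult_left_mono sum_mono)
      finally show "(norm (dotm (grad (eta n)) U))\<^sup>2 <= B1" .
    qed
    moreover have "norm (smul (lapl (eta n)) u) <= B2" for n
    proof -
      note cS = smooth_continuous[OF sS[OF E[of n]]]
      have "norm (smul (lapl (eta n)) u) <= norm (smul (%x. K * S (E n) x) u)" unfolding smul_def
      proof (rule norm_mulop_mono)
        show "norm (lapl (eta n) y *\<^sub>R repr u y) <= norm ((K * S (E n) y) *\<^sub>R repr u y)" for y
          using leta[of n y] S0[OF E, of n y] K0 by (simp add: mult_right_mono abs_mult)
      qed (intro pw_op_mult continuous_intros cS smooth_continuous smooth_lapl seta)+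
      also have "... = K * norm (\<Sum>q\<in>I. smul (P q (E n)) u)"
      proof -
        have "smul (S (E n)) u = (\<Sum>q\<in>I. smul (P q (E n)) u)"
          unfolding S_def[abs_def] by (rule smul_sum[OF fin smooth_continuous[OF sP[OF _ E]]])
        thus ?thesis unfolding smul_scale[OF cS] using K0 by simp
      qed
      also have "... <= B2"
        unfolding B2_def using K0 MP(1)[OF _ E u g] by (intro mult_left_mono order_trans[OF norm_sum] sum_mono)
      finally show ?thesis .
    qed
    ultimately show "\<exists>B. \<forall>n. norm (dotm (grad (eta n)) U) <= B \<and> norm (smul (lapl (eta n)) u) <= B"
      by (intro exI[of _ "max (sqrt B1) B2"]) (auto simp: le_max_iff_disj)
  qed
qed

text \<open>\<open>restr g = g\<close> fixes \<open>g\<close> outside \<Omega>, where the weak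
  equation says nothing; \<open>regular w\<close> supplies the second derivatives that membership in
  the Dirichlet domain asks for.\<close>

definition lap_graph :: "(('a, real) l2 \<times> ('a, real) l2) set" where
  "lap_graph = {(w, g). \<exists>W. (w, W) \<in> H10_graph \<and> weak_lap W g \<and> regular w \<and> restr g = g}"

lemma smul_one_idem: "continuous_on UNIV f ==> restr (smul f x) = smul f x"
  unfolding smul_def by (rule mulop_mulop) (auto intro!: pw_op_mult continuous_on_const)

lemma subspace_test: "subspace (cls ` tests)"
proof -
  have "cls ` tests = fst ` (%phi. (cls phi, cls (grad phi))) ` tests" by (simp add: image_image)
  also have "subspace ..." by (rule linear_subspace_image[OF linear_fst subspace_test_graph]) finally show ?thesis .
qed

lemma smul_closure_test: "y \<in> closure (cls ` tests) ==> restr y = y"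
proof -
  have "closed {z :: ('a, real) l2. restr z = z}"
    by (intro closed_Collect_eq continuous_intros bounded_linear.continuous_on[OF bounded_linear_smul])
  hence "closure (cls ` tests) \<subseteq> {z. restr z = z}"
    using H10_graph_supp(1)[OF H10_graph_test] by (intro closure_minimal) auto
  thus "y \<in> closure (cls ` tests) ==> restr y = y" by blast
qed

text \<open>The Riesz representative of \<open>x\<close> in the closure differs from
  \<open>x\<close> by a vector orthogonal to all test functions, and \<open>test_dense\<close> makes
  it 0.\<close>

lemma closure_test:
  assumes "restr x = x" shows "x \<in> closure (cls ` tests)"
proof -
  obtain y where y: "y \<in> closure (cls ` tests)" "!!z. z \<in> cls ` tests ==> inner x z = inner y z"
    by (rule riesz_subspace[OF subspace_test, of "inner x" "norm x"]) (auto simp: inner_add_right Cauchy_Schwarz_ineq2)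
  have "restr y = y" by (rule smul_closure_test[OF y(1)])
  hence "restr (x - y) = x - y"
    using assms linear_diff[OF bounded_linear.linear[OF bounded_linear_smul[OF continuous_on_const]], of 1 x y] by simp
  hence "x - y = 0" by (rule test_dense) (use y(2) in \<open>simp add: inner_diff_left\<close>)
  thus ?thesis using y(1) by simp
qed

theorem lap_graph_dense_range:
  assumes x: "restr x = x" and o: "!!w g. (w, g) \<in> lap_graph ==> inner x (w - g) = 0"
  shows "x = 0"
proof -
  obtain u U where u: "(u, U) \<in> H10_graph" and sol: "!!phi \<Phi>. (phi, \<Phi>) \<in> H10_graph ==> inner u phi + inner U \<Phi> = inner x phi"
    using weak_solution by blast
  have lap: "weak_lap U (u - x)"
    unfolding weak_lap_def using sol[OF H10_graph_test] by (auto simp: inner_diff_left algebra_simps)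
  obtain eta :: "nat => 'a => real" where eta: "!!n. smooth (eta n)" "!!n x. \<bar>eta n x\<bar> <= 1" "!!x. x \<in> \<Omega> ==> (%n. eta n x) \<longlonglongrightarrow> 1"
    "!!n. \<exists>c>0. \<forall>x\<in>\<Omega>. eta n x ~= 0 --> (\<forall>i\<in>J. \<forall>j\<in>J. i ~= j --> c <= l i x + l j x)"
    "!!u U g. (u, U) \<in> H10_graph ==> weak_lap U g ==>
      \<exists>B. \<forall>n. norm (dotm (grad (eta n)) U) <= B \<and> norm (smul (lapl (eta n)) u) <= B"
    by (rule cutoff) (blast intro: that)
  note ceta = smooth_continuous[OF eta(1)]
  define g where "g n = smul (eta n) (u - x) + 2 *\<^sub>R dotm (grad (eta n)) U + smul (lapl (eta n)) u" for n
  note w = H10_graph_mult[OF u eta(1)] and gl = weak_lap_mult[OF u lap eta(1), folded g_def]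
  have eq: "inner x (smul (eta n) u) = inner x (g n)" for n
  proof -
    have "regular (smul (eta n) u)"
      using eta(4)[of n] regular_away_from_edges[OF u lap eta(1), of _ n] by blast
    moreover have "restr (g n) = g n"
    proof -
      have "restr (dotm (grad (eta n)) U) = dotm (grad (eta n)) U" unfolding smul_def dotm_def
        by (rule mulop_mulop) (auto intro!: pw_op_mult pw_op_inner continuous_on_const continuous_grad eta(1))
      thus ?thesis unfolding g_def
          linear_add[OF bounded_linear.linear[OF bounded_linear_smul[OF continuous_on_const]]]
          linear_scale[OF bounded_linear.linear[OF bounded_linear_smul[OF continuous_on_const]]]
        by (simp add: smul_one_idem ceta smooth_continuous[OF smooth_lapl[OF eta(1)]])
    qed
    ultimately have "(smul (eta n) u, g n) \<in> lap_graph" using w[of n] gl[of n] unfolding lap_graph_def by blast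
    from o[OF this] show ?thesis by (simp add: inner_diff_right)
  qed
  have lim: "(%n. smul (eta n) z) \<longlonglongrightarrow> restr z" for z :: "('a, real) l2"
    unfolding smul_def
  proof (rule mulop_tendsto[where M = 1])
    show "norm (eta n y *\<^sub>R v) <= 1 * norm v" for n y and v :: real using eta(2)[of n y] by (simp add: abs_mult mult_left_le_one_le)
    show "(%n. eta n y *\<^sub>R v) \<longlonglongrightarrow> 1 *\<^sub>R v" if "y \<in> \<Omega>" for y and v :: real by (intro tendsto_intros eta(3)[OF that])
  qed (auto intro!: pw_op_mult ceta continuous_on_const)
  have su: "restr u = u" by (rule H10_graph_supp(1)[OF u])
  \<comment> \<open>With the Laplacian moved onto the fixed test function, the derivatives of the
    cutoff disappear from the expression.\<close>
  have gt: "(%n. inner (g n) (cls phi)) \<longlonglongrightarrow> inner (u - x) (cls phi)" if p: "phi \<in> tests" for phi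
  proof -
    have "(%n. inner (smul (eta n) u) (cls (lapl phi))) \<longlonglongrightarrow> inner (restr u) (cls (lapl phi))"
      by (intro tendsto_intros lim)
    thus ?thesis using weak_lap_inner[OF w gl p] weak_lap_inner[OF u lap p] by (simp add: su)
  qed
  obtain B where B: "!!n. norm (g n) <= B"
  proof -
    obtain B0 where B0: "!!n. norm (dotm (grad (eta n)) U) <= B0" "!!n. norm (smul (lapl (eta n)) u) <= B0" using eta(5)[OF u lap] by blast
    obtain B1 where B1: "!!n. norm (smul (eta n) (u - x)) <= B1"
      using convergent_imp_Bseq[OF convergentI[OF lim[of "u - x"]]] unfolding Bseq_def by blast
    have "norm (g n) <= B1 + 2 * B0 + B0" for n unfolding g_def using B0[of n] B1[of n]
      by (intro order_trans[OF norm_triangle_ineq] add_mono) (auto intro: order_trans)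
    thus ?thesis by (rule that)
  qed
  \<comment> \<open>Boundedness together with convergence on a dense set gives weak convergence,
    which suffices because \<open>x\<close> is fixed.\<close>
  have "(%n. inner (g n) x) \<longlonglongrightarrow> inner (u - x) x"
  proof (rule LIMSEQ_I)
    fix r :: real assume r: "0 < r"
    define B' where "B' = max B 0 + norm (u - x) + 1"
    have B': "0 < B'" by (simp add: B'_def add_nonneg_pos add_nonneg_nonneg)
    obtain phi where p: "phi \<in> tests" "dist (cls phi) x < r / (2 * B')"
      using closure_test[OF x] r B' unfolding closure_approachable by (metis (no_types, lifting) divide_pos_pos image_iff mult_pos_pos zero_less_numeral)
    obtain n0 where n0: "!!n. n0 <= n ==> norm (inner (g n) (cls phi) - inner (u - x) (cls phi)) < r / 2"
      using LIMSEQ_D[OF gt[OF p(1)], of "r / 2"] r by auto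
    have "norm (inner (g n) x - inner (u - x) x) < r" if "n0 <= n" for n
    proof -
      have "\<bar>inner (g n - (u - x)) (x - cls phi)\<bar> <= norm (g n - (u - x)) * norm (x - cls phi)" by (rule Cauchy_Schwarz_ineq2)
      also have "... <= B' * (r / (2 * B'))" using B[of n] norm_triangle_ineq4[of "g n" "u - x"] p(2) B'
        by (intro mult_mono) (auto simp: B'_def dist_norm norm_minus_commute)
      also have "... = r / 2" using B' by simp
      finally have "\<bar>inner (g n - (u - x)) (x - cls phi)\<bar> <= r / 2" .
      moreover have "inner (g n) x - inner (u - x) x = inner (g n - (u - x)) (x - cls phi) + (inner (g n) (cls phi) - inner (u - x) (cls phi))"
        by (simp only: inner_diff_left inner_diff_right)
      ultimately show ?thesis using n0[OF that] unfolding real_norm_def by linarith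
    qed
    thus "\<exists>no. \<forall>n\<ge>no. norm (inner (g n) x - inner (u - x) x) < r" by blast
  qed
  moreover have "(%n. inner (smul (eta n) u) x) \<longlonglongrightarrow> inner u x"
    using lim[of u] unfolding su by (intro tendsto_intros)
  ultimately have "inner u x = inner (u - x) x" using eq LIMSEQ_unique by (simp add: inner_commute)
  thus ?thesis by (simp add: inner_diff_left)
qed

end

section \<open>The Dirichlet Laplacian as a dissipative graph\<close>

context polytope_domain
begin

text \<open>The passage from Lebesgue-measurable functions on \<Omega> to Borel functions on the
  whole space: extend by 0 and choose a Borel function that agrees almost everywhere.\<close>

definition l2_of :: "('a => real) => ('a, real) l2" where
  "l2_of f = cls (SOME g. sq_int g \<and> (AE x in lborel. g x = (if x \<in> \<Omega> then f x else 0)))"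

lemma domain_lebesgue: "\<Omega> \<in> sets lebesgue" "\<Omega> \<inter> space lebesgue \<in> sets lebesgue"
  using open_domain by auto

lemma L2_lebesgue:
  "f \<in> L2 \<Omega> \<longleftrightarrow> (%x. if x \<in> \<Omega> then f x else 0) \<in> borel_measurable lebesgue \<and>
    integrable lebesgue (%x. (if x \<in> \<Omega> then f x else 0)\<^sup>2)"
proof -
  have "(%x. indicator \<Omega> x *\<^sub>R f x) = (%x. if x \<in> \<Omega> then f x else 0)"
    "(%x. indicator \<Omega> x *\<^sub>R (f x)\<^sup>2) = (%x. (if x \<in> \<Omega> then f x else 0)\<^sup>2)" by (auto simp: indicator_def)
  thus ?thesis unfolding L2_def mem_Collect_eq borel_measurable_restrict_space_iff[OF domain_lebesgue(2)]
      integrable_restrict_space[OF domain_lebesgue(2)] by simp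
qed

lemma L2_representative:
  assumes "f \<in> L2 \<Omega>"
  obtains g where "sq_int g" "AE x in lborel. g x = (if x \<in> \<Omega> then f x else 0)" "l2_of f = cls g"
proof -
  let ?f = "%x. if x \<in> \<Omega> then f x else 0"
  obtain g where g: "g \<in> borel_measurable lborel" "AE x in lborel. ?f x = g x"
    using completion_ex_borel_measurable_real[of ?f lborel] assms unfolding L2_lebesgue by blast
  have [measurable]: "g \<in> borel_measurable borel" using g(1) by simp
  have "integrable lebesgue (%x. (g x)\<^sup>2)"
  proof (rule Bochner_Integration.integrable_cong_AE_imp)
    show "integrable lebesgue (%x. (?f x)\<^sup>2)" using assms unfolding L2_lebesgue by blast
    show "(%x. (g x)\<^sup>2) \<in> borel_measurable lebesgue" by (intro measurable_completion) measurable
    show "AE x in lebesgue. (?f x)\<^sup>2 = (g x)\<^sup>2" using AE_completion[OF g(2)] by eventually_elim simp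
  qed
  hence "integrable lborel (%x. (g x)\<^sup>2)" by (subst (asm) integrable_completion) auto
  hence "sq_int g" by (simp add: sq_int_def)
  moreover have "AE x in lborel. g x = ?f x" using g(2) by eventually_elim simp
  ultimately have "\<exists>g. sq_int g \<and> (AE x in lborel. g x = ?f x)" by blast
  from someI_ex[OF this] show ?thesis by (intro that[of "SOME g. sq_int g \<and> (AE x in lborel. g x = ?f x)"]) (auto simp: l2_of_def)
qed

lemma l2_of_eqI:
  assumes "f \<in> L2 \<Omega>" "sq_int g" "AE x in lborel. g x = (if x \<in> \<Omega> then f x else 0)"
  shows "l2_of f = cls g"
proof -
  obtain h where h: "sq_int h" "AE x in lborel. h x = (if x \<in> \<Omega> then f x else 0)" "l2_of f = cls h"
    by (rule L2_representative[OF assms(1)])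
  have "AE x in lborel. h x = g x" using h(2) assms(3) by eventually_elim simp
  thus ?thesis using h(1,3) assms(2) by (simp add: cls_eq_iff)
qed

lemma sq_int_L2:
  assumes "sq_int g" "!!x. x \<notin> \<Omega> ==> g x = 0"
  shows "g \<in> L2 \<Omega>" and "l2_of g = cls g"
proof -
  have e: "(%x. if x \<in> \<Omega> then g x else 0) = g" using assms(2) by auto
  have m: "g \<in> borel_measurable lborel" using assms(1) by (simp add: sq_int_def)
  have "integrable lborel (%x. (g x)\<^sup>2)" using assms(1) by (simp add: sq_int_def)
  hence "integrable lebesgue (%x. (g x)\<^sup>2)" using m by (subst integrable_completion) auto
  thus "g \<in> L2 \<Omega>" unfolding L2_lebesgue e fun_cong[OF e] using measurable_completion[OF m] by simp
  thus "l2_of g = cls g" using assms by (intro l2_of_eqI) auto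
qed

lemma test_L2:
  assumes "phi \<in> tests" shows "phi \<in> L2 \<Omega>" "l2_of phi = cls phi"
  using sq_int_L2[OF test_sq_int[OF assms] test_zero_outside[OF assms]] by auto

lemma L2_inner_eq:
  assumes "f \<in> L2 \<Omega>" "h \<in> L2 \<Omega>" shows "L2_inner \<Omega> f h = inner (l2_of f) (l2_of h)"
proof -
  obtain f' where f: "sq_int f'" "AE x in lborel. f' x = (if x \<in> \<Omega> then f x else 0)" "l2_of f = cls f'"
    by (rule L2_representative[OF assms(1)])
  obtain h' where h: "sq_int h'" "AE x in lborel. h' x = (if x \<in> \<Omega> then h x else 0)" "l2_of h = cls h'"
    by (rule L2_representative[OF assms(2)])
  note [measurable] = sq_int_measurable[OF f(1)] sq_int_measurable[OF h(1)]
  have "L2_inner \<Omega> f h = (LINT x|lebesgue. (if x \<in> \<Omega> then f x else 0) * (if x \<in> \<Omega> then h x else 0))"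
    unfolding L2_inner_def integral_restrict_space[OF domain_lebesgue(2)]
    by (rule Bochner_Integration.integral_cong) (auto simp: indicator_def)
  also have "... = (LINT x|lebesgue. f' x * h' x)"
  proof (rule integral_cong_AE)
    show "(%x. (if x \<in> \<Omega> then f x else 0) * (if x \<in> \<Omega> then h x else 0)) \<in> borel_measurable lebesgue"
      using assms unfolding L2_lebesgue by (intro borel_measurable_times) auto
    show "(%x. f' x * h' x) \<in> borel_measurable lebesgue" by (intro measurable_completion) measurable
    show "AE x in lebesgue. (if x \<in> \<Omega> then f x else 0) * (if x \<in> \<Omega> then h x else 0) = f' x * h' x"
      using AE_completion[OF f(2)] AE_completion[OF h(2)] by eventually_elim simp
  qed
  also have "... = (LINT x|lborel. f' x * h' x)" by (rule integral_completion) measurable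
  finally show ?thesis by (simp add: f(3) h(3) inner_cls f(1) h(1))
qed

lemma L2_norm_eq: "f \<in> L2 \<Omega> ==> L2_norm \<Omega> f = norm (l2_of f)"
  by (simp add: L2_norm_def L2_inner_eq norm_eq_sqrt_inner)

lemma L2_add:
  assumes "f \<in> L2 \<Omega>" "h \<in> L2 \<Omega>"
  shows "(%x. f x + h x) \<in> L2 \<Omega>" and "l2_of (%x. f x + h x) = l2_of f + l2_of h"
proof -
  obtain f' where f: "sq_int f'" "AE x in lborel. f' x = (if x \<in> \<Omega> then f x else 0)" "l2_of f = cls f'"
    by (rule L2_representative[OF assms(1)])
  obtain h' where h: "sq_int h'" "AE x in lborel. h' x = (if x \<in> \<Omega> then h x else 0)" "l2_of h = cls h'"
    by (rule L2_representative[OF assms(2)])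
  have ae: "AE x in lborel. f' x + h' x = (if x \<in> \<Omega> then f x + h x else 0)"
    using f(2) h(2) by eventually_elim simp
  note s = sq_int_add[OF f(1) h(1)]
  have e: "(%x. if x \<in> \<Omega> then f x + h x else 0) = (%x. (if x \<in> \<Omega> then f x else 0) + (if x \<in> \<Omega> then h x else 0))" by auto
  have m: "(%x. if x \<in> \<Omega> then f x + h x else 0) \<in> borel_measurable lebesgue"
    unfolding e using assms unfolding L2_lebesgue by (intro borel_measurable_add) auto
  have "integrable lborel (%x. (f' x + h' x)\<^sup>2)" using s by (simp add: sq_int_def)
  hence "integrable lebesgue (%x. (f' x + h' x)\<^sup>2)"
    using s by (subst integrable_completion) (auto simp: sq_int_def)
  hence "integrable lebesgue (%x. (if x \<in> \<Omega> then f x + h x else 0)\<^sup>2)"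
    by (rule Bochner_Integration.integrable_cong_AE_imp)
      (use m AE_completion[OF ae] in \<open>auto elim!: eventually_mono\<close>)
  thus L: "(%x. f x + h x) \<in> L2 \<Omega>" unfolding L2_lebesgue using m by blast
  show "l2_of (%x. f x + h x) = l2_of f + l2_of h"
    using l2_of_eqI[OF L s ae] by (simp add: f(3) h(3) cls_add f(1) h(1))
qed

lemma L2_scale:
  assumes "f \<in> L2 \<Omega>" shows "(%x. c * f x) \<in> L2 \<Omega>" and "l2_of (%x. c * f x) = c *\<^sub>R l2_of f"
proof -
  obtain f' where f: "sq_int f'" "AE x in lborel. f' x = (if x \<in> \<Omega> then f x else 0)" "l2_of f = cls f'"
    by (rule L2_representative[OF assms(1)])
  have e: "(%x. if x \<in> \<Omega> then c * f x else 0) = (%x. c * (if x \<in> \<Omega> then f x else 0))" by auto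
  show L: "(%x. c * f x) \<in> L2 \<Omega>"
    using assms unfolding L2_lebesgue e fun_cong[OF e] power_mult_distrib
    by (intro conjI borel_measurable_times borel_measurable_const integrable_mult_right) auto
  have "AE x in lborel. c *\<^sub>R f' x = (if x \<in> \<Omega> then c * f x else 0)" using f(2) by eventually_elim simp
  from l2_of_eqI[OF L sq_int_scaleR[OF f(1)] this]
  show "l2_of (%x. c * f x) = c *\<^sub>R l2_of f" by (simp only: f(3) cls_scaleR[OF f(1)])
qed

lemma L2_diff:
  assumes "f \<in> L2 \<Omega>" "h \<in> L2 \<Omega>"
  shows "(%x. f x - h x) \<in> L2 \<Omega>" and "l2_of (%x. f x - h x) = l2_of f - l2_of h"
  using L2_add[OF assms(1) L2_scale(1)[OF assms(2)], of "- 1"] L2_scale(2)[OF assms(2), of "- 1"] by simp_all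

lemma L2_zero: "(%x. 0) \<in> L2 \<Omega>" and l2_of_zero: "l2_of (%x. 0) = 0"
  using sq_int_L2[OF sq_int_0] by (auto simp: cls_0)

lemma L2_sum:
  assumes "!!j. j \<in> I ==> f j \<in> L2 \<Omega>"
  shows "(%x. \<Sum>j\<in>I. f j x) \<in> L2 \<Omega>" and "l2_of (%x. \<Sum>j\<in>I. f j x) = (\<Sum>j\<in>I. l2_of (f j))"
proof -
  have "(%x. \<Sum>j\<in>I. f j x) \<in> L2 \<Omega> \<and> l2_of (%x. \<Sum>j\<in>I. f j x) = (\<Sum>j\<in>I. l2_of (f j))"
    using assms
  proof (induction I rule: infinite_finite_induct)
    case (insert i I)
    hence "f i \<in> L2 \<Omega>" and I: "(%x. \<Sum>j\<in>I. f j x) \<in> L2 \<Omega>" "l2_of (%x. \<Sum>j\<in>I. f j x) = (\<Sum>j\<in>I. l2_of (f j))" by auto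
    from L2_add[OF this(1,2)] show ?case unfolding sum.insert[OF insert.hyps] I(2) by blast
  qed (simp_all add: L2_zero l2_of_zero)
  thus "(%x. \<Sum>j\<in>I. f j x) \<in> L2 \<Omega>" "l2_of (%x. \<Sum>j\<in>I. f j x) = (\<Sum>j\<in>I. l2_of (f j))" by blast+
qed

lemma l2_of_null:
  assumes "f \<in> L2 \<Omega>" "AE x in lebesgue_on \<Omega>. f x = 0" shows "l2_of f = 0"
proof -
  have "L2_inner \<Omega> f f = 0"
    unfolding L2_inner_def by (rule integral_eq_zero_AE) (use assms(2) in \<open>auto elim: eventually_mono\<close>)
  thus ?thesis using L2_inner_eq[OF assms(1) assms(1)] by simp
qed

lemma smul_l2_of:
  assumes "f \<in> L2 \<Omega>" shows "restr (l2_of f) = l2_of f"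
proof -
  obtain g where g: "sq_int g" "AE x in lborel. g x = (if x \<in> \<Omega> then f x else 0)" "l2_of f = cls g"
    by (rule L2_representative[OF assms])
  have "AE x in lborel. (if x \<in> \<Omega> then 1 *\<^sub>R g x else 0) = g x" using g(2) by eventually_elim auto
  thus ?thesis using sq_int_mulop[OF pw_op_mult[OF continuous_on_const] g(1), of 1] g(1)
    unfolding g(3) smul_def mulop_cls[OF pw_op_mult[OF continuous_on_const] g(1)] by (simp add: cls_eq_iff)
qed

lemma l2_of_surj:
  assumes "restr z = z" obtains f where "f \<in> L2 \<Omega>" "l2_of f = z"
proof -
  obtain g where g: "sq_int g" "z = cls g" by (rule l2_cases)
  let ?g = "%y. if y \<in> \<Omega> then 1 *\<^sub>R g y else 0"
  have s: "sq_int ?g" by (rule sq_int_mulop[OF pw_op_mult[OF continuous_on_const] g(1)])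
  have "cls ?g = z" using assms unfolding g(2) smul_def mulop_cls[OF pw_op_mult[OF continuous_on_const] g(1)] .
  thus ?thesis using sq_int_L2[OF s] by (intro that[of ?g]) auto
qed

section \<open>Weak derivatives in terms of classes\<close>

lemma has_weak_partial_iff:
  assumes "f \<in> L2 \<Omega>" "h \<in> L2 \<Omega>"
  shows "has_weak_partial \<Omega> i f h \<longleftrightarrow>
    (\<forall>phi\<in>tests. inner (l2_of f) (cls (partial i phi)) = - inner (l2_of h) (cls phi))"
  unfolding has_weak_partial_def by (simp add: L2_inner_eq assms test_L2 test_L2[OF test_partial])

text \<open>By density of the test functions a weak derivative has only one class, which identifies
  the representative selected in \<open>weak_partial\<close>.\<close>

lemma weak_partial:
  assumes f: "f \<in> L2 \<Omega>" and z: "restr z = z"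
    and d: "!!phi. phi \<in> tests ==> inner (l2_of f) (cls (partial i phi)) = - inner z (cls phi)"
  shows "\<exists>w\<in>L2 \<Omega>. has_weak_partial \<Omega> i f w" and "weak_partial \<Omega> i f \<in> L2 \<Omega>" and "l2_of (weak_partial \<Omega> i f) = z"
proof -
  obtain h where h: "h \<in> L2 \<Omega>" "l2_of h = z" using l2_of_surj[OF z] by blast
  hence "has_weak_partial \<Omega> i f h" using d by (simp add: has_weak_partial_iff[OF f h(1)])
  with h(1) show ex: "\<exists>w\<in>L2 \<Omega>. has_weak_partial \<Omega> i f w" by blast
  hence "\<exists>w. w \<in> L2 \<Omega> \<and> has_weak_partial \<Omega> i f w" by blast
  from someI_ex[OF this] have w: "weak_partial \<Omega> i f \<in> L2 \<Omega>" "has_weak_partial \<Omega> i f (weak_partial \<Omega> i f)"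
    by (auto simp: weak_partial_def)
  show "weak_partial \<Omega> i f \<in> L2 \<Omega>" by (rule w(1))
  have "l2_of (weak_partial \<Omega> i f) - z = 0"
  proof (rule test_dense)
    show "restr (l2_of (weak_partial \<Omega> i f) - z) = l2_of (weak_partial \<Omega> i f) - z"
      using smul_l2_of[OF w(1)] z linear_diff[OF bounded_linear.linear[OF bounded_linear_smul[OF continuous_on_const]], of 1 "l2_of (weak_partial \<Omega> i f)" z]
      by simp
    show "inner (l2_of (weak_partial \<Omega> i f) - z) (cls phi) = 0" if "phi \<in> tests" for phi
      using w(2) d[OF that] that by (simp add: has_weak_partial_iff[OF f w(1)] inner_diff_left)
  qed
  thus "l2_of (weak_partial \<Omega> i f) = z" by simp
qed

lemma H10_graph_weak_partial:
  assumes "(w, W) \<in> H10_graph" "f \<in> L2 \<Omega>" "l2_of f = w"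
  shows "\<exists>h\<in>L2 \<Omega>. has_weak_partial \<Omega> i f h" and "weak_partial \<Omega> i f \<in> L2 \<Omega>"
    and "l2_of (weak_partial \<Omega> i f) = dotm (%x. i) W"
proof -
  have s: "restr (dotm (%x. i) W) = dotm (%x. i) W"
    unfolding smul_def dotm_def by (rule mulop_mulop) (auto intro!: pw_op_mult pw_op_inner continuous_on_const)
  have d: "inner (l2_of f) (cls (partial i phi)) = - inner (dotm (%x. i) W) (cls phi)" if p: "phi \<in> tests" for phi
    using weak_gradient[OF assms(1) p, of i] inner_vmul[OF continuous_on_const, of i "cls phi" W]
      vmul_cls[OF continuous_on_const test_sq_int[OF p] test_zero_outside[OF p], of i]
    by (simp add: assms(3) inner_commute)
  show "\<exists>h\<in>L2 \<Omega>. has_weak_partial \<Omega> i f h" and "weak_partial \<Omega> i f \<in> L2 \<Omega>"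
    and "l2_of (weak_partial \<Omega> i f) = dotm (%x. i) W" using weak_partial[OF assms(2) s d] by blast+
qed

lemma H10_graph_H10:
  assumes "(w, W) \<in> H10_graph" "f \<in> L2 \<Omega>" "l2_of f = w"
  shows "f \<in> H10 \<Omega>"
proof -
  have "f \<in> H1 \<Omega>" using assms(2) H10_graph_weak_partial(1)[OF assms] by (simp add: H1_def)
  moreover have "\<exists>phi\<in>tests. H1_norm \<Omega> (%x. f x - phi x) < eps" if e: "0 < eps" for eps
  proof -
    \<comment> \<open>The function and each of its \<open>DIM('a)\<close> weak derivatives are
      bounded by \<open>del\<close> separately.\<close>
    let ?K = "sqrt (1 + real DIM('a))"
    have K: "0 < ?K" by simp
    obtain phi where p: "phi \<in> tests" "dist (cls phi, cls (grad phi)) (w, W) < eps / ?K"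
      using assms(1) e K unfolding H10_graph_def closure_approachable by (auto dest: spec[of _ "eps / ?K"])
    define del where "del = norm (w - cls phi, W - cls (grad phi))"
    have "del = dist (cls phi, cls (grad phi)) (w, W)" unfolding del_def by (subst dist_commute) (simp add: dist_norm)
    hence del: "0 <= del" "del < eps / ?K" using p(2) by simp_all
    have g: "(w - cls phi, W - cls (grad phi)) \<in> H10_graph"
      using subspace_diff[OF subspace_H10_graph assms(1) H10_graph_test[OF p(1)]] by simp
    note L = L2_diff[OF assms(2) test_L2(1)[OF p(1)], unfolded test_L2(2)[OF p(1)] assms(3)]
    have wp: "L2_norm \<Omega> (weak_partial \<Omega> i (%x. f x - phi x)) <= del" if "i \<in> Basis" for i
    proof -
      have "L2_norm \<Omega> (weak_partial \<Omega> i (%x. f x - phi x)) = norm (dotm (%x. i) (W - cls (grad phi)))"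
        using L2_norm_eq[OF H10_graph_weak_partial(2)[OF g L]] H10_graph_weak_partial(3)[OF g L] by simp
      also have "... <= norm (restr (W - cls (grad phi)))" unfolding dotm_def smul_def
        by (rule norm_mulop_mono[OF pw_op_inner[OF continuous_on_const] pw_op_mult[OF continuous_on_const]])
          (use Cauchy_Schwarz_ineq2[of i] that in simp)
      also have "... <= del" using H10_graph_supp(2)[OF g] norm_snd_le[of "W - cls (grad phi)" "w - cls phi"] by (simp add: del_def)
      finally show ?thesis .
    qed
    have n0: "L2_norm \<Omega> (%x. f x - phi x) <= del"
      using norm_fst_le[of "w - cls phi" "W - cls (grad phi)"] by (simp add: L2_norm_eq L del_def)
    have nn: "0 <= L2_norm \<Omega> (%x. f x - phi x)" "0 <= L2_norm \<Omega> (weak_partial \<Omega> i (%x. f x - phi x))" for i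
      using L2_norm_eq[OF L(1)] L2_norm_eq[OF H10_graph_weak_partial(2)[OF g L], of i] by simp_all
    have "(L2_norm \<Omega> (%x. f x - phi x))\<^sup>2 + (\<Sum>i\<in>Basis. (L2_norm \<Omega> (weak_partial \<Omega> i (%x. f x - phi x)))\<^sup>2)
        <= del\<^sup>2 + (\<Sum>i\<in>(Basis :: 'a set). del\<^sup>2)"
      by (intro add_mono sum_mono power_mono n0 wp nn)
    also have "... = (?K * del)\<^sup>2" by (simp add: power_mult_distrib algebra_simps)
    finally have "H1_norm \<Omega> (%x. f x - phi x) <= ?K * del"
      unfolding H1_norm_def using del(1) by (intro real_le_lsqrt) (auto intro!: add_nonneg_nonneg sum_nonneg)
    also have "... < eps" using del(2) K by (simp add: pos_less_divide_eq mult.commute)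
    finally show ?thesis using p(1) by blast
  qed
  ultimately show ?thesis by (simp add: H10_def)
qed

text \<open>The bounded functional is given on test functions, not on their classes, hence
  \<open>riesz_image\<close>.\<close>

lemma regular_second_derivative:
  assumes "regular w"
  obtains y where "restr y = y"
    "!!phi. phi \<in> tests ==> inner w (cls (partial a (partial b phi))) = inner y (cls phi)"
proof -
  obtain C where C: "!!phi. phi \<in> tests ==> \<bar>inner w (cls (partial a (partial b phi)))\<bar> <= C * norm (cls phi)"
    using assms unfolding regular_def by metis
  have t2: "sq_int (partial a (partial b phi))" if "phi \<in> tests" for phi
    by (rule test_sq_int[OF test_partial[OF test_partial[OF that]]])
  show ?thesis
  proof (rule riesz_image[of tests cls "%phi. inner w (cls (partial a (partial b phi)))" C])
    show "tests ~= {}" using test_0 by blast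
    fix phi psi c assume p: "phi \<in> tests" "psi \<in> tests"
    let ?u = "%x. phi x + c * psi x"
    note s = p[THEN test_smooth] and t = test_add[OF p(1) test_scale[OF p(2), of c]]
    have d: "partial i (%x. f x + c * g x) = (%x. partial i f x + c *\<^sub>R partial i g x)" if "smooth f" "smooth g" for i f g
      using that by (intro ext) (simp add: partial_fun_add partial_fun_scale smooth_mult smooth_const)
    have "partial a (partial b ?u) = (%x. partial a (partial b phi) x + c *\<^sub>R partial a (partial b psi) x)"
      unfolding d[OF s] using d[OF smooth_partial[OF s(1)] smooth_partial[OF s(2)]] by simp
    hence "inner w (cls (partial a (partial b ?u)))
        = inner w (cls (partial a (partial b phi))) + c * inner w (cls (partial a (partial b psi)))"
      by (simp only: cls_add[OF t2[OF p(1)] sq_int_scaleR[OF t2[OF p(2)]]] cls_scaleR[OF t2[OF p(2)]]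
          inner_add_right inner_scaleR_right)
    moreover have "cls ?u = cls phi + c *\<^sub>R cls psi"
      using cls_add[OF test_sq_int[OF p(1)] sq_int_scaleR[OF test_sq_int[OF p(2)], of c]]
        cls_scaleR[OF test_sq_int[OF p(2)], of c] by simp
    ultimately show "\<exists>u\<in>tests. cls u = cls phi + c *\<^sub>R cls psi \<and> inner w (cls (partial a (partial b u)))
        = inner w (cls (partial a (partial b phi))) + c * inner w (cls (partial a (partial b psi)))" using t by blast
  qed (use C that smul_closure_test in auto)
qed

text \<open>The bridge to the given operator: through it, equations tested against the Dirichlet
  domain become available for the pairs of the graph. The second derivatives come from Riesz'
  theorem, and density of the test functions identifies their trace with \<open>g\<close>.\<close>

theorem lap_graph_dirichlet:
  assumes "(w, g) \<in> lap_graph" "f \<in> L2 \<Omega>" "l2_of f = w"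
  shows "f \<in> dirichlet_domain \<Omega>" and "dirichlet_laplacian \<Omega> f \<in> L2 \<Omega>" and "l2_of (dirichlet_laplacian \<Omega> f) = g"
proof -
  obtain W where W: "(w, W) \<in> H10_graph" "weak_lap W g" and reg: "regular w" and g: "restr g = g"
    using assms(1) unfolding lap_graph_def by blast
  note wp = H10_graph_weak_partial[OF W(1) assms(2,3)]
  have ex: "\<exists>y. restr y = y \<and> (\<forall>phi\<in>tests. inner w (cls (partial a (partial b phi))) = inner y (cls phi))" for a b
    by (rule regular_second_derivative[OF reg, of a b]) blast
  obtain Y where Y: "!!a b. restr (Y a b) = Y a b"
    "!!a b phi. phi \<in> tests ==> inner w (cls (partial a (partial b phi))) = inner (Y a b) (cls phi)"
    using ex by metis
  have d: "inner (l2_of (weak_partial \<Omega> i f)) (cls (partial j phi)) = - inner (Y i j) (cls phi)"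
    if p: "phi \<in> tests" for i j phi
    using weak_gradient[OF W(1) test_partial[OF p], of i j] Y(2)[OF p, of i j] wp(3)[of i]
      inner_vmul[OF continuous_on_const, of i "cls (partial j phi)" W]
      vmul_cls[OF continuous_on_const test_sq_int[OF test_partial[OF p]] test_zero_outside[OF test_partial[OF p]], of i j]
    by (simp add: inner_commute)
  have wpp: "\<exists>h\<in>L2 \<Omega>. has_weak_partial \<Omega> j (weak_partial \<Omega> i f) h" "weak_partial \<Omega> j (weak_partial \<Omega> i f) \<in> L2 \<Omega>"
    "l2_of (weak_partial \<Omega> j (weak_partial \<Omega> i f)) = Y i j" for i j
    by (rule weak_partial[OF wp(2) Y(1)[of i j]], rule d, assumption)+
  have "f \<in> H1 \<Omega>" using assms(2) wp(1) by (simp add: H1_def)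
  moreover have "weak_partial \<Omega> i f \<in> H1 \<Omega>" for i using wp(2) wpp(1) by (simp add: H1_def)
  ultimately show "f \<in> dirichlet_domain \<Omega>"
    using H10_graph_H10[OF W(1) assms(2,3)] by (simp add: dirichlet_domain_def H2_def)
  have L: "dirichlet_laplacian \<Omega> f = (%x. \<Sum>i\<in>Basis. weak_partial \<Omega> i (weak_partial \<Omega> i f) x)"
    by (rule ext) (simp add: dirichlet_laplacian_def)
  note S = L2_sum[of Basis "%i. weak_partial \<Omega> i (weak_partial \<Omega> i f)", OF wpp(2)]
  show "dirichlet_laplacian \<Omega> f \<in> L2 \<Omega>" unfolding L by (rule S(1))
  have l: "l2_of (dirichlet_laplacian \<Omega> f) = (\<Sum>i\<in>Basis. Y i i)"
    unfolding L by (rule trans[OF S(2)]) (simp only: wpp(3))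
  have "l2_of (dirichlet_laplacian \<Omega> f) - g = 0"
  proof (rule test_dense)
    note lin = bounded_linear.linear[OF bounded_linear_smul[OF continuous_on_const]]
    show "restr (l2_of (dirichlet_laplacian \<Omega> f) - g) = l2_of (dirichlet_laplacian \<Omega> f) - g"
      unfolding linear_diff[OF lin] g l linear_sum[OF lin] Y(1) ..
    fix phi assume p: "phi \<in> tests"
    have "inner g (cls phi) = (\<Sum>i\<in>Basis. inner w (cls (partial i (partial i phi))))"
      unfolding weak_lap_inner[OF W p] lapl_def[abs_def]
      using cls_sum[of Basis "%i. partial i (partial i phi)"]
      by (simp add: test_sq_int[OF test_partial[OF test_partial[OF p]]] inner_sum_right)
    thus "inner (l2_of (dirichlet_laplacian \<Omega> f) - g) (cls phi) = 0"
      by (simp add: l inner_diff_left inner_sum_left Y(2)[OF p])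
  qed
  thus "l2_of (dirichlet_laplacian \<Omega> f) = g" by simp
qed

text \<open>The values of the first component outside \<open>\<Omega>\<close> are left free, so that the domain of the graph is
  dense in the space of all square-integrable functions.\<close>

definition full_graph :: "(('a, real) l2 \<times> ('a, real) l2) set" where
  "full_graph = {(x, g). (restr x, g) \<in> lap_graph}"

lemma subspace_lap_graph: "subspace lap_graph" unfolding subspace_def
proof (intro conjI ballI allI)
  note lin = bounded_linear.linear[OF bounded_linear_smul[OF continuous_on_const]]
  have "regular 0" unfolding regular_def by (auto intro!: exI[of _ 0])
  moreover have "(0, 0) \<in> H10_graph" using subspace_0[OF subspace_H10_graph] by (simp add: zero_prod_def)
  ultimately show "0 \<in> lap_graph" unfolding lap_graph_def zero_prod_def mem_Collect_eq prod.case
    by (intro exI[of _ 0]) (simp add: weak_lap_def linear_0[OF lin])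
  fix x assume "x \<in> lap_graph"
  then obtain w g W where x: "x = (w, g)" "(w, W) \<in> H10_graph" "weak_lap W g" "regular w" "restr g = g"
    unfolding lap_graph_def by auto
  show "c *\<^sub>R x \<in> lap_graph" for c
  proof -
    have "regular (c *\<^sub>R w)" unfolding regular_def
    proof (intro allI)
      fix a b
      obtain C where C: "!!phi. phi \<in> tests ==> \<bar>inner w (cls (partial a (partial b phi)))\<bar> <= C * norm (cls phi)"
        using x(4) unfolding regular_def by metis
      show "\<exists>C. \<forall>phi\<in>tests. \<bar>inner (c *\<^sub>R w) (cls (partial a (partial b phi)))\<bar> <= C * norm (cls phi)"
        using mult_left_mono[OF C, of _ "\<bar>c\<bar>"] by (intro exI[of _ "\<bar>c\<bar> * C"]) (auto simp: abs_mult mult.assoc)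
    qed
    thus ?thesis using x subspace_scale[OF subspace_H10_graph x(2), of c] unfolding lap_graph_def
      by (auto simp: weak_lap_def linear_scale[OF lin] intro!: exI[of _ "c *\<^sub>R W"])
  qed
  fix y assume "y \<in> lap_graph"
  then obtain w' g' W' where y: "y = (w', g')" "(w', W') \<in> H10_graph" "weak_lap W' g'" "regular w'" "restr g' = g'"
    unfolding lap_graph_def by auto
  show "x + y \<in> lap_graph"
    using x y subspace_add[OF subspace_H10_graph x(2) y(2)] regular_add[OF x(4) y(4)] unfolding lap_graph_def
    by (auto simp: weak_lap_def linear_add[OF lin] inner_add_left intro!: exI[of _ "W + W'"])
qed

lemma test_lap_graph:
  assumes p: "phi \<in> tests" shows "(cls phi, cls (lapl phi)) \<in> lap_graph"
proof -
  have "regular (cls phi)" unfolding regular_def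
  proof (intro allI exI ballI)
    fix a b psi assume q: "psi \<in> tests"
    have "inner (cls phi) (cls (partial a (partial b psi))) = inner (cls (partial b (partial a phi))) (cls psi)"
      using integration_by_parts[OF p test_partial[OF q], of a b] integration_by_parts[OF test_partial[OF p] q, of b a] by simp
    thus "\<bar>inner (cls phi) (cls (partial a (partial b psi)))\<bar> <= norm (cls (partial b (partial a phi))) * norm (cls psi)"
      by (simp add: Cauchy_Schwarz_ineq2)
  qed
  moreover have "weak_lap (cls (grad phi)) (cls (lapl phi))" unfolding weak_lap_def
  proof
    fix psi assume q: "psi \<in> tests"
    have "inner (cls psi) (cls (lapl phi)) = (\<Sum>i\<in>Basis. inner (cls psi) (cls (partial i (partial i phi))))"
      unfolding lapl_def[abs_def] using cls_sum[of Basis "%i. partial i (partial i phi)"]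
      by (simp add: test_sq_int[OF test_partial[OF test_partial[OF p]]] inner_sum_right)
    also have "... = (\<Sum>i\<in>Basis. - inner (cls (grad psi)) (cls (%y. partial i phi y *\<^sub>R i)))"
      by (intro sum.cong refl weak_gradient[OF H10_graph_test[OF q] test_partial[OF p]])
    also have "... = - inner (cls (grad psi)) (cls (grad phi))"
      unfolding grad_def[of phi, abs_def] using cls_sum[of Basis "%i y. partial i phi y *\<^sub>R i"]
      by (simp add: sq_int_test_scaleR[OF test_partial[OF p] continuous_on_const] sum_negf inner_sum_right)
    finally show "inner (cls (grad phi)) (cls (grad psi)) = - inner (cls (lapl phi)) (cls psi)" by (simp add: inner_commute)
  qed
  moreover have "restr (cls (lapl phi)) = cls (lapl phi)"
  proof -
    have "lapl phi = (%x. \<Sum>i\<in>Basis. partial i (partial i phi) x)" by (rule ext) (simp add: lapl_def)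
    hence "sq_int (lapl phi)" using sq_int_sum[of Basis "%i. partial i (partial i phi)"] test_sq_int[OF test_partial[OF test_partial[OF p]]] by simp
    moreover have "lapl phi y = 0" if "y \<notin> \<Omega>" for y
      using test_zero_outside[OF test_partial[OF test_partial[OF p]] that] by (simp add: lapl_def)
    ultimately show ?thesis by (simp add: smul_cls continuous_on_const)
  qed
  ultimately show ?thesis using H10_graph_test[OF p] unfolding lap_graph_def by blast
qed

lemma lap_graph_supp: "(w, g) \<in> lap_graph ==> restr w = w \<and> restr g = g"
  unfolding lap_graph_def using H10_graph_supp(1) by auto

lemma lap_graph_full: "(w, g) \<in> lap_graph ==> (w, g) \<in> full_graph"
  using lap_graph_supp by (simp add: full_graph_def)

text \<open>Pairs \<open>(z, 0)\<close> with \<open>restr z = 0\<close> belong to the full graph.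
  The factor \<open>c\<close> serves the range, with \<open>c = 1\<close>, and the domain, with
  \<open>c = 0\<close>.\<close>

lemma orthogonal_off_domain:
  assumes "!!x a. (x, a) \<in> full_graph ==> inner w (x - c *\<^sub>R a) = 0"
  shows "restr w = w"
proof -
  note lin = bounded_linear.linear[OF bounded_linear_smul[OF continuous_on_const]]
  have "inner (w - restr w) z = 0" for z
  proof -
    have "restr (z - restr z) = 0" unfolding linear_diff[OF lin] by (simp add: smul_one_idem continuous_on_const)
    hence "(z - restr z, 0) \<in> full_graph"
      using subspace_0[OF subspace_lap_graph] by (simp add: full_graph_def zero_prod_def)
    from assms[OF this] show ?thesis
      using inner_smul[OF continuous_on_const, of 1 w z] by (simp add: inner_diff_left inner_diff_right)
  qed
  from this[of "w - restr w"] show ?thesis by simp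
qed

text \<open>Green's formula makes the operator minus the inner product of gradients, whence symmetry
  and sign. The density conditions reduce to vectors supported in \<Omega>.\<close>

theorem dissipative_full_graph: "dissipative_graph full_graph"
proof
  note lin = bounded_linear.linear[OF bounded_linear_smul[OF continuous_on_const]]
  have form: "\<exists>W. (restr x, W) \<in> H10_graph \<and> (\<forall>y V. (restr y, V) \<in> H10_graph --> inner a y = - inner W V)"
    if xa: "(x, a) \<in> full_graph" for x a
  proof -
    obtain W where W: "(restr x, W) \<in> H10_graph" "weak_lap W a" "restr a = a"
      using xa unfolding full_graph_def lap_graph_def by blast
    have "inner a y = - inner W V" if "(restr y, V) \<in> H10_graph" for y V
      using weak_lap_H10[OF W(2) that] inner_smul[OF continuous_on_const, of 1 a y] W(3) by simp
    thus ?thesis using W(1) by blast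
  qed
  show "subspace full_graph" unfolding subspace_def
  proof (intro conjI ballI allI)
    show "0 \<in> full_graph" using subspace_0[OF subspace_lap_graph] by (simp add: full_graph_def zero_prod_def linear_0[OF lin])
    fix x assume x: "x \<in> full_graph"
    show "c *\<^sub>R x \<in> full_graph" for c
      using x subspace_scale[OF subspace_lap_graph, of "(restr (fst x), snd x)" c]
      by (auto simp: full_graph_def linear_scale[OF lin] split: prod.splits)
    fix y assume y: "y \<in> full_graph"
    show "x + y \<in> full_graph"
      using x y subspace_add[OF subspace_lap_graph, of "(restr (fst x), snd x)" "(restr (fst y), snd y)"]
      by (auto simp: full_graph_def linear_add[OF lin] split: prod.splits)
  qed
  fix x a assume xa: "(x, a) \<in> full_graph"
  obtain W where W: "(restr x, W) \<in> H10_graph" "!!y V. (restr y, V) \<in> H10_graph ==> inner a y = - inner W V"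
    using form[OF xa] by blast
  show "inner a x <= 0" using W(2)[OF W(1)] by simp
  fix y b assume "(y, b) \<in> full_graph"
  then obtain V where V: "(restr y, V) \<in> H10_graph" "!!y W. (restr y, W) \<in> H10_graph ==> inner b y = - inner V W"
    using form by blast
  show "inner a y = inner x b" using W(2)[OF V(1)] V(2)[OF W(1)] by (simp add: inner_commute)
next
  fix w assume o: "!!x a. (x, a) \<in> full_graph ==> inner w (x - a) = 0"
  show "w = 0"
  proof (rule lap_graph_dense_range)
    show "restr w = w" by (rule orthogonal_off_domain[where c = 1]) (simp add: o)
  qed (use o lap_graph_full in blast)
next
  fix w assume o: "!!x a. (x, a) \<in> full_graph ==> inner w x = 0"
  show "w = 0"
  proof (rule test_dense)
    show "restr w = w" by (rule orthogonal_off_domain[where c = 0]) (simp add: o)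
  qed (use o lap_graph_full[OF test_lap_graph] in blast)
qed

end

text \<open>An open convex set is the interior of its closure, so the closed half-spaces of the
  polyhedron can be replaced by open ones; their normals are then scaled to length one.\<close>

lemma convex_polyhedral_domain_polytope:
  assumes "convex_polyhedral_domain \<Omega>" obtains J where "polytope_domain J \<Omega>"
proof -
  have O: "\<Omega> ~= {}" "open \<Omega>" "bounded \<Omega>" "convex \<Omega>" "polyhedron (closure \<Omega>)"
    using assms by (auto simp: convex_polyhedral_domain_def)
  obtain F a b where F: "finite F" "closure \<Omega> = \<Inter>F" "!!h. h \<in> F ==> a h ~= 0 \<and> h = {x. inner (a h) x <= b h}"
    using O(5) unfolding polyhedron_def by metis
  define J where "J = (%h. (a h /\<^sub>R norm (a h), b h / norm (a h))) ` F"
  have lt: "inner (a h /\<^sub>R norm (a h)) x < b h / norm (a h) \<longleftrightarrow> inner (a h) x < b h" if "h \<in> F" for h x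
    using F(3)[OF that] by (simp add: field_simps)
  have sub: "\<Omega> \<subseteq> {x. inner (a h) x < b h}" if "h \<in> F" for h
  proof -
    have "\<Omega> \<subseteq> {x. inner (a h) x <= b h}" using closure_subset[of \<Omega>] F(2) F(3)[OF that] that by blast
    from interior_maximal[OF this O(2)] show ?thesis unfolding interior_halfspace_le[OF conjunct1[OF F(3)[OF that]]] .
  qed
  have "\<Omega> = {x. \<forall>h\<in>F. inner (a h) x < b h}"
  proof
    show "\<Omega> \<subseteq> {x. \<forall>h\<in>F. inner (a h) x < b h}" using sub by blast
    have "{x. \<forall>h\<in>F. inner (a h) x < b h} = (\<Inter>h\<in>F. {x. inner (a h) x < b h})" by auto
    hence op: "open {x. \<forall>h\<in>F. inner (a h) x < b h}" using F(1) by (auto intro!: open_INT open_halfspace_lt)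
    have "{x. \<forall>h\<in>F. inner (a h) x < b h} \<subseteq> closure \<Omega>"
    proof
      fix x assume x: "x \<in> {x. \<forall>h\<in>F. inner (a h) x < b h}"
      have "x \<in> h" if "h \<in> F" for h using F(3)[OF that] x that by fastforce
      thus "x \<in> closure \<Omega>" unfolding F(2) by blast
    qed
    from interior_maximal[OF this op] show "{x. \<forall>h\<in>F. inner (a h) x < b h} \<subseteq> \<Omega>"
      unfolding convex_interior_closure[OF O(4)] interior_open[OF O(2)] .
  qed
  also have "... = {x. \<forall>j\<in>J. inner (fst j) x < snd j}" unfolding J_def using lt by auto
  finally have "polytope_domain J \<Omega>" using F(1,3) O(1,3) by unfold_locales (auto simp: J_def)
  thus ?thesis by (rule that)
qed

section \<open>The generating polynomials of the scheme\<close>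

lemma bdf_sum_quot: "(\<Sum>j=1..k. smult (1 / real j) (one_minus_X ^ j)) = one_minus_X * bdf_quot k"
  unfolding bdf_quot_def sum_distrib_left by (intro sum.cong refl) (simp add: power_eq_if del: mult_pCons_left)

lemma shifted_bdf_sum_quot:
  "(\<Sum>j=2..k. smult (1 / (real j - 1)) (one_minus_X ^ j)) = one_minus_X * (one_minus_X * bdf_quot (k - 1))"
proof -
  have "(\<Sum>j=2..k. smult (1 / (real j - 1)) (one_minus_X ^ j)) = (\<Sum>j=1..k-1. smult (1 / real j) (one_minus_X ^ Suc j))"
    by (rule sum.reindex_bij_witness[of _ Suc "%j. j - 1"]) (auto simp: of_nat_diff simp del: mult_pCons_left power_Suc)
  also have "... = one_minus_X * (\<Sum>j=1..k-1. smult (1 / real j) (one_minus_X ^ j))"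
    unfolding sum_distrib_left by (intro sum.cong refl) (simp del: mult_pCons_left)
  finally show ?thesis unfolding bdf_sum_quot .
qed

lemma rho_b_quot: "rho_b \<tau> k = smult (1 / \<tau>) (one_minus_X * bdf_quot k)" unfolding rho_b_def bdf_sum_quot ..

lemma rho_s_quot: "rho_s \<tau> k = smult (1 / \<tau>) (one_minus_X * sbdf_quot k)"
  unfolding rho_s_def bdf_sum_quot shifted_bdf_sum_quot sbdf_quot_def right_diff_distrib ..

lemma rho_w_quot: "rho_w \<tau> k \<beta> = smult (1 / \<tau>) (one_minus_X * wsbdf_quot k (\<beta> - 1))"
proof -
  have "smult \<beta> (smult c A) + smult (1 - \<beta>) (smult c (A - B)) = smult c (A + smult (\<beta> - 1) B)" for A B :: "real poly" and c
    by (rule poly_eqI) (simp add: algebra_simps)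
  thus ?thesis
    unfolding rho_w_def rho_b_quot rho_s_quot wsbdf_quot_def sbdf_quot_def right_diff_distrib distrib_left mult_smult_right .
qed

lemma w_coeff_quot: "\<tau> ~= 0 ==> w_coeff \<tau> k \<beta> j = coeff (one_minus_X * wsbdf_quot k (\<beta> - 1)) j"
  and b_coeff_quot: "\<tau> ~= 0 ==> b_coeff \<tau> k m j = coeff ((one_minus_X * bdf_quot k) ^ m) j"
  and s_coeff_quot: "\<tau> ~= 0 ==> s_coeff \<tau> k m j = coeff ((one_minus_X * sbdf_quot k) ^ m) j"
  by (simp_all add: w_coeff_def b_coeff_def s_coeff_def rho_w_quot rho_b_quot rho_s_quot smult_power
      power_one_over del: mult_pCons_left)

text \<open>The constant term is a harmonic sum plus a nonnegative multiple of a shorter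
  one.\<close>

lemma leading_weight_pos:
  fixes g :: real
  assumes "1 <= k" "0 <= g" shows "0 < coeff (one_minus_X * wsbdf_quot k g) 0"
proof -
  have q: "poly (bdf_quot j) 0 = (\<Sum>i=1..j. 1 / real i)" for j by (simp add: bdf_quot_def poly_sum)
  have "0 < poly (bdf_quot k) (0 :: real)" unfolding q using assms(1) by (intro sum_pos) auto
  moreover have "0 <= poly (bdf_quot (k - 1)) (0 :: real)" unfolding q by (intro sum_nonneg) auto
  ultimately have "0 < poly (one_minus_X * wsbdf_quot k g) 0"
    using assms(2) by (simp add: wsbdf_quot_def add_pos_nonneg del: mult_pCons_left)
  thus ?thesis by (simp only: poly_0_coeff_0)
qed

text \<open>The powers of the grid points contribute \<tau>^m, which cancels against the
  prefactor.\<close>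

lemma correction_quot:
  assumes "\<tau> ~= 0"
  shows "\<beta> * d / Gamma (real (m + 1)) * (1 / \<tau> ^ m) * (\<Sum>j=0..n. b_coeff \<tau> k m j * (real (n - j) * \<tau>) ^ m)
      + (1 - \<beta>) * d / Gamma (real (m + 1)) * (1 / \<tau> ^ m) * (\<Sum>j=0..n - 1. s_coeff \<tau> k m j * (real (n + m - 1 - j) * \<tau>) ^ m)
    = correction k m \<beta> n * d"
proof -
  have G: "Gamma (real (m + 1)) = fact m" using Gamma_fact[of m, where 'a = real] by (simp add: add.commute)
  have S: "1 / \<tau> ^ m * (\<Sum>j\<in>I. c j * (x j * \<tau>) ^ m) = (\<Sum>j\<in>I. c j * x j ^ m)" for I :: "nat set" and c x
    using assms by (simp add: power_mult_distrib sum_distrib_left)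
  show ?thesis unfolding G mult.assoc S correction_def b_coeff_quot[OF assms] s_coeff_quot[OF assms]
    by (simp add: field_simps del: mult_pCons_left)
qed

section \<open>The error estimate\<close>

context polytope_domain
begin

lemma inner_l2_of_smul: "f \<in> L2 \<Omega> ==> inner (l2_of f) (restr x) = inner (l2_of f) x"
  using inner_smul[OF continuous_on_const, of 1 "l2_of f" x] by (simp add: smul_l2_of)

text \<open>Adding \<open>v\<close> to \<open>V\<close> turns the problem into the homogeneous
  equation with initial value \<open>v\<close>, for which the semigroup representation is
  available.\<close>

lemma evolution_l2:
  assumes ev: "evolution_solution \<Omega> T v V" and v: "v \<in> L2 \<Omega>" and s: "s <= T"
  defines "u \<equiv> %t. l2_of (V t) + l2_of v"
  shows "continuous_on {0..s} u"
    and "0 < t ==> t < s ==> \<exists>D. (u has_vector_derivative D) (at t within {0..s}) \<and>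
      (\<forall>x a. (x, a) \<in> full_graph --> inner D x = inner (u t) a)"
proof -
  have V: "!!t. t \<in> {0..T} ==> V t \<in> L2 \<Omega>" using ev by (simp add: evolution_solution_def)
  have sub: "{0..s} \<subseteq> {0..T}" using s by auto
  have ev_in: "\<forall>\<^sub>F r in at t within {0..s}. r \<in> {0..s} \<and> r ~= t" for t by (simp add: eventually_at_filter)
  show "continuous_on {0..s} u" unfolding continuous_on_def
  proof
    fix t assume t: "t \<in> {0..s}"
    hence tT: "t \<in> {0..T}" using sub by blast
    have "((%r. L2_norm \<Omega> (%x. V r x - V t x)) \<longlongrightarrow> 0) (at t within {0..T})"
      using ev tT by (simp add: evolution_solution_def)
    from tendsto_within_subset[OF this sub] have "((%r. norm (u r - u t)) \<longlongrightarrow> 0) (at t within {0..s})"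
    proof (rule Lim_transform_eventually)
      show "\<forall>\<^sub>F r in at t within {0..s}. L2_norm \<Omega> (%x. V r x - V t x) = norm (u r - u t)"
        using ev_in
      proof eventually_elim
        case (elim r)
        hence "V r \<in> L2 \<Omega>" using V sub by blast
        thus ?case using L2_diff[OF _ V[OF tT]] by (simp add: L2_norm_eq u_def)
      qed
    qed
    thus "(u \<longlongrightarrow> u t) (at t within {0..s})" by (simp add: tendsto_norm_zero_iff LIM_zero_iff)
  qed
  assume t: "0 < t" "t < s"
  hence tT: "t \<in> {0<..T}" "t \<in> {0..T}" using s by auto
  then obtain D where D: "D \<in> L2 \<Omega>" "((%r. L2_norm \<Omega> (%x. (V r x - V t x) / (r - t) - D x)) \<longlongrightarrow> 0) (at t within {0..T})"
    and eq: "!!phi. phi \<in> dirichlet_domain \<Omega> ==> L2_inner \<Omega> D phi - dirichlet_laplacian_ext \<Omega> (V t) phi = dirichlet_laplacian_ext \<Omega> v phi"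
    using ev unfolding evolution_solution_def by blast
  have "((%r. norm ((1 / norm (r - t)) *\<^sub>R (u r - (u t + (r - t) *\<^sub>R l2_of D)))) \<longlongrightarrow> 0) (at t within {0..s})"
  proof (rule Lim_transform_eventually[OF tendsto_within_subset[OF D(2) sub]])
    show "\<forall>\<^sub>F r in at t within {0..s}. L2_norm \<Omega> (%x. (V r x - V t x) / (r - t) - D x)
        = norm ((1 / norm (r - t)) *\<^sub>R (u r - (u t + (r - t) *\<^sub>R l2_of D)))" using ev_in
    proof eventually_elim
      case (elim r)
      hence r: "V r \<in> L2 \<Omega>" "r ~= t" using V sub by auto
      note d = L2_diff[OF r(1) V[OF tT(2)]]
      have "(%x. (V r x - V t x) / (r - t) - D x) = (%x. (1 / (r - t)) * (V r x - V t x) - D x)" by simp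
      hence "L2_norm \<Omega> (%x. (V r x - V t x) / (r - t) - D x) = norm ((1 / (r - t)) *\<^sub>R (u r - u t) - l2_of D)"
        using L2_diff[OF L2_scale(1)[OF d(1), of "1 / (r - t)"] D(1)] L2_scale(2)[OF d(1), of "1 / (r - t)"] d(2)
        by (simp add: L2_norm_eq u_def)
      also have "(1 / (r - t)) *\<^sub>R (u r - u t) - l2_of D = (1 / (r - t)) *\<^sub>R (u r - (u t + (r - t) *\<^sub>R l2_of D))"
        using r(2) by (simp add: scaleR_diff_right scaleR_add_right)
      also have "norm ... = norm ((1 / norm (r - t)) *\<^sub>R (u r - (u t + (r - t) *\<^sub>R l2_of D)))" by simp
      finally show ?case .
    qed
  qed
  hence "(u has_vector_derivative l2_of D) (at t within {0..s})"
    unfolding has_vector_derivative_def has_derivative_within tendsto_norm_zero_iff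
    by (simp add: bounded_linear_scaleR_left)
  moreover have "inner (l2_of D) x = inner (u t) a" if xa: "(x, a) \<in> full_graph" for x a
  proof -
    have g: "(restr x, a) \<in> lap_graph" using xa by (simp add: full_graph_def)
    obtain f where f: "f \<in> L2 \<Omega>" "l2_of f = restr x"
      by (rule l2_of_surj[of "restr x"]) (simp_all add: smul_one_idem continuous_on_const)
    note F = lap_graph_dirichlet[OF g f]
    from eq[OF F(1)] show ?thesis
      by (simp add: dirichlet_laplacian_ext_def L2_inner_eq D(1) f F V[OF tT(2)] v inner_l2_of_smul u_def inner_add_left)
  qed
  ultimately show "\<exists>D. (u has_vector_derivative D) (at t within {0..s}) \<and>
      (\<forall>x a. (x, a) \<in> full_graph --> inner D x = inner (u t) a)" by blast
qed

lemma scheme_l2: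
  assumes sc: "scheme_solution \<Omega> m k \<beta> \<tau> N v V" and v: "v \<in> L2 \<Omega>" and \<tau>: "0 < \<tau>"
    and i: "1 <= i" "i <= N" and xa: "(x, a) \<in> full_graph"
  shows "inner (\<Sum>j=0..i. coeff (one_minus_X * wsbdf_quot k (\<beta> - 1)) j *\<^sub>R l2_of (V (i - j))) x
    = inner (\<tau> *\<^sub>R (\<beta> *\<^sub>R l2_of (V i) + (1 - \<beta>) *\<^sub>R l2_of (V (i - 1)) + correction k m \<beta> i *\<^sub>R l2_of v)) a"
proof -
  have V: "V n \<in> L2 \<Omega>" if "n <= N" for n using sc that by (simp add: scheme_solution_def)
  have g: "(restr x, a) \<in> lap_graph" using xa by (simp add: full_graph_def)
  obtain f where f: "f \<in> L2 \<Omega>" "l2_of f = restr x"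
    by (rule l2_of_surj[of "restr x"]) (simp_all add: smul_one_idem continuous_on_const)
  note F = lap_graph_dirichlet[OF g f]
  let ?w = "%j. w_coeff \<tau> k \<beta> j"
  let ?S = "%x. \<Sum>j=0..i. ?w j * V (i - j) x"
  have S: "?S \<in> L2 \<Omega>" "l2_of ?S = (\<Sum>j=0..i. ?w j *\<^sub>R l2_of (V (i - j)))"
    using L2_sum[of "{0..i}" "%j x. ?w j * V (i - j) x"] L2_scale[OF V] i by simp_all
  have "L2_inner \<Omega> (%x. 1 / \<tau> * ?S x) f - \<beta> * dirichlet_laplacian_ext \<Omega> (V i) f - (1 - \<beta>) * dirichlet_laplacian_ext \<Omega> (V (i - 1)) f
      = correction k m \<beta> i * dirichlet_laplacian_ext \<Omega> v f"
  proof -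
    have "i \<in> {1..N}" using i by simp
    from sc[unfolded scheme_solution_def, THEN conjunct2, THEN conjunct2, rule_format, OF this F(1)] show ?thesis
      unfolding correction_quot[OF less_imp_neq[OF \<tau>, symmetric]] .
  qed
  moreover have "L2_inner \<Omega> (%x. 1 / \<tau> * ?S x) f = 1 / \<tau> * inner (l2_of ?S) x"
    using L2_scale[OF S(1), of "1 / \<tau>"] L2_inner_eq[OF L2_scale(1)[OF S(1), of "1 / \<tau>"] f(1)]
    by (simp only: f(2) inner_scaleR_left inner_l2_of_smul[OF S(1)])
  moreover have "dirichlet_laplacian_ext \<Omega> h f = inner (l2_of h) a" if "h \<in> L2 \<Omega>" for h
    by (simp add: dirichlet_laplacian_ext_def L2_inner_eq that F)
  ultimately have "1 / \<tau> * inner (l2_of ?S) x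
      = \<beta> * inner (l2_of (V i)) a + (1 - \<beta>) * inner (l2_of (V (i - 1))) a + correction k m \<beta> i * inner (l2_of v) a"
    using V i v by (simp add: algebra_simps)
  hence "inner (l2_of ?S) x = \<tau> * (\<beta> * inner (l2_of (V i)) a + (1 - \<beta>) * inner (l2_of (V (i - 1))) a + correction k m \<beta> i * inner (l2_of v) a)"
    using \<tau> by (simp add: field_simps)
  thus ?thesis unfolding S(2) using \<tau> by (simp add: w_coeff_quot inner_add_left del: mult_pCons_left)
qed

end

theorem theorem5p1:
  fixes \<Omega> :: "'a::euclidean_space set" and m k :: nat and \<beta> T :: real
  assumes "convex_polyhedral_domain \<Omega>"
    and "1 \<le> m" and "m \<le> k" and "k \<le> 7"
    and "\<beta> \<ge> 3"
    and "T > 0"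
  shows "\<exists>c>0. \<forall>N\<ge>1. \<forall>\<tau>. \<tau> = T / real N \<longrightarrow>
           (\<forall>v\<in>L2 \<Omega>. \<forall>V Vd.
              evolution_solution \<Omega> T v V \<longrightarrow> scheme_solution \<Omega> m k \<beta> \<tau> N v Vd \<longrightarrow>
              (\<forall>n\<in>{1..N}. \<forall>t. t = real n * \<tau> \<longrightarrow>
                 L2_norm \<Omega> (\<lambda>x. V t x - Vd n x)
                   \<le> (c * \<tau> ^ (m + 1) * t powi (- int m - 1) + c * \<tau> ^ k * t powi (- int k))
                      * L2_norm \<Omega> v))"
proof -
  obtain J where "polytope_domain J \<Omega>" using convex_polyhedral_domain_polytope[OF assms(1)] .
  then interpret polytope_domain J \<Omega> .
  interpret wsbdf k m \<beta> using assms(2-5) by unfold_locales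
  interpret dissipative_graph full_graph by (rule dissipative_full_graph)
  \<comment> \<open>The constant stems from the scalar problem and depends on \<open>m\<close>,
    \<open>k\<close> and \<beta> only.\<close>
  obtain C where C: "0 < C"
    "!!z n V. 0 < z ==> 1 <= n ==> V 0 = 0 ==>
      (!!i. 1 <= i ==> i <= n ==>
        (\<Sum>j=0..i. coeff (one_minus_X * wsbdf_quot k (\<beta> - 1)) j * V (i - j)) + z * (\<beta> * V i + (1 - \<beta>) * V (i - 1))
         = - z * correction k m \<beta> i) ==>
      \<bar>exp (- z * real n) - 1 - V n\<bar> <= C * (1 / real n ^ (m + 1) + 1 / real n ^ k)"
    by (rule scalar_error_bound[unfolded g_def], rule that, assumption, blast)
  have main: "L2_norm \<Omega> (%x. V (real n * \<tau>) x - Vd n x)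
      <= (C * \<tau> ^ (m + 1) * (real n * \<tau>) powi (- int m - 1) + C * \<tau> ^ k * (real n * \<tau>) powi (- int k)) * L2_norm \<Omega> v"
    if N: "1 <= N" "\<tau> = T / real N" and v: "v \<in> L2 \<Omega>" and ev: "evolution_solution \<Omega> T v V"
      and sc: "scheme_solution \<Omega> m k \<beta> \<tau> N v Vd" and n: "1 <= n" "n <= N" for N n \<tau> v V Vd
  proof -
    have \<tau>: "0 < \<tau>" using N assms(6) by simp
    have nT: "real n * \<tau> <= T" using mult_right_mono[of "real n" "real N" \<tau>] N n \<tau> by simp
    have nT0: "0 <= real n * \<tau>" using \<tau> by simp
    have V: "V t \<in> L2 \<Omega>" if "0 <= t" "t <= T" for t using ev that by (simp add: evolution_solution_def)
    have Vd: "Vd i \<in> L2 \<Omega>" if "i <= N" for i using sc that by (simp add: scheme_solution_def)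
    have V0: "l2_of (V 0) = 0" using ev assms(6) by (intro l2_of_null V) (auto simp: evolution_solution_def)
    have Vd0: "l2_of (Vd 0) = 0" using sc by (intro l2_of_null Vd) (auto simp: scheme_solution_def)
    let ?M = "C * (1 / real n ^ (m + 1) + 1 / real n ^ k)"
    have "norm (l2_of (V (real n * \<tau>)) + l2_of v - l2_of v - l2_of (Vd n)) <= ?M * norm (l2_of v)"
    proof (rule scheme_error[where w = "coeff (one_minus_X * wsbdf_quot k (\<beta> - 1))" and c = "correction k m \<beta>"
          and V = "%i. l2_of (Vd i)" and u = "%t. l2_of (V t) + l2_of v"])
      show "0 < coeff (one_minus_X * wsbdf_quot k (\<beta> - 1)) 0" using assms(2-5) by (intro leading_weight_pos) auto
      show "0 < \<tau>" "0 < \<beta>" "1 <= n" using \<tau> assms(5) n by auto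
      show "l2_of (V 0) + l2_of v = l2_of v" by (simp add: V0)
      show "l2_of (Vd 0) = 0" by (rule Vd0)
      show "continuous_on {0..real n * \<tau>} (%t. l2_of (V t) + l2_of v)" by (rule evolution_l2(1)[OF ev v nT])
    qed (rule C(2) evolution_l2(2)[OF ev v nT] scheme_l2[OF sc v \<tau>]; use n in simp)+
    hence "L2_norm \<Omega> (%x. V (real n * \<tau>) x - Vd n x) <= ?M * L2_norm \<Omega> v"
      using L2_diff[OF V[OF nT0 nT] Vd[OF n(2)]] by (simp add: L2_norm_eq v)
    also have "?M = C * \<tau> ^ (m + 1) * (real n * \<tau>) powi (- int m - 1) + C * \<tau> ^ k * (real n * \<tau>) powi (- int k)"
    proof -
      \<comment> \<open>With \<open>t = n \<tau>\<close> the step size cancels, and the rate in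
        \<open>n\<close> is the asserted one.\<close>
      have e: "\<tau> ^ j * (real n * \<tau>) powi (- int j) = 1 / real n ^ j" for j
        using \<tau> by (simp add: power_int_minus power_mult_distrib divide_inverse)
      have "- int m - 1 = - int (m + 1)" by simp
      thus ?thesis using e[of "m + 1"] e[of k] by (simp only: distrib_left mult.assoc)
    qed finally show ?thesis .
  qed
  show ?thesis by (intro exI[of _ C] conjI C(1)) (use main in auto)
qed

end
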